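(* Let $n\ge1$ and $g>0$, and let $\mathcal{S}_n:\mathbb{C}[\mathbf{x}]^{S_n}\to\mathbb{C}[\mathbf{z}]^{S_n}$, $\mathbf{z}=(z_1,\dots,z_n)$, be the operator $\mathcal{S}_nf=[Q_{z_1}\cdots Q_{z_n}f](1,\dots,1)$. Then $\mathcal{S}_n$ can be decomposed into a product of $n$ linear operators $$\mathcal{S}_n=\mathcal{A}_1\cdots\mathcal{A}_n,$$ $$\mathcal{A}_k:\ \mathbb{C}[x_1,\dots,x_k]^{S_k}\to\mathbb{C}[x_1,\dots,x_{k-1}]^{S_{k-1}}\otimes\mathbb{C}[z_k],\qquad k=1,\dots,n$$ (in particular $\mathcal{A}_1:\mathbb{C}[x_1]\to\mathbb{C}[z_1]$), where in the product the operators $\mathcal{A}_k$ act trivially (as unit operators) on the variables $\mathbf{z}$. Furthermore, for every partition $\lambda=(\lambda_1,\dots,\lambda_n)$, $\lambda_1\ge\dots\ge\lambda_n\ge0$, and every $k=1,\dots,n$, these operators act on the restricted Jack polynomials as follows: $$\mathcal{A}_k:\ P_\lambda^{(1/g)}(x_1,\dots,x_k,1,\dots,1)\ \mapsto\ P_\lambda^{(1/g)}(x_1,\dots,x_{k-1},1,\dots,1)\,q_\lambda(z_k),$$ where $q_\lambda(z)$ is the eigenvalue of $Q_z$ on $P_\lambda^{(1/g)}$ ($Q_zP_\lambda^{(1/g)}=q_\lambda(z)P_\lambda^{(1/g)}$).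
   Context: Notation: $\Delta_n(\mathbf{x})=\prod_{1\le i<j\le n}(x_j-x_i)$; $\mathbb{C}[\mathbf{x}]^{S_n}$ is the ring of symmetric polynomials in $\mathbf{x}=(x_1,\dots,x_n)$. In $P_\lambda^{(1/g)}(x_1,\dots,x_k,1,\dots,1)$ the last $n-k$ of the $n$ arguments are set equal to $1$. The operator $Q_z$. For $g>0$, real $z>1$, and reals $0<y_1<\dots<y_n$, and $p\in\mathbb{C}[\mathbf{x}]^{S_n}$ put $$[Q_zp](\mathbf{y})=\frac{\Gamma(ng)}{\Gamma(g)^n}\,\frac{(z-1)^{1-ng}}{\Delta_n(\mathbf{y})\prod_{i=1}^n y_i^{g-1}}\int_{\Omega_{\mathbf{x}}}d\mathbf{x}\;\delta(x_1\cdots x_n-z\,y_1\cdots y_n)\,\Delta_n(\mathbf{x})\Big[\prod_{i=1}^n\xi_i^{g-1}\Big]p(\mathbf{x}),$$ where $\Omega_{\mathbf{x}}=\{\mathbf{x}\in\mathbb{R}^n: 0<y_1<x_1<y_2<\dots<x_{n-1}<y_n<x_n<\infty\}$, $\xi_i=\prod_{k=1}^n(x_k-y_i)\big/\prod_{k\ne i}(y_k-y_i)>0$, and $\delta$ is the Dirac delta function (so $\int\delta(h(\mathbf x))F(\mathbf x)d\mathbf x=\int_{\{h=0\}}F\,dS/|\nabla h|$). The function $[Q_zp](\mathbf{y})$ is a polynomial in $z$ and a symmetric polynomial in $\mathbf{y}$; accordingly $Q_z$ is extended to all $z\in\mathbb{C}$ and (renaming $\mathbf{y}$ as $\mathbf{x}$)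 regarded as a linear operator on $\mathbb{C}[\mathbf{x}]^{S_n}$. The Jack polynomials are eigenfunctions of $Q_z$, with eigenvalues $q_\lambda(z)\in\mathbb{C}(g)[z]$. Jack polynomials. For partitions $\mu,\lambda$ with $n$ parts (zeros allowed), $\mu\preceq\lambda$ means $\sum_{j=1}^n\mu_j=\sum_{j=1}^n\lambda_j$ and $\sum_{j=1}^k\mu_j\le\sum_{j=1}^k\lambda_j$ for $k=1,\dots,n-1$. $m_\lambda(\mathbf{x})$ is the sum of $x_1^{\nu_1}\cdots x_n^{\nu_n}$ over all distinct permutations $\nu$ of $\lambda$. The Jack polynomials $P_\lambda^{(1/g)}(\mathbf{x})\in\mathbb{C}(g)[\mathbf{x}]^{S_n}$ are the unique symmetric polynomials of the form $P_\lambda^{(1/g)}=m_\lambda+\sum_{\mu\prec\lambda}v_{\lambda\mu}(g)m_\mu$ such that $D(u;g)P_\lambda^{(1/g)}=\big[\prod_{i=1}^n(\lambda_i+(n-i)g+u)\big]P_\lambda^{(1/g)}$, where $$D(u;g)=\frac{(-1)^{n(n-1)/2}}{\Delta_n(\mathbf{x})}\det\Big[x_i^{n-j}\Big(x_i\frac{\partial}{\partial x_i}+(n-j)g+u\Big)\Big]_{i,j=1}^n .$$ *)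

theory Defs
  imports
    "HOL-Analysis.Analysis"
    "HOL-Library.Poly_Mapping"
    "HOL-Computational_Algebra.Polynomial"
    "HOL-Combinatorics.Permutations"
begin

text \<open>
  Finitely supported functions on exponent vectors, with the convolution product of
  \<^theory>\<open>HOL-Library.Poly_Mapping\<close>. The variables are indexed from 1, so
  the polynomials in n variables are those mentioning only the variables 1, ..., n.

  The space \<open>complex mpoly mpoly\<close> is C[x][z] = C[x] \<open>\<otimes>\<close> C[z]: the outer
  exponents belong to z, the inner ones to x.
\<close>

type_synonym 'a mpoly = "(nat \<Rightarrow>\<^sub>0 nat) \<Rightarrow>\<^sub>0 'a"

definition Const :: "'a::zero \<Rightarrow> 'a mpoly" where
  "Const c = Poly_Mapping.single 0 c"

definition Var :: "nat \<Rightarrow> 'a::zero_neq_one mpoly" where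
  "Var i = Poly_Mapping.single (Poly_Mapping.single i 1) 1"

definition vars :: "'a::zero mpoly \<Rightarrow> nat set" where
  "vars p = (\<Union>m\<in>Poly_Mapping.keys p. Poly_Mapping.keys m)"

text \<open>Replace every coefficient a by \<open>c a\<close> and every variable i by \<open>\<sigma> i\<close>.\<close>

definition insertion ::
  "('a::zero \<Rightarrow> 'b::comm_semiring_1) \<Rightarrow> (nat \<Rightarrow> 'b) \<Rightarrow> 'a mpoly \<Rightarrow> 'b" where
  "insertion c \<sigma> p =
     (\<Sum>m\<in>Poly_Mapping.keys p. c (Poly_Mapping.lookup p m) *
        (\<Prod>i\<in>Poly_Mapping.keys m. \<sigma> i ^ Poly_Mapping.lookup m i))"

definition eval :: "(nat \<Rightarrow> complex) \<Rightarrow> complex mpoly \<Rightarrow> complex" where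
  "eval x p = insertion (\<lambda>c. c) x p"

definition mpderiv :: "nat \<Rightarrow> complex mpoly \<Rightarrow> complex mpoly" where
  "mpderiv i p =
     (\<Sum>m\<in>Poly_Mapping.keys p.
        Poly_Mapping.single (m - Poly_Mapping.single i 1)
          (of_nat (Poly_Mapping.lookup m i) * Poly_Mapping.lookup p m))"

definition sym_polys :: "nat \<Rightarrow> complex mpoly set" where
  "sym_polys n =
     {p. vars p \<subseteq> {1..n} \<and>
         (\<forall>\<pi>. \<pi> permutes {1..n} \<longrightarrow> insertion Const (\<lambda>i. Var (\<pi> i)) p = p)}"

definition vandermonde :: "nat \<Rightarrow> (nat \<Rightarrow> 'a::comm_ring_1) \<Rightarrow> 'a" where
  "vandermonde n x = (\<Prod>j\<in>{1..n}. \<Prod>i\<in>{1..<j}. x j - x i)"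

text \<open>A partition with n parts (zeros allowed) is an exponent vector on the indices 1, ..., n.\<close>

definition partitions :: "nat \<Rightarrow> (nat \<Rightarrow>\<^sub>0 nat) set" where
  "partitions n =
     {lam. Poly_Mapping.keys lam \<subseteq> {1..n} \<and>
         (\<forall>i\<in>{1..<n}. Poly_Mapping.lookup lam (Suc i) \<le> Poly_Mapping.lookup lam i)}"

definition dominated :: "nat \<Rightarrow> (nat \<Rightarrow>\<^sub>0 nat) \<Rightarrow> (nat \<Rightarrow>\<^sub>0 nat) \<Rightarrow> bool" where
  "dominated n \<mu> lam \<longleftrightarrow>
     (\<Sum>j=1..n. Poly_Mapping.lookup \<mu> j) = (\<Sum>j=1..n. Poly_Mapping.lookup lam j) \<and>
     (\<forall>k\<in>{1..<n}. (\<Sum>j=1..k. Poly_Mapping.lookup \<mu> j) \<le> (\<Sum>j=1..k. Poly_Mapping.lookup lam j))"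

definition monomial_sym :: "nat \<Rightarrow> (nat \<Rightarrow>\<^sub>0 nat) \<Rightarrow> complex mpoly" where
  "monomial_sym n lam =
     (\<Sum>\<nu> | \<exists>\<pi>. \<pi> permutes {1..n} \<and>
              (\<forall>i. Poly_Mapping.lookup \<nu> i = Poly_Mapping.lookup lam (\<pi> i)).
        Poly_Mapping.single \<nu> 1)"

text \<open>The (i,j) entry \<open>x\<^sub>i\<^sup>n\<^sup>-\<^sup>j (x\<^sub>i \<partial>/\<partial>x\<^sub>i + (n-j)g + u)\<close> of the matrix defining D(u;g).\<close>

definition D_entry ::
  "nat \<Rightarrow> real \<Rightarrow> complex \<Rightarrow> nat \<Rightarrow> nat \<Rightarrow> complex mpoly \<Rightarrow> complex mpoly" where
  "D_entry n g u i j p =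
     Var i ^ (n - j) *
       (Var i * mpderiv i p + Const (of_nat (n - j) * of_real g + u) * p)"

text \<open>Entries in different rows commute, so the Leibniz expansion of the determinant is unambiguous.\<close>

definition D_det :: "nat \<Rightarrow> real \<Rightarrow> complex \<Rightarrow> complex mpoly \<Rightarrow> complex mpoly" where
  "D_det n g u p =
     (\<Sum>\<sigma> | \<sigma> permutes {1..n}.
        of_int (sign \<sigma>) * foldr (\<lambda>i. D_entry n g u i (\<sigma> i)) [1..<Suc n] p)"

text \<open>
  On symmetric p the image under the determinant is antisymmetric, so the division by the
  Vandermonde product is exact.
\<close>

definition D_op :: "nat \<Rightarrow> real \<Rightarrow> complex \<Rightarrow> complex mpoly \<Rightarrow> complex mpoly" where
  "D_op n g u p =
     (THE r. vandermonde n Var * r = (- 1) ^ (n * (n - 1) div 2) * D_det n g u p)"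

text \<open>
  The parameter g is a positive real number. At every such g the eigenvalues, as polynomials
  in u, separate the partitions (the numbers \<open>\<lambda>\<^sub>i + (n-i)g\<close> decrease strictly in i), so the
  conditions below determine the value at g of the Jack polynomial over C(g).
\<close>

definition jack :: "nat \<Rightarrow> real \<Rightarrow> (nat \<Rightarrow>\<^sub>0 nat) \<Rightarrow> complex mpoly" where
  "jack n g lam =
     (THE P.
        (\<exists>v. P = monomial_sym n lam +
               (\<Sum>\<mu> | \<mu> \<in> partitions n \<and> dominated n \<mu> lam \<and> \<mu> \<noteq> lam.
                  Const (v \<mu>) * monomial_sym n \<mu>)) \<and>
        (\<forall>u. D_op n g u P =
             Const (\<Prod>i=1..n. of_nat (Poly_Mapping.lookup lam i)
                               + of_nat (n - i) * of_real g + u) * P))"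

text \<open>Set the variables k+1, k+2, ... equal to 1.\<close>

definition restrict_ones :: "nat \<Rightarrow> complex mpoly \<Rightarrow> complex mpoly" where
  "restrict_ones k p = insertion Const (\<lambda>i. if i \<le> k then Var i else 1) p"

text \<open>
  The point of \<open>\<real>\<^sup>n\<close> with coordinates \<open>x\<^sub>1, ..., x\<^sub>n\<close> is a function
  on nat of which only the values at 1, ..., n matter.
\<close>

definition partial :: "nat \<Rightarrow> ((nat \<Rightarrow> real) \<Rightarrow> real) \<Rightarrow> (nat \<Rightarrow> real) \<Rightarrow> real" where
  "partial i h x = deriv (\<lambda>t. h (x(i := t))) (x i)"

text \<open>
  The integral of F over the hypersurface \<open>x\<^sub>n = \<phi>(x\<^sub>1, ..., x\<^sub>n\<^sub>-\<^sub>1)\<close> with respect to surface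
  measure, whose density over \<open>\<real>\<^sup>n\<^sup>-\<^sup>1\<close> is \<open>dS = (1 + \<bar>\<nabla>\<phi>\<bar>\<^sup>2)\<^sup>1\<^sup>/\<^sup>2\<close>. For n = 1 the base is
  a single point of mass 1.
\<close>

definition graph_integral ::
  "nat \<Rightarrow> ((nat \<Rightarrow> real) \<Rightarrow> real) \<Rightarrow> ((nat \<Rightarrow> real) \<Rightarrow> complex) \<Rightarrow> complex" where
  "graph_integral n \<phi> F =
     (LINT x|(\<Pi>\<^sub>M i\<in>{1..<n}. lborel).
        complex_of_real (sqrt (1 + (\<Sum>i\<in>{1..<n}. (partial i \<phi> x)\<^sup>2))) * F (x(n := \<phi> x)))"

text \<open>
  The integral of \<open>\<delta>(h(x)) F(x)\<close> over \<open>\<Omega>\<close>, that is, of \<open>F / \<bar>\<nabla>h\<bar>\<close> over \<open>\<Omega> \<inter> {h = 0}\<close> with respect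
  to surface measure, where on \<open>\<Omega>\<close> the equation h(x) = 0 amounts to
  \<open>x\<^sub>n = \<phi>(x\<^sub>1, ..., x\<^sub>n\<^sub>-\<^sub>1)\<close>.
\<close>

definition delta_integral ::
  "nat \<Rightarrow> (nat \<Rightarrow> real) set \<Rightarrow> ((nat \<Rightarrow> real) \<Rightarrow> real) \<Rightarrow> ((nat \<Rightarrow> real) \<Rightarrow> real) \<Rightarrow>
   ((nat \<Rightarrow> real) \<Rightarrow> complex) \<Rightarrow> complex" where
  "delta_integral n \<Omega> h \<phi> F =
     graph_integral n \<phi>
       (\<lambda>x. indicator \<Omega> x * F x / complex_of_real (sqrt (\<Sum>i=1..n. (partial i h x)\<^sup>2)))"

definition ordered_pos :: "nat \<Rightarrow> (nat \<Rightarrow> real) \<Rightarrow> bool" where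
  "ordered_pos n y \<longleftrightarrow> 0 < y 1 \<and> (\<forall>i\<in>{1..<n}. y i < y (Suc i))"

definition interlacing :: "nat \<Rightarrow> (nat \<Rightarrow> real) \<Rightarrow> (nat \<Rightarrow> real) set" where
  "interlacing n y =
     {x. (\<forall>i\<in>{1..n}. y i < x i) \<and> (\<forall>i\<in>{1..<n}. x i < y (Suc i))}"

definition xi :: "nat \<Rightarrow> (nat \<Rightarrow> real) \<Rightarrow> (nat \<Rightarrow> real) \<Rightarrow> nat \<Rightarrow> real" where
  "xi n x y i = (\<Prod>k=1..n. x k - y i) / (\<Prod>k\<in>{1..n} - {i}. y k - y i)"

text \<open>\<open>[Q\<^sub>zp](y)\<close> for real z > 1 and \<open>0 < y\<^sub>1 < ... < y\<^sub>n\<close>.\<close>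

definition Q_integral ::
  "nat \<Rightarrow> real \<Rightarrow> real \<Rightarrow> complex mpoly \<Rightarrow> (nat \<Rightarrow> real) \<Rightarrow> complex" where
  "Q_integral n g z p y =
     complex_of_real
       (Gamma (real n * g) / Gamma g ^ n * (z - 1) powr (1 - real n * g)
          / (vandermonde n y * (\<Prod>i=1..n. y i powr (g - 1)))) *
     delta_integral n (interlacing n y)
       (\<lambda>x. (\<Prod>i=1..n. x i) - z * (\<Prod>i=1..n. y i))
       (\<lambda>x. z * (\<Prod>i=1..n. y i) / (\<Prod>i\<in>{1..<n}. x i))
       (\<lambda>x. complex_of_real (vandermonde n x * (\<Prod>i=1..n. xi n x y i powr (g - 1)))
              * eval (\<lambda>i. complex_of_real (x i)) p)"

text \<open>
  The integral as a polynomial in z with coefficients in the symmetric polynomials in y; it is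
  determined by its values on the open set of admissible (z, y).
\<close>

definition Q_poly :: "nat \<Rightarrow> real \<Rightarrow> complex mpoly \<Rightarrow> complex mpoly poly" where
  "Q_poly n g p =
     (THE R. (\<forall>j. coeff R j \<in> sym_polys n) \<and>
        (\<forall>z y. 1 < z \<and> ordered_pos n y \<longrightarrow>
           eval (\<lambda>i. complex_of_real (y i)) (poly R (Const (complex_of_real z)))
             = Q_integral n g z p y))"

definition Q_op :: "nat \<Rightarrow> real \<Rightarrow> complex \<Rightarrow> complex mpoly \<Rightarrow> complex mpoly" where
  "Q_op n g z p = poly (Q_poly n g p) (Const z)"

definition Q_eigenvalue :: "nat \<Rightarrow> real \<Rightarrow> (nat \<Rightarrow>\<^sub>0 nat) \<Rightarrow> complex poly" where
  "Q_eigenvalue n g lam =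
     (THE q. \<forall>z. Q_op n g z (jack n g lam) = Const (poly q z) * jack n g lam)"

definition S_op :: "nat \<Rightarrow> real \<Rightarrow> complex mpoly \<Rightarrow> complex mpoly" where
  "S_op n g f =
     (THE s. s \<in> sym_polys n \<and>
        (\<forall>z. eval z s = eval (\<lambda>_. 1) (foldr (\<lambda>k. Q_op n g (z k)) [1..<Suc n] f)))"

text \<open>C[z] as a subring of C[x][z].\<close>

definition z_embed :: "complex mpoly \<Rightarrow> complex mpoly mpoly" where
  "z_embed s = Poly_Mapping.map Const s"

text \<open>The polynomial \<open>q(z\<^sub>k)\<close> as an element of C[x][z].\<close>

definition in_z :: "nat \<Rightarrow> complex poly \<Rightarrow> complex mpoly mpoly" where
  "in_z k q = poly (map_poly (\<lambda>c. Const (Const c)) q) (Var k)"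

text \<open>\<open>C[x\<^sub>1, ..., x\<^sub>k\<^sub>-\<^sub>1]\<^sup>S \<otimes> C[z\<^sub>k]\<close> with S the symmetric group on k - 1 letters.\<close>

definition A_target :: "nat \<Rightarrow> complex mpoly mpoly set" where
  "A_target k = {F. vars F \<subseteq> {k} \<and> (\<forall>m. Poly_Mapping.lookup F m \<in> sym_polys (k - 1))}"

definition linear_on_sym :: "nat \<Rightarrow> (complex mpoly \<Rightarrow> complex mpoly mpoly) \<Rightarrow> bool" where
  "linear_on_sym k A \<longleftrightarrow>
     (\<forall>p\<in>sym_polys k. \<forall>r\<in>sym_polys k. A (p + r) = A p + A r) \<and>
     (\<forall>c. \<forall>p\<in>sym_polys k. A (Const c * p) = Const (Const c) * A p)"

text \<open>
  The operator A acting on x and as the unit operator on z: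
  \<open>\<Sum>\<^sub>m p\<^sub>m z\<^sup>m \<mapsto> \<Sum>\<^sub>m A(p\<^sub>m) z\<^sup>m\<close>.
\<close>

definition extend_z ::
  "(complex mpoly \<Rightarrow> complex mpoly mpoly) \<Rightarrow> complex mpoly mpoly \<Rightarrow> complex mpoly mpoly" where
  "extend_z A F =
     (\<Sum>m\<in>Poly_Mapping.keys F. A (Poly_Mapping.lookup F m) * Poly_Mapping.single m 1)"

end

theory Submission
  imports Defs "HOL-Computational_Algebra.Fraction_Field" "HOL-Computational_Algebra.Fundamental_Theorem_Algebra"
begin

text \<open>With \<open>r\<^sub>i = \<xi>\<^sub>i / y\<^sub>i\<close> as new variables the integral becomes an average over the simplex
  \<open>\<Sum> r\<^sub>i = z - 1\<close> with Dirichlet weight \<open>\<Prod> r\<^sub>i\<^bsup>g-1\<^esup>\<close>, in which \<open>e\<^sub>k(x)\<close> is a polynomial in y and r.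
  Integration by parts shows that \<open>Q\<^sub>z\<close> commutes with the Laplace--Beltrami operator, which also commutes
  with D(u). Both are triangular in the dominance order, so the Jack polynomials are
  eigenfunctions of \<open>Q\<^sub>z\<close>. If \<open>y\<^sub>k = \<dots> = y\<^sub>n = 1\<close>, then n - k of the x are 1 as well; hence
  \<open>[Q\<^sub>z f](x\<^sub>1, \<dots>, x\<^bsub>k-1\<^esub>, 1, \<dots>, 1)\<close> only depends on \<open>f(x\<^sub>1, \<dots>, x\<^sub>k, 1, \<dots>, 1)\<close>, and this defines \<open>A\<^sub>k\<close>.\<close>

section \<open>Polynomials\<close>

text \<open>\<open>jack\<close> is a definite description through the whole family D(u), of order n,
  whereas commutation with Q is proved for the second-order operator \<open>Hop\<close>: such an
  operator is fixed by its values and its carre du champ on generators, so computations with the e_k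
  suffice. The two families meet in \<open>Hop_D_op_commute\<close>. The eigenvalues of
  \<open>Hop\<close> increase strictly with dominance, so this one operator produces the Jack
  polynomials; D(u) inherits them by commutation, and its own eigenvalues give the uniqueness that
  the description asks for.

  The integral exists only for real z > 1 and ordered positive y. The algebra is therefore carried
  out with \<open>Qalg\<close>, defined for every complex z by Dirichlet moments instead of an
  integral; the x are never solved for and enter only through e_k(x). That the integral has the same
  values is shown for nonnegative integrands by splitting off the smallest y again and again, which
  reduces the change of variables from x to r to monotone substitutions in one variable.\<close>

type_synonym expo = "nat \<Rightarrow>\<^sub>0 nat"
type_synonym cpoly = "complex mpoly"

abbreviation lk :: "('a \<Rightarrow>\<^sub>0 'b::zero) => 'a => 'b" where "lk \<equiv> Poly_Mapping.lookup"
abbreviation sg :: "'a => 'b => ('a \<Rightarrow>\<^sub>0 'b::zero)" where "sg \<equiv> Poly_Mapping.single"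
abbreviation mk :: "('a => 'b) => ('b \<Rightarrow>\<^sub>0 'c::zero) => ('a \<Rightarrow>\<^sub>0 'c)" where "mk \<equiv> Poly_Mapping.map_key"
abbreviation ky :: "('a \<Rightarrow>\<^sub>0 'b::zero) => 'a set" where "ky \<equiv> Poly_Mapping.keys"

lemma lk_sum_single: "(\<Sum>m\<in>ky p. sg m (lk p m)) = (p :: 'a \<Rightarrow>\<^sub>0 'b::comm_monoid_add)"
proof (rule poly_mapping_eqI)
  fix k
  have "lk (\<Sum>m\<in>ky p. sg m (lk p m)) k = (\<Sum>m\<in>ky p. if m = k then lk p m else 0)"
    by (simp add: lookup_sum lookup_single when_def)
  also have "... = lk p k" by (simp add: sum.delta in_keys_iff)
  finally show "lk (\<Sum>m\<in>ky p. sg m (lk p m)) k = lk p k" .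
qed

lemma mpoly_induct [case_names zero add]:
  assumes "P 0" and "\<And>m a p. P p ==> P (sg m a + p)"
  shows "P (p :: 'a \<Rightarrow>\<^sub>0 'b::comm_monoid_add)"
proof -
  have "P (\<Sum>m\<in>M. sg m (lk p m))" if "finite M" for M using that by induction (auto simp: assms)
  from this[of "ky p"] show ?thesis by (simp add: lk_sum_single)
qed

subsection \<open>Evaluation homomorphisms\<close>

text \<open>One notion covers evaluation, permutation of variables, restriction,
  \<open>Const\<close>, \<open>z_embed\<close> and the passage to fractions, so that each of them
  commutes with sums, products and substitutions for the same reason.\<close>

locale semiring_hom =
  fixes c :: "'a::comm_semiring_1 => 'b::comm_semiring_1"
  assumes h0 [simp]: "c 0 = 0" and h1 [simp]: "c 1 = 1"
    and hadd: "c (a + b) = c a + c b" and hmult: "c (a * b) = c a * c b"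
begin

lemma hsum: "c (sum f A) = (\<Sum>a\<in>A. c (f a))" by (induction A rule: infinite_finite_induct) (auto simp: hadd)

lemma hprod: "c (prod f A) = (\<Prod>a\<in>A. c (f a))" by (induction A rule: infinite_finite_induct) (auto simp: hmult)

lemma hpower: "c (a ^ k) = c a ^ k" by (induction k) (auto simp: hmult)

end

lemmas hom_simps = semiring_hom.hadd semiring_hom.hmult semiring_hom.hsum semiring_hom.hprod
  semiring_hom.hpower semiring_hom.h0 semiring_hom.h1

lemma semiring_hom_id: "semiring_hom (\<lambda>c. c)" by standard auto

lemma semiring_hom_comp: "semiring_hom c ==> semiring_hom d ==> semiring_hom (\<lambda>x. d (c x))" by (simp add: semiring_hom_def)

lemma hom_uminus:
  fixes c :: "'a::comm_ring_1 => 'b::comm_ring_1"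
  assumes "semiring_hom c" shows "c (- a) = - c a"
proof -
  interpret semiring_hom c by fact
  have "c (-a) + c a = 0" by (simp flip: hadd)
  then show ?thesis by (simp add: eq_neg_iff_add_eq_0)
qed

lemma hom_diff:
  fixes c :: "'a::comm_ring_1 => 'b::comm_ring_1"
  assumes "semiring_hom c" shows "c (a - b) = c a - c b"
  using semiring_hom.hadd[OF assms, of a "-b"] hom_uminus[OF assms, of b] by simp

definition mon :: "(nat => 'b::comm_semiring_1) => expo => 'b" where
  "mon \<sigma> m = (\<Prod>i\<in>ky m. \<sigma> i ^ lk m i)"

lemma mon_superset: "finite I ==> ky m \<subseteq> I ==> mon \<sigma> m = (\<Prod>i\<in>I. \<sigma> i ^ lk m i)"
  unfolding mon_def by (rule prod.mono_neutral_left) (auto simp: in_keys_iff)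

lemma mon_0 [simp]: "mon \<sigma> 0 = 1" by (simp add: mon_def)

lemma mon_single [simp]: "mon \<sigma> (sg i k) = \<sigma> i ^ k" by (cases "k = 0") (auto simp: mon_def)

lemma mon_add: "mon \<sigma> (m + m') = mon \<sigma> m * mon \<sigma> m'"
proof -
  let ?I = "ky m \<union> ky m'"
  have "mon \<sigma> (m + m') = (\<Prod>i\<in>?I. \<sigma> i ^ lk (m + m') i)" by (rule mon_superset) (use keys_add[of m m'] in auto)
  also have "... = (\<Prod>i\<in>?I. \<sigma> i ^ lk m i) * (\<Prod>i\<in>?I. \<sigma> i ^ lk m' i)" by (simp add: lookup_add power_add prod.distrib)
  also have "... = mon \<sigma> m * mon \<sigma> m'" by (simp add: mon_superset[of ?I])
  finally show ?thesis .
qed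

lemma insertion_mon: "insertion c \<sigma> p = (\<Sum>m\<in>ky p. c (lk p m) * mon \<sigma> m)" by (simp add: insertion_def mon_def)

lemma insertion_zero [simp]: "insertion c \<sigma> 0 = 0" by (simp add: insertion_def)

context semiring_hom begin

lemma insertion_superset:
  "finite M ==> ky p \<subseteq> M ==> insertion c \<sigma> p = (\<Sum>m\<in>M. c (lk p m) * mon \<sigma> m)"
  unfolding insertion_mon by (rule sum.mono_neutral_left) (auto simp: in_keys_iff)

lemma insertion_add: "insertion c \<sigma> (p + q) = insertion c \<sigma> p + insertion c \<sigma> q"
proof -
  let ?M = "ky p \<union> ky q"
  have "insertion c \<sigma> (p + q) = (\<Sum>m\<in>?M. c (lk (p + q) m) * mon \<sigma> m)"
    by (rule insertion_superset) (use keys_add[of p q] in auto)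
  also have "... = insertion c \<sigma> p + insertion c \<sigma> q"
    by (simp add: insertion_superset[of ?M] lookup_add hadd distrib_right sum.distrib)
  finally show ?thesis .
qed

lemma insertion_single: "insertion c \<sigma> (sg m a) = c a * mon \<sigma> m" by (subst insertion_superset[of "{m}"]) (auto simp: )

lemma insertion_mult: "insertion c \<sigma> (p * q) = insertion c \<sigma> p * insertion c \<sigma> q"
proof (induction p rule: mpoly_induct)
  case (add m a p)
  have "insertion c \<sigma> (sg m a * q) = insertion c \<sigma> (sg m a) * insertion c \<sigma> q" by (induction q rule: mpoly_induct)
      (auto simp: distrib_left insertion_add mult_single insertion_single hmult mon_add mult_ac)
  with add show ?case by (simp add: distrib_right insertion_add)
qed simp

lemma insertion_hom: "semiring_hom (insertion c \<sigma>)"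
proof
  show "insertion c \<sigma> 1 = 1" using insertion_single[of \<sigma> 0 1] by simp
qed (auto simp: insertion_add insertion_mult)

lemma insertion_Const [simp]: "insertion c \<sigma> (Const a) = c a" by (simp add: Const_def insertion_single)

lemma insertion_Var [simp]: "insertion c \<sigma> (Var i) = \<sigma> i" by (simp add: Var_def insertion_single)

end

lemma Const_hom: "semiring_hom (Const :: 'a::comm_semiring_1 => 'a mpoly)"
  by standard (auto simp: Const_def single_add mult_single)

lemmas insertion_Const_hom = semiring_hom.insertion_hom[OF Const_hom]
  and insertion_Const_Const = semiring_hom.insertion_Const[OF Const_hom]
  and insertion_Const_Var = semiring_hom.insertion_Var[OF Const_hom]
  and insertion_Const_single = semiring_hom.insertion_single[OF Const_hom]

lemma Const_0 [simp]: "Const 0 = 0" by (simp add: Const_def)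
lemma Const_1 [simp]: "Const 1 = 1" by (simp add: Const_def)
lemma Const_add: "Const (a + b) = Const a + Const (b::'a::comm_semiring_1)" by (rule semiring_hom.hadd[OF Const_hom])
lemma Const_mult: "Const (a * b) = Const a * Const (b::'a::comm_semiring_1)" by (rule semiring_hom.hmult[OF Const_hom])
lemma Const_diff: "Const (a - b) = Const a - Const (b::'a::comm_ring_1)" by (rule hom_diff[OF Const_hom])
lemma Const_uminus: "Const (- b) = - Const (b::'a::comm_ring_1)" by (rule hom_uminus[OF Const_hom])

lemma Const_of_nat: "Const (of_nat k) = (of_nat k :: 'a::comm_semiring_1 mpoly)" by (simp add: Const_def)

lemma Const_of_int: "Const (of_int k) = (of_int k :: 'a::comm_ring_1 mpoly)" by (simp add: Const_def)

lemma lookup_Const_mult: "lk (Const a * p) m = a * lk (p::'a::comm_semiring_1 mpoly) m"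
proof (induction p rule: mpoly_induct)
  case (add k b p)
  have "lk (Const a * sg k b) m = a * lk (sg k b) m" by (auto simp: Const_def mult_single lookup_single when_def)
  with add show ?case by (simp add: distrib_left lookup_add)
qed simp

lemma Const_inj [simp]: "Const a = Const b \<longleftrightarrow> a = b" by (auto simp: Const_def dest: injD[OF inj_single])

lemma single_conv_mon: "sg m a = Const a * mon Var m"
  for a :: "'a::comm_semiring_1"
proof -
  have *: "mon Var m = (sg m 1 :: 'a mpoly)"
  proof (induction m rule: mpoly_induct)
    case (add i k m)
    have "(sg (sg i k) 1 :: 'a mpoly) = Var i ^ k"
    proof (induction k)
      case (Suc k)
      have "sg i (Suc k) = sg i 1 + sg i k" by (simp flip: single_add)
      then have "sg (sg i (Suc k)) 1 = (Var i * sg (sg i k) 1 :: 'a mpoly)" by (simp add: Var_def mult_single)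
      with Suc show ?case by simp
    qed simp
    moreover have "sg (sg i k) 1 * sg m 1 = (sg (sg i k + m) 1 :: 'a mpoly)" by (simp add: mult_single)
    ultimately show ?case using add by (simp add: mon_add)
  qed simp
  show ?thesis by (simp add: * Const_def mult_single)
qed

text \<open>Growing products one variable at a time fits statements about derivations and
  divisibility, where only a product with a generator has to be examined.\<close>

lemma mpoly_ring_induct [case_names Const add times]:
  assumes "\<And>a. P (Const a)" and "\<And>p q. P p ==> P q ==> P (p + q)" and "\<And>p i. P p ==> P (p * Var i)"
  shows "P (p :: 'a::comm_semiring_1 mpoly)"
proof (induction p rule: mpoly_induct)
  case zero
  then show ?case using assms(1)[of 0] by simp
next
  case (add m a p)
  have pw: "P q ==> P (q * Var i ^ k)" for q i k
  proof (induction k)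
    case (Suc k)
    then show ?case using assms(3)[of "q * Var i ^ k" i] by (simp add: mult_ac)
  qed simp
  have "P (Const a * mon Var m)"
  proof (induction m rule: mpoly_induct)
    case (add i k m)
    from pw[OF this, of i k] show ?case by (simp add: mon_add mult_ac)
  qed (simp add: assms(1))
  then show ?case using add assms(2) by (simp add: single_conv_mon)
qed

lemma hom_insertion:
  assumes "semiring_hom c" "semiring_hom h"
  shows "h (insertion c \<sigma> p) = insertion (\<lambda>a. h (c a)) (\<lambda>i. h (\<sigma> i)) p"
proof -
  interpret h: semiring_hom h by fact
  show ?thesis by (simp add: insertion_def h.hsum h.hmult h.hprod h.hpower)
qed

lemma insertion_insertion:
  assumes "semiring_hom c"
  shows "insertion c \<tau> (insertion Const \<sigma> p) = insertion c (\<lambda>i. insertion c \<tau> (\<sigma> i)) p"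
  using hom_insertion[OF Const_hom semiring_hom.insertion_hom[OF assms], of \<tau> \<sigma> p]
  by (simp add: semiring_hom.insertion_Const[OF assms])

lemma insertion_Var_id: "insertion Const Var p = p" for p :: "'a::comm_semiring_1 mpoly"
  by (simp add: insertion_mon single_conv_mon[symmetric] lk_sum_single)

lemma insertion_cong:
  assumes "\<And>i. i \<in> vars p ==> \<sigma> i = \<tau> i"
  shows "insertion c \<sigma> p = insertion c \<tau> p" unfolding insertion_def
  by (intro sum.cong refl arg_cong2[where f = "(*)"] prod.cong arg_cong2[where f = "(^)"] assms)
    (auto simp: vars_def)

lemma eval_hom: "semiring_hom (eval x)" unfolding eval_def by (rule semiring_hom.insertion_hom[OF semiring_hom_id])

lemma eval_add: "eval x (p + q) = eval x p + eval x q"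
  and eval_mult: "eval x (p * q) = eval x p * eval x q"
  and eval_0 [simp]: "eval x 0 = 0" and eval_1 [simp]: "eval x 1 = 1"
  and eval_diff: "eval x (p - q) = eval x p - eval x q"
  and eval_uminus: "eval x (- p) = - eval x p"
  and eval_sum: "eval x (sum f A) = (\<Sum>a\<in>A. eval x (f a))"
  and eval_prod: "eval x (prod f A) = (\<Prod>a\<in>A. eval x (f a))"
  and eval_power: "eval x (p ^ k) = eval x p ^ k" using eval_hom[of x] by (auto simp: hom_simps hom_diff hom_uminus)

lemma eval_Const [simp]: "eval x (Const a) = a" and eval_Var [simp]: "eval x (Var i) = x i"
  by (auto simp: eval_def semiring_hom.insertion_Const[OF semiring_hom_id]
      semiring_hom.insertion_Var[OF semiring_hom_id])

lemma eval_insertion: "eval x (insertion Const \<sigma> p) = eval (\<lambda>i. eval x (\<sigma> i)) p"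
  unfolding eval_def by (rule insertion_insertion[OF semiring_hom_id])

lemma eval_mon: "eval x p = (\<Sum>m\<in>ky p. lk p m * mon x m)" by (simp add: eval_def insertion_mon)

lemma eval_single: "eval x (sg m a) = a * mon x m"
  unfolding eval_def by (rule semiring_hom.insertion_single[OF semiring_hom_id])

subsection \<open>Variables\<close>

lemma vars_subset_iff: "vars p \<subseteq> A \<longleftrightarrow> (\<forall>m\<in>ky p. ky m \<subseteq> A)" by (auto simp: vars_def)

lemma vars_0 [simp]: "vars 0 = {}" by (simp add: vars_def)

lemma vars_Const [simp]: "vars (Const a) = {}" by (auto simp: vars_def Const_def split: if_splits)

lemma vars_1 [simp]: "vars 1 = {}" by (simp add: vars_def)

lemma vars_Var: "vars (Var i :: 'a::zero_neq_one mpoly) = {i}" by (auto simp: vars_def Var_def)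

lemma vars_add: "vars p \<subseteq> A ==> vars q \<subseteq> A ==> vars (p + q) \<subseteq> A" using keys_add[of p q] unfolding vars_subset_iff by blast

lemma vars_mult: "vars p \<subseteq> A ==> vars q \<subseteq> A ==> vars (p * q) \<subseteq> A"
  for p q :: "'a::comm_semiring_1 mpoly" unfolding vars_subset_iff
proof
  fix m assume *: "\<forall>m\<in>ky p. ky m \<subseteq> A" "\<forall>m\<in>ky q. ky m \<subseteq> A" "m \<in> ky (p * q)"
  then obtain a b where "a \<in> ky p" "b \<in> ky q" "m = a + b" using keys_mult[of p q] by auto
  moreover from this * have "ky a \<subseteq> A" "ky b \<subseteq> A" by auto
  ultimately show "ky m \<subseteq> A" using keys_add[of a b] by blast
qed

lemma vars_uminus [simp]: "vars (- p) = vars (p::'a::ab_group_add mpoly)" by (auto simp: vars_def in_keys_iff)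

lemma vars_diff: "vars p \<subseteq> A ==> vars q \<subseteq> A ==> vars (p - q) \<subseteq> (A::nat set)"
  for p q :: "'a::comm_ring_1 mpoly" using vars_add[of p A "- q"] by simp

lemma vars_sum: "(\<And>a. a \<in> B ==> vars (f a) \<subseteq> A) ==> vars (sum f B) \<subseteq> A"
  by (induction B rule: infinite_finite_induct) (simp_all add: vars_add)

lemma vars_prod: "(\<And>a. a \<in> B ==> vars (f a) \<subseteq> A) ==> vars (prod f B) \<subseteq> A"
  for f :: "'b => 'a::comm_semiring_1 mpoly" by (induction B rule: infinite_finite_induct) (simp_all add: vars_mult)

lemma vars_power: "vars p \<subseteq> A ==> vars (p ^ k) \<subseteq> A"
  for p :: "'a::comm_semiring_1 mpoly" by (induction k) (simp_all add: vars_mult)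

lemma vars_insertion:
  fixes p :: "'a::comm_semiring_1 mpoly"
  assumes "\<And>i. i \<in> vars p ==> vars (\<sigma> i :: 'a mpoly) \<subseteq> A"
  shows "vars (insertion Const \<sigma> p) \<subseteq> A" unfolding insertion_def
  by (intro vars_sum vars_mult vars_prod vars_power assms, simp) (force simp: vars_def)


text \<open>Induction on the variables: in one variable the values are those of a univariate
  polynomial with infinitely many roots. A separate set \<open>X i\<close> for each variable leaves
  room for points with prescribed order.\<close>

lemma mpoly_eq_0_if_eval:
  fixes p :: "cpoly"
  assumes "finite V" "vars p \<subseteq> V" "\<And>i. infinite (X i)"
    and "\<And>x. (\<And>i. x i \<in> X i) ==> eval x p = 0"
  shows "p = 0" using assms(1,2,4)
proof (induction V arbitrary: p rule: finite_induct)
  case empty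
  have "p = Const (lk p 0)"
  proof (rule poly_mapping_eqI)
    fix m show "lk p m = lk (Const (lk p 0)) m"
      using empty(1) by (cases "m = 0") (auto simp: Const_def lookup_single when_def vars_def in_keys_iff)
  qed
  moreover obtain x where "\<And>i. x i \<in> X i"
  proof
    show "(SOME t. t \<in> X i) \<in> X i" for i using assms(3)[of i] by (metis finite.emptyI some_in_eq)
  qed
  ultimately show ?case using empty(2)[of x] by (metis Const_0 eval_Const)
next
  case (insert i V p)
  define rem where "rem m = m - sg i (lk m i)" for m :: "expo"
  have rem: "m = rem m + sg i (lk m i)" for m
    by (rule poly_mapping_eqI) (auto simp: rem_def lookup_add lookup_minus lookup_single when_def)
  define q where "q k = (\<Sum>m | m \<in> ky p \<and> lk m i = k. sg (rem m) (lk p m))" for k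
  have fin: "finite {m \<in> ky p. lk m i = k}" for k by simp
  obtain N where N: "\<And>m. m \<in> ky p ==> lk m i \<le> N" using finite_nat_set_iff_bounded_le[of "(\<lambda>m. lk m i) ` ky p"] by auto
  have ev: "eval (x(i := t)) p = (\<Sum>k\<le>N. eval x (q k) * t ^ k)" if "vars p \<subseteq> insert i V" for x t
  proof -
    have "eval (x(i := t)) p = (\<Sum>m\<in>ky p. lk p m * mon (x(i := t)) m)" by (rule eval_mon)
    also have "... = (\<Sum>m\<in>ky p. lk p m * mon x (rem m) * t ^ lk m i)"
    proof (intro sum.cong refl)
      fix m
      have "mon (x(i := t)) m = mon (x(i := t)) (rem m) * t ^ lk m i" by (subst rem) (simp add: mon_add)
      also have "mon (x(i := t)) (rem m) = mon x (rem m)"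
        unfolding mon_def by (rule prod.cong) (auto simp: rem_def lookup_minus in_keys_iff)
      finally show "lk p m * mon (x(i := t)) m = lk p m * mon x (rem m) * t ^ lk m i" by (simp only: mult.assoc)
    qed
    also have "... = (\<Sum>k\<le>N. \<Sum>m | m \<in> ky p \<and> lk m i = k. lk p m * mon x (rem m) * t ^ lk m i)"
      by (rule sum.group[symmetric]) (use N in auto)
    also have "... = (\<Sum>k\<le>N. eval x (q k) * t ^ k)" by (simp add: q_def eval_sum eval_single sum_distrib_right)
    finally show ?thesis .
  qed
  have q0: "q k = 0" if "k \<le> N" for k
  proof (rule insert.IH)
    have "ky (rem m) \<subseteq> V" if "m \<in> ky p" for m
    proof
      fix j assume j: "j \<in> ky (rem m)"
      then have "j \<in> ky m" "j \<noteq> i" by (auto simp: rem_def in_keys_iff lookup_minus)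
      then show "j \<in> V" using insert.prems(1) that unfolding vars_subset_iff by auto
    qed
    then have "vars (sg (rem m) (lk p m)) \<subseteq> V" if "m \<in> ky p" for m using that by (simp add: vars_def)
    then show "vars (q k) \<subseteq> V" unfolding q_def by (intro vars_sum) auto
    fix x :: "nat => complex" assume x: "\<And>j. x j \<in> X j"
    let ?P = "\<Sum>k\<le>N. monom (eval x (q k)) k"
    have "poly ?P t = 0" if "t \<in> X i" for t using ev[OF insert.prems(1), of x t] insert.prems(2)[of "x(i := t)"] x that
      by (simp add: poly_sum poly_monom)
    then have "\<not> finite {t. poly ?P t = 0}"
      using assms(3)[of i] by (metis (mono_tags, lifting) finite_subset mem_Collect_eq subsetI)
    then have "?P = 0" using poly_roots_finite by blast
    then have "coeff ?P k = 0" by simp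
    then show "eval x (q k) = 0" using \<open>k \<le> N\<close> by (simp add: coeff_sum)
  qed
  show ?case
  proof (rule poly_mapping_eqI)
    fix m
    show "lk p m = lk 0 m"
    proof (cases "m \<in> ky p")
      case True
      let ?k = "lk m i"
      have "lk (q ?k) (rem m) = (\<Sum>m' | m' \<in> ky p \<and> lk m' i = ?k. if m' = m then lk p m' else 0)" unfolding q_def lookup_sum
        by (rule sum.cong) (auto simp: lookup_single when_def, metis rem)
      also have "... = lk p m" using True by (simp add: sum.delta)
      finally show ?thesis using q0[OF N[OF True]] by simp
    qed (simp add: in_keys_iff)
  qed
qed

lemma mpoly_eqI_eval:
  fixes p q :: "cpoly"
  assumes "finite V" "vars p \<subseteq> V" "vars q \<subseteq> V" "\<And>i. infinite (X i)"
    and "\<And>x. (\<And>i. x i \<in> X i) ==> eval x p = eval x q"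
  shows "p = q" using mpoly_eq_0_if_eval[OF assms(1) vars_diff[OF assms(2,3)], of X] assms(4,5) by (simp add: eval_diff)

lemma finite_vars [simp]: "finite (vars p)" by (simp add: vars_def)

lemma mpoly_eqI:
  fixes p q :: "cpoly"
  assumes "\<And>x. eval x p = eval x q" shows "p = q" by (rule mpoly_eqI_eval[where V = "vars p \<union> vars q" and X = "\<lambda>_. UNIV"])
    (auto simp: assms infinite_UNIV_char_0)

text \<open>The open intervals from i to i + 1 are disjoint and ordered, so every point of their
  product is increasing: the admissible points contain a product of infinite sets.\<close>

lemma mpoly_eqI_ordered:
  fixes p q :: "cpoly"
  assumes "vars p \<subseteq> {1..n}" "vars q \<subseteq> {1..n}"
    and ev: "\<And>y. ordered_pos n y ==> inj y ==> eval (\<lambda>i. complex_of_real (y i)) p = eval (\<lambda>i. complex_of_real (y i)) q"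
  shows "p = q"
proof (rule mpoly_eqI_eval[where V = "{1..n}" and X = "\<lambda>i. complex_of_real ` {real i <..< real i + 1}"])
  show "infinite (complex_of_real ` {real i <..< real i + 1})" for i by (subst finite_image_iff) (auto intro: inj_onI)
  fix x assume x: "\<And>i. x i \<in> complex_of_real ` {real i <..< real i + 1}"
  define y where "y i = Re (x i)" for i
  have y: "x i = complex_of_real (y i)" "real i < y i" "y i < real i + 1" for i using x[of i] by (auto simp: y_def)
  have "y i < y j" if "i < j" for i j using y(3)[of i] y(2)[of j] that by linarith
  then have "inj y" "ordered_pos n y" using y(2)[of 1] by (auto intro: linorder_injI simp: ordered_pos_def less_imp_neq)
  moreover have "x = (\<lambda>i. complex_of_real (y i))" using y(1) by auto
  ultimately show "eval x p = eval x q" using ev by simp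
qed (use assms in auto)

subsection \<open>Derivations\<close>

text \<open>The Euler operator \<open>x\<^sub>i \<partial>/\<partial>x\<^sub>i\<close>. It is
  diagonal on monomials, so its rules can be read off coefficientwise; those of
  \<open>mpderiv\<close> follow by cancelling \<open>Var i\<close>.\<close>

definition theta :: "nat => cpoly => cpoly" where
  "theta i p = (\<Sum>m\<in>ky p. sg m (of_nat (lk m i) * lk p m))"

lemma lookup_theta: "lk (theta i p) m = of_nat (lk m i) * lk p m"
proof -
  have "lk (theta i p) m = (\<Sum>k\<in>ky p. if k = m then of_nat (lk m i) * lk p m else 0)"
    unfolding theta_def lookup_sum by (rule sum.cong) (auto simp: lookup_single when_def)
  then show ?thesis by (auto simp: in_keys_iff)
qed

lemma theta_add: "theta i (p + q) = theta i p + theta i q"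
  and theta_diff: "theta i (p - q) = theta i p - theta i q"
  and theta_0 [simp]: "theta i 0 = 0"
  and theta_commute: "theta i (theta j p) = theta j (theta i p)"
  and theta_Const_mult: "theta i (Const c * p) = Const c * theta i p"
  and theta_single: "theta i (sg m a) = sg m (of_nat (lk m i) * a)" by (auto intro!: poly_mapping_eqI
      simp: lookup_theta lookup_add lookup_minus lookup_Const_mult lookup_single distrib_left right_diff_distrib mult.left_commute
        when_def)

lemma theta_mult: "theta i (p * q) = theta i p * q + p * theta i q"
proof (induction p rule: mpoly_induct)
  case (add m a p)
  have "theta i (sg m a * q) = theta i (sg m a) * q + sg m a * theta i q" by (induction q rule: mpoly_induct)
      (auto simp: distrib_left distrib_right theta_add mult_single theta_single lookup_add
        algebra_simps single_add simp flip: single_add)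
  with add show ?case by (simp add: distrib_right theta_add algebra_simps)
qed simp

lemma theta_Var: "theta i (Var j) = (if i = j then Var j else 0)" by (auto simp: Var_def theta_single lookup_single)

lemma theta_Const [simp]: "theta i (Const c) = 0" by (simp add: Const_def theta_single)

lemma theta_1 [simp]: "theta i 1 = 0" using theta_Const[of i 1] by simp

lemma keys_theta: "ky (theta i p) \<subseteq> ky p" by (auto simp: in_keys_iff lookup_theta)

lemma vars_theta: "vars p \<subseteq> A ==> vars (theta i p) \<subseteq> A" using keys_theta[of i p] by (auto simp: vars_def)

lemma Var_nonzero [simp]: "Var i \<noteq> (0 :: cpoly)" using eval_Var[of "\<lambda>_. 1" i] by (metis eval_0 zero_neq_one)

lemma Var_mpderiv: "Var i * mpderiv i p = theta i p"
proof -
  have *: "Var i * sg (m - sg i 1) (of_nat (lk m i) * a) = sg m (of_nat (lk m i) * a)" for m and a :: complex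
  proof (cases "lk m i = 0")
    case False
    then have "sg i 1 + (m - sg i 1) = m"
      by (intro poly_mapping_eqI) (auto simp: lookup_add lookup_minus lookup_single when_def)
    then show ?thesis by (simp add: Var_def mult_single)
  qed simp
  show ?thesis unfolding mpderiv_def theta_def sum_distrib_left by (intro sum.cong refl *)
qed

lemma mpderiv_eqI: "Var i * q = theta i p ==> mpderiv i p = q"
  using Var_mpderiv[of i p] mult_left_cancel[OF Var_nonzero[of i], of "mpderiv i p" q] by simp

lemma mpderiv_add: "mpderiv i (p + q) = mpderiv i p + mpderiv i q"
  by (rule mpderiv_eqI) (simp add: distrib_left Var_mpderiv theta_add)

lemma mpderiv_mult: "mpderiv i (p * q) = mpderiv i p * q + p * mpderiv i q"
proof (rule mpderiv_eqI)
  show "Var i * (mpderiv i p * q + p * mpderiv i q) = theta i (p * q)"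
    unfolding theta_mult unfolding Var_mpderiv[symmetric] by (simp add: algebra_simps)
qed

lemma mpderiv_0 [simp]: "mpderiv i 0 = 0" by (simp add: mpderiv_def)

lemma mpderiv_Const [simp]: "mpderiv i (Const c) = 0" by (rule mpderiv_eqI) simp

lemma mpderiv_Var: "mpderiv i (Var j) = (if i = j then 1 else 0)" by (rule mpderiv_eqI) (simp add: theta_Var)

section \<open>Symmetric polynomials\<close>

declare One_nat_def [simp del]

subsection \<open>Permutation of the variables\<close>

text \<open>The map need not be bijective: \<open>ident\<close> below identifies two variables by
  the same substitution.\<close>

definition pm :: "(nat => nat) => cpoly => cpoly" where
  "pm \<pi> p = insertion Const (\<lambda>i. Var (\<pi> i)) p"

lemma pm_hom: "semiring_hom (pm \<pi>)" unfolding pm_def by (rule insertion_Const_hom)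

lemma pm_add: "pm \<pi> (p + q) = pm \<pi> p + pm \<pi> q"
  and pm_mult: "pm \<pi> (p * q) = pm \<pi> p * pm \<pi> q"
  and pm_0 [simp]: "pm \<pi> 0 = 0" and pm_1 [simp]: "pm \<pi> 1 = 1"
  and pm_diff: "pm \<pi> (p - q) = pm \<pi> p - pm \<pi> q"
  and pm_uminus: "pm \<pi> (- p) = - pm \<pi> p"
  and pm_sum: "pm \<pi> (sum f A) = (\<Sum>a\<in>A. pm \<pi> (f a))"
  and pm_prod: "pm \<pi> (prod f A) = (\<Prod>a\<in>A. pm \<pi> (f a))"
  and pm_power: "pm \<pi> (p ^ k) = pm \<pi> p ^ k" using pm_hom[of \<pi>] by (auto simp: hom_simps hom_diff hom_uminus)

lemma pm_Const [simp]: "pm \<pi> (Const a) = Const a" and pm_Var [simp]: "pm \<pi> (Var i) = Var (\<pi> i)"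
  by (simp_all add: pm_def insertion_Const_Const
      insertion_Const_Var)

lemma pm_of_int [simp]: "pm \<pi> (of_int k) = of_int k" by (metis Const_of_int pm_Const)

lemma eval_pm: "eval x (pm \<pi> p) = eval (\<lambda>i. x (\<pi> i)) p" by (simp add: pm_def eval_insertion)

lemma pm_pm: "pm \<pi> (pm \<sigma> p) = pm (\<lambda>i. \<pi> (\<sigma> i)) p" by (rule mpoly_eqI) (simp add: eval_pm)

lemma lookup_map_key: "inj f ==> lk (mk f m) i = lk m (f i)" by (simp add: map_key.rep_eq)

lemma pm_single:
  assumes "bij \<pi>"
  shows "pm \<pi> (sg m a) = sg (mk (inv \<pi>) m) a"
proof -
  have inj: "inj (inv \<pi>)" using assms by (simp add: bij_imp_bij_inv bij_is_inj)
  have k: "ky (mk (inv \<pi>) m) = \<pi> ` ky m"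
  proof (rule set_eqI)
    fix i
    have "i \<in> \<pi> ` ky m \<longleftrightarrow> inv \<pi> i \<in> ky m"
      using assms by (auto simp: bij_def image_iff surj_f_inv_f intro!: bexI[of _ "inv \<pi> i"])
    then show "i \<in> ky (mk (inv \<pi>) m) \<longleftrightarrow> i \<in> \<pi> ` ky m" by (simp add: in_keys_iff lookup_map_key[OF inj])
  qed
  have "mon (\<lambda>i. Var (\<pi> i)) m = (mon Var (mk (inv \<pi>) m) :: cpoly)" unfolding mon_def k by (subst prod.reindex)
      (use assms in \<open>simp_all add: lookup_map_key[OF inj] bij_is_inj inj_on_subset[OF bij_is_inj[OF assms]]\<close>)
  then show ?thesis unfolding pm_def insertion_Const_single by (simp add: single_conv_mon)
qed

lemma lookup_pm:
  assumes "bij \<pi>"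
  shows "lk (pm \<pi> p) m = lk p (mk \<pi> m)"
proof (induction p rule: mpoly_induct)
  case (add k a p)
  have inj: "inj (inv \<pi>)" "inj \<pi>" using assms by (auto simp: bij_imp_bij_inv bij_is_inj)
  have "mk (inv \<pi>) k = m \<longleftrightarrow> k = mk \<pi> m"
    unfolding poly_mapping_eq_iff fun_eq_iff lookup_map_key[OF inj(1)] lookup_map_key[OF inj(2)]
    using assms by (auto simp: bij_def surj_f_inv_f) (metis surj_f_inv_f inv_f_f)+
  then have "lk (pm \<pi> (sg k a)) m = lk (sg k a) (mk \<pi> m)" by (auto simp: pm_single[OF assms] lookup_single when_def)
  with add show ?case by (simp add: pm_add lookup_add)
qed simp

lemma pm_theta:
  assumes "bij \<pi>"
  shows "pm \<pi> (theta i p) = theta (\<pi> i) (pm \<pi> p)" by (rule poly_mapping_eqI)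
    (simp add: lookup_pm[OF assms] lookup_theta lookup_map_key bij_is_inj[OF assms])

lemma permutes_bij_nat: "\<pi> permutes A ==> bij (\<pi> :: nat => nat)" by (rule permutes_bij)

lemma map_key_inv:
  assumes "\<pi> permutes A"
  shows "mk (inv \<pi>) (mk \<pi> m) = m"
    and "mk \<pi> (mk (inv \<pi>) m) = m" using permutes_inverses[OF assms] by (auto intro!: poly_mapping_eqI
      simp: lookup_map_key permutes_inj[OF assms] permutes_inj[OF permutes_inv[OF assms]])

lemma map_key_permutes:
  assumes "\<pi> permutes A" "ky m \<subseteq> A"
  shows "ky (mk \<pi> m) \<subseteq> A" using assms by (auto simp: in_keys_iff lookup_map_key permutes_inj)
    (metis in_keys_iff permutes_in_image subsetD)

lemma sym_polys_pm: "sym_polys n = {p. vars p \<subseteq> {1..n} \<and> (\<forall>\<pi>. \<pi> permutes {1..n} --> pm \<pi> p = p)}"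
  by (simp add: sym_polys_def pm_def)

lemma sym_vars: "p \<in> sym_polys n ==> vars p \<subseteq> {1..n}"
  and sym_pm: "p \<in> sym_polys n ==> \<pi> permutes {1..n} ==> pm \<pi> p = p" by (auto simp: sym_polys_pm)

lemma sym_Const [intro, simp]: "Const c \<in> sym_polys n"
  and sym_0 [intro, simp]: "0 \<in> sym_polys n"
  and sym_1 [intro, simp]: "1 \<in> sym_polys n"
  and sym_add [intro]: "p \<in> sym_polys n ==> q \<in> sym_polys n ==> p + q \<in> sym_polys n"
  and sym_diff [intro]: "p \<in> sym_polys n ==> q \<in> sym_polys n ==> p - q \<in> sym_polys n"
  and sym_mult [intro]: "p \<in> sym_polys n ==> q \<in> sym_polys n ==> p * q \<in> sym_polys n" unfolding sym_polys_pm mem_Collect_eq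
  by (simp_all add: pm_add pm_mult pm_diff vars_add vars_mult vars_diff)

lemma sym_sum: "(\<And>a. a \<in> A ==> f a \<in> sym_polys n) ==> sum f A \<in> sym_polys n" by (induction A rule: infinite_finite_induct) auto

lemma sym_prod: "(\<And>a. a \<in> A ==> f a \<in> sym_polys n) ==> prod f A \<in> sym_polys n"
  by (induction A rule: infinite_finite_induct) auto

lemma sym_power: "p \<in> sym_polys n ==> p ^ k \<in> sym_polys n" by (induction k) auto

lemma sym_lookup:
  "p \<in> sym_polys n ==> \<pi> permutes {1..n} ==> lk p (mk \<pi> m) = lk p m"
  using sym_pm[of p n \<pi>] lookup_pm[OF permutes_bij_nat, of \<pi> "{1..n}" p m] by simp

subsection \<open>Exponents and dominance\<close>

text \<open>The sum starts at index 0, so that the partial sums determine an exponent vector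
  whatever its support (\<open>pre_eqD\<close>); on partitions the entry at 0 vanishes.\<close>

definition pre :: "expo => nat => nat" where
  "pre m k = (\<Sum>i\<le>k. lk m i)"

definition sdeg :: "nat set => expo => nat" where
  "sdeg S m = (\<Sum>i\<in>S. lk m i)"

lemma pre_add: "pre (a + b) k = pre a k + pre b k" by (simp add: pre_def lookup_add sum.distrib)
lemma sdeg_add: "sdeg S (a + b) = sdeg S a + sdeg S b" by (simp add: sdeg_def lookup_add sum.distrib)

lemma pre_eqD:
  assumes "\<And>k. pre a k = pre b k" shows "a = b"
proof (rule poly_mapping_eqI)
  fix k show "lk a k = lk b k" using assms[of k] assms[of "k - 1"] by (cases k) (auto simp: pre_def)
qed

lemma lookup_beyond: "ky (m :: expo) \<subseteq> {1..n} ==> n < i ==> lk m i = 0"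
  using subsetD[of "ky m" "{1..n}" i] by (cases "i \<in> ky m") (auto simp: in_keys_iff)

lemma lookup_at_0: "ky (m :: expo) \<subseteq> {1..n} ==> lk m 0 = 0"
  using subsetD[of "ky m" "{1..n}" 0] by (cases "0 \<in> ky m") (auto simp: in_keys_iff)

lemma pre_sdeg: "ky m \<subseteq> {1..n} ==> pre m k = sdeg {1..k} m" unfolding pre_def sdeg_def
  by (rule sum.mono_neutral_right) (auto simp: not_le Suc_le_eq lookup_at_0)

lemma pre_beyond: "ky m \<subseteq> {1..n} ==> n \<le> k ==> pre m k = pre m n"
  unfolding pre_def by (rule sum.mono_neutral_right) (auto simp: lookup_beyond)

text \<open>An upper bound in the order of partial sums together with the coefficient there; c = 0
  is allowed and then leaves only the bound.\<close>

definition leads :: "expo => complex => cpoly => bool" where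
  "leads m c p \<longleftrightarrow> lk p m = c \<and> (\<forall>\<nu>\<in>ky p. \<forall>k. pre \<nu> k \<le> pre m k)"

text \<open>Partial sums add and each factor obeys its own bound, so a + b = m + m' forces a = m and
  b = m': a single product contributes to the top coefficient.\<close>

lemma leads_mult:
  assumes "leads m c p" "leads m' c' q" shows "leads (m + m') (c * c') (p * q)"
proof -
  have eq: "a = m \<and> b = m'" if "a \<in> ky p" "b \<in> ky q" "a + b = m + m'" for a b
  proof -
    have "pre a k + pre b k = pre m k + pre m' k" for k by (metis that(3) pre_add)
    moreover have "pre a k \<le> pre m k" "pre b k \<le> pre m' k" for k using assms that by (auto simp: leads_def)
    ultimately have "pre a k = pre m k" "pre b k = pre m' k" for k
      by (metis add_le_cancel_left add_le_cancel_right le_antisym)+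
    then show ?thesis by (auto intro: pre_eqD)
  qed
  have "lk (p * q) (m + m') = (\<Sum>a\<in>ky p. \<Sum>b\<in>ky q. lk (sg (a + b) (lk p a * lk q b)) (m + m'))"
  proof -
    have "p * q = (\<Sum>a\<in>ky p. sg a (lk p a)) * (\<Sum>b\<in>ky q. sg b (lk q b))" by (simp only: lk_sum_single)
    also have "... = (\<Sum>a\<in>ky p. \<Sum>b\<in>ky q. sg (a + b) (lk p a * lk q b))" by (simp only: sum_product mult_single)
    finally show ?thesis by (simp add: lookup_sum)
  qed
  also have "... = (\<Sum>a\<in>ky p. \<Sum>b\<in>ky q. if a = m then (if b = m' then c * c' else 0) else 0)"
    using assms eq by (intro sum.cong refl) (auto simp: lookup_single when_def leads_def)
  also have "... = (\<Sum>a\<in>ky p. if a = m then (\<Sum>b\<in>ky q. if b = m' then c * c' else 0) else 0)" by (intro sum.cong refl) auto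
  also have "... = c * c'" using assms by (auto simp: leads_def in_keys_iff)
  finally have "lk (p * q) (m + m') = c * c'" .
  moreover have "pre \<nu> k \<le> pre (m + m') k" if \<nu>: "\<nu> \<in> ky (p * q)" for \<nu> k
  proof -
    obtain a b where "a \<in> ky p" "b \<in> ky q" "\<nu> = a + b" using \<nu> keys_mult[of p q] by auto
    then show ?thesis using assms by (auto simp: leads_def pre_add add_mono)
  qed
  ultimately show ?thesis by (auto simp: leads_def)
qed

lemma leads_1: "leads 0 1 1" by (simp add: leads_def)

lemma leads_prod:
  assumes "\<And>a. a \<in> A ==> leads (m a) 1 (f a)" shows "leads (sum m A) 1 (prod f A)" using assms
proof (induction A rule: infinite_finite_induct)
  case (insert a A)
  then show ?case using leads_mult[of "m a" 1 "f a" "sum m A" 1 "prod f A"] by simp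
qed (auto simp: leads_1)

lemma leads_power:
  assumes "leads m 1 p" shows "leads (\<Sum>_<k. m) 1 (p ^ k)" using leads_prod[of "{..<k}" "\<lambda>_. m" "\<lambda>_. p"] assms by simp

text \<open>The exponents in the convex hull of the permutations of \<open>lam\<close>.\<close>

definition dhull :: "nat => expo => expo set" where
  "dhull n lam = {\<nu>. ky \<nu> \<subseteq> {1..n} \<and> (\<forall>S\<subseteq>{1..n}. sdeg S \<nu> \<le> pre lam (card S)) \<and> sdeg {1..n} \<nu> = pre lam n}"

lemma hull_add: "a \<in> dhull n lam ==> b \<in> dhull n mu ==> a + b \<in> dhull n (lam + mu)"
  using keys_add[of a b] by (fastforce simp: dhull_def sdeg_add pre_add add_mono)

lemma sdeg_map_key:
  assumes "\<pi> permutes A" shows "sdeg S (mk \<pi> m) = sdeg (\<pi> ` S) m"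
proof -
  have "inj \<pi>" using assms by (rule permutes_inj)
  then show ?thesis unfolding sdeg_def by (subst sum.reindex) (auto simp: lookup_map_key inj_on_def)
qed

lemma hull_map_key:
  assumes "\<pi> permutes {1..n}" "\<nu> \<in> dhull n lam" shows "mk \<pi> \<nu> \<in> dhull n lam"
proof -
  have "\<pi> ` S \<subseteq> {1..n}" "card (\<pi> ` S) = card S" if "S \<subseteq> {1..n}" for S using that assms(1) permutes_image[OF assms(1)]
    by (auto intro!: card_image dest: permutes_inj intro: inj_on_subset)
  then show ?thesis using assms map_key_permutes[OF assms(1), of \<nu>]
    unfolding dhull_def mem_Collect_eq sdeg_map_key[OF assms(1)] permutes_image[OF assms(1)] by metis
qed

lemma hull_pre_le:
  assumes "\<nu> \<in> dhull n lam" "ky lam \<subseteq> {1..n}" shows "pre \<nu> k \<le> pre lam k"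
proof (cases "k \<le> n")
  case True
  then show ?thesis using assms by (auto simp: dhull_def pre_sdeg[of \<nu> n] dest: spec[of _ "{1..k}"])
next
  case False
  have "pre \<nu> n = pre lam n" using assms by (auto simp: dhull_def pre_sdeg[of \<nu> n])
  then show ?thesis using False assms pre_beyond[of \<nu> n k] pre_beyond[of lam n k] by (auto simp: dhull_def)
qed

lemma partitions_keys: "lam \<in> partitions n ==> ky lam \<subseteq> {1..n}" by (simp add: partitions_def)

lemma partitions_antimono:
  assumes "lam \<in> partitions n" "1 \<le> i" "i \<le> j" shows "lk lam j \<le> lk lam i" using assms(3)
proof (induction j rule: dec_induct)
  case (step j)
  show ?case
  proof (cases "j < n")
    case True
    then have "lk lam (Suc j) \<le> lk lam j" using assms step by (auto simp: partitions_def)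
    with step show ?thesis by simp
  next
    case False
    then have "Suc j \<notin> ky lam" using partitions_keys[OF assms(1)] by auto
    then show ?thesis by (simp add: in_keys_iff)
  qed
qed simp

text \<open>The largest index in S is at least \<open>card S\<close>, so by monotonicity its part is
  at most the part with number \<open>card S\<close>; remove it and induct.\<close>

lemma sdeg_le_pre:
  assumes "lam \<in> partitions n" "finite S" "S \<subseteq> {1..}" shows "sdeg S lam \<le> pre lam (card S)" using assms(2,3)
proof (induction "card S" arbitrary: S)
  case 0
  then show ?case by (simp add: sdeg_def)
next
  case (Suc k S)
  let ?j = "Max S"
  have j: "?j \<in> S" using Suc by (metis Max_in card.empty nat.distinct(1))
  have "S \<subseteq> {1..?j}" using Suc by auto
  then have "card S \<le> ?j" by (metis card_atLeastAtMost card_mono diff_Suc_1 finite_atLeastAtMost)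
  then have "lk lam ?j \<le> lk lam (card S)" using Suc(2) by (intro partitions_antimono[OF assms(1)]) auto
  moreover have "sdeg (S - {?j}) lam \<le> pre lam (card (S - {?j}))" using Suc j by (intro Suc(1)) auto
  moreover have "card (S - {?j}) = k" using Suc j by simp
  moreover have "sdeg S lam = lk lam ?j + sdeg (S - {?j}) lam" unfolding sdeg_def using j Suc by (simp add: sum.remove)
  moreover have "pre lam (card S) = pre lam k + lk lam (card S)" using Suc(2) by (simp add: pre_def flip: Suc(2))
  ultimately show ?case by simp
qed

lemma dominated_pre:
  assumes "mu \<in> partitions n" "lam \<in> partitions n"
  shows "dominated n mu lam \<longleftrightarrow> pre mu n = pre lam n \<and> (\<forall>k. pre mu k \<le> pre lam k)"
proof -
  note k = partitions_keys[OF assms(1)] partitions_keys[OF assms(2)]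
  have "(\<forall>k\<in>{1..<n}. pre mu k \<le> pre lam k) \<longleftrightarrow> (\<forall>k. pre mu k \<le> pre lam k)" if "pre mu n = pre lam n"
  proof (intro iffI allI)
    fix k assume *: "\<forall>k\<in>{1..<n}. pre mu k \<le> pre lam k"
    consider "k = 0" | "k \<in> {1..<n}" | "n \<le> k" by fastforce
    then show "pre mu k \<le> pre lam k"
    proof cases
      case 1
      then show ?thesis using k by (auto simp: pre_sdeg[of _ n] sdeg_def)
    next
      case 3
      then show ?thesis using k that by (simp add: pre_beyond[of _ n k])
    qed (use * in auto)
  qed auto
  then show ?thesis unfolding dominated_def using k by (auto simp: pre_sdeg[of _ n] sdeg_def)
qed

lemma partition_in_hull: 
  assumes "lam \<in> partitions n" shows "lam \<in> dhull n lam"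
proof -
  have "sdeg S lam \<le> pre lam (card S)" if "S \<subseteq> {1..n}" for S
    using sdeg_le_pre[OF assms finite_subset[OF that]] subset_trans[OF that, of "{1..}"] by auto
  then show ?thesis using partitions_keys[OF assms] pre_sdeg[of lam n n] by (simp add: dhull_def)
qed

text \<open>Dominance compares partitions only, while \<open>dhull\<close> contains arbitrary
  exponents, is stable under permutations and adds under products. This bridge lets exponents be
  tracked by hulls throughout.\<close>

lemma dominated_iff_hull:
  assumes "mu \<in> partitions n" "lam \<in> partitions n"
  shows "dominated n mu lam \<longleftrightarrow> mu \<in> dhull n lam"
proof
  assume *: "dominated n mu lam"
  then have le: "pre mu k \<le> pre lam k" for k using dominated_pre[OF assms] by auto
  have "sdeg S mu \<le> pre lam (card S)" if "S \<subseteq> {1..n}" for S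
    using sdeg_le_pre[OF assms(1), of S] le[of "card S"] that finite_subset[OF that] by fastforce
  then show "mu \<in> dhull n lam"
    using * dominated_pre[OF assms] partitions_keys[OF assms(1)] by (auto simp: dhull_def pre_sdeg[of mu n])
next
  assume "mu \<in> dhull n lam"
  then show "dominated n mu lam" using hull_pre_le[of mu n lam] partitions_keys[OF assms(1)] partitions_keys[OF assms(2)]
    by (auto simp: dominated_pre[OF assms] dhull_def pre_sdeg[of mu n])
qed

lemma dominated_refl: "dominated n lam lam" by (simp add: dominated_def)

lemma dominated_trans: "dominated n a b ==> dominated n b c ==> dominated n a c"
  by (auto simp: dominated_def) (meson atLeastLessThan_iff le_trans)

lemma dominated_antisym:
  "a \<in> partitions n ==> b \<in> partitions n ==> dominated n a b ==> dominated n b a ==> a = b"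
  by (rule pre_eqD) (simp add: dominated_pre le_antisym)

text \<open>Rearrangements of each other lie in each other's hull, and dominance is
  antisymmetric.\<close>

lemma map_key_partition_unique:
  assumes "mu \<in> partitions n" "mu' \<in> partitions n" "\<pi> permutes {1..n}" "mu' = mk \<pi> mu"
  shows "mu' = mu"
proof -
  have 1: "mu' \<in> dhull n mu" using hull_map_key[OF assms(3) partition_in_hull[OF assms(1)]] assms(4) by simp
  have "mu = mk (inv \<pi>) mu'" by (simp add: assms(4) map_key_inv[OF assms(3)])
  then have 2: "mu \<in> dhull n mu'" using hull_map_key[OF permutes_inv[OF assms(3)] partition_in_hull[OF assms(2)]] by simp
  show ?thesis using 1 2 assms by (metis dominated_antisym dominated_iff_hull)
qed

lemma ex_sort:
  assumes "ky \<nu> \<subseteq> {1..n}"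
  obtains \<pi> where "\<pi> permutes {1..n}" "mk \<pi> \<nu> \<in> partitions n"
proof -
  \<comment> \<open>A permutation that maximises this weight sorts the entries: exchanging two
    adjacent entries in the wrong order would raise the weight by their difference.\<close>
  define w where "w \<pi> = (\<Sum>i=1..n. (n - i) * lk \<nu> (\<pi> i))" for \<pi>
  let ?P = "{\<pi>. \<pi> permutes {1..n}}"
  have fin: "finite ?P" by (simp add: finite_permutations)
  have "?P \<noteq> {}" using permutes_id by blast
  then obtain \<pi> where \<pi>: "\<pi> permutes {1..n}" and max: "\<And>\<sigma>. \<sigma> permutes {1..n} ==> w \<sigma> \<le> w \<pi>"
    using Max_in[of "w ` ?P"] Max_ge[of "w ` ?P"] fin by (metis (no_types, lifting) finite_imageI imageE image_eqI image_is_empty mem_Collect_eq)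
  have "lk \<nu> (\<pi> (Suc i)) \<le> lk \<nu> (\<pi> i)" if i: "i \<in> {1..<n}" for i
  proof (rule ccontr)
    assume neg: "\<not> ?thesis"
    let ?t = "Transposition.transpose i (Suc i)"
    have "\<pi> \<circ> ?t permutes {1..n}" using \<pi> i by (intro permutes_compose permutes_swap_id) auto
    then have le: "w (\<pi> \<circ> ?t) \<le> w \<pi>" by (rule max)
    let ?R = "{1..n} - {i, Suc i}"
    have split: "(\<Sum>j=1..n. f j) = f i + f (Suc i) + (\<Sum>j\<in>?R. f j)" for f :: "nat => nat"
    proof -
      have "{1..n} = insert i (insert (Suc i) ?R)" using i by auto
      then show ?thesis by (metis (no_types, lifting) Diff_iff add.assoc finite_Diff finite_atLeastAtMost
            finite_insert insertCI insert_iff n_not_Suc_n sum.insert)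
    qed
    have R: "(\<Sum>j\<in>?R. (n - j) * lk \<nu> ((\<pi> \<circ> ?t) j)) = (\<Sum>j\<in>?R. (n - j) * lk \<nu> (\<pi> j))"
      by (rule sum.cong) (auto simp: transpose_apply_other)
    obtain d where d: "n - i = Suc d" "n - Suc i = d" using i by (metis Suc_diff_Suc atLeastLessThan_iff)
    have "w (\<pi> \<circ> ?t) = (n - i) * lk \<nu> (\<pi> (Suc i)) + (n - Suc i) * lk \<nu> (\<pi> i) + (\<Sum>j\<in>?R. (n - j) * lk \<nu> (\<pi> j))"
      unfolding w_def split R by simp
    moreover have "w \<pi> = (n - i) * lk \<nu> (\<pi> i) + (n - Suc i) * lk \<nu> (\<pi> (Suc i)) + (\<Sum>j\<in>?R. (n - j) * lk \<nu> (\<pi> j))"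
      unfolding w_def split by simp
    ultimately show False using le neg d by simp
  qed
  then have "mk \<pi> \<nu> \<in> partitions n"
    using map_key_permutes[OF \<pi> assms] \<pi> by (simp add: partitions_def lookup_map_key permutes_inj)
  with \<pi> show ?thesis by (rule that)
qed

lemma finite_bounded_exponents:
  assumes "finite A"
  shows "finite {m :: expo. ky m \<subseteq> A \<and> (\<forall>i. lk m i \<le> N)}"
proof -
  have "finite {f. \<forall>x. (x \<in> A --> f x \<in> {..N}) \<and> (x \<notin> A --> f x = 0)}" using assms by (intro finite_set_of_finite_funs) auto
  moreover have "lk ` {m :: expo. ky m \<subseteq> A \<and> (\<forall>i. lk m i \<le> N)} \<subseteq> {f. \<forall>x. (x \<in> A --> f x \<in> {..N}) \<and> (x \<notin> A --> f x = 0)}"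
    by (auto simp: in_keys_iff)
  ultimately have "finite (lk ` {m :: expo. ky m \<subseteq> A \<and> (\<forall>i. lk m i \<le> N)})" by (rule rev_finite_subset)
  moreover have "inj_on lk {m :: expo. ky m \<subseteq> A \<and> (\<forall>i. lk m i \<le> N)}"
    by (rule inj_onI) (simp only: poly_mapping.lookup_inject)
  ultimately show ?thesis by (rule finite_imageD)
qed

lemma finite_hull: "finite (dhull n lam)"
proof (rule finite_subset)
  show "dhull n lam \<subseteq> {m. ky m \<subseteq> {1..n} \<and> (\<forall>i. lk m i \<le> pre lam n)}"
  proof (intro subsetI CollectI conjI allI)
    fix m i assume m: "m \<in> dhull n lam"
    show "lk m i \<le> pre lam n"
    proof (cases "i \<in> {1..n}")
      case True
      then have "lk m i \<le> sdeg {1..n} m" unfolding sdeg_def by (intro member_le_sum) auto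
      with m show ?thesis by (simp add: dhull_def)
    next
      case False
      then have "i \<notin> ky m" using m by (auto simp: dhull_def)
      then show ?thesis by (simp add: in_keys_iff)
    qed
  qed (auto simp: dhull_def)
qed (simp add: finite_bounded_exponents)

subsection \<open>Monomial symmetric polynomials\<close>

lemma monomial_orbit:
  "{\<nu>. \<exists>\<pi>. \<pi> permutes {1..n} \<and> (\<forall>i. lk \<nu> i = lk lam (\<pi> i))} = (\<lambda>\<pi>. mk \<pi> lam) ` {\<pi>. \<pi> permutes {1..n}}"
  by (auto simp: lookup_map_key permutes_inj image_iff poly_mapping_eq_iff fun_eq_iff)

lemma lookup_monomial_sym:
  "lk (monomial_sym n lam) m = (if \<exists>\<pi>. \<pi> permutes {1..n} \<and> m = mk \<pi> lam then 1 else 0)"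
proof -
  let ?O = "(\<lambda>\<pi>. mk \<pi> lam) ` {\<pi>. \<pi> permutes {1..n}}"
  have "lk (monomial_sym n lam) m = (\<Sum>\<nu>\<in>?O. if \<nu> = m then 1 else 0)" unfolding monomial_sym_def monomial_orbit lookup_sum
    by (rule sum.cong) (auto simp: lookup_single when_def)
  also have "... = (if m \<in> ?O then 1 else 0)" by (simp add: finite_permutations)
  finally show ?thesis by auto
qed

lemma keys_monomial_sym:
  "lam \<in> partitions n ==> ky (monomial_sym n lam) \<subseteq> dhull n lam"
  by (auto simp: in_keys_iff lookup_monomial_sym hull_map_key partition_in_hull split: if_splits)

lemma map_key_comp: "inj f ==> inj g ==> mk f (mk g m) = mk (g \<circ> f) m"
  by (rule poly_mapping_eqI) (simp add: lookup_map_key inj_compose)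

lemma sym_polysI:
  assumes "vars p \<subseteq> {1..n}" "\<And>\<pi> m. \<pi> permutes {1..n} ==> lk p (mk \<pi> m) = lk p m"
  shows "p \<in> sym_polys n" unfolding sym_polys_pm using assms
  by (auto intro!: poly_mapping_eqI simp: lookup_pm permutes_bij_nat)

lemma monomial_sym_sym:
  assumes "lam \<in> partitions n" shows "monomial_sym n lam \<in> sym_polys n"
proof (rule sym_polysI)
  show "vars (monomial_sym n lam) \<subseteq> {1..n}" using keys_monomial_sym[OF assms] by (auto simp: vars_def dhull_def)
  fix \<sigma> m assume \<sigma>: "\<sigma> permutes {1..n}"
  have "(\<exists>\<pi>. \<pi> permutes {1..n} \<and> mk \<sigma> m = mk \<pi> lam) \<longleftrightarrow> (\<exists>\<pi>. \<pi> permutes {1..n} \<and> m = mk \<pi> lam)"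
  proof safe
    fix \<pi> assume *: "\<pi> permutes {1..n}" "mk \<sigma> m = mk \<pi> lam"
    have "m = mk (inv \<sigma>) (mk \<sigma> m)" by (simp add: map_key_inv[OF \<sigma>])
    also have "... = mk (\<pi> \<circ> inv \<sigma>) lam"
      unfolding * by (rule map_key_comp) (use \<sigma> * permutes_inj[OF permutes_inv[OF \<sigma>]] in \<open>auto simp: permutes_inj\<close>)
    finally show "\<exists>\<pi>. \<pi> permutes {1..n} \<and> m = mk \<pi> lam" using \<sigma> * by (metis permutes_compose permutes_inv)
  next
    fix \<pi> assume "\<pi> permutes {1..n}"
    then show "\<exists>\<pi>'. \<pi>' permutes {1..n} \<and> mk \<sigma> (mk \<pi> lam) = mk \<pi>' lam"
      using \<sigma> by (intro exI[of _ "\<pi> \<circ> \<sigma>"]) (auto simp: map_key_comp permutes_inj permutes_compose)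
  qed
  then show "lk (monomial_sym n lam) (mk \<sigma> m) = lk (monomial_sym n lam) m" by (simp add: lookup_monomial_sym)
qed

lemma lookup_monomial_sym_partition:
  assumes "lam \<in> partitions n" "mu \<in> partitions n"
  shows "lk (monomial_sym n lam) mu = (if mu = lam then 1 else 0)"
proof -
  have "\<exists>\<pi>. \<pi> permutes {1..n} \<and> lam = mk \<pi> lam"
    by (rule exI[of _ id]) (simp add: permutes_id poly_mapping_eq_iff fun_eq_iff lookup_map_key)
  then show ?thesis using map_key_partition_unique[OF assms] by (auto simp: lookup_monomial_sym)
qed

lemma sym_eq_0_if_partitions:
  assumes "p \<in> sym_polys n" "\<And>mu. mu \<in> partitions n ==> lk p mu = 0"
  shows "p = 0"
proof (rule poly_mapping_eqI)
  fix m
  show "lk p m = lk 0 m"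
  proof (cases "ky m \<subseteq> {1..n}")
    case True
    then obtain \<pi> where "\<pi> permutes {1..n}" "mk \<pi> m \<in> partitions n" by (rule ex_sort)
    then show ?thesis using sym_lookup[OF assms(1), of \<pi> m] assms(2) by simp
  next
    case False
    then have "m \<notin> ky p" using sym_vars[OF assms(1)] by (auto simp: vars_def)
    then show ?thesis by (simp add: in_keys_iff)
  qed
qed

lemma sym_expand:
  assumes "p \<in> sym_polys n" "finite U" "U \<subseteq> partitions n" "ky p \<inter> partitions n \<subseteq> U"
  shows "p = (\<Sum>mu\<in>U. Const (lk p mu) * monomial_sym n mu)"
proof -
  have "p - (\<Sum>mu\<in>U. Const (lk p mu) * monomial_sym n mu) = 0"
  proof (rule sym_eq_0_if_partitions)
    show "p - (\<Sum>mu\<in>U. Const (lk p mu) * monomial_sym n mu) \<in> sym_polys n"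
      using assms by (intro sym_diff sym_sum sym_mult monomial_sym_sym) auto
    fix nu assume nu: "nu \<in> partitions n"
    have "lk (\<Sum>mu\<in>U. Const (lk p mu) * monomial_sym n mu) nu = (\<Sum>mu\<in>U. if mu = nu then lk p nu else 0)"
      unfolding lookup_sum lookup_Const_mult by (rule sum.cong) (use assms nu in \<open>auto simp: lookup_monomial_sym_partition\<close>)
    also have "... = lk p nu" using assms nu by (auto simp: in_keys_iff)
    finally show "lk (p - (\<Sum>mu\<in>U. Const (lk p mu) * monomial_sym n mu)) nu = 0" by (simp add: lookup_minus)
  qed
  then show ?thesis by simp
qed

lemma sym_keys_hull_iff:
  assumes "p \<in> sym_polys n" "lam \<in> partitions n"
  shows "ky p \<subseteq> dhull n lam \<longleftrightarrow> (\<forall>mu\<in>ky p \<inter> partitions n. dominated n mu lam)"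
proof
  assume "ky p \<subseteq> dhull n lam"
  then show "\<forall>mu\<in>ky p \<inter> partitions n. dominated n mu lam" using assms(2) by (auto simp: dominated_iff_hull)
next
  assume *: "\<forall>mu\<in>ky p \<inter> partitions n. dominated n mu lam"
  show "ky p \<subseteq> dhull n lam"
  proof
    fix m assume m: "m \<in> ky p"
    then have "ky m \<subseteq> {1..n}" using sym_vars[OF assms(1)] by (auto simp: vars_def)
    then obtain \<pi> where \<pi>: "\<pi> permutes {1..n}" "mk \<pi> m \<in> partitions n" by (rule ex_sort)
    then have "mk \<pi> m \<in> ky p" using m sym_lookup[OF assms(1) \<pi>(1)] by (simp add: in_keys_iff)
    then have "mk \<pi> m \<in> dhull n lam" using * \<pi> assms(2) by (auto simp: dominated_iff_hull)
    then have "mk (inv \<pi>) (mk \<pi> m) \<in> dhull n lam" by (rule hull_map_key[OF permutes_inv[OF \<pi>(1)]])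
    then show "m \<in> dhull n lam" by (simp add: map_key_inv[OF \<pi>(1)])
  qed
qed

subsection \<open>Triangular operators\<close>

definition down :: "nat => expo => expo set" where
  "down n lam = {mu \<in> partitions n. dominated n mu lam}"

definition downset :: "nat => expo set => bool" where
  "downset n U \<longleftrightarrow> finite U \<and> U \<subseteq> partitions n \<and> (\<forall>mu\<in>U. down n mu \<subseteq> U)"

text \<open>By symmetry the partition exponents stand for all exponents. For a downset U this is the
  span of the \<open>monomial_sym n mu\<close> with mu in U.\<close>

definition sym_span :: "nat => expo set => cpoly set" where
  "sym_span n U = {p \<in> sym_polys n. ky p \<inter> partitions n \<subseteq> U}"

lemma finite_down: "lam \<in> partitions n ==> finite (down n lam)"
  by (rule finite_subset[OF _ finite_hull[of n lam]]) (auto simp: down_def dominated_iff_hull)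

lemma downset_down: "lam \<in> partitions n ==> downset n (down n lam)"
  unfolding downset_def using finite_down by (auto simp: down_def intro: dominated_trans)

lemma down_refl: "lam \<in> partitions n ==> lam \<in> down n lam" by (simp add: down_def dominated_refl)

lemma downset_strict: "lam \<in> partitions n ==> downset n (down n lam - {lam})"
  unfolding downset_def using finite_down[of lam n] by (auto simp: down_def intro: dominated_trans dest: dominated_antisym)

lemma sym_span_0 [simp]: "0 \<in> sym_span n U"
  and sym_span_add: "p \<in> sym_span n U ==> q \<in> sym_span n U ==> p + q \<in> sym_span n U"
  and sym_span_diff: "p \<in> sym_span n U ==> q \<in> sym_span n U ==> p - q \<in> sym_span n U"
  and sym_span_Const_mult: "p \<in> sym_span n U ==> Const c * p \<in> sym_span n U" unfolding sym_span_def
  by (auto simp: in_keys_iff lookup_add lookup_minus lookup_Const_mult sym_add sym_diff sym_mult)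
    (metis (mono_tags, lifting) IntI add.right_neutral diff_zero in_keys_iff subsetD)+

lemma sym_span_sum: "(\<And>a. a \<in> A ==> f a \<in> sym_span n U) ==> sum f A \<in> sym_span n U"
  by (induction A rule: infinite_finite_induct) (auto intro: sym_span_add)

lemma sym_span_mono: "p \<in> sym_span n U ==> U \<subseteq> U' ==> p \<in> sym_span n U'" by (auto simp: sym_span_def)

lemma sym_span_down_iff:
  "lam \<in> partitions n ==> p \<in> sym_span n (down n lam) \<longleftrightarrow> p \<in> sym_polys n \<and> ky p \<subseteq> dhull n lam"
  using sym_keys_hull_iff[of p n lam] by (auto simp: sym_span_def down_def)

lemma monomial_sym_span: "lam \<in> partitions n ==> monomial_sym n lam \<in> sym_span n (down n lam)"
  by (simp add: sym_span_down_iff monomial_sym_sym keys_monomial_sym)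

lemma sym_span_expand:
  assumes "p \<in> sym_span n U" "downset n U"
  shows "p = (\<Sum>mu\<in>U. Const (lk p mu) * monomial_sym n mu)"
  using assms by (intro sym_expand) (auto simp: sym_span_def downset_def)

lemma sym_span_lookup: "p \<in> sym_span n U ==> mu \<in> partitions n ==> mu \<notin> U ==> lk p mu = 0"
  by (auto simp: sym_span_def in_keys_iff)

lemma sym_in_span:
  assumes "p \<in> sym_polys n"
  obtains U where "downset n U" "p \<in> sym_span n U"
proof
  let ?U = "\<Union>mu\<in>ky p \<inter> partitions n. down n mu"
  show "downset n ?U" unfolding downset_def by (auto simp: finite_down) (auto simp: down_def intro: dominated_trans)
  show "p \<in> sym_span n ?U" using assms down_refl by (auto simp: sym_span_def)
qed

lemma ex_maximal:
  assumes "finite U" "U \<subseteq> partitions n" "U \<noteq> {}"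
  obtains mu where "mu \<in> U" "\<And>nu. nu \<in> U ==> mu \<in> down n nu ==> nu = mu"
proof -
  have "\<exists>mu\<in>U. \<forall>nu\<in>U. mu \<in> down n nu --> nu = mu" using assms(1,3,2)
  proof (induction U rule: finite_ne_induct)
    case (insert x U)
    then obtain mu where mu: "mu \<in> U" "\<forall>nu\<in>U. mu \<in> down n nu --> nu = mu" by auto
    show ?case
    proof (cases "mu \<in> down n x")
      case True
      have "nu = x" if "nu \<in> U" "x \<in> down n nu" for nu
      proof -
        have "mu \<in> down n nu" using True that by (auto simp: down_def intro: dominated_trans)
        then have "nu = mu" using mu that by auto
        then show ?thesis using True that insert.prems by (auto simp: down_def intro: dominated_antisym)
      qed
      then show ?thesis by auto
    next
      case False
      then show ?thesis using mu by auto
    qed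
  qed auto
  then show ?thesis using that by auto
qed

text \<open>Removing a maximal element from a finite downset leaves a downset, so downsets can be
  built by adding one partition above or incomparable to those present.\<close>

lemma downset_induct [consumes 1, case_names empty insert]:
  assumes "downset n U" and "P {}"
    and "\<And>mu U. downset n U ==> downset n (insert mu U) ==> mu \<notin> U ==> mu \<in> partitions n ==>
           down n mu \<subseteq> insert mu U ==> P U ==> P (insert mu U)"
  shows "P U" using assms(1)
proof (induction "card U" arbitrary: U)
  case 0
  then show ?case using assms(2) by (simp add: downset_def)
next
  case (Suc k U)
  then have U: "finite U" "U \<subseteq> partitions n" "U \<noteq> {}" by (auto simp: downset_def)
  then obtain mu where mu: "mu \<in> U" "\<And>nu. nu \<in> U ==> mu \<in> down n nu ==> nu = mu" by (metis ex_maximal)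
  have d: "downset n (U - {mu})" using Suc(3) mu unfolding downset_def by (auto simp: subset_iff)
  have "P (U - {mu})" using Suc(1)[OF _ d] Suc(2) mu U by simp
  moreover have "insert mu (U - {mu}) = U" using mu by auto
  moreover have "down n mu \<subseteq> U" "mu \<in> partitions n" using Suc(3) mu by (auto simp: downset_def)
  ultimately show ?case using assms(3)[OF d, of mu] Suc(3) by simp
qed

text \<open>Elimination from the top: subtracting \<open>lk p mu\<close> times \<open>b mu\<close>
  clears the maximal mu and stays inside the span.\<close>

lemma unitriangular_expand:
  assumes b: "\<And>mu. mu \<in> partitions n ==> b mu \<in> sym_span n (down n mu) \<and> lk (b mu) mu = 1"
    and "downset n U" "p \<in> sym_span n U"
  shows "\<exists>c. p = (\<Sum>mu\<in>U. Const (c mu) * b mu)" using assms(2,3)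
proof (induction U arbitrary: p rule: downset_induct)
  case empty
  then have "p = 0" by (intro sym_eq_0_if_partitions[of p n]) (auto simp: sym_span_def in_keys_iff)
  then show ?case by simp
next
  case (insert mu U)
  let ?q = "p - Const (lk p mu) * b mu"
  have "b mu \<in> sym_span n (insert mu U)" using b[OF insert(4)] insert(5) sym_span_mono by blast
  then have q: "?q \<in> sym_span n (insert mu U)" using insert.prems by (intro sym_span_diff sym_span_Const_mult)
  moreover have "lk ?q mu = 0" using b[OF insert(4)] by (simp add: lookup_minus lookup_Const_mult)
  ultimately have "?q \<in> sym_span n U" by (auto simp: sym_span_def in_keys_iff)
  then obtain c where c: "?q = (\<Sum>nu\<in>U. Const (c nu) * b nu)" using insert.IH by blast
  have "p = Const (lk p mu) * b mu + (\<Sum>nu\<in>U. Const (c nu) * b nu)" using c by (simp add: algebra_simps)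
  also have "... = (\<Sum>nu\<in>insert mu U. Const ((c(mu := lk p mu)) nu) * b nu)"
    using insert(1,3) by (subst sum.insert) (auto simp: downset_def intro!: sum.cong)
  finally show ?case by blast
qed

definition lin_op :: "nat => (cpoly => cpoly) => bool" where
  "lin_op n L \<longleftrightarrow> (\<forall>p\<in>sym_polys n. \<forall>q\<in>sym_polys n. L (p + q) = L p + L q) \<and>
     (\<forall>c. \<forall>p\<in>sym_polys n. L (Const c * p) = Const c * L p)"

definition triangular :: "nat => (cpoly => cpoly) => (expo => complex) => bool" where
  "triangular n L l \<longleftrightarrow> lin_op n L \<and> (\<forall>lam\<in>partitions n. \<forall>p\<in>sym_span n (down n lam).
     L p \<in> sym_span n (down n lam) \<and> lk (L p) lam = l lam * lk p lam)"

lemma lin_op_add: "lin_op n L ==> p \<in> sym_polys n ==> q \<in> sym_polys n ==> L (p + q) = L p + L q"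
  and lin_op_Const_mult: "lin_op n L ==> p \<in> sym_polys n ==> L (Const c * p) = Const c * L p" by (simp_all add: lin_op_def)

lemma lin_op_0: "lin_op n L ==> L 0 = 0" unfolding lin_op_def by (metis Const_0 mult_zero_left sym_0)

lemma lin_op_sum:
  assumes "lin_op n L" "\<And>a. a \<in> A ==> f a \<in> sym_polys n"
  shows "L (\<Sum>a\<in>A. Const (c a) * f a) = (\<Sum>a\<in>A. Const (c a) * L (f a))" using assms(2)
proof (induction A rule: infinite_finite_induct)
  case (insert x F)
  have "Const (c x) * f x \<in> sym_polys n" "(\<Sum>a\<in>F. Const (c a) * f a) \<in> sym_polys n"
    using insert.prems by (auto intro!: sym_sum)
  then have "L (Const (c x) * f x + (\<Sum>a\<in>F. Const (c a) * f a)) = L (Const (c x) * f x) + L (\<Sum>a\<in>F. Const (c a) * f a)"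
    using assms(1)[unfolded lin_op_def, THEN conjunct1, rule_format] by blast
  with insert assms(1) show ?case by (simp add: lin_op_def)
qed (auto simp: lin_op_0[OF assms(1)])

lemma lin_op_diff:
  assumes "lin_op n L" "p \<in> sym_polys n" "q \<in> sym_polys n" shows "L (p - q) = L p - L q"
proof -
  have "L (p + Const (-1) * q) = L p + Const (-1) * L q" using assms by (simp add: lin_op_def sym_mult)
  then show ?thesis by (simp add: Const_uminus)
qed

context
  fixes n L l assumes tri: "triangular n L l"
begin

lemma tri_lin: "lin_op n L" using tri by (simp add: triangular_def)

lemma tri_monomial:
  assumes "mu \<in> partitions n"
  shows "L (monomial_sym n mu) \<in> sym_span n (down n mu)" "lk (L (monomial_sym n mu)) mu = l mu"
  using tri monomial_sym_span[OF assms] assms by (auto simp: triangular_def lookup_monomial_sym_partition)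

lemma tri_span:
  assumes "downset n U" "p \<in> sym_span n U" shows "L p \<in> sym_span n U"
proof -
  have U: "U \<subseteq> partitions n" using assms by (simp add: downset_def)
  have "L p = (\<Sum>mu\<in>U. Const (lk p mu) * L (monomial_sym n mu))"
    by (subst sym_span_expand[OF assms(2,1)], rule lin_op_sum[OF tri_lin]) (use U monomial_sym_sym in auto)
  moreover have "Const (lk p mu) * L (monomial_sym n mu) \<in> sym_span n U" if "mu \<in> U" for mu
    using that U tri_monomial(1)[of mu] assms(1)
    by (intro sym_span_Const_mult) (auto simp: downset_def intro: sym_span_mono)
  ultimately show ?thesis by (auto intro: sym_span_sum)
qed

text \<open>Since mu is maximal in U, the images of the other monomial symmetric polynomials have no
  mu-coefficient.\<close>

lemma tri_lookup:
  assumes "downset n U" "p \<in> sym_span n U" "mu \<in> U" "\<And>nu. nu \<in> U ==> mu \<in> down n nu ==> nu = mu"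
  shows "lk (L p) mu = l mu * lk p mu"
proof -
  have U: "U \<subseteq> partitions n" "finite U" using assms by (auto simp: downset_def)
  have "L p = (\<Sum>nu\<in>U. Const (lk p nu) * L (monomial_sym n nu))"
    by (subst sym_span_expand[OF assms(2,1)], rule lin_op_sum[OF tri_lin]) (use U monomial_sym_sym in auto)
  then have "lk (L p) mu = (\<Sum>nu\<in>U. lk p nu * lk (L (monomial_sym n nu)) mu)" by (simp add: lookup_sum lookup_Const_mult)
  also have "... = (\<Sum>nu\<in>U. if nu = mu then lk p mu * l mu else 0)"
  proof (intro sum.cong refl)
    fix nu assume nu: "nu \<in> U"
    show "lk p nu * lk (L (monomial_sym n nu)) mu = (if nu = mu then lk p mu * l mu else 0)"
    proof (cases "nu = mu")
      case True
      then show ?thesis using tri_monomial(2)[of mu] U assms(3) by auto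
    next
      case False
      then have "mu \<notin> down n nu" using assms(4) nu by auto
      then have "lk (L (monomial_sym n nu)) mu = 0"
        using tri_monomial(1)[of nu] nu U assms(3) by (auto intro!: sym_span_lookup)
      with False show ?thesis by simp
    qed
  qed
  also have "... = l mu * lk p mu" using U assms(3) by simp
  finally show ?thesis .
qed

text \<open>Back substitution: the top coefficient is matched by dividing by
  \<open>l mu - c\<close>, and the remaining right side lies in the smaller span.\<close>

lemma tri_solve:
  assumes "downset n U" "\<And>mu. mu \<in> U ==> l mu \<noteq> c" "q \<in> sym_span n U"
  shows "\<exists>p\<in>sym_span n U. L p - Const c * p = q" using assms
proof (induction U arbitrary: q rule: downset_induct)
  case empty
  then have "q = 0" by (intro sym_eq_0_if_partitions[of q n]) (auto simp: sym_span_def in_keys_iff)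
  then show ?case using lin_op_0[OF tri_lin] by (intro bexI[of _ 0]) auto
next
  case (insert mu U)
  let ?a = "lk q mu / (l mu - c)"
  let ?m = "Const ?a * monomial_sym n mu"
  have ne: "l mu - c \<noteq> 0" using insert.prems by auto
  have m: "?m \<in> sym_span n (insert mu U)"
    using monomial_sym_span[OF insert(4)] insert(5) by (blast intro: sym_span_Const_mult sym_span_mono)
  have ms: "monomial_sym n mu \<in> sym_polys n" by (rule monomial_sym_sym[OF insert(4)])
  let ?q = "q - (L ?m - Const c * ?m)"
  have "?q \<in> sym_span n (insert mu U)"
    by (rule sym_span_diff[OF insert.prems(2) sym_span_diff[OF tri_span[OF insert(2) m] sym_span_Const_mult[OF m]]])
  moreover have "lk ?q mu = 0"
  proof -
    have "L ?m = Const ?a * L (monomial_sym n mu)" using tri_lin ms by (simp add: lin_op_def)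
    then have "lk (L ?m) mu = ?a * l mu" using tri_monomial(2)[OF insert(4)] by (simp add: lookup_Const_mult)
    moreover have "lk ?m mu = ?a" using insert(4) by (simp add: lookup_Const_mult lookup_monomial_sym_partition)
    ultimately have "lk ?q mu = lk q mu - (?a * l mu - c * ?a)" unfolding lookup_minus lookup_Const_mult[of c] by simp
    also have "... = lk q mu - ?a * (l mu - c)" by (simp only: right_diff_distrib mult.commute[of c])
    also have "... = 0" using ne by simp
    finally show ?thesis .
  qed
  ultimately have "?q \<in> sym_span n U" by (auto simp: sym_span_def in_keys_iff)
  then obtain p where p: "p \<in> sym_span n U" "L p - Const c * p = ?q" using insert.IH insert.prems(1) by blast
  have "L (p + ?m) = L p + L ?m" using p(1) ms by (intro lin_op_add[OF tri_lin]) (auto simp: sym_span_def)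
  then have "L (p + ?m) - Const c * (p + ?m) = q" using p(2) by (simp add: algebra_simps)
  moreover have "p + ?m \<in> sym_span n (insert mu U)" using p(1) m by (intro sym_span_add) (auto intro: sym_span_mono)
  ultimately show ?case by blast
qed

text \<open>With P = m_lam + p the eigenvalue equation becomes an inhomogeneous equation for p in
  the strictly lower span, where \<open>l lam\<close> is not a diagonal entry.\<close>

lemma tri_eigenvector:
  assumes lam: "lam \<in> partitions n" and "\<And>mu. mu \<in> down n lam ==> mu \<noteq> lam ==> l mu \<noteq> l lam"
  shows "\<exists>P\<in>sym_span n (down n lam). lk P lam = 1 \<and> L P = Const (l lam) * P"
proof -
  let ?m = "monomial_sym n lam" and ?U = "down n lam - {lam}"
  let ?q = "Const (l lam) * ?m - L ?m"
  have "?q \<in> sym_span n (down n lam)"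
    using tri_monomial(1)[OF lam] monomial_sym_span[OF lam] by (intro sym_span_diff sym_span_Const_mult)
  moreover have "lk ?q lam = 0"
    using tri_monomial(2)[OF lam] lam by (simp add: lookup_minus lookup_Const_mult lookup_monomial_sym_partition)
  ultimately have "?q \<in> sym_span n ?U" by (auto simp: sym_span_def in_keys_iff)
  then obtain p where p: "p \<in> sym_span n ?U" "L p - Const (l lam) * p = ?q"
    using tri_solve[OF downset_strict[OF lam], of "l lam" ?q] assms(2) by auto
  have "L (?m + p) = L ?m + L p" using tri_lin p(1) monomial_sym_sym[OF lam] by (auto simp: lin_op_def sym_span_def)
  then have "L (?m + p) = Const (l lam) * (?m + p)" using p(2) by (simp add: algebra_simps)
  moreover have "?m + p \<in> sym_span n (down n lam)"
    using p(1) monomial_sym_span[OF lam] by (intro sym_span_add) (auto intro: sym_span_mono)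
  moreover have "lk (?m + p) lam = 1"
    using sym_span_lookup[OF p(1) lam] lam by (simp add: lookup_add lookup_monomial_sym_partition)
  ultimately show ?thesis by blast
qed

lemma tri_maximal_eigenvalue:
  assumes "v \<in> sym_span n (down n lam)" "lam \<in> partitions n" "lk v lam = 0" "v \<noteq> 0"
  obtains mu where "mu \<in> down n lam" "mu \<noteq> lam" "lk v mu \<noteq> 0" "lk (L v) mu = l mu * lk v mu"
proof -
  let ?K = "ky v \<inter> partitions n"
  have v: "v \<in> sym_polys n" using assms by (simp add: sym_span_def)
  have "?K \<noteq> {}"
  proof
    assume "?K = {}"
    then have "v = 0" by (intro sym_eq_0_if_partitions[OF v]) (auto simp: in_keys_iff)
    with assms(4) show False by simp
  qed
  then obtain mu where mu: "mu \<in> ?K" "\<And>nu. nu \<in> ?K ==> mu \<in> down n nu ==> nu = mu"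
    using ex_maximal[of ?K n] by (metis Int_lower2 finite_Int finite_keys)
  let ?U = "\<Union>mu\<in>?K. down n mu"
  have "downset n ?U" unfolding downset_def by (auto simp: finite_down) (auto simp: down_def intro: dominated_trans)
  moreover have "v \<in> sym_span n ?U" using v down_refl by (auto simp: sym_span_def)
  moreover have "mu \<in> ?U" using mu(1) down_refl by auto
  moreover have "nu = mu" if "nu \<in> ?U" "mu \<in> down n nu" for nu
  proof -
    from that(1) obtain k where k: "k \<in> ?K" "nu \<in> down n k" by blast
    then have "mu \<in> down n k" using that by (auto simp: down_def intro: dominated_trans)
    then have "k = mu" using mu k by auto
    then show ?thesis using k that by (auto simp: down_def intro: dominated_antisym)
  qed
  ultimately have "lk (L v) mu = l mu * lk v mu" by (rule tri_lookup)
  moreover have "mu \<in> down n lam" using mu assms(1) by (auto simp: sym_span_def)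
  ultimately show ?thesis using mu(1) assms(3) that by (auto simp: in_keys_iff)
qed

text \<open>The difference from the multiple of P has no lam-coefficient. If it were nonzero, L
  would scale its coefficient at a maximal exponent mu both by \<open>l mu\<close> and by
  \<open>l lam\<close>.\<close>

lemma tri_eigenvector_unique:
  assumes "lam \<in> partitions n" "\<And>mu. mu \<in> down n lam ==> mu \<noteq> lam ==> l mu \<noteq> l lam"
    and P: "P \<in> sym_span n (down n lam)" "lk P lam = 1" "L P = Const (l lam) * P"
    and v: "v \<in> sym_span n (down n lam)" "L v = Const (l lam) * v"
  shows "v = Const (lk v lam) * P"
proof (rule ccontr)
  assume "v \<noteq> Const (lk v lam) * P"
  let ?w = "v - Const (lk v lam) * P"
  have w: "?w \<in> sym_span n (down n lam)" using P v by (intro sym_span_diff sym_span_Const_mult)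
  have "lk ?w lam = 0" using P by (simp add: lookup_minus lookup_Const_mult)
  then obtain mu where mu: "mu \<in> down n lam" "mu \<noteq> lam" "lk ?w mu \<noteq> 0" "lk (L ?w) mu = l mu * lk ?w mu"
    using tri_maximal_eigenvalue[OF w assms(1)] \<open>v \<noteq> _\<close> by auto
  have "L ?w = L v - Const (lk v lam) * L P"
    using lin_op_diff[OF tri_lin] tri_lin P(1) v(1) by (auto simp: lin_op_def sym_span_def sym_mult)
  then have "L ?w = Const (l lam) * ?w" using P v by (simp add: algebra_simps)
  then have "l lam * lk ?w mu = l mu * lk ?w mu" using mu(4) by (simp add: lookup_Const_mult)
  then show False using mu assms(2) by auto
qed

end

subsection \<open>The Vandermonde product\<close>

text \<open>Opposite in sign to \<open>vandermonde\<close> in every factor. The staircase monomial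
  then has coefficient 1, and the power of -1 in \<open>D_op\<close> disappears.\<close>

definition vand :: "nat => cpoly" where
  "vand n = (\<Prod>j=1..n. \<Prod>i\<in>{1..<j}. Var i - Var j)"

definition pairs :: "nat => (nat \<times> nat) set" where
  "pairs n = {(i, j). 1 \<le> i \<and> i < j \<and> j \<le> n}"

lemma finite_pairs [simp]: "finite (pairs n)" by (rule finite_subset[of _ "{1..n} \<times> {1..n}"]) (auto simp: pairs_def)

lemma prod_pairs:
  fixes f :: "nat => nat => 'a::comm_monoid_mult"
  shows "(\<Prod>j=1..n. \<Prod>i\<in>{1..<j}. f i j) = (\<Prod>(i, j)\<in>pairs n. f i j)"
proof -
  have "(\<Prod>j=1..n. \<Prod>i\<in>{1..<j}. f i j) = (\<Prod>(j, i)\<in>(SIGMA j:{1..n}. {1..<j}). f i j)" by (rule prod.Sigma) auto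
  also have "... = (\<Prod>(i, j)\<in>pairs n. f i j)"
    by (rule prod.reindex_bij_witness[of _ prod.swap prod.swap]) (auto simp: pairs_def)
  finally show ?thesis .
qed

lemma vand_pairs: "vand n = (\<Prod>(i, j)\<in>pairs n. Var i - Var j)" by (simp add: vand_def prod_pairs)

lemma card_pairs: "card (pairs n) = n * (n - 1) div 2"
proof -
  have "pairs n = prod.swap ` (SIGMA j:{1..n}. {1..<j})" by (force simp: pairs_def)
  then have "card (pairs n) = card (SIGMA j:{1..n}. {1..<j})" by (simp add: card_image)
  also have "... = (\<Sum>j=1..n. j - 1)" by simp
  also have "... = n * (n - 1) div 2"
  proof (induction n)
    case (Suc n)
    have "even (n * (n - 1))" by (cases n) auto
    then have "n * (n - 1) div 2 + n = (Suc n * n) div 2" by (cases n) auto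
    with Suc show ?case by simp
  qed simp
  finally show ?thesis .
qed

lemma vandermonde_vand: "(- 1) ^ (n * (n - 1) div 2) * vandermonde n Var = vand n"
proof -
  have "vandermonde n Var = (\<Prod>(i, j)\<in>pairs n. (- 1) * (Var i - Var j :: cpoly))"
    unfolding vandermonde_def prod_pairs by (intro prod.cong refl) auto
  also have "... = (- 1) ^ (n * (n - 1) div 2) * vand n"
    by (simp only: case_prod_unfold prod.distrib prod_constant vand_pairs card_pairs)
  finally show ?thesis by (simp flip: mult.assoc power_mult_distrib)
qed

lemma Var_inj: "Var i = (Var j :: cpoly) \<longleftrightarrow> i = j" using vars_Var[of i] vars_Var[of j] by (metis singleton_inject)

lemma vand_nonzero [simp]: "vand n \<noteq> 0" by (simp add: vand_pairs case_prod_unfold Var_inj) (auto simp: pairs_def)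

lemma vars_vand: "vars (vand n) \<subseteq> {1..n}"
proof -
  have "vars (Var i - Var j :: cpoly) \<subseteq> {1..n}" if "(i, j) \<in> pairs n" for i j
    by (rule vars_diff) (use that in \<open>auto simp: vars_Var pairs_def\<close>)
  then show ?thesis unfolding vand_pairs by (intro vars_prod) (simp add: split_beta)
qed

text \<open>Substitution of the variable \<open>j\<close> for \<open>i\<close>: its kernel is generated by \<open>x\<^sub>i - x\<^sub>j\<close>, which is
  therefore a prime element.\<close>

definition ident :: "nat => nat => cpoly => cpoly" where
  "ident i j = pm (id(i := j))"

lemma ident_dvd: "(Var i - Var j) dvd p - ident i j p"
proof (induction p rule: mpoly_ring_induct)
  case (add p q)
  have "p + q - ident i j (p + q) = (p - ident i j p) + (q - ident i j q)" by (simp add: ident_def pm_add)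
  then show ?case using dvd_add[OF add] by (simp only:)
next
  case (times p k)
  have "p * Var k - ident i j (p * Var k) = (p - ident i j p) * Var k + ident i j p * (Var k - Var ((id(i := j)) k))"
    by (simp add: ident_def pm_mult algebra_simps)
  moreover have "(Var i - Var j) dvd (Var k - Var ((id(i := j)) k) :: cpoly)" by simp
  ultimately show ?case using dvd_add[OF dvd_mult2[OF times] dvd_mult] by (simp only:)
qed (simp add: ident_def)

lemma ident_eq_0_dvd: "ident i j p = 0 ==> (Var i - Var j) dvd p" using ident_dvd[of i j p] by simp

text \<open>Divide by one factor at a time. The substitution \<open>ident i j\<close> kills the
  product but none of the factors already split off, hence it kills the cofactor, which is therefore
  divisible by the next factor.\<close>

lemma vand_dvd:
  assumes "\<And>i j. (i, j) \<in> pairs n ==> ident i j p = 0"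
  shows "vand n dvd p"
proof -
  have "(\<Prod>(i, j)\<in>T. Var i - Var j) dvd p" if "finite T" "T \<subseteq> pairs n" for T using that
  proof (induction T rule: finite_induct)
    case (insert ij T)
    obtain i j where ij: "ij = (i, j)" by force
    then have ijn: "1 \<le> i" "i < j" "j \<le> n" using insert by (auto simp: pairs_def)
    obtain r where r: "p = (\<Prod>(i, j)\<in>T. Var i - Var j) * r" using insert by (auto elim: dvdE)
    have "ident i j (\<Prod>(i, j)\<in>T. Var i - Var j) * ident i j r = 0"
      using assms[of i j] insert.prems ij r by (simp add: ident_def pm_mult)
    moreover have "ident i j (\<Prod>(i, j)\<in>T. Var i - Var j) \<noteq> 0"
    proof -
      have "Var ((id(i := j)) k) \<noteq> (Var ((id(i := j)) l) :: cpoly)" if "(k, l) \<in> T" for k l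
      proof -
        have "(k, l) \<noteq> (i, j)" "k < l" using that insert ij by (auto simp: pairs_def)
        then show ?thesis using ijn by (auto simp: Var_inj)
      qed
      then show ?thesis using insert(1) by (auto simp: ident_def pm_prod case_prod_unfold pm_diff)
    qed
    ultimately have "(Var i - Var j) dvd r" by (intro ident_eq_0_dvd) auto
    then have "(\<Prod>(i, j)\<in>T. Var i - Var j) * (Var i - Var j) dvd p" unfolding r by (rule mult_dvd_mono[OF dvd_refl])
    then show ?case using insert by (simp add: ij mult.commute)
  qed simp
  then show ?thesis by (simp add: vand_pairs)
qed

text \<open>Once the two variables are identified, their transposition is invisible, so the image
  equals its own negative.\<close>

lemma ident_antisym:
  assumes "pm (Transposition.transpose i j) p = - p" shows "ident i j p = 0"
proof -
  have "ident i j p = ident i j (pm (Transposition.transpose i j) p)" unfolding ident_def pm_pm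
    by (rule arg_cong[of _ _ "\<lambda>f. pm f p"]) (auto simp: fun_eq_iff Transposition.transpose_def)
  also have "... = - ident i j p" by (simp add: assms ident_def pm_uminus)
  finally have "2 * ident i j p = 0" by (metis add.right_inverse mult_2)
  then show ?thesis by simp
qed

definition antisym_poly :: "nat => cpoly => bool" where
  "antisym_poly n p \<longleftrightarrow> vars p \<subseteq> {1..n} \<and> (\<forall>\<pi>. \<pi> permutes {1..n} --> pm \<pi> p = of_int (sign \<pi>) * p)"

lemma antisym_vand_dvd:
  assumes "antisym_poly n p" shows "vand n dvd p"
proof (rule vand_dvd)
  fix i j assume "(i, j) \<in> pairs n"
  then have "i \<in> {1..n}" "j \<in> {1..n}" "i \<noteq> j" by (auto simp: pairs_def)
  then have "pm (Transposition.transpose i j) p = - p"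
    using assms permutes_swap_id[of i "{1..n}" j] by (simp add: antisym_poly_def sign_swap_id)
  then show "ident i j p = 0" by (rule ident_antisym)
qed

subsection \<open>Weights\<close>

text \<open>The polynomial ring is an integral domain, so the product of the parts of highest weight
  of p and r survives in p * r. Integer weights admit negative ones as well, which turn upper bounds
  into lower bounds.\<close>

lemma top_weight:
  fixes p r :: "cpoly" and w :: "expo => int"
  assumes w: "\<And>a b. w (a + b) = w a + w b"
    and q: "\<And>m. m \<in> ky (p * r) ==> w m \<le> d"
    and k: "k \<in> ky p" "\<And>m. m \<in> ky p ==> w m \<le> w k"
    and m: "m \<in> ky r"
  shows "w m \<le> d - w k"
proof -
  define t where "t = Max (w ` ky r)"
  have t: "w m \<le> t" if "m \<in> ky r" for m unfolding t_def using that by (intro Max_ge) auto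
  have "t \<in> w ` ky r" unfolding t_def using m by (intro Max_in) auto
  then obtain l where l: "l \<in> ky r" "w l = t" by auto
  define part where "part v s p = (\<Sum>m | m \<in> ky p \<and> w m = (v :: int). sg m (lk p m :: complex))" for v p and s :: nat
  have lp: "lk (part v 0 p) m = (if w m = v then lk p m else 0)" for v p m
  proof -
    have "lk (part v 0 p) m = (\<Sum>k | k \<in> ky p \<and> w k = v. if k = m then lk p m else 0)"
      unfolding part_def lookup_sum by (rule sum.cong) (auto simp: lookup_single when_def)
    then show ?thesis by (auto simp: in_keys_iff)
  qed
  let ?p = "part (w k) 0 p" and ?r = "part t 0 r"
  have "?p \<noteq> 0" "?r \<noteq> 0" using lp[of "w k" p k] lp[of t r l] k l by (auto simp: in_keys_iff)
  then have "?p * ?r \<noteq> 0" by simp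
  then obtain \<mu> where mu: "\<mu> \<in> ky (?p * ?r)" by (metis ex_in_conv keys_eq_empty)
  obtain a b where ab: "a \<in> ky ?p" "b \<in> ky ?r" "\<mu> = a + b" using mu keys_mult[of ?p ?r] by auto
  then have w\<mu>: "w \<mu> = w k + t" by (auto simp: w in_keys_iff lp split: if_splits)
  have rest: "w \<nu> < w k + t" if "\<nu> \<in> ky (p * r - ?p * ?r)" for \<nu>
  proof -
    have e: "p * r - ?p * ?r = (p - ?p) * r + ?p * (r - ?r)" by (simp add: algebra_simps)
    have "\<nu> \<in> ky ((p - ?p) * r) \<union> ky (?p * (r - ?r))"
      using that keys_add[of "(p - ?p) * r" "?p * (r - ?r)"] unfolding e by blast
    then consider "\<nu> \<in> ky ((p - ?p) * r)" | "\<nu> \<in> ky (?p * (r - ?r))" by blast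
    then show ?thesis
    proof cases
      case 1
      then obtain a b where "a \<in> ky (p - ?p)" "b \<in> ky r" "\<nu> = a + b" using keys_mult by blast
      then show ?thesis using t[of b] k(2)[of a] by (auto simp: w in_keys_iff lp lookup_minus split: if_splits)
    next
      case 2
      then obtain a b where "a \<in> ky ?p" "b \<in> ky (r - ?r)" "\<nu> = a + b" using keys_mult by blast
      then show ?thesis using t[of b] by (auto simp: w in_keys_iff lp lookup_minus split: if_splits)
    qed
  qed
  have "\<mu> \<notin> ky (p * r - ?p * ?r)" using rest[of \<mu>] w\<mu> by auto
  then have "\<mu> \<in> ky (p * r)" using mu by (auto simp: in_keys_iff lookup_minus)
  then show ?thesis using q[of \<mu>] w\<mu> t[OF m] by simp
qed

section \<open>The Vandermonde determinant and quotients by it\<close>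

definition rho :: "nat => expo" where
  "rho n = (\<Sum>i=1..n. sg i (n - i))"

lemma lookup_rho: "lk (rho n) i = (if i \<in> {1..n} then n - i else 0)"
  unfolding rho_def lookup_sum by (simp add: lookup_single when_def)

lemma rho_partition: "rho n \<in> partitions n" by (auto simp: partitions_def lookup_rho in_keys_iff split: if_splits)

definition altsum :: "nat => cpoly" where
  "altsum n = (\<Sum>\<sigma> | \<sigma> permutes {1..n}. of_int (sign \<sigma>) * (\<Prod>i=1..n. Var i ^ (n - \<sigma> i)))"

lemma prod_Var_rho:
  assumes "\<sigma> permutes {1..n}"
  shows "(\<Prod>i=1..n. Var i ^ (n - \<sigma> i)) = (sg (mk \<sigma> (rho n)) 1 :: cpoly)"
proof -
  have *: "lk (mk \<sigma> (rho n)) i = (if i \<in> {1..n} then n - \<sigma> i else 0)" for i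
    using permutes_in_image[OF assms, of i] by (simp add: lookup_map_key permutes_inj[OF assms] lookup_rho)
  then have "ky (mk \<sigma> (rho n)) \<subseteq> {1..n}" by (auto simp: in_keys_iff split: if_splits)
  then show ?thesis by (simp add: single_conv_mon mon_superset[of "{1..n}"] *)
qed

lemma rho_map_key_inj:
  assumes "\<sigma> permutes {1..n}" "\<tau> permutes {1..n}"
    "mk \<sigma> (rho n) = mk \<tau> (rho n)"
  shows "\<sigma> = \<tau>"
proof
  fix i
  show "\<sigma> i = \<tau> i"
  proof (cases "i \<in> {1..n}")
    case True
    have "lk (rho n) (\<sigma> i) = lk (rho n) (\<tau> i)" using arg_cong[OF assms(3), of "\<lambda>m. lk m i"]
      by (simp add: lookup_map_key[OF permutes_inj[OF assms(1)]] lookup_map_key[OF permutes_inj[OF assms(2)]])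
    moreover have "\<sigma> i \<in> {1..n}" "\<tau> i \<in> {1..n}"
      using True permutes_in_image[OF assms(1)] permutes_in_image[OF assms(2)] by metis+
    ultimately show ?thesis by (auto simp: lookup_rho)
  next
    case False
    then show ?thesis using assms by (simp add: permutes_not_in)
  qed
qed

lemma of_int_mult_single: "of_int k * sg m 1 = (sg m (of_int k) :: cpoly)"
proof -
  have "of_int k * sg m 1 = (sg 0 (of_int k) * sg m 1 :: cpoly)" by (simp only: single_of_int)
  then show ?thesis by (simp only: mult_single add_0 mult_1_right)
qed

lemma altsum_single: "altsum n = (\<Sum>\<sigma> | \<sigma> permutes {1..n}. sg (mk \<sigma> (rho n)) (of_int (sign \<sigma>)))" unfolding altsum_def
proof (intro sum.cong refl)
  fix \<sigma> assume "\<sigma> \<in> {\<sigma>. \<sigma> permutes {1..n}}"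
  then show "of_int (sign \<sigma>) * (\<Prod>i=1..n. Var i ^ (n - \<sigma> i)) = (sg (mk \<sigma> (rho n)) (of_int (sign \<sigma>)) :: cpoly)"
    by (simp only: mem_Collect_eq prod_Var_rho of_int_mult_single)
qed

lemma lookup_altsum:
  assumes "\<sigma> permutes {1..n}"
  shows "lk (altsum n) (mk \<sigma> (rho n)) = of_int (sign \<sigma>)"
proof -
  have "lk (altsum n) (mk \<sigma> (rho n)) = (\<Sum>\<tau> | \<tau> permutes {1..n}. if \<tau> = \<sigma> then of_int (sign \<sigma>) else 0)"
    unfolding altsum_single lookup_sum
    by (rule sum.cong) (auto simp: lookup_single when_def dest: rho_map_key_inj[OF _ assms])
  then show ?thesis using assms by (simp add: finite_permutations)
qed

lemma keys_altsum: "ky (altsum n) = (\<lambda>\<sigma>. mk \<sigma> (rho n)) ` {\<sigma>. \<sigma> permutes {1..n}}"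
proof
  show "ky (altsum n) \<subseteq> (\<lambda>\<sigma>. mk \<sigma> (rho n)) ` {\<sigma>. \<sigma> permutes {1..n}}"
    unfolding altsum_single by (rule order_trans[OF Poly_Mapping.keys_sum]) (auto split: if_splits)
  show "(\<lambda>\<sigma>. mk \<sigma> (rho n)) ` {\<sigma>. \<sigma> permutes {1..n}} \<subseteq> ky (altsum n)" by (auto simp: in_keys_iff lookup_altsum)
qed

lemma keys_altsum_hull: "ky (altsum n) \<subseteq> dhull n (rho n)"
  by (auto simp: keys_altsum intro!: hull_map_key partition_in_hull rho_partition)

lemma leads_hull:
  assumes "lk p lam = c" "ky p \<subseteq> dhull n lam" "ky lam \<subseteq> {1..n}"
  shows "leads lam c p" using assms hull_pre_le[of _ n lam] by (auto simp: leads_def)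

lemma rho_leads_altsum: "leads (rho n) 1 (altsum n)"
proof (rule leads_hull[OF _ keys_altsum_hull partitions_keys[OF rho_partition]])
  have "mk id (rho n) = rho n" by (rule poly_mapping_eqI) (simp add: lookup_map_key)
  then show "lk (altsum n) (rho n) = 1" using lookup_altsum[of id n] permutes_id by simp
qed

text \<open>Reindexing by \<sigma> \<circ> inv \<pi> costs the sign of \<pi>.\<close>

lemma pm_alternating_sum:
  assumes \<pi>: "\<pi> permutes {1..n}"
    and f: "\<And>\<sigma>. \<sigma> permutes {1..n} ==> pm \<pi> (f \<sigma>) = f (\<sigma> \<circ> inv \<pi>)"
  shows "pm \<pi> (\<Sum>\<sigma> | \<sigma> permutes {1..n}. of_int (sign \<sigma>) * f \<sigma>) =
    of_int (sign \<pi>) * (\<Sum>\<sigma> | \<sigma> permutes {1..n}. of_int (sign \<sigma>) * f \<sigma>)"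
proof -
  have "pm \<pi> (\<Sum>\<sigma> | \<sigma> permutes {1..n}. of_int (sign \<sigma>) * f \<sigma>) =
      (\<Sum>\<sigma> | \<sigma> permutes {1..n}. of_int (sign \<pi>) * (of_int (sign (\<sigma> \<circ> inv \<pi>)) * f (\<sigma> \<circ> inv \<pi>)))" unfolding pm_sum
  proof (intro sum.cong refl)
    fix \<sigma> assume "\<sigma> \<in> {\<sigma>. \<sigma> permutes {1..n}}"
    then have \<sigma>: "\<sigma> permutes {1..n}" by simp
    have "sign (\<sigma> \<circ> inv \<pi>) = sign \<sigma> * sign \<pi>"
      using \<sigma> \<pi> by (metis finite_atLeastAtMost permutation_permutes permutes_inv sign_compose sign_inverse)
    moreover have "sign \<pi> * sign \<pi> = 1" by (simp add: sign_idempotent)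
    ultimately have "sign \<pi> * sign (\<sigma> \<circ> inv \<pi>) = sign \<sigma>" by (metis mult.left_commute mult.right_neutral)
    then have "of_int (sign \<pi>) * (of_int (sign (\<sigma> \<circ> inv \<pi>)) * f (\<sigma> \<circ> inv \<pi>)) = of_int (sign \<sigma>) * f (\<sigma> \<circ> inv \<pi>)"
      by (simp flip: mult.assoc of_int_mult)
    then show "pm \<pi> (of_int (sign \<sigma>) * f \<sigma>) = of_int (sign \<pi>) * (of_int (sign (\<sigma> \<circ> inv \<pi>)) * f (\<sigma> \<circ> inv \<pi>))"
      by (simp only: pm_mult pm_of_int f[OF \<sigma>])
  qed
  also have "... = (\<Sum>\<sigma> | \<sigma> permutes {1..n}. of_int (sign \<pi>) * (of_int (sign \<sigma>) * f \<sigma>))"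
    by (rule sum.reindex_bij_witness[of _ "\<lambda>\<sigma>. \<sigma> \<circ> \<pi>" "\<lambda>\<sigma>. \<sigma> \<circ> inv \<pi>"])
      (use \<pi> in \<open>auto simp: comp_assoc permutes_inv_o permutes_compose permutes_inv\<close>)
  finally show ?thesis by (simp add: sum_distrib_left)
qed

lemma antisym_altsum: "antisym_poly n (altsum n)" unfolding antisym_poly_def
proof (intro conjI allI impI)
  show "vars (altsum n) \<subseteq> {1..n}" using keys_altsum_hull by (auto simp: vars_def dhull_def)
  fix \<pi> assume \<pi>: "\<pi> permutes {1..n}"
  have "pm \<pi> (\<Prod>i=1..n. Var i ^ (n - \<sigma> i)) = (\<Prod>i=1..n. Var i ^ (n - (\<sigma> \<circ> inv \<pi>) i))" for \<sigma>
  proof -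
    have "(\<Prod>i=1..n. Var (\<pi> i) ^ (n - \<sigma> i)) = (\<Prod>i=1..n. Var i ^ (n - \<sigma> (inv \<pi> i)) :: cpoly)"
      by (rule prod.reindex_bij_witness[of _ "inv \<pi>" \<pi>])
        (use \<pi> in \<open>auto simp: permutes_inverses permutes_in_image permutes_inv
          simp flip: atLeastAtMost_iff\<close>)
    then show ?thesis by (simp add: pm_prod pm_power)
  qed
  then show "pm \<pi> (altsum n) = of_int (sign \<pi>) * altsum n" unfolding altsum_def by (intro pm_alternating_sum[OF \<pi>])
qed

lemma keys_zero_const:
  assumes "\<And>m. m \<in> ky p ==> m = 0" shows "p = Const (lk p 0)"
proof (rule poly_mapping_eqI)
  fix m show "lk p m = lk (Const (lk p 0)) m"
    using assms[of m] by (cases "m = 0") (auto simp: Const_def lookup_single when_def in_keys_iff)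
qed

lemma vand_leads: "leads (\<Sum>(i, j)\<in>pairs n. sg i 1) 1 (vand n)"
proof -
  have "leads (sg i 1) 1 (Var i - Var j)" if "(i, j) \<in> pairs n" for i j
  proof -
    have "i < j" using that by (simp add: pairs_def)
    then have "(\<Sum>l\<le>k. lk (sg j 1) l) \<le> (\<Sum>l\<le>k. lk (sg i (1::nat)) l)" for k by (simp add: lookup_single when_def)
    moreover have "ky (Var i - Var j :: cpoly) \<subseteq> {sg i 1, sg j 1}"
      by (auto simp: in_keys_iff lookup_minus Var_def lookup_single when_def split: if_splits)
    moreover have "sg i (1::nat) \<noteq> sg j 1" using \<open>i < j\<close> by (metis keys_single less_irrefl singleton_inject zero_neq_one)
    then have "lk (Var i - Var j) (sg i 1) = (1::complex)" by (auto simp: lookup_minus Var_def lookup_single)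
    ultimately show ?thesis unfolding leads_def pre_def by fastforce
  qed
  then have "leads (\<Sum>ij\<in>pairs n. sg (fst ij) 1) 1 (\<Prod>ij\<in>pairs n. Var (fst ij) - Var (snd ij))"
    by (intro leads_prod) (metis prod.collapse)
  then show ?thesis by (simp add: vand_pairs case_prod_unfold)
qed

lemma keys_Var_diff: "m \<in> ky (Var i - Var j :: cpoly) ==> m = sg i 1 \<or> m = sg j 1"
  by (auto simp: in_keys_iff lookup_minus Var_def lookup_single when_def split: if_splits)

lemma keys_prod_sdeg:
  fixes f :: "'b => cpoly"
  assumes "\<And>a m. a \<in> A ==> m \<in> ky (f a) ==> sdeg S m = d a"
  shows "m \<in> ky (prod f A) ==> sdeg S m = sum d A" using assms
proof (induction A arbitrary: m rule: infinite_finite_induct)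
  case (insert x A)
  then obtain a b where "a \<in> ky (f x)" "b \<in> ky (prod f A)" "m = a + b" using keys_mult[of "f x" "prod f A"] by auto
  then show ?case using insert by (simp add: sdeg_add)
qed (auto simp: sdeg_def)

lemma sdeg_vand:
  assumes "m \<in> ky (vand n)" shows "sdeg {1..n} m = card (pairs n)"
proof -
  have "sdeg {1..n} m = (\<Sum>ij\<in>pairs n. 1)" using assms unfolding vand_pairs
  proof (rule keys_prod_sdeg[rotated])
    fix ij m assume *: "ij \<in> pairs n" "m \<in> ky (case ij of (i, j) => (Var i - Var j :: cpoly))"
    obtain i j where "ij = (i, j)" by force
    then show "sdeg {1..n} m = 1" using * keys_Var_diff[of m i j] by (auto simp: pairs_def sdeg_def lookup_single when_def)
  qed
  then show ?thesis by simp
qed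

lemma pre_rho: "pre (rho n) n = card (pairs n)"
proof -
  have "pre (rho n) n = (\<Sum>i=1..n. n - i)"
    unfolding pre_sdeg[OF partitions_keys[OF rho_partition]] sdeg_def by (simp add: lookup_rho)
  also have "... = (\<Sum>j=1..n. j - 1)" by (rule sum.reindex_bij_witness[of _ "\<lambda>j. n + 1 - j" "\<lambda>j. n + 1 - j"]) auto
  also have "... = card (SIGMA j:{1..n}. {1..<j})" by simp
  also have "pairs n = prod.swap ` (SIGMA j:{1..n}. {1..<j})" by (force simp: pairs_def)
  then have "card (SIGMA j:{1..n}. {1..<j}) = card (pairs n)" by (simp add: card_image)
  finally show ?thesis .
qed

lemma vars_lookup: "vars p \<subseteq> A ==> m \<in> ky p ==> j \<notin> A ==> lk m j = 0" unfolding vars_subset_iff by (metis in_keys_iff subsetD)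

text \<open>The weight is the degree in a variable outside {1..n}; it is 0 for the product and for
  the Vandermonde factor.\<close>

lemma vand_quotient_vars:
  assumes "vars (vand n * r) \<subseteq> {1..n}" shows "vars r \<subseteq> {1..n}"
proof
  fix j assume "j \<in> vars r"
  then obtain m where m: "m \<in> ky r" "lk m j \<noteq> 0" by (auto simp: vars_def in_keys_iff)
  show "j \<in> {1..n}"
  proof (rule ccontr)
    assume j: "j \<notin> {1..n}"
    have z: "lk m j = 0" if "m \<in> ky p" "vars p \<subseteq> {1..n}" for m and p :: "cpoly" using vars_lookup[OF that(2,1) j] .
    obtain k where k: "k \<in> ky (vand n)" by (metis ex_in_conv keys_eq_empty vand_nonzero)
    have "int (lk m j) \<le> 0 - int (lk k j)" by (rule top_weight[where p = "vand n" and r = r and w = "\<lambda>m. int (lk m j)"])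
        (use k m z assms vars_vand in \<open>auto simp: lookup_add\<close>)
    with m show False by simp
  qed
qed

text \<open>Antisymmetry gives divisibility, and comparison of total degrees makes the quotient a
  constant. The dominating exponents of both sides must then agree, and their coefficients show that
  the constant is 1.\<close>

lemma vand_altsum: "vand n = altsum n"
proof -
  obtain r where r: "altsum n = vand n * r" using antisym_vand_dvd[OF antisym_altsum] by (rule dvdE)
  have v: "vars r \<subseteq> {1..n}"
  proof (rule vand_quotient_vars)
    show "vars (vand n * r) \<subseteq> {1..n}" using antisym_altsum[of n] unfolding antisym_poly_def by (simp only: r)
  qed
  obtain k where k: "k \<in> ky (vand n)" by (metis ex_in_conv keys_eq_empty vand_nonzero)
  have "m = 0" if m: "m \<in> ky r" for m
  proof -
    have "int (sdeg {1..n} m) \<le> int (card (pairs n)) - int (sdeg {1..n} k)"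
    proof (rule top_weight[where p = "vand n" and r = r and w = "\<lambda>m. int (sdeg {1..n} m)", OF _ _ k _ m])
      show "int (sdeg {1..n} m) \<le> int (card (pairs n))" if "m \<in> ky (vand n * r)" for m
        using that keys_altsum_hull[of n] by (auto simp: r dhull_def pre_rho)
      show "int (sdeg {1..n} m) \<le> int (sdeg {1..n} k)" if "m \<in> ky (vand n)" for m using that k by (simp add: sdeg_vand)
    qed (simp add: sdeg_add)
    then have "sdeg {1..n} m = 0" using sdeg_vand[OF k] by simp
    then have "lk m i = 0" if "i \<in> {1..n}" for i using that by (auto simp: sdeg_def)
    moreover have "lk m i = 0" if "i \<notin> {1..n}" for i using vars_lookup[OF v m that] .
    ultimately show "m = 0" by (intro poly_mapping_eqI) (auto)
  qed
  then have rc: "r = Const (lk r 0)" by (rule keys_zero_const)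
  let ?k = "\<Sum>(i, j)\<in>pairs n. sg i (1::nat)"
  have l1: "leads ?k (lk r 0) (altsum n)" using vand_leads[of n] unfolding leads_def r by (subst (1 2) rc)
      (auto simp: lookup_Const_mult mult.commute[of "vand n"] in_keys_iff)
  have "lk r 0 \<noteq> 0" using r rc antisym_altsum lookup_altsum[of id n] permutes_id
    by (metis Const_0 lookup_zero mult_zero_right of_int_1 sign_id zero_neq_one)
  then have "?k \<in> ky (altsum n)" using l1 by (auto simp: leads_def in_keys_iff)
  then have "pre ?k k \<le> pre (rho n) k" for k using rho_leads_altsum by (auto simp: leads_def)
  moreover have "rho n \<in> ky (altsum n)" using rho_leads_altsum by (auto simp: leads_def in_keys_iff)
  then have "pre (rho n) k \<le> pre ?k k" for k using l1 by (auto simp: leads_def)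
  ultimately have "?k = rho n" by (intro pre_eqD) (simp add: le_antisym)
  then have "lk r 0 = 1" using l1 rho_leads_altsum by (simp add: leads_def)
  then show ?thesis using r rc by simp
qed

lemma ex_permutes_image:
  assumes "S \<subseteq> {1..n}"
  obtains \<sigma> where "\<sigma> permutes {1..n}" "\<sigma> ` S = {1..card S}"
proof -
  have fin: "finite S" using assms finite_subset by auto
  have "card S \<le> n" using card_mono[OF _ assms] by simp
  obtain f where f: "bij_betw f S {1..card S}" using finite_same_card_bij[of S "{1..card S}"] fin by auto
  have "card ({1..n} - S) = card ({1..n} - {1..card S})" using \<open>card S \<le> n\<close> assms fin by (simp add: card_Diff_subset)
  then obtain g where g: "bij_betw g ({1..n} - S) ({1..n} - {1..card S})"
    using finite_same_card_bij[of "{1..n} - S" "{1..n} - {1..card S}"] by auto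
  define \<sigma> where "\<sigma> x = (if x \<in> S then f x else if x \<in> {1..n} then g x else x)" for x
  have "bij_betw \<sigma> S {1..card S}" using f by (rule bij_betw_cong[THEN iffD1, rotated]) (simp add: \<sigma>_def)
  moreover have "bij_betw \<sigma> ({1..n} - S) ({1..n} - {1..card S})"
    using g by (rule bij_betw_cong[THEN iffD1, rotated]) (simp add: \<sigma>_def)
  ultimately have "bij_betw \<sigma> (S \<union> ({1..n} - S)) ({1..card S} \<union> ({1..n} - {1..card S}))" by (rule bij_betw_combine) auto
  moreover have "S \<union> ({1..n} - S) = {1..n}" "{1..card S} \<union> ({1..n} - {1..card S}) = {1..n}" using assms \<open>card S \<le> n\<close> by auto
  ultimately have "\<sigma> permutes {1..n}" using assms by (intro bij_imp_permutes) (auto simp: \<sigma>_def)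
  moreover have "\<sigma> ` S = {1..card S}" using \<open>bij_betw \<sigma> S {1..card S}\<close> by (simp add: bij_betw_def)
  ultimately show ?thesis by (rule that)
qed

text \<open>For each S the degree in the variables of S serves as weight. Among the exponents of
  \<open>vand n\<close> it is largest at the rearrangement of \<open>rho n\<close> that puts its
  first \<open>card S\<close> entries on S.\<close>

lemma vand_quotient_hull:
  assumes q: "ky (vand n * r) \<subseteq> dhull n (lam + rho n)"
  shows "ky r \<subseteq> dhull n lam"
proof
  fix m assume m: "m \<in> ky r"
  have "vars (vand n * r) \<subseteq> {1..n}" using q by (auto simp: vars_def dhull_def)
  then have "vars r \<subseteq> {1..n}" by (rule vand_quotient_vars)
  then have k: "ky m \<subseteq> {1..n}" using m by (simp add: vars_subset_iff)
  have kh: "ky (vand n) \<subseteq> dhull n (rho n)" by (simp add: vand_altsum keys_altsum_hull)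
  have "sdeg S m \<le> pre lam (card S)" if S: "S \<subseteq> {1..n}" for S
  proof -
    obtain \<sigma> where \<sigma>: "\<sigma> permutes {1..n}" "\<sigma> ` S = {1..card S}" using ex_permutes_image[OF S] .
    let ?k = "mk \<sigma> (rho n)"
    have kv: "?k \<in> ky (vand n)" using \<sigma> by (auto simp: vand_altsum keys_altsum)
    have sk: "sdeg S ?k = pre (rho n) (card S)"
      by (simp add: sdeg_map_key[OF \<sigma>(1)] \<sigma>(2) pre_sdeg[OF partitions_keys[OF rho_partition]])
    have "int (sdeg S m) \<le> int (pre (lam + rho n) (card S)) - int (sdeg S ?k)"
    proof (rule top_weight[where p = "vand n" and r = r and w = "\<lambda>m. int (sdeg S m)", OF _ _ kv _ m])
      show "int (sdeg S m) \<le> int (pre (lam + rho n) (card S))" if "m \<in> ky (vand n * r)" for m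
        using that q S by (auto simp: dhull_def)
      show "int (sdeg S m) \<le> int (sdeg S ?k)" if "m \<in> ky (vand n)" for m
        using that kh S unfolding sk by (auto simp: dhull_def)
    qed (simp add: sdeg_add)
    then show ?thesis by (simp add: sk pre_add)
  qed
  moreover have "sdeg {1..n} m \<ge> pre lam n"
  proof -
    obtain k where kv: "k \<in> ky (vand n)" by (metis ex_in_conv keys_eq_empty vand_nonzero)
    have tot: "sdeg {1..n} k = pre (rho n) n" if "k \<in> ky (vand n)" for k using that kh by (auto simp: dhull_def)
    \<comment> \<open>With minus the total degree as weight, \<open>top_weight\<close> yields the
      lower bound.\<close>
    have "- int (sdeg {1..n} m) \<le> - int (pre (lam + rho n) n) - (- int (sdeg {1..n} k))"
    proof (rule top_weight[where p = "vand n" and r = r and w = "\<lambda>m. - int (sdeg {1..n} m)", OF _ _ kv _ m])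
      show "- int (sdeg {1..n} m) \<le> - int (pre (lam + rho n) n)" if "m \<in> ky (vand n * r)" for m
        using that q by (auto simp: dhull_def)
      show "- int (sdeg {1..n} m) \<le> - int (sdeg {1..n} k)" if "m \<in> ky (vand n)" for m using tot[OF that] tot[OF kv] by simp
    qed (simp add: sdeg_add)
    then show ?thesis by (simp add: tot[OF kv] pre_add)
  qed
  moreover have "sdeg {1..n} m \<le> pre lam n" using calculation(1)[of "{1..n}"] by simp
  ultimately show "m \<in> dhull n lam" using k by (auto simp: dhull_def)
qed

lemma vand_antisym: "antisym_poly n (vand n)" by (simp add: vand_altsum antisym_altsum)

lemma vand_quotient_sym:
  assumes "antisym_poly n (vand n * r)" shows "r \<in> sym_polys n" unfolding sym_polys_pm
proof (intro CollectI conjI allI impI)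
  show "vars r \<subseteq> {1..n}" by (rule vand_quotient_vars) (use assms in \<open>simp add: antisym_poly_def\<close>)
  fix \<pi> assume \<pi>: "\<pi> permutes {1..n}"
  have "of_int (sign \<pi>) * (vand n * r) = pm \<pi> (vand n * r)" using assms \<pi> by (simp add: antisym_poly_def)
  also have "... = of_int (sign \<pi>) * (vand n * pm \<pi> r)"
    using vand_antisym \<pi> by (simp add: antisym_poly_def pm_mult mult.assoc)
  finally have "of_int (sign \<pi>) * (vand n * r) = of_int (sign \<pi>) * (vand n * pm \<pi> r)" .
  moreover have "(of_int (sign \<pi>) :: cpoly) \<noteq> 0" by (simp add: sign_def)
  ultimately show "pm \<pi> r = r" by simp
qed

section \<open>Exact division of antisymmetric polynomials\<close>

definition vquot :: "nat => cpoly => cpoly" where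
  "vquot n q = (THE r. vand n * r = q)"

lemma vquot_eqI: "vand n * r = q ==> vquot n q = r" unfolding vquot_def by (rule the_equality) auto

lemma vand_vquot: "antisym_poly n q ==> vand n * vquot n q = q" using antisym_vand_dvd[of n q] by (metis dvdE vquot_eqI)

lemma vquot_sym: "antisym_poly n q ==> vquot n q \<in> sym_polys n" by (rule vand_quotient_sym) (simp add: vand_vquot)

lemma vquot_span:
  assumes "lam \<in> partitions n" "antisym_poly n q" "ky q \<subseteq> dhull n (lam + rho n)"
  shows "vquot n q \<in> sym_span n (down n lam)" "lk (vquot n q) lam = lk q (lam + rho n)"
proof -
  have k: "ky (vquot n q) \<subseteq> dhull n lam" by (rule vand_quotient_hull) (simp add: vand_vquot assms)
  then show "vquot n q \<in> sym_span n (down n lam)" by (simp add: sym_span_down_iff assms vquot_sym)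
  have "leads (rho n + lam) (1 * lk (vquot n q) lam) (vand n * vquot n q)"
    by (rule leads_mult[OF _ leads_hull[OF refl k partitions_keys[OF assms(1)]]])
      (simp add: vand_altsum rho_leads_altsum)
  then show "lk (vquot n q) lam = lk q (lam + rho n)" by (simp add: vand_vquot assms leads_def add.commute)
qed

subsection \<open>Elementary symmetric polynomials\<close>

text \<open>Index set and semiring are left open: the function is applied to variables, to numbers
  and to constant polynomials, and with one or two indices removed.\<close>

definition elem :: "nat set => (nat => 'a::comm_semiring_1) => nat => 'a" where
  "elem A x k = (\<Sum>I | I \<subseteq> A \<and> card I = k. \<Prod>i\<in>I. x i)"

lemma elem_hom: "semiring_hom h ==> h (elem A x k) = elem A (\<lambda>i. h (x i)) k"
  by (simp add: elem_def semiring_hom.hsum semiring_hom.hprod)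

lemma eval_elem: "eval x (elem A Var k) = elem A x k" by (simp add: elem_hom[OF eval_hom])

lemma elem_0 [simp]: "finite A ==> elem A x 0 = 1"
proof -
  assume "finite A"
  then have "{I. I \<subseteq> A \<and> card I = 0} = {{}}" by (auto dest: finite_subset)
  then show ?thesis by (simp add: elem_def)
qed

lemma sum_insert_subsets:
  fixes F :: "nat set => 'a::comm_monoid_add"
  assumes "finite A" "a \<notin> A"
  shows "(\<Sum>I | I \<subseteq> insert a A \<and> card I = Suc k. F I) =
    (\<Sum>I | I \<subseteq> A \<and> card I = Suc k. F I) + (\<Sum>I | I \<subseteq> A \<and> card I = k. F (insert a I))"
proof -
  have fin: "finite I" if "I \<subseteq> insert a A" for I using that assms finite_subset by blast
  have *: "{I. I \<subseteq> insert a A \<and> card I = Suc k} =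
      {I. I \<subseteq> A \<and> card I = Suc k} \<union> insert a ` {I. I \<subseteq> A \<and> card I = k}" (is "?L = ?R1 \<union> ?R2")
  proof (intro set_eqI iffI)
    fix I assume I: "I \<in> ?L"
    show "I \<in> ?R1 \<union> ?R2"
    proof (cases "a \<in> I")
      case True
      then have "I = insert a (I - {a})" "I - {a} \<subseteq> A" "card (I - {a}) = k" using I fin[of I] by auto
      then show ?thesis by blast
    qed (use I in auto)
  next
    fix I assume "I \<in> ?R1 \<union> ?R2"
    then show "I \<in> ?L"
    proof
      assume "I \<in> ?R2"
      then obtain J where J: "I = insert a J" "J \<subseteq> A" "card J = k" by auto
      then have "a \<notin> J" "finite J" using assms finite_subset[of J A] by auto
      then show ?thesis using J by auto
    qed auto
  qed
  have "inj_on (insert a) {I. I \<subseteq> A \<and> card I = k}"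
    using assms(2) by (intro inj_onI) (metis (no_types, lifting) insert_ident mem_Collect_eq subsetD)
  then show ?thesis unfolding * using assms by (subst sum.union_disjoint) (auto simp: sum.reindex)
qed

lemma elem_insert_Suc:
  assumes "finite A" "a \<notin> A"
  shows "elem (insert a A) x (Suc k) = elem A x (Suc k) + x a * elem A x k"
proof -
  have "(\<Sum>I | I \<subseteq> A \<and> card I = k. \<Prod>i\<in>insert a I. x i) = (\<Sum>I | I \<subseteq> A \<and> card I = k. x a * (\<Prod>i\<in>I. x i))"
    using assms by (intro sum.cong refl) (auto dest: finite_subset intro!: prod.insert)
  then show ?thesis unfolding elem_def sum_insert_subsets[OF assms] by (simp add: sum_distrib_left)
qed

lemma elem_large:
  assumes "finite A" "card A < k" shows "elem A x k = 0"
proof -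
  have "card I \<noteq> k" if "I \<subseteq> A" for I using card_mono[OF assms(1) that] assms(2) by linarith
  then have "{I. I \<subseteq> A \<and> card I = k} = {}" by blast
  then show ?thesis unfolding elem_def by (simp only: sum.empty)
qed

lemma prod_diff_elem:
  fixes x :: "nat => 'a::comm_ring_1"
  assumes "finite A"
  shows "(\<Prod>i\<in>A. t - x i) = (\<Sum>k\<le>card A. (- 1) ^ k * elem A x k * t ^ (card A - k))" using assms
proof (induction A rule: finite_induct)
  case (insert a A)
  let ?N = "card A"
  have "(\<Prod>i\<in>insert a A. t - x i) = (t - x a) * (\<Sum>k\<le>?N. (- 1) ^ k * elem A x k * t ^ (?N - k))" using insert by simp
  also have "... = (\<Sum>k\<le>?N. (- 1) ^ k * elem A x k * t ^ (Suc ?N - k)) +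
      (\<Sum>k\<le>?N. (- 1) ^ Suc k * (x a * elem A x k) * t ^ (?N - k))"
    by (simp add: left_diff_distrib sum_distrib_left sum_negf Suc_diff_le mult_ac flip: sum_subtractf)
  also have "(\<Sum>k\<le>?N. (- 1) ^ k * elem A x k * t ^ (Suc ?N - k)) = (\<Sum>k\<le>Suc ?N. (- 1) ^ k * elem A x k * t ^ (Suc ?N - k))"
    using elem_large[of A "Suc ?N" x] insert by simp
  also have "... = t ^ Suc ?N + (\<Sum>k\<le>?N. (- 1) ^ Suc k * elem A x (Suc k) * t ^ (?N - k))"
    using insert by (subst sum.atMost_Suc_shift) simp
  also have "... + (\<Sum>k\<le>?N. (- 1) ^ Suc k * (x a * elem A x k) * t ^ (?N - k)) =
      t ^ Suc ?N + (\<Sum>k\<le>?N. (- 1) ^ Suc k * elem (insert a A) x (Suc k) * t ^ (?N - k))"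
    by (simp only: add.assoc sum.distrib[symmetric])
      (intro arg_cong2[where f = "(+)"] sum.cong refl, simp add: elem_insert_Suc[OF insert(1,2)] algebra_simps)
  also have "... = (\<Sum>k\<le>Suc ?N. (- 1) ^ k * elem (insert a A) x k * t ^ (Suc ?N - k))"
    using insert by (subst sum.atMost_Suc_shift) simp
  finally show ?case using insert by simp
qed simp

abbreviation esym :: "nat => nat => cpoly" where "esym n \<equiv> elem {1..n} Var"

lemma sum_image_subsets:
  assumes "inj_on f A"
  shows "(\<Sum>J | J \<subseteq> f ` A \<and> card J = k. F J) = (\<Sum>I | I \<subseteq> A \<and> card I = k. F (f ` I))"
proof -
  have "inj_on f I" if "I \<subseteq> A" for I by (rule inj_on_subset[OF assms that])
  then have "{J. J \<subseteq> f ` A \<and> card J = k} = (`) f ` {I. I \<subseteq> A \<and> card I = k}" by (auto simp: subset_image_iff card_image)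
  moreover have "inj_on ((`) f) {I. I \<subseteq> A \<and> card I = k}" by (rule inj_on_subset[OF inj_on_image_Pow[OF assms]]) auto
  ultimately show ?thesis by (simp add: sum.reindex)
qed

lemma esym_sym: "esym n k \<in> sym_polys n" unfolding sym_polys_pm
proof (intro CollectI conjI allI impI)
  show "vars (esym n k) \<subseteq> {1..n}" unfolding elem_def by (intro vars_sum vars_prod) (auto simp: vars_Var)
  fix \<pi> assume \<pi>: "\<pi> permutes {1..n}"
  have inj: "inj_on \<pi> I" for I using permutes_inj[OF \<pi>] inj_on_subset by blast
  have "pm \<pi> (esym n k) = (\<Sum>I | I \<subseteq> {1..n} \<and> card I = k. \<Prod>i\<in>\<pi> ` I. Var i)"
    by (simp add: elem_def pm_sum pm_prod prod.reindex[OF inj])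
  then show "pm \<pi> (esym n k) = esym n k"
    unfolding sum_image_subsets[OF inj, of "\<lambda>I. \<Prod>i\<in>I. Var i :: cpoly", symmetric] permutes_image[OF \<pi>]
    by (simp only: elem_def)
qed

definition col :: "nat => expo" where
  "col k = (\<Sum>i\<in>{1..k}. sg i 1)"

lemma lookup_col: "lk (col k) i = (if i \<in> {1..k} then 1 else 0)"
  unfolding col_def lookup_sum by (simp add: lookup_single when_def)

lemma prod_Var_set: "finite I ==> (\<Prod>i\<in>I. Var i) = (sg (\<Sum>i\<in>I. sg i 1) 1 :: cpoly)"
  by (induction I rule: finite_induct) (auto simp: Var_def mult_single)

lemma keys_esym: "m \<in> ky (esym n k) ==> \<exists>I\<subseteq>{1..n}. card I = k \<and> m = (\<Sum>i\<in>I. sg i 1)"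
proof -
  assume "m \<in> ky (esym n k)"
  then have "m \<in> (\<Union>I\<in>{I. I \<subseteq> {1..n} \<and> card I = k}. ky (\<Prod>i\<in>I. Var i :: cpoly))"
    unfolding elem_def by (rule subsetD[OF Poly_Mapping.keys_sum])
  then obtain I where I: "I \<subseteq> {1..n}" "card I = k" "m \<in> ky (\<Prod>i\<in>I. Var i :: cpoly)" by auto
  then have "m = (\<Sum>i\<in>I. sg i 1)" using prod_Var_set[OF finite_subset[OF I(1)]] by simp
  with I(1,2) show ?thesis by blast
qed

lemma pre_col: "pre (col k) j = min j k"
proof -
  have "pre (col k) j = (\<Sum>i\<in>{..j} \<inter> {1..k}. 1)"
    unfolding pre_def lookup_col by (simp only: sum.inter_restrict[OF finite_atMost])
  also have "{..j} \<inter> {1..k} = {1..min j k}" by auto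
  finally show ?thesis by simp
qed

lemma subset_hull:
  assumes I: "I \<subseteq> {1..n}" "card I = k" shows "(\<Sum>i\<in>I. sg i 1) \<in> dhull n (col k)"
proof -
  let ?m = "\<Sum>i\<in>I. sg i (1 :: nat)"
  have fin: "finite I" using I finite_subset by blast
  have k: "k \<le> n" using card_mono[OF _ I(1)] I(2) by simp
  have lm: "lk ?m i = (if i \<in> I then 1 else 0)" for i unfolding lookup_sum using fin by (simp add: lookup_single when_def)
  have s: "sdeg S ?m = card (S \<inter> I)" if "finite S" for S using that by (simp add: sdeg_def lm sum.If_cases)
  show ?thesis unfolding dhull_def mem_Collect_eq
  proof (intro conjI allI impI)
    have "ky ?m \<subseteq> I" by (auto simp: in_keys_iff lm split: if_splits)
    then show "ky ?m \<subseteq> {1..n}" using I(1) by (rule subset_trans)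
    show "sdeg {1..n} ?m = pre (col k) n" using I k by (simp add: s pre_col Int_absorb1)
    fix S :: "nat set" assume "S \<subseteq> {1..n}"
    then have "finite S" using finite_subset by blast
    then show "sdeg S ?m \<le> pre (col k) (card S)" using I(2) fin by (auto simp: s pre_col intro: card_mono)
  qed
qed

lemma keys_esym_hull: "ky (esym n k) \<subseteq> dhull n (col k)" using keys_esym subset_hull by blast

lemma lookup_esym_col: "k \<le> n ==> lk (esym n k) (col k) = 1"
proof -
  assume k: "k \<le> n"
  have "lk (esym n k) (col k) = (\<Sum>I | I \<subseteq> {1..n} \<and> card I = k. if I = {1..k} then 1 else 0)" unfolding elem_def lookup_sum
  proof (intro sum.cong refl)
    fix I assume "I \<in> {I. I \<subseteq> {1..n} \<and> card I = k}"
    then have fin: "finite I" using finite_subset by auto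
    have "lk (\<Sum>i\<in>I. sg i 1) i = (if i \<in> I then (1::nat) else 0)" for i
      unfolding lookup_sum using fin by (simp add: lookup_single when_def)
    then have "(\<Sum>i\<in>I. sg i 1) = col k \<longleftrightarrow> I = {1..k}"
      by (auto simp: poly_mapping_eq_iff fun_eq_iff lookup_col split: if_splits)
    then show "lk (\<Prod>i\<in>I. Var i :: cpoly) (col k) = (if I = {1..k} then 1 else 0)"
      using fin by (simp add: prod_Var_set lookup_single when_def)
  qed
  also have "... = 1" using k by simp
  finally show ?thesis .
qed

text \<open>The variable k of F stands for e_k; index 0 gives 1 and indices above n give 0, so any F
  may be inserted.\<close>

definition esub :: "nat => cpoly => cpoly" where
  "esub n F = insertion Const (esym n) F"

lemma esub_hom: "semiring_hom (esub n)" unfolding esub_def by (rule insertion_Const_hom)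

lemma esub_add: "esub n (F + G) = esub n F + esub n G"
  and esub_mult: "esub n (F * G) = esub n F * esub n G"
  and esub_0 [simp]: "esub n 0 = 0" and esub_1 [simp]: "esub n 1 = 1"
  and esub_sum: "esub n (sum f A) = (\<Sum>a\<in>A. esub n (f a))"
  and esub_prod: "esub n (prod f A) = (\<Prod>a\<in>A. esub n (f a))"
  and esub_power: "esub n (F ^ k) = esub n F ^ k" using esub_hom[of n] by (auto simp: hom_simps)

lemma esub_Const [simp]: "esub n (Const c) = Const c" and esub_Var [simp]: "esub n (Var k) = esym n k"
  by (simp_all add: esub_def insertion_Const_Const
      insertion_Const_Var)

lemma esub_sym: "esub n F \<in> sym_polys n"
  unfolding esub_def insertion_def by (intro sym_sum sym_mult sym_prod sym_power esym_sym) auto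

text \<open>In the symbols e_r this is the elementary symmetric polynomial of the conjugate
  partition: lam has \<open>lk lam r - lk lam (Suc r)\<close> columns of height r.\<close>

definition emon :: "nat => expo => cpoly" where
  "emon n lam = (\<Prod>r=1..n. Var r ^ (lk lam r - lk lam (Suc r)))"

lemma esub_emon: "esub n (emon n lam) = (\<Prod>r=1..n. esym n r ^ (lk lam r - lk lam (Suc r)))"
  by (simp add: emon_def esub_prod esub_power)

lemma partition_cols:
  assumes "lam \<in> partitions n"
  shows "(\<Sum>r=1..n. \<Sum>_<lk lam r - lk lam (Suc r). col r) = lam"
proof (rule poly_mapping_eqI)
  fix i
  have "lk (\<Sum>r=1..n. \<Sum>_<lk lam r - lk lam (Suc r). col r) i =
      (\<Sum>r=1..n. if 1 \<le> i \<and> i \<le> r then lk lam r - lk lam (Suc r) else 0)"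
    unfolding lookup_sum by (rule sum.cong) (auto simp: lookup_col)
  also have "... = lk lam i"
  proof (cases "i \<in> {1..n}")
    case True
    have "(\<Sum>r=1..n. if 1 \<le> i \<and> i \<le> r then lk lam r - lk lam (Suc r) else 0) = (\<Sum>r\<in>{i..n}. lk lam r - lk lam (Suc r))"
      using True by (intro sum.mono_neutral_cong_right) auto
    also have "... = (\<Sum>r\<in>{i..<Suc n}. lk lam r - lk lam (Suc r))" by (simp add: atLeastLessThanSuc_atLeastAtMost)
    also have "... = lk lam i - lk lam (Suc n)"
    proof -
      have "k \<ge> i ==> (\<Sum>r\<in>{i..<k}. lk lam r - lk lam (Suc r)) = lk lam i - lk lam k" for k
      proof (induction k rule: dec_induct)
        case (step k)
        have "lk lam (Suc k) \<le> lk lam k" "lk lam k \<le> lk lam i"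
          using True step by (auto intro!: partitions_antimono[OF assms])
        with step show ?case by simp
      qed simp
      from this[of "Suc n"] show ?thesis using True by (simp del: sum.op_ivl_Suc)
    qed
    also have "lk lam (Suc n) = 0" by (rule lookup_beyond[OF partitions_keys[OF assms]]) simp
    finally show ?thesis by simp
  next
    case False
    then have "lk lam i = 0" using partitions_keys[OF assms] by (auto simp: in_keys_iff subset_iff)
    with False show ?thesis by (auto intro!: sum.neutral)
  qed
  finally show "lk (\<Sum>r=1..n. \<Sum>_<lk lam r - lk lam (Suc r). col r) i = lk lam i" .
qed

lemma zero_in_hull: "0 \<in> dhull n 0" by (simp add: dhull_def sdeg_def pre_def)

lemma keys_prod_hull:
  fixes f :: "'b => cpoly"
  assumes "\<And>a. a \<in> A ==> ky (f a) \<subseteq> dhull n (lam a)"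
  shows "ky (prod f A) \<subseteq> dhull n (sum lam A)" using assms
proof (induction A rule: infinite_finite_induct)
  case (insert x A)
  show ?case
  proof
    fix m assume "m \<in> ky (prod f (insert x A))"
    then obtain a b where "a \<in> ky (f x)" "b \<in> ky (prod f A)" "m = a + b" using insert keys_mult[of "f x" "prod f A"] by auto
    then show "m \<in> dhull n (sum lam (insert x A))" using insert by (auto intro!: hull_add)
  qed
qed (auto simp: zero_in_hull)

lemma esub_emon_span:
  assumes "lam \<in> partitions n"
  shows "esub n (emon n lam) \<in> sym_span n (down n lam)" "lk (esub n (emon n lam)) lam = 1"
proof -
  let ?p = "\<lambda>r. esym n r ^ (lk lam r - lk lam (Suc r))"
  have "ky (?p r) \<subseteq> dhull n (\<Sum>_<lk lam r - lk lam (Suc r). col r)" if "r \<in> {1..n}" for r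
    using keys_prod_hull[of "{..<lk lam r - lk lam (Suc r)}" "\<lambda>_. esym n r" n "\<lambda>_. col r"]
      keys_esym_hull[of n r] that by simp
  then have "ky (prod ?p {1..n}) \<subseteq> dhull n (\<Sum>r=1..n. \<Sum>_<lk lam r - lk lam (Suc r). col r)" by (rule keys_prod_hull)
  then show "esub n (emon n lam) \<in> sym_span n (down n lam)" using esub_sym[of n "emon n lam"]
    unfolding sym_span_down_iff[OF assms] esub_emon partition_cols[OF assms] by blast
  have "leads (\<Sum>_<lk lam r - lk lam (Suc r). col r) 1 (?p r)" if "r \<in> {1..n}" for r
  proof -
    have "ky (col r) \<subseteq> {1..n}" using that by (auto simp: in_keys_iff lookup_col split: if_splits)
    then have "leads (col r) 1 (esym n r)"
      using that by (intro leads_hull) (auto simp: lookup_esym_col dest!: subsetD[OF keys_esym_hull])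
    then show ?thesis by (rule leads_power)
  qed
  then have "leads (\<Sum>r=1..n. \<Sum>_<lk lam r - lk lam (Suc r). col r) 1 (prod ?p {1..n})" by (rule leads_prod)
  then show "lk (esub n (emon n lam)) lam = 1" unfolding partition_cols[OF assms] esub_emon leads_def by blast
qed

lemma sym_span_esub:
  assumes "downset n U" "p \<in> sym_span n U"
  obtains c where "p = esub n (\<Sum>mu\<in>U. Const (c mu) * emon n mu)"
proof -
  obtain c where "p = (\<Sum>mu\<in>U. Const (c mu) * esub n (emon n mu))"
    using unitriangular_expand[OF _ assms, of "\<lambda>mu. esub n (emon n mu)"] esub_emon_span by blast
  then have "p = esub n (\<Sum>mu\<in>U. Const (c mu) * emon n mu)" by (simp add: esub_sum esub_mult)
  then show ?thesis by (rule that)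
qed

lemma vars_emon: "vars (emon n lam) \<subseteq> {1..n}" unfolding emon_def by (intro vars_prod vars_power) (auto simp: vars_Var)

text \<open>The products of the e_r attached to conjugate partitions are unitriangular with respect
  to dominance, so they span. F is an arbitrary representative; \<open>xsub_cong\<close> later shows
  that its choice is immaterial.\<close>

theorem sym_polys_esub:
  assumes "p \<in> sym_polys n" obtains F where "p = esub n F" "vars F \<subseteq> {1..n}"
proof -
  obtain U where U: "downset n U" "p \<in> sym_span n U" using sym_in_span[OF assms] .
  then obtain c where "p = esub n (\<Sum>mu\<in>U. Const (c mu) * emon n mu)" by (rule sym_span_esub)
  moreover have "vars (\<Sum>mu\<in>U. Const (c mu) * emon n mu) \<subseteq> {1..n}" by (intro vars_sum vars_mult vars_emon) simp
  ultimately show ?thesis by (rule that)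
qed

section \<open>The operators of Sekiguchi and of Laplace--Beltrami\<close>

lemma D_entry_theta:
  "D_entry n g u i j p = Var i ^ (n - j) * (theta i p + Const (of_nat (n - j) * of_real g + u) * p)"
  by (simp add: D_entry_def Var_mpderiv)

text \<open>A product of the commuting operators theta_i + c_i, diagonal on monomials by
  \<open>lookup_tw\<close>.\<close>

definition tw :: "(nat => complex) => nat list => cpoly => cpoly" where
  "tw c ks p = foldr (\<lambda>i q. theta i q + Const (c i) * q) ks p"

lemma tw_simps [simp]: "tw c [] p = p" "tw c (k # ks) p = theta k (tw c ks p) + Const (c k) * tw c ks p"
  by (simp_all add: tw_def)

lemma lookup_tw: "distinct ks ==> lk (tw c ks p) m = (\<Prod>i\<in>set ks. of_nat (lk m i) + c i) * lk p m"
  by (induction ks) (auto simp: lookup_add lookup_theta lookup_Const_mult algebra_simps)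

lemma theta_power_other: "i \<noteq> k ==> theta i (Var k ^ e) = 0" by (induction e) (auto simp: theta_mult theta_Var)

lemma theta_prod_other: "i \<notin> A ==> theta i (\<Prod>k\<in>A. Var k ^ e k) = 0"
  by (induction A rule: infinite_finite_induct) (auto simp: theta_mult theta_power_other)

text \<open>The Euler operator of one row does not act on the powers contributed by the other rows,
  so all powers of a Leibniz term move to the front.\<close>

lemma D_entries:
  assumes "distinct ks"
  shows "foldr (\<lambda>i. D_entry n g u i (\<sigma> i)) ks p =
    (\<Prod>i\<in>set ks. Var i ^ (n - \<sigma> i)) * tw (\<lambda>i. of_nat (n - \<sigma> i) * of_real g + u) ks p" using assms
proof (induction ks)
  case (Cons k ks)
  then have "theta k (\<Prod>i\<in>set ks. Var i ^ (n - \<sigma> i)) = 0" by (intro theta_prod_other) auto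
  with Cons show ?case by (simp add: D_entry_theta theta_mult algebra_simps)
qed simp

abbreviation upto_list :: "nat => nat list" where "upto_list n \<equiv> [1..<Suc n]"

lemma set_upto_list: "set (upto_list n) = {1..n}" by auto

lemma D_det_tw:
  "D_det n g u p = (\<Sum>\<sigma> | \<sigma> permutes {1..n}. of_int (sign \<sigma>) *
    ((\<Prod>i=1..n. Var i ^ (n - \<sigma> i)) * tw (\<lambda>i. of_nat (n - \<sigma> i) * of_real g + u) (upto_list n) p))"
  unfolding D_det_def by (simp only: D_entries distinct_upt set_upto_list)

lemma pm_tw:
  assumes \<pi>: "\<pi> permutes {1..n}" and p: "p \<in> sym_polys n"
  shows "pm \<pi> (tw c (upto_list n) p) = tw (\<lambda>i. c (inv \<pi> i)) (upto_list n) p"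
proof (rule poly_mapping_eqI)
  fix m
  have "(\<Prod>i=1..n. of_nat (lk m (\<pi> i)) + c i) = (\<Prod>i=1..n. of_nat (lk m i) + c (inv \<pi> i))"
    by (rule prod.reindex_bij_witness[of _ "inv \<pi>" \<pi>])
      (use \<pi> in \<open>auto simp: permutes_inverses permutes_in_image permutes_inv simp flip: atLeastAtMost_iff\<close>)
  then show "lk (pm \<pi> (tw c (upto_list n) p)) m = lk (tw (\<lambda>i. c (inv \<pi> i)) (upto_list n) p) m"
    using sym_lookup[OF p \<pi>, of m]
    by (simp add: lookup_pm[OF permutes_bij[OF \<pi>]] lookup_tw set_upto_list lookup_map_key[OF permutes_inj[OF \<pi>]]
        del: upt_Suc set_upt)
qed

lemma pm_prod_Var_pow:
  assumes "\<pi> permutes {1..n}"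
  shows "pm \<pi> (\<Prod>i=1..n. Var i ^ (n - \<sigma> i)) = (\<Prod>i=1..n. Var i ^ (n - (\<sigma> \<circ> inv \<pi>) i))"
proof -
  have "(\<Prod>i=1..n. Var (\<pi> i) ^ (n - \<sigma> i)) = (\<Prod>i=1..n. Var i ^ (n - \<sigma> (inv \<pi> i)) :: cpoly)"
    by (rule prod.reindex_bij_witness[of _ "inv \<pi>" \<pi>])
      (use assms in \<open>auto simp: permutes_inverses permutes_in_image permutes_inv
        simp flip: atLeastAtMost_iff\<close>)
  then show ?thesis by (simp add: pm_prod pm_power)
qed

lemma vars_tw: "vars p \<subseteq> A ==> vars (tw c ks p) \<subseteq> A" by (induction ks) (simp_all add: vars_add vars_mult vars_theta)

lemma antisym_D_det:
  assumes p: "p \<in> sym_polys n" shows "antisym_poly n (D_det n g u p)" unfolding antisym_poly_def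
proof (intro conjI allI impI)
  show "vars (D_det n g u p) \<subseteq> {1..n}" unfolding D_det_tw
    by (intro vars_sum vars_mult vars_prod vars_power vars_tw sym_vars[OF p])
      (auto simp: vars_Var simp flip: Const_of_int)
  fix \<pi> assume \<pi>: "\<pi> permutes {1..n}"
  show "pm \<pi> (D_det n g u p) = of_int (sign \<pi>) * D_det n g u p" unfolding D_det_tw
    by (rule pm_alternating_sum[OF \<pi>]) (simp add: pm_mult pm_prod_Var_pow[OF \<pi>] pm_tw[OF \<pi> p] del: upt_Suc)
qed

lemma D_op_vquot: "D_op n g u p = vquot n (D_det n g u p)"
proof -
  let ?s = "(- 1 :: cpoly) ^ (n * (n - 1) div 2)"
  have s: "?s * ?s = 1" by (simp flip: power_mult_distrib)
  have "vandermonde n Var * r = ?s * q \<longleftrightarrow> vand n * r = q" for r q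
  proof -
    have "vand n * r = ?s * (vandermonde n Var * r)" by (simp flip: vandermonde_vand add: mult.assoc)
    moreover have "?s * (?s * q) = q" by (simp add: s flip: mult.assoc)
    moreover have "?s * a = ?s * b \<longleftrightarrow> a = b" for a b by simp
    ultimately show ?thesis by metis
  qed
  then show ?thesis by (simp add: D_op_def vquot_def)
qed

lemma tw_add: "tw c ks (p + q) = tw c ks p + tw c ks q" by (induction ks) (auto simp: theta_add algebra_simps)

lemma tw_Const_mult: "tw c ks (Const a * p) = Const a * tw c ks p"
  by (induction ks) (auto simp: theta_Const_mult algebra_simps)

lemma D_det_add: "D_det n g u (p + q) = D_det n g u p + D_det n g u q"
  unfolding D_det_tw tw_add by (simp add: distrib_left sum.distrib del: upt_Suc)

lemma D_det_Const_mult: "D_det n g u (Const a * p) = Const a * D_det n g u p"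
  unfolding D_det_tw tw_Const_mult by (simp add: sum_distrib_left mult_ac del: upt_Suc)

lemma lin_op_vquot:
  assumes "\<And>p. p \<in> sym_polys n ==> antisym_poly n (L p)"
    and "\<And>p q. p \<in> sym_polys n ==> q \<in> sym_polys n ==> L (p + q) = L p + L q"
    and "\<And>c p. p \<in> sym_polys n ==> L (Const c * p) = Const c * L p"
  shows "lin_op n (\<lambda>p. vquot n (L p))" unfolding lin_op_def
proof (intro conjI ballI allI)
  fix p q assume pq: "p \<in> sym_polys n" "q \<in> sym_polys n"
  show "vquot n (L (p + q)) = vquot n (L p) + vquot n (L q)"
    by (rule vquot_eqI) (simp add: distrib_left vand_vquot assms pq)
next
  fix c p assume p: "p \<in> sym_polys n"
  have "vand n * (Const c * vquot n (L p)) = Const c * (vand n * vquot n (L p))" by (simp add: mult_ac)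
  then show "vquot n (L (Const c * p)) = Const c * vquot n (L p)" by (intro vquot_eqI) (simp add: vand_vquot assms p)
qed

text \<open>Division by the Vandermonde product subtracts \<open>rho n\<close> from hull and leading
  exponent, so triangularity can be checked on the antisymmetric numerator at lam + rho.\<close>

lemma triangular_vquot:
  assumes "\<And>p. p \<in> sym_polys n ==> antisym_poly n (L p)"
    and "\<And>p q. p \<in> sym_polys n ==> q \<in> sym_polys n ==> L (p + q) = L p + L q"
    and "\<And>c p. p \<in> sym_polys n ==> L (Const c * p) = Const c * L p"
    and "\<And>lam p. lam \<in> partitions n ==> p \<in> sym_polys n ==> ky p \<subseteq> dhull n lam ==>
           ky (L p) \<subseteq> dhull n (lam + rho n) \<and> lk (L p) (lam + rho n) = l lam * lk p lam"
  shows "triangular n (\<lambda>p. vquot n (L p)) l" unfolding triangular_def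
proof (intro conjI ballI)
  show "lin_op n (\<lambda>p. vquot n (L p))" by (rule lin_op_vquot) (use assms in auto)
  fix lam p assume lam: "lam \<in> partitions n" and p: "p \<in> sym_span n (down n lam)"
  then have p': "p \<in> sym_polys n" "ky p \<subseteq> dhull n lam" by (auto simp: sym_span_down_iff)
  show "vquot n (L p) \<in> sym_span n (down n lam)" "lk (vquot n (L p)) lam = l lam * lk p lam"
    using vquot_span[OF lam assms(1)] assms(4)[OF lam] p' by auto
qed

lemma keys_mult_hull:
  fixes p q :: "cpoly"
  assumes "ky p \<subseteq> dhull n a" "ky q \<subseteq> dhull n b" shows "ky (p * q) \<subseteq> dhull n (a + b)"
proof
  fix m assume "m \<in> ky (p * q)"
  then obtain k l where "k \<in> ky p" "l \<in> ky q" "m = k + l" using keys_mult[of p q] by auto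
  then show "m \<in> dhull n (a + b)" using assms by (auto intro: hull_add)
qed

lemma keys_sum_hull:
  assumes "\<And>a. a \<in> A ==> ky (f a) \<subseteq> S" shows "ky (sum f A) \<subseteq> S" using Poly_Mapping.keys_sum[of f A] assms by blast

lemma keys_Const_mult: "ky (Const c * p) \<subseteq> ky (p :: cpoly)" by (auto simp: in_keys_iff lookup_Const_mult)

lemma keys_of_int_mult: "ky (of_int k * p) \<subseteq> ky (p :: cpoly)"
  using keys_Const_mult[of "of_int k" p] by (simp add: Const_of_int)

lemma keys_tw: "ky (tw c ks p) \<subseteq> ky p"
proof (induction ks)
  case (Cons k ks)
  have "ky (tw c (k # ks) p) \<subseteq> ky (tw c ks p)" by (auto simp: in_keys_iff lookup_add lookup_theta lookup_Const_mult)
  with Cons show ?case by blast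
qed simp

lemma leads_Const_mult: "leads m c p ==> leads m (a * c) (Const a * p)"
  using keys_Const_mult[of a p] by (auto simp: leads_def lookup_Const_mult)

lemma leads_sum:
  assumes "\<And>a. a \<in> A ==> leads m (c a) (f a)" shows "leads m (sum c A) (sum f A)"
  using assms Poly_Mapping.keys_sum[of f A] by (fastforce simp: leads_def lookup_sum)

lemma leads_add: "leads m c p ==> leads m d q ==> leads m (c + d) (p + q)"
  using keys_add[of p q] by (fastforce simp: leads_def lookup_add)

lemma leads_theta: "leads m c p ==> leads m (of_nat (lk m i) * c) (theta i p)"
  using keys_theta[of i p] by (auto simp: leads_def lookup_theta)

definition D_eval :: "nat => real => complex => expo => complex" where
  "D_eval n g u lam = (\<Prod>i=1..n. of_nat (lk lam i) + of_nat (n - i) * of_real g + u)"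

theorem triangular_D_op: "triangular n (D_op n g u) (D_eval n g u)" unfolding D_op_vquot
proof (rule triangular_vquot)
  fix lam p assume lam: "lam \<in> partitions n" and p: "p \<in> sym_polys n" "ky p \<subseteq> dhull n lam"
  let ?c = "\<lambda>\<sigma> i. of_nat (n - \<sigma> i) * of_real g + u"
  let ?t = "\<lambda>\<sigma>. (\<Prod>i=1..n. Var i ^ (n - \<sigma> i)) * tw (?c \<sigma>) (upto_list n) p"
  have k: "ky (tw (?c \<sigma>) (upto_list n) p) \<subseteq> dhull n lam" for \<sigma> using keys_tw p(2) by blast
  have r: "ky (\<Prod>i=1..n. Var i ^ (n - \<sigma> i) :: cpoly) \<subseteq> dhull n (rho n)" if "\<sigma> permutes {1..n}" for \<sigma>
    unfolding prod_Var_rho[OF that] using that by (auto intro!: hull_map_key partition_in_hull rho_partition)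
  have kt: "ky (?t \<sigma>) \<subseteq> dhull n (lam + rho n)" if "\<sigma> permutes {1..n}" for \<sigma>
    using keys_mult_hull[OF r[OF that] k] by (simp only: add.commute)
  have "ky (D_det n g u p) \<subseteq> dhull n (lam + rho n)"
    unfolding D_det_tw using kt keys_of_int_mult by (intro keys_sum_hull) blast
  moreover have "leads (rho n + lam) (D_eval n g u lam * lk p lam) (D_det n g u p)"
  proof -
    \<comment> \<open>The monomial of \<sigma> has the exponent rho only for \<sigma> = id. At lam +
      rho the determinant thus reduces to its main diagonal, which yields
      \<open>D_eval\<close>.\<close>
    have "leads (rho n) (if \<sigma> = id then 1 else 0) (\<Prod>i=1..n. Var i ^ (n - \<sigma> i))" if "\<sigma> permutes {1..n}" for \<sigma>
    proof (rule leads_hull[OF _ r[OF that] partitions_keys[OF rho_partition]])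
      have id: "mk id (rho n) = rho n" by (rule poly_mapping_eqI) (simp add: lookup_map_key)
      then have "mk \<sigma> (rho n) = rho n \<longleftrightarrow> \<sigma> = id" using rho_map_key_inj[OF that permutes_id] by metis
      then show "lk (\<Prod>i=1..n. Var i ^ (n - \<sigma> i)) (rho n) = (if \<sigma> = id then 1 else 0 :: complex)"
        unfolding prod_Var_rho[OF that] by (simp add: lookup_single when_def)
    qed
    moreover have "leads lam (lk (tw (?c \<sigma>) (upto_list n) p) lam) (tw (?c \<sigma>) (upto_list n) p)" for \<sigma>
      by (rule leads_hull[OF refl k partitions_keys[OF lam]])
    ultimately have "leads (rho n + lam) ((if \<sigma> = id then 1 else 0) * lk (tw (?c \<sigma>) (upto_list n) p) lam) (?t \<sigma>)"
      if "\<sigma> permutes {1..n}" for \<sigma> using that by (intro leads_mult)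
    note lt = this
    have "leads (rho n + lam) (\<Sum>\<sigma> | \<sigma> permutes {1..n}. of_int (sign \<sigma>) * ((if \<sigma> = id then 1 else 0) * lk (tw (?c \<sigma>) (upto_list n) p) lam)) (D_det n g u p)"
      unfolding D_det_tw
    proof (rule leads_sum)
      fix \<sigma> assume "\<sigma> \<in> {\<sigma>. \<sigma> permutes {1..n}}"
      then have \<sigma>: "\<sigma> permutes {1..n}" by simp
      show "leads (rho n + lam) (of_int (sign \<sigma>) * ((if \<sigma> = id then 1 else 0) * lk (tw (?c \<sigma>) (upto_list n) p) lam))
          (of_int (sign \<sigma>) * ?t \<sigma>)"
        unfolding Const_of_int[symmetric, where 'a = complex] by (rule leads_Const_mult[OF lt[OF \<sigma>]])
    qed
    also have "(\<Sum>\<sigma> | \<sigma> permutes {1..n}. of_int (sign \<sigma>) * ((if \<sigma> = id then 1 else 0) * lk (tw (?c \<sigma>) (upto_list n) p) lam)) =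
        (\<Sum>\<sigma> | \<sigma> permutes {1..n}. if \<sigma> = id then lk (tw (?c id) (upto_list n) p) lam else 0)" by (rule sum.cong) auto
    also have "... = lk (tw (?c id) (upto_list n) p) lam" using permutes_id by (simp add: finite_permutations del: upt_Suc)
    also have "... = D_eval n g u lam * lk p lam"
      by (simp only: lookup_tw distinct_upt set_upto_list D_eval_def id_apply add.assoc)
    finally show ?thesis .
  qed
  ultimately show "ky (D_det n g u p) \<subseteq> dhull n (lam + rho n) \<and> lk (D_det n g u p) (lam + rho n) = D_eval n g u lam * lk p lam"
    by (simp add: leads_def add.commute)
qed (auto simp: antisym_D_det D_det_add D_det_Const_mult)

text \<open>The Vandermonde product V times the Laplace--Beltrami operator 1/2 Sum theta_i^2 + g Sum
  (theta_i V / V) theta_i, where theta_i V / V is the sum of x_i / (x_i - x_j) over j \<noteq> i.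
  Keeping V as a factor avoids denominators.\<close>

definition Hnum :: "nat => real => cpoly => cpoly" where
  "Hnum n g p = Const (1 / 2) * (vand n * (\<Sum>i=1..n. theta i (theta i p))) +
     Const (of_real g) * (\<Sum>i=1..n. theta i (vand n) * theta i p)"

lemma Hnum_add: "Hnum n g (p + q) = Hnum n g p + Hnum n g q"
  unfolding Hnum_def theta_add by (simp add: sum.distrib algebra_simps)

lemma Hnum_Const_mult: "Hnum n g (Const c * p) = Const c * Hnum n g p"
  unfolding Hnum_def theta_Const_mult by (simp add: sum_distrib_left algebra_simps)

definition Hop :: "nat => real => cpoly => cpoly" where
  "Hop n g p = vquot n (Hnum n g p)"

lemma antisym_Hnum:
  assumes p: "p \<in> sym_polys n" shows "antisym_poly n (Hnum n g p)" unfolding antisym_poly_def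
proof (intro conjI allI impI)
  show "vars (Hnum n g p) \<subseteq> {1..n}" unfolding Hnum_def
    by (intro vars_add vars_mult vars_sum vars_theta vars_vand sym_vars[OF p]) auto
  fix \<pi> assume \<pi>: "\<pi> permutes {1..n}"
  note b = permutes_bij[OF \<pi>]
  have re: "(\<Sum>i=1..n. f (\<pi> i)) = (\<Sum>i=1..n. f i)" for f :: "nat => cpoly"
    using sum.permute[OF \<pi>, of f] by (simp add: comp_def)
  have v: "pm \<pi> (vand n) = of_int (sign \<pi>) * vand n" using vand_antisym \<pi> by (simp add: antisym_poly_def)
  have tv: "theta i (of_int (sign \<pi>) * vand n) = of_int (sign \<pi>) * theta i (vand n)" for i
    using theta_Const_mult[of i "of_int (sign \<pi>)" "vand n"] by (simp add: Const_of_int)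
  show "pm \<pi> (Hnum n g p) = of_int (sign \<pi>) * Hnum n g p"
    unfolding Hnum_def pm_add pm_mult pm_sum pm_theta[OF b] sym_pm[OF p \<pi>] v tv pm_Const
    by (simp only: re[of "\<lambda>i. theta i (theta i p)"] mult.assoc
        re[of "\<lambda>i. of_int (sign \<pi>) * (theta i (vand n) * theta i p)"])
      (simp add: algebra_simps sum_distrib_left)
qed

definition H_eval :: "nat => real => expo => real" where
  "H_eval n g lam = (\<Sum>i=1..n. real (lk lam i) ^ 2 / 2 + g * (real (n - i) * real (lk lam i)))"

theorem triangular_Hop: "triangular n (Hop n g) (\<lambda>lam. of_real (H_eval n g lam))" unfolding Hop_def
proof (rule triangular_vquot)
  fix lam p assume lam: "lam \<in> partitions n" and p: "p \<in> sym_polys n" "ky p \<subseteq> dhull n lam"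
  have v: "ky (vand n) \<subseteq> dhull n (rho n)" by (simp add: vand_altsum keys_altsum_hull)
  have t: "ky (theta i q) \<subseteq> S" if "ky q \<subseteq> S" for i q S using keys_theta[of i q] that by blast
  have "ky (Hnum n g p) \<subseteq> dhull n (rho n + lam)"
  proof -
    have "ky (vand n * (\<Sum>i=1..n. theta i (theta i p))) \<subseteq> dhull n (rho n + lam)"
      by (intro keys_mult_hull v keys_sum_hull t p)
    moreover have "ky (\<Sum>i=1..n. theta i (vand n) * theta i p) \<subseteq> dhull n (rho n + lam)"
      by (intro keys_mult_hull v keys_sum_hull t p)
    ultimately show ?thesis unfolding Hnum_def by (intro order_trans[OF keys_add] Un_least order_trans[OF keys_Const_mult])
  qed
  moreover have "leads (rho n + lam) (of_real (H_eval n g lam) * lk p lam) (Hnum n g p)"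
  proof -
    have lv: "leads (rho n) 1 (vand n)" by (simp add: vand_altsum rho_leads_altsum)
    have lp: "leads lam (lk p lam) p" by (rule leads_hull[OF refl p(2) partitions_keys[OF lam]])
    have "leads (rho n + lam) (1 / 2 * (1 * (\<Sum>i=1..n. of_nat (lk lam i) * (of_nat (lk lam i) * lk p lam))) +
        of_real g * (\<Sum>i=1..n. (of_nat (lk (rho n) i) * 1) * (of_nat (lk lam i) * lk p lam))) (Hnum n g p)"
      unfolding Hnum_def by (intro leads_add leads_Const_mult leads_mult leads_sum leads_theta lv lp)
    also have "1 / 2 * (1 * (\<Sum>i=1..n. of_nat (lk lam i) * (of_nat (lk lam i) * lk p lam))) +
        of_real g * (\<Sum>i=1..n. (of_nat (lk (rho n) i) * 1) * (of_nat (lk lam i) * lk p lam)) =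
        (\<Sum>i=1..n. (of_nat (lk lam i) ^ 2 / 2 + of_real g * (of_nat (n - i) * of_nat (lk lam i))) * lk p lam)"
      unfolding sum_distrib_left sum.distrib[symmetric]
      by (rule sum.cong) (auto simp: lookup_rho power2_eq_square algebra_simps)
    also have "... = of_real (H_eval n g lam) * lk p lam" by (simp add: H_eval_def sum_distrib_right)
    finally show ?thesis .
  qed
  ultimately show "ky (Hnum n g p) \<subseteq> dhull n (lam + rho n) \<and>
      lk (Hnum n g p) (lam + rho n) = of_real (H_eval n g lam) * lk p lam" by (simp add: leads_def add.commute)
qed (simp_all add: antisym_Hnum Hnum_add Hnum_Const_mult)

text \<open>Abel summation of d with nonnegative partial sums against decreasing weights s.\<close>

lemma sum_prefix_le:
  fixes d s :: "nat => int"
  assumes "\<And>k. 0 \<le> (\<Sum>i\<in>{1..k}. d i)" "\<And>k. 1 \<le> k ==> s (Suc k) \<le> s k"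
  shows "s (Suc N) * (\<Sum>i\<in>{1..Suc N}. d i) \<le> (\<Sum>i\<in>{1..Suc N}. d i * s i)"
proof (induction N)
  case (Suc N)
  have "s (Suc (Suc N)) * (\<Sum>i\<in>{1..Suc N}. d i) \<le> s (Suc N) * (\<Sum>i\<in>{1..Suc N}. d i)"
    using assms(1)[of "Suc N"] assms(2)[of "Suc N"] by (intro mult_right_mono) auto
  with Suc show ?case by (simp add: algebra_simps)
qed (simp add: mult.commute)

text \<open>Sum (n - i) lam_i is the sum of the partial sums and hence grows strictly; with g > 0
  this makes the total strict. The squares grow weakly: factor lam_i^2 - mu_i^2 and sum by parts
  against the decreasing weights lam_i + mu_i.\<close>

lemma H_eval_strict:
  assumes g: "g > 0" and lam: "lam \<in> partitions n" and mu: "mu \<in> down n lam" "mu \<noteq> lam"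
  shows "H_eval n g mu < H_eval n g lam"
proof -
  have mup: "mu \<in> partitions n" using mu by (simp add: down_def)
  have le: "pre mu k \<le> pre lam k" and eqn: "pre mu n = pre lam n" for k using mu lam by (auto simp: down_def dominated_pre)
  have lin: "(\<Sum>i=1..n. (n - i) * lk nu i) = (\<Sum>k<n. pre nu k)" if "nu \<in> partitions n" for nu
  proof -
    have "(\<Sum>k<n. pre nu k) = (\<Sum>k<n. \<Sum>i=1..n. if i \<le> k then lk nu i else 0)"
    proof (rule sum.cong)
      fix k assume "k \<in> {..<n}"
      then show "pre nu k = (\<Sum>i=1..n. if i \<le> k then lk nu i else 0)"
        unfolding pre_sdeg[OF partitions_keys[OF that]] sdeg_def by (intro sum.mono_neutral_cong_left) auto
    qed simp
    also have "... = (\<Sum>i=1..n. \<Sum>k<n. if i \<le> k then lk nu i else 0)" by (rule sum.swap)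
    also have "... = (\<Sum>i=1..n. (n - i) * lk nu i)"
    proof (rule sum.cong)
      fix i assume "i \<in> {1..n}"
      have "(\<Sum>k<n. if i \<le> k then lk nu i else 0) = (\<Sum>k\<in>{i..<n}. lk nu i)" by (rule sum.mono_neutral_cong_right) auto
      then show "(\<Sum>k<n. if i \<le> k then lk nu i else 0) = (n - i) * lk nu i" by simp
    qed simp
    finally show ?thesis by simp
  qed
  obtain k where k: "pre mu k \<noteq> pre lam k" using mu(2) pre_eqD by blast
  then have "k < n" using eqn pre_beyond partitions_keys[OF mup] partitions_keys[OF lam] by (metis not_less)
  then have "(\<Sum>k<n. pre mu k) < (\<Sum>k<n. pre lam k)" using k le by (intro sum_strict_mono_ex1) (auto simp: less_le)
  then have 1: "(\<Sum>i=1..n. (n - i) * lk mu i) < (\<Sum>i=1..n. (n - i) * lk lam i)" by (simp add: lin mup lam)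
  have 2: "(\<Sum>i=1..n. int (lk mu i) ^ 2) \<le> (\<Sum>i=1..n. int (lk lam i) ^ 2)"
  proof (cases n)
    case (Suc N)
    let ?d = "\<lambda>i. int (lk lam i) - int (lk mu i)" and ?s = "\<lambda>i. int (lk lam i) + int (lk mu i)"
    have pi: "(\<Sum>i\<in>{1..k}. ?d i) = int (pre lam k) - int (pre mu k)" for k
      by (simp add: pre_sdeg[OF partitions_keys[OF lam]] pre_sdeg[OF partitions_keys[OF mup]] sdeg_def sum_subtractf)
    have "?s (Suc N) * (\<Sum>i\<in>{1..Suc N}. ?d i) \<le> (\<Sum>i\<in>{1..Suc N}. ?d i * ?s i)"
    proof (rule sum_prefix_le)
      show "0 \<le> (\<Sum>i\<in>{1..k}. ?d i)" for k unfolding pi using le by simp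
      show "?s (Suc k) \<le> ?s k" if "1 \<le> k" for k
        using that partitions_antimono[OF lam, of k "Suc k"] partitions_antimono[OF mup, of k "Suc k"] by simp
    qed
    then have "0 \<le> (\<Sum>i=1..n. ?d i * ?s i)" using pi[of n] eqn Suc by simp
    also have "... = (\<Sum>i=1..n. int (lk lam i) ^ 2 - int (lk mu i) ^ 2)"
      by (rule sum.cong) (auto simp: power2_eq_square algebra_simps)
    finally show ?thesis by (simp add: sum_subtractf)
  qed simp
  have "real (\<Sum>i=1..n. (n - i) * lk mu i) < real (\<Sum>i=1..n. (n - i) * lk lam i)" using 1 by (simp only: of_nat_less_iff)
  then have "g * (\<Sum>i=1..n. real (n - i) * real (lk mu i)) < g * (\<Sum>i=1..n. real (n - i) * real (lk lam i))" using g by simp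
  moreover have "real_of_int (\<Sum>i=1..n. int (lk mu i) ^ 2) \<le> real_of_int (\<Sum>i=1..n. int (lk lam i) ^ 2)"
    using 2 by (simp only: of_int_le_iff)
  then have "(\<Sum>i=1..n. real (lk mu i) ^ 2 / 2) \<le> (\<Sum>i=1..n. real (lk lam i) ^ 2 / 2)" by (simp flip: sum_divide_distrib)
  ultimately show ?thesis unfolding H_eval_def by (simp only: sum.distrib sum_distrib_left)
qed

subsection \<open>Commutation of the two operators\<close>

lemma sum_offdiag_swap:
  fixes F :: "nat => nat => 'a::comm_monoid_add"
  assumes "finite T"
  shows "(\<Sum>j\<in>T. \<Sum>i\<in>T - {j}. F i j) = (\<Sum>j\<in>T. \<Sum>i\<in>T - {j}. F j i)"
proof -
  have *: "(\<Sum>j\<in>T. \<Sum>i\<in>T - {j}. F i j) = (\<Sum>j\<in>T. \<Sum>i\<in>T. if i = j then 0 else F i j)" for F :: "nat => nat => 'a"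
    using assms by (intro sum.cong refl sum.mono_neutral_cong_left) auto
  show ?thesis unfolding * by (subst sum.swap) (auto intro!: sum.cong)
qed

text \<open>With \<open>w i j = x\<^sub>i x\<^sub>j / (x\<^sub>i - x\<^sub>j)\<^sup>2\<close> and the commuting operators \<open>\<pi>\<^sub>k\<close> (the conjugates of
  \<open>x\<^sub>k \<partial>/\<partial>x\<^sub>k\<close> by the power \<open>g\<close> of the Vandermonde product), the determinant
  becomes the sum over all partial matchings M of the indices of
  \<open>(g (g - 1))\<^bsup>|M|\<^esup> (\<Prod>(i,j)\<in>M. w i j) (\<Prod>k\<notin>M. \<pi>\<^sub>k + u)\<close>. The function \<open>DDs\<close> is defined by the resulting
  recursion, which makes sense for every subset of the indices; this is what allows an induction.\<close>

locale cm =
  fixes N :: "nat set" and x :: "nat => 'a::field" and th :: "nat => 'a => 'a" and g u :: 'a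
  assumes finN: "finite N"
    and th_add: "th i (f + h) = th i f + th i h"
    and th_mult: "th i (f * h) = th i f * h + f * th i h"
    and th_comm: "th i (th j f) = th j (th i f)"
    and th_x: "th i (x j) = (if i = j then x j else 0)"
    and x_inj: "i \<noteq> j ==> x i \<noteq> x j"
    and th_g: "th i g = 0" and th_u: "th i u = 0"
begin

lemma th_0 [simp]: "th i 0 = 0" using th_add[of i 0 0] by (simp only: add_0_left add_cancel_right_right)
lemma th_1 [simp]: "th i 1 = 0" using th_mult[of i 1 1] by (simp only: mult_1_left mult_1_right add_cancel_right_right)
lemma th_uminus: "th i (- f) = - th i f" using th_add[of i f "- f"] by (simp add: eq_neg_iff_add_eq_0 add.commute)
lemma th_diff: "th i (f - h) = th i f - th i h" using th_add[of i f "- h"] by (simp add: th_uminus)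
lemma th_sum: "th i (sum f A) = (\<Sum>a\<in>A. th i (f a))" by (induction A rule: infinite_finite_induct) (auto simp: th_add)

lemma th_divide:
  assumes "h \<noteq> 0" shows "th i (f / h) = (th i f * h - f * th i h) / h ^ 2"
proof -
  have "th i f = th i (f / h * h)" using assms by simp
  also have "... = th i (f / h) * h + f / h * th i h" by (rule th_mult)
  finally have "th i (f / h) * h = th i f - f / h * th i h" by simp
  then have "th i (f / h) = (th i f - f / h * th i h) / h" using assms by (simp add: eq_divide_eq)
  also have "... = (th i f * h - f * th i h) / h ^ 2" using assms by (simp add: field_simps power2_eq_square)
  finally show ?thesis .
qed

definition w :: "nat => nat => 'a" where "w i j = x i * x j / (x i - x j) ^ 2"
text \<open>The logarithmic derivative of the Vandermonde product over all of N, also when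
  \<open>DDs\<close> below is taken over a smaller set.\<close>

definition ph :: "nat => 'a" where "ph k = (\<Sum>j\<in>N - {k}. x k / (x k - x j))"
definition pk :: "nat => 'a => 'a" where "pk k f = th k f + g * ph k * f"
definition kap :: 'a where "kap = g * (g - 1)"

lemma w_sym: "w i j = w j i" by (simp add: w_def mult.commute power2_commute)

lemma th_w_other: "k \<noteq> i ==> k \<noteq> j ==> th k (w i j) = 0"
proof (cases "i = j")
  case False
  assume "k \<noteq> i" "k \<noteq> j"
  then have "th k ((x i - x j) ^ 2) = 0" "th k (x i * x j) = 0" by (simp_all add: power2_eq_square th_mult th_diff th_x)
  then show ?thesis using x_inj[OF False] by (simp add: w_def th_divide)
qed (simp add: w_def)

lemma th_w1:
  assumes "i \<noteq> j" shows "th i (w i j) = - (w i j * ((x i + x j) / (x i - x j)))"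
proof -
  have ne: "x i - x j \<noteq> 0" using x_inj[OF assms] by simp
  have "th i (w i j) = (x i * x j * (x i - x j) ^ 2 - x i * x j * (2 * (x i - x j) * x i)) / ((x i - x j) ^ 2) ^ 2"
  proof -
    have "th i ((x i - x j) ^ 2) = 2 * (x i - x j) * x i" "th i (x i * x j) = x i * x j"
      unfolding power2_eq_square th_mult th_diff th_x using assms by (simp_all add: algebra_simps)
    moreover have "(x i - x j) ^ 2 \<noteq> 0" using ne by simp
    note th_divide[OF this, of i "x i * x j"]
    ultimately show ?thesis unfolding w_def by (simp only:)
  qed
  also have "... = - (w i j * ((x i + x j) / (x i - x j)))"
  proof -
    have *: "p * d ^ 2 - p * (2 * d * a) = - (p * (a + b) * d)" if "d = a - b" for p d a b :: 'a
      unfolding that by (simp add: algebra_simps power2_eq_square)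
    have **: "- (p * s * d) / (d ^ 2) ^ 2 = - (p / d ^ 2 * (s / d))" if "d \<noteq> 0" for p s d :: 'a
      using that by (simp add: divide_simps power2_eq_square)
    show ?thesis unfolding w_def *[OF refl] **[OF ne] ..
  qed
  finally show ?thesis .
qed

lemma th_w2: "i \<noteq> j ==> th j (w i j) = - th i (w i j)"
proof -
  assume "i \<noteq> j"
  then have "th j (w i j) = - (w i j * ((x j + x i) / (x j - x i)))" by (metis th_w1 w_sym)
  also have "(x j + x i) / (x j - x i) = - ((x i + x j) / (x i - x j))"
    by (metis add.commute minus_diff_eq minus_divide_right)
  finally show ?thesis using \<open>i \<noteq> j\<close> by (simp add: th_w1)
qed

lemma th_ph:
  assumes "l \<in> N" "l \<noteq> k" shows "th l (ph k) = w k l"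
proof -
  have "th l (x k / (x k - x j)) = (if j = l then w k l else 0)" if "j \<noteq> k" for j
    using that assms x_inj[of k j] by (auto simp: th_divide th_diff th_x w_def)
  then have "th l (ph k) = (\<Sum>j\<in>N - {k}. if j = l then w k l else 0)" unfolding ph_def th_sum by (intro sum.cong) auto
  then show ?thesis using assms finN by simp
qed

lemma th_ph_same: "th k (ph k) = - (\<Sum>j\<in>N - {k}. w k j)"
proof -
  have "th k (x k / (x k - x j)) = - w k j" if "j \<noteq> k" for j
    using that x_inj[of k j] by (auto simp: th_divide th_diff th_x w_def divide_simps algebra_simps)
  then show ?thesis unfolding ph_def th_sum by (simp flip: sum_negf)
qed

lemma pk_add: "pk k (f + h) = pk k f + pk k h" by (simp add: pk_def th_add algebra_simps)
lemma pk_0 [simp]: "pk k 0 = 0" by (simp add: pk_def)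
lemma pk_mult: "pk k (h * f) = th k h * f + h * pk k f" by (simp add: pk_def th_mult algebra_simps)
lemma pk_sum: "pk k (sum f A) = (\<Sum>a\<in>A. pk k (f a))" by (induction A rule: infinite_finite_induct) (auto simp: pk_add)
lemma pk_const: "th k h = 0 ==> pk k (h * f) = h * pk k f" by (simp add: pk_mult)

text \<open>The potentials have symmetric cross derivatives: th k (ph l) and th l (ph k) are both
  \<open>w k l\<close>.\<close>

lemma pk_comm: "k \<in> N ==> l \<in> N ==> pk k (pk l f) = pk l (pk k f)"
proof (cases "k = l")
  case False
  assume "k \<in> N" "l \<in> N"
  then have "th k (ph l) = w l k" "th l (ph k) = w k l" using False by (auto simp: th_ph)
  then show ?thesis by (simp add: pk_def th_add th_mult th_g w_sym[of l k] th_comm[of k l] algebra_simps)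
qed simp

lemma th_pk: "k \<in> N ==> k \<noteq> l ==> th k (pk l f) = pk l (th k f) + g * w k l * f"
  by (simp add: pk_def th_add th_mult th_g th_ph th_comm[of k l] w_sym[of k l] algebra_simps)

lemma th_kap [simp]: "th k kap = 0" by (simp add: kap_def th_mult th_diff th_g)

function DDs :: "nat set => 'a => 'a" where
  "DDs S f = (if finite S \<and> S \<noteq> {} then pk (Max S) (DDs (S - {Max S}) f) + u * DDs (S - {Max S}) f +
       kap * (\<Sum>j\<in>S - {Max S}. w (Max S) j * DDs (S - {Max S} - {j}) f) else f)" by auto
termination
proof (relation "Wellfounded.measure (\<lambda>(S, f). card S)", goal_cases)
  case (2 S f)
  then show ?case by (simp add: card_gt_0_iff)
next
  case (3 S f)
  then show ?case by (simp add: card_gt_0_iff)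
next
  case (4 S f j)
  then have "card (S - {Max S} - {j}) \<le> card (S - {Max S})" by (intro card_mono) auto
  also have "... < card S" using 4 by (simp add: card_gt_0_iff)
  finally show ?case by simp
qed auto

declare DDs.simps [simp del]

lemma DDs_empty [simp]: "DDs {} f = f" by (simp add: DDs.simps)

text \<open>The recursion singles out the maximum only to be well defined; any k may be removed
  first. Expanding at k and at the maximum m in either order yields the expression \<open>X\<close>,
  which is symmetric in both because the \<open>pk\<close> commute and the pairs matched to k and m
  may be exchanged.\<close>

lemma DDs_insert:
  assumes "finite T" "T \<subseteq> N" "k \<in> N" "k \<notin> T"
  shows "DDs (insert k T) f = pk k (DDs T f) + u * DDs T f + kap * (\<Sum>j\<in>T. w k j * DDs (T - {j}) f)" using assms
proof (induction "card T" arbitrary: T k rule: less_induct)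
  case less
  let ?S = "insert k T"
  let ?m = "Max ?S"
  have mS: "?m \<in> ?S" using less by (intro Max_in) auto
  have unf: "DDs ?S f = pk ?m (DDs (?S - {?m}) f) + u * DDs (?S - {?m}) f +
       kap * (\<Sum>j\<in>?S - {?m}. w ?m j * DDs (?S - {?m} - {j}) f)" using less by (subst DDs.simps) auto
  show ?case
  proof (cases "?m = k")
    case True
    have "?S - {k} = T" using less by auto
    with unf True show ?thesis by simp
  next
    case False
    define m where "m = ?m"
    define T' where "T' = T - {m}"
    have m: "m \<in> T" "m \<noteq> k" "m \<in> N" using mS False less by (auto simp: m_def)
    have T: "T = insert m T'" "m \<notin> T'" "finite T'" "T' \<subseteq> N" "k \<notin> T'" "k \<in> N" using m less by (auto simp: T'_def)
    have S1: "?S - {m} = insert k T'" using T m by auto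
    have S2: "insert k T' - {k} = T'" "insert k T' - {j} = insert k (T' - {j})" if "j \<in> T'" for j using T that by auto
    have S2': "insert k T' - {k} = T'" using T by auto
    have S3: "insert m T' - {m} = T'" using T by auto
    have S4: "insert m T' - {j} = insert m (T' - {j})" if "j \<in> T'" for j using T that by auto
    have card: "card T' < card T" "card (T' - {j}) < card T" for j using T card_Diff1_le[of T' j] by auto
    have IH: "DDs (insert a T') f = pk a (DDs T' f) + u * DDs T' f + kap * (\<Sum>j\<in>T'. w a j * DDs (T' - {j}) f)"
      "DDs (insert a (T' - {j})) f = pk a (DDs (T' - {j}) f) + u * DDs (T' - {j}) f +
         kap * (\<Sum>i\<in>T' - {j}. w a i * DDs (T' - {j} - {i}) f)"
      if "a \<in> N" "a \<notin> T'" for a j using less.hyps[OF card(1), of a] less.hyps[OF card(2)[of j], of a] T that by auto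
    define X where "X a b = pk a (pk b (DDs T' f)) + u * pk a (DDs T' f) + u * pk b (DDs T' f) + u * u * DDs T' f
        + kap * (w a b * DDs T' f) + kap * (\<Sum>j\<in>T'. w b j * pk a (DDs (T' - {j}) f) + u * (w b j * DDs (T' - {j}) f))
        + kap * (\<Sum>j\<in>T'. w a j * pk b (DDs (T' - {j}) f) + u * (w a j * DDs (T' - {j}) f))
        + kap * kap * (\<Sum>j\<in>T'. \<Sum>i\<in>T' - {j}. w a j * (w b i * DDs (T' - {j} - {i}) f))" for a b
    have X: "pk a (DDs (insert b T') f) + u * DDs (insert b T') f +
         kap * (w a b * DDs T' f + (\<Sum>j\<in>T'. w a j * DDs (insert b (T' - {j})) f)) = X a b"
      if "a \<in> N" "b \<in> N" "a \<notin> T'" "b \<notin> T'" "a \<noteq> b" for a b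
    proof -
      have p: "pk a (w b j * h) = w b j * pk a h" if "j \<in> T'" for j h
        using \<open>a \<noteq> b\<close> \<open>a \<notin> T'\<close> that by (intro pk_const th_w_other) auto
      have 1: "pk a (\<Sum>j\<in>T'. w b j * DDs (T' - {j}) f) = (\<Sum>j\<in>T'. w b j * pk a (DDs (T' - {j}) f))"
        unfolding pk_sum by (intro sum.cong refl p)
      show ?thesis unfolding X_def IH[OF that(2,4)] pk_add pk_const[OF th_kap] pk_const[OF th_u] 1
        by (simp add: algebra_simps sum.distrib sum_distrib_left)
    qed
    have "X a b = X b a" if "a \<in> N" "b \<in> N" for a b
    proof -
      have "(\<Sum>j\<in>T'. \<Sum>i\<in>T' - {j}. w a j * (w b i * DDs (T' - {j} - {i}) f)) =
          (\<Sum>j\<in>T'. \<Sum>i\<in>T' - {j}. w b j * (w a i * DDs (T' - {j} - {i}) f))"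
        by (subst sum_offdiag_swap[OF T(3)], intro sum.cong refl)
          (simp add: Diff_insert2[symmetric] insert_commute mult.left_commute)
      then show ?thesis unfolding X_def by (simp add: pk_comm[OF that] w_sym[of a b])
    qed
    moreover have "DDs ?S f = X m k"
    proof -
      have "(\<Sum>j\<in>insert k T'. w m j * DDs (insert k T' - {j}) f) =
          w m k * DDs T' f + (\<Sum>j\<in>T'. w m j * DDs (insert k (T' - {j})) f)" using T S2' S2 by (simp add: sum.insert)
      then show ?thesis using unf unfolding m_def[symmetric] S1 using X[of m k] T m by simp
    qed
    moreover have "pk k (DDs T f) + u * DDs T f + kap * (\<Sum>j\<in>T. w k j * DDs (T - {j}) f) = X k m"
    proof -
      have "(\<Sum>j\<in>T. w k j * DDs (T - {j}) f) = w k m * DDs T' f + (\<Sum>j\<in>T'. w k j * DDs (insert m (T' - {j})) f)"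
        unfolding T(1) using T(2,3) S3 S4 by (simp add: sum.insert)
      then show ?thesis unfolding T(1) using X[of k m] T m by simp
    qed
    ultimately show ?thesis using T m by simp
  qed
qed

text \<open>The recursion refers to sets smaller by one and by two elements, so the hypothesis is
  supplied for all subsets.\<close>

lemma DDs_induct [consumes 2, case_names empty insert]:
  assumes "finite S" "S \<subseteq> N" and "P {}"
    and "\<And>k T. finite T ==> T \<subseteq> N ==> k \<in> N ==> k \<notin> T ==> (\<And>R. R \<subseteq> T ==> P R) ==> P (insert k T)"
  shows "P S" using assms(1,2)
proof (induction "card S" arbitrary: S rule: less_induct)
  case less
  show ?case
  proof (cases "S = {}")
    case False
    then obtain k where k: "k \<in> S" by auto
    have "P R" if "R \<subseteq> S - {k}" for R
    proof (rule less.hyps)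
      show "card R < card S" using that k less.prems by (intro psubset_card_mono) auto
    qed (use that less.prems finite_subset[of R S] in auto)
    then have "P (insert k (S - {k}))" using less.prems k by (intro assms(4)) auto
    then show ?thesis using k by (simp add: insert_absorb)
  qed (simp add: assms)
qed

lemma DDs_add: "finite S ==> S \<subseteq> N ==> DDs S (f + h) = DDs S f + DDs S h"
proof (induction S arbitrary: f h rule: DDs_induct)
  case (insert k T)
  have "DDs (T - {j}) (f + h) = DDs (T - {j}) f + DDs (T - {j}) h" "DDs T (f + h) = DDs T f + DDs T h" for j f h
    using insert.IH[of "T - {j}"] insert.IH[of T] by auto
  then show ?case using insert(1-4) by (simp add: DDs_insert pk_add algebra_simps sum.distrib)
qed simp

lemma DDs_mult0:
  "finite S ==> S \<subseteq> N ==> (\<And>j. j \<in> S ==> th j h = 0) ==> DDs S (h * f) = h * DDs S f"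
proof (induction S arbitrary: f rule: DDs_induct)
  case (insert k T)
  have "DDs (T - {j}) (h * f) = h * DDs (T - {j}) f" "DDs T (h * f) = h * DDs T f" for j f
    using insert.IH[of "T - {j}"] insert.IH[of T] insert.prems by auto
  then show ?case using insert(1-4) insert.prems by (simp add: DDs_insert pk_mult algebra_simps sum_distrib_left)
qed simp

lemma DDs_0 [simp]: "finite S ==> S \<subseteq> N ==> DDs S 0 = 0" using DDs_mult0[of S 0 0] by simp

lemma DDs_sum:
  assumes "finite S" "S \<subseteq> N" shows "DDs S (sum f A) = (\<Sum>a\<in>A. DDs S (f a))"
  by (induction A rule: infinite_finite_induct) (auto simp: assms DDs_add)

lemma DDs_diff:
  assumes "finite S" "S \<subseteq> N" shows "DDs S (f - h) = DDs S f - DDs S h" using DDs_add[OF assms, of "f - h" h] by simp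

text \<open>An index occurs only once in each term of the matching sum, so \<open>DDs S\<close> is
  of first order in \<open>th i\<close> and one derivative of h appears.\<close>

lemma DDs_mult1:
  assumes "finite S" "S \<subseteq> N" "i \<in> S" "\<And>j. j \<in> S - {i} ==> th j h = 0"
  shows "DDs S (h * f) = h * DDs S f + th i h * DDs (S - {i}) f"
proof -
  let ?T = "S - {i}"
  have T: "finite ?T" "?T \<subseteq> N" "i \<in> N" "i \<notin> ?T" "insert i ?T = S" using assms by auto
  have 1: "DDs ?T (h * f) = h * DDs ?T f" by (rule DDs_mult0) (use assms in auto)
  have 2: "DDs (?T - {j}) (h * f) = h * DDs (?T - {j}) f" for j by (rule DDs_mult0) (use assms in auto)
  show ?thesis using DDs_insert[OF T(1-4), of "h * f"] DDs_insert[OF T(1-4), of f]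
    unfolding T(5) 1 2 by (simp add: pk_mult algebra_simps sum_distrib_left)
qed

lemma pk_DDs: "finite S ==> S \<subseteq> N ==> k \<in> N ==> k \<notin> S ==> pk k (DDs S f) = DDs S (pk k f)"
proof (induction S arbitrary: f rule: DDs_induct)
  case (insert l T)
  have 1: "pk k (DDs (T - {j}) f) = DDs (T - {j}) (pk k f)" "pk k (DDs T f) = DDs T (pk k f)" for j
    using insert.IH[of "T - {j}"] insert.IH[of T] insert.prems by auto
  have 2: "pk k (w l j * h) = w l j * pk k h" if "j \<in> T" for j h using insert.prems that by (intro pk_const th_w_other) auto
  have 3: "pk k (\<Sum>j\<in>T. w l j * DDs (T - {j}) f) = (\<Sum>j\<in>T. w l j * DDs (T - {j}) (pk k f))"
    unfolding pk_sum by (intro sum.cong refl) (simp add: 2 1)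
  show ?case unfolding DDs_insert[OF insert(1-4)] pk_add pk_const[OF th_kap] pk_const[OF th_u] 3
    by (simp add: pk_comm[OF insert.prems(1) insert(3)] 1)
qed simp

text \<open>\<open>th k\<close> commutes with \<open>pk l\<close> except for the term g th k (ph l)
  = g w k l, which uses up the index l.\<close>

lemma th_DDs:
  "finite S ==> S \<subseteq> N ==> k \<in> N ==> k \<notin> S ==> th k (DDs S f) = DDs S (th k f) + g * (\<Sum>j\<in>S. w k j * DDs (S - {j}) f)"
proof (induction S arbitrary: f rule: DDs_induct)
  case (insert l T)
  have IH: "th k (DDs T f) = DDs T (th k f) + g * (\<Sum>j\<in>T. w k j * DDs (T - {j}) f)"
    "th k (DDs (T - {j}) f) = DDs (T - {j}) (th k f) + g * (\<Sum>i\<in>T - {j}. w k i * DDs (T - {j} - {i}) f)" for j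
    using insert.IH[of "T - {j}"] insert.IH[of T] insert.prems by auto
  have kl: "k \<noteq> l" using insert.prems by auto
  have w0: "th k (w l j) = 0" if "j \<in> T" for j using insert.prems that by (intro th_w_other) auto
  have p: "pk l (w k j * h) = w k j * pk l h" if "j \<in> T" for j h using insert(4) kl that by (intro pk_const th_w_other) auto
  have s1: "th k (\<Sum>j\<in>T. w l j * DDs (T - {j}) f) =
      (\<Sum>j\<in>T. w l j * DDs (T - {j}) (th k f)) + g * (\<Sum>j\<in>T. \<Sum>i\<in>T - {j}. w l j * (w k i * DDs (T - {j} - {i}) f))"
    unfolding th_sum by (simp add: th_mult w0 IH(2) distrib_left sum.distrib sum_distrib_left mult.left_commute)
  have s2: "(\<Sum>j\<in>T. \<Sum>i\<in>T - {j}. w l j * (w k i * DDs (T - {j} - {i}) f)) =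
      (\<Sum>j\<in>T. \<Sum>i\<in>T - {j}. w k j * (w l i * DDs (T - {j} - {i}) f))"
    by (subst sum_offdiag_swap[OF insert(1)], intro sum.cong refl)
      (simp add: Diff_insert2[symmetric] insert_commute mult.left_commute)
  have d: "DDs (insert l T - {j}) f = pk l (DDs (T - {j}) f) + u * DDs (T - {j}) f +
      kap * (\<Sum>i\<in>T - {j}. w l i * DDs (T - {j} - {i}) f)" if "j \<in> T" for j
  proof -
    have "insert l T - {j} = insert l (T - {j})" using that insert(4) by auto
    then show ?thesis using DDs_insert[of "T - {j}" l f] insert(1-4) by auto
  qed
  have "insert l T - {l} = T" using insert(4) by auto
  then have "(\<Sum>j\<in>insert l T. w k j * DDs (insert l T - {j}) f) = w k l * DDs T f +
      (\<Sum>j\<in>T. w k j * (pk l (DDs (T - {j}) f) + u * DDs (T - {j}) f + kap * (\<Sum>i\<in>T - {j}. w l i * DDs (T - {j} - {i}) f)))"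
    using insert(1,4) d by (simp add: sum.insert)
  moreover have "pk l (th k (DDs T f)) = pk l (DDs T (th k f)) + g * (\<Sum>j\<in>T. w k j * pk l (DDs (T - {j}) f))"
    unfolding IH(1) pk_add pk_const[OF th_g] pk_sum by (simp add: p)
  ultimately show ?case
    unfolding DDs_insert[OF insert(1-4)] th_add th_mult th_kap th_u s1 s2 th_pk[OF insert.prems(1) kl] IH(1)
    by (simp add: algebra_simps sum.distrib sum_distrib_left)
qed simp

text \<open>For S = N this is the Calogero--Sutherland Hamiltonian conjugated by the power g of the
  Vandermonde product; \<open>laplace_DDs\<close> shows that it differs from the Laplace--Beltrami
  operator (doubled) by a constant.\<close>

definition HH :: "nat set => 'a => 'a" where
  "HH S f = (\<Sum>k\<in>S. pk k (pk k f)) - kap * (\<Sum>i\<in>S. \<Sum>j\<in>S - {i}. w i j) * f"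

lemma sum_w_insert:
  assumes "finite T" "k \<notin> T"
  shows "(\<Sum>i\<in>insert k T. \<Sum>j\<in>insert k T - {i}. w i j) = (\<Sum>i\<in>T. \<Sum>j\<in>T - {i}. w i j) + 2 * (\<Sum>j\<in>T. w k j)"
proof -
  have "(\<Sum>j\<in>insert k T - {i}. w i j) = w k i + (\<Sum>j\<in>T - {i}. w i j)" if "i \<in> T" for i
  proof -
    have "insert k T - {i} = insert k (T - {i})" using that assms by auto
    then show ?thesis using assms by (simp add: w_sym)
  qed
  moreover have "insert k T - {k} = T" using assms by auto
  ultimately show ?thesis using assms by (simp add: sum.distrib)
qed

lemma HH_insert:
  assumes "finite T" "k \<notin> T"
  shows "HH (insert k T) f = HH T f + pk k (pk k f) - 2 * kap * (\<Sum>j\<in>T. w k j) * f"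
  unfolding HH_def sum_w_insert[OF assms] using assms by (simp add: algebra_simps)

lemma HH_add: "HH S (f + h) = HH S f + HH S h" by (simp add: HH_def pk_add sum.distrib algebra_simps)

lemma HH_const: "(\<And>k. th k c = 0) ==> HH S (c * f) = c * HH S f" by (simp add: HH_def pk_mult sum_distrib_left algebra_simps)

lemma HH_sum: "HH S (sum f A) = (\<Sum>a\<in>A. HH S (f a))"
proof (induction A rule: infinite_finite_induct)
  case (insert a A)
  then show ?case by (simp add: HH_add)
qed (simp_all add: HH_def)

lemma HH_pk:
  assumes "finite T" "T \<subseteq> N" "k \<in> N" "k \<notin> T"
  shows "HH (insert k T) (pk k f) = pk k (HH (insert k T) f) + 2 * kap * (\<Sum>j\<in>T. th k (w k j)) * f"
proof -
  let ?S = "insert k T"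
  let ?W = "\<Sum>i\<in>?S. \<Sum>j\<in>?S - {i}. w i j"
  have "th k ?W = 2 * (\<Sum>j\<in>T. th k (w k j))"
  proof -
    have "th k (\<Sum>i\<in>T. \<Sum>j\<in>T - {i}. w i j) = 0" unfolding th_sum using assms(4) by (intro sum.neutral ballI th_w_other) auto
    moreover have "th k 2 = 0" using th_add[of k 1 1] by simp
    ultimately show ?thesis unfolding sum_w_insert[OF assms(1,4)] by (simp add: th_add th_mult th_sum)
  qed
  moreover have "pk k (\<Sum>j\<in>?S. pk j (pk j f)) = (\<Sum>j\<in>?S. pk j (pk j (pk k f)))"
    unfolding pk_sum using assms by (intro sum.cong refl) (metis insert_iff pk_comm subsetD)
  moreover have "pk k (HH ?S f) = pk k (\<Sum>j\<in>?S. pk j (pk j f)) - kap * (th k ?W * f + ?W * pk k f)"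
    unfolding HH_def using pk_add[of k "HH ?S f" "kap * ?W * f"] by (simp add: HH_def pk_const pk_mult mult.assoc)
  ultimately show ?thesis unfolding HH_def by (simp add: algebra_simps)
qed

text \<open>\<open>w k j\<close> changes sign under exchange of \<open>th k\<close> and
  \<open>th j\<close>, so the two first-order terms combine to \<open>pk k - pk j\<close> and the
  two second derivatives are equal.\<close>

lemma HH_w:
  assumes "finite S" "S \<subseteq> N" "k \<in> S" "j \<in> S" "k \<noteq> j"
  shows "HH S (w k j * f) = w k j * HH S f + 2 * (th k (w k j) * (pk k f - pk j f)) + 2 * (th k (th k (w k j)) * f)"
proof -
  let ?S = "S - {k} - {j}"
  have S: "S = insert k (insert j ?S)" using assms by auto
  have ne: "k \<notin> insert j ?S" "j \<notin> ?S" "finite ?S" using assms by auto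
  have split: "(\<Sum>i\<in>S. F i) = F k + F j + (\<Sum>i\<in>?S. F i)" for F :: "nat => 'a"
    using assms by (simp add: sum.remove[of S k] sum.remove[of "S - {k}" j] add.assoc)
  have 1: "(\<Sum>i\<in>?S. pk i (pk i (w k j * f))) = w k j * (\<Sum>i\<in>?S. pk i (pk i f))"
  proof -
    have "pk i (w k j * h) = w k j * pk i h" if "i \<in> ?S" for i h using that by (intro pk_const th_w_other) auto
    then show ?thesis by (simp add: sum_distrib_left)
  qed
  have jw: "th j (w k j) = - th k (w k j)" by (rule th_w2[OF assms(5)])
  have "th j (th j (w k j)) = th k (th k (w k j))" unfolding jw th_uminus by (subst th_comm) (simp add: jw th_uminus)
  then have jt: "th j (- th k (w k j)) = th k (th k (w k j))" by (simp only: jw)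
  have e1: "pk j (w k j * h) = w k j * pk j h + - th k (w k j) * h" for h unfolding pk_mult jw by simp
  have e2: "pk j (- th k (w k j) * h) = th k (th k (w k j)) * h - th k (w k j) * pk j h" for h unfolding pk_mult jt by simp
  have "pk j (pk j (w k j * f)) = th k (th k (w k j)) * f - 2 * (th k (w k j) * pk j f) + w k j * pk j (pk j f)"
    by (simp only: e1 pk_add e2) (simp add: algebra_simps)
  moreover have "pk k (pk k (w k j * f)) = th k (th k (w k j)) * f + 2 * (th k (w k j) * pk k f) + w k j * pk k (pk k f)"
  proof -
    have e1: "pk k (w k j * h) = w k j * pk k h + th k (w k j) * h" for h unfolding pk_mult by simp
    have e2: "pk k (th k (w k j) * h) = th k (th k (w k j)) * h + th k (w k j) * pk k h" for h unfolding pk_mult by simp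
    show ?thesis by (simp only: e1 pk_add e2) (simp add: algebra_simps)
  qed
  ultimately show ?thesis unfolding HH_def split 1 by (simp add: algebra_simps)
qed

text \<open>The three-body identity on which the integrability of the model rests. By
  \<open>th_w1\<close> every derivative is w times a factor (x_i + x_j) / (x_i - x_j), here P, Q, R;
  pairing these factors leaves a polynomial identity in a, b, c.\<close>

lemma triple:
  assumes "i \<noteq> j" "j \<noteq> k" "i \<noteq> k"
  shows "w i j * (th k (w k j) + th k (w k i)) + w k j * (th i (w i j) + th i (w i k))
    + w k i * (th j (w j i) + th j (w j k)) = 0"
proof -
  define a b c where "a = x i" "b = x j" "c = x k"
  have ne: "a - b \<noteq> 0" "b - c \<noteq> 0" "a - c \<noteq> 0" "b - a \<noteq> 0" "c - b \<noteq> 0" "c - a \<noteq> 0"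
    using x_inj assms by (auto simp: a_b_c_def)
  have sym: "x j * x i / (x j - x i) ^ 2 = x i * x j / (x i - x j) ^ 2"
    "x k * x i / (x k - x i) ^ 2 = x i * x k / (x i - x k) ^ 2"
    "x k * x j / (x k - x j) ^ 2 = x j * x k / (x j - x k) ^ 2" by (simp_all add: mult.commute power2_commute)
  define p q r where "p = a * b / (a - b) ^ 2" "q = b * c / (b - c) ^ 2" "r = a * c / (a - c) ^ 2"
  define P Q R where "P = (a + b) / (a - b)" "Q = (b + c) / (b - c)" "R = (a + c) / (a - c)"
  have neg: "(b + a) / (b - a) = - P" "(c + b) / (c - b) = - Q" "(c + a) / (c - a) = - R"
    unfolding P_Q_R_def by (metis add.commute minus_diff_eq minus_divide_right)+
  have "w i j * (th k (w k j) + th k (w k i)) + w k j * (th i (w i j) + th i (w i k))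
    + w k i * (th j (w j i) + th j (w j k)) = p * (q * Q + r * R) + q * (- (p * P) - r * R) + r * (p * P - q * Q)"
    using assms unfolding th_w1[OF assms(1)] th_w1[OF assms(2)] th_w1[OF assms(3)]
      th_w1[OF assms(1)[symmetric]] th_w1[OF assms(2)[symmetric]] th_w1[OF assms(3)[symmetric]]
    unfolding w_def sym unfolding a_b_c_def[symmetric] neg unfolding p_q_r_def P_Q_R_def by simp
  also have "... = p * q * (Q - P) + p * r * (R + P) - q * r * (R + Q)" by (simp add: algebra_simps)
  also have "... = 0"
  proof -
    have 1: "Q - P = 2 * (a * c - b * b) / ((b - c) * (a - b))"
      unfolding P_Q_R_def using ne by (simp add: divide_simps) (simp add: algebra_simps)
    have 2: "R + P = 2 * (a * a - b * c) / ((a - c) * (a - b))"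
      unfolding P_Q_R_def using ne by (simp add: divide_simps) (simp add: algebra_simps)
    have 3: "R + Q = 2 * (a * b - c * c) / ((a - c) * (b - c))"
      unfolding P_Q_R_def using ne by (simp add: divide_simps) (simp add: algebra_simps)
    define A B C where "A = a - b" "B = b - c" "C = a - c"
    have nz: "A \<noteq> 0" "B \<noteq> 0" "C \<noteq> 0" using ne by (auto simp: A_B_C_def)
    have "p * q * (Q - P) + p * r * (R + P) - q * r * (R + Q) =
      2 * a * b * c * (b * (a * c - b * b) * C ^ 3 + a * (a * a - b * c) * B ^ 3 - c * (a * b - c * c) * A ^ 3)
        / (A ^ 3 * B ^ 3 * C ^ 3)" unfolding 1 2 3 unfolding p_q_r_def A_B_C_def[symmetric] using nz
      by (simp add: divide_simps power2_eq_square power3_eq_cube) (simp add: algebra_simps)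
    also have "b * (a * c - b * b) * C ^ 3 + a * (a * a - b * c) * B ^ 3 - c * (a * b - c * c) * A ^ 3 = 0"
      unfolding A_B_C_def by (simp add: power3_eq_cube algebra_simps)
    finally show ?thesis by simp
  qed
  finally show ?thesis .
qed

lemma sum_antisym_off_diag:
  fixes G :: "nat => nat => 'a"
  assumes "finite T" "\<And>i j. i \<in> T ==> j \<in> T ==> i \<noteq> j ==> G i j + G j i = 0"
  shows "(\<Sum>j\<in>T. \<Sum>i\<in>T - {j}. G j i) = 0" using assms
proof (induction T rule: finite_induct)
  case (insert a T)
  have "(\<Sum>i\<in>insert a T - {j}. G j i) = G j a + (\<Sum>i\<in>T - {j}. G j i)" if "j \<in> T" for j
  proof -
    have "insert a T - {j} = insert a (T - {j})" using that insert by auto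
    then show ?thesis using insert by simp
  qed
  moreover have "insert a T - {a} = T" using insert by auto
  ultimately have "(\<Sum>j\<in>insert a T. \<Sum>i\<in>insert a T - {j}. G j i) = (\<Sum>i\<in>T. G a i + G i a) + (\<Sum>j\<in>T. \<Sum>i\<in>T - {j}. G j i)"
    using insert by (simp add: sum.distrib add.assoc)
  also have "... = 0" using insert by (auto intro!: sum.neutral)
  finally show ?case .
qed simp

text \<open>Split off k. The induction hypothesis for T and for each T - {j} disposes of everything
  except derivatives of the \<open>w k j\<close>; what is left is a double sum over ordered pairs in
  T, and \<open>triple\<close> cancels each pair against its transpose.\<close>

theorem HH_DDs: "finite S ==> S \<subseteq> N ==> HH S (DDs S f) = DDs S (HH S f)"
proof (induction S arbitrary: f rule: DDs_induct)
  case (insert k T)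
  let ?S = "insert k T"
  note T = insert(1-4)
  define d where "d = DDs T f"
  define d1 where "d1 j = DDs (T - {j}) f" for j
  define d2 where "d2 j i = DDs (T - {j} - {i}) f" for j i
  define t where "t j = th k (w k j)" for j
  define H where "H = HH ?S"
  have kj: "k \<noteq> j" if "j \<in> T" for j using that T by auto
  have tj: "th j (w k j) = - t j" if "j \<in> T" for j using th_w2[OF kj[OF that]] by (simp add: t_def)
  have c: "DDs T (H f) = H d + 2 * kap * (\<Sum>j\<in>T. t j * d1 j)"
  proof -
    have wf: "DDs T (w k j * f) = w k j * d - t j * d1 j" if "j \<in> T" for j
    proof -
      have "th i (w k j) = 0" if "i \<in> T - {j}" for i using that T by (intro th_w_other) auto
      then show ?thesis using DDs_mult1[OF T(1,2) that, of "w k j" f] tj[OF that] by (simp add: d_def d1_def)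
    qed
    have "H f = HH T f + pk k (pk k f) - 2 * kap * (\<Sum>j\<in>T. w k j * f)"
      unfolding H_def HH_insert[OF T(1,4)] by (simp add: sum_distrib_right mult.assoc)
    then have "DDs T (H f) = DDs T (HH T f) + DDs T (pk k (pk k f)) - DDs T (2 * kap * (\<Sum>j\<in>T. w k j * f))"
      using T by (simp add: DDs_add DDs_diff)
    also have "DDs T (2 * kap * (\<Sum>j\<in>T. w k j * f)) = 2 * kap * (\<Sum>j\<in>T. w k j * d - t j * d1 j)"
    proof -
      have "th j (2 * kap) = 0" for j using th_add[of j 1 1] by (simp add: th_mult)
      then show ?thesis using T wf by (simp add: DDs_mult0 DDs_sum)
    qed
    also have "DDs T (HH T f) = HH T d" unfolding d_def using insert.IH[of T f] by simp
    also have "DDs T (pk k (pk k f)) = pk k (pk k d)" unfolding d_def using T by (simp add: pk_DDs)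
    also have "HH T d + pk k (pk k d) - 2 * kap * (\<Sum>j\<in>T. w k j * d - t j * d1 j) = H d + 2 * kap * (\<Sum>j\<in>T. t j * d1 j)"
      unfolding H_def HH_insert[OF T(1,4)] by (simp add: sum_subtractf sum_distrib_left sum_distrib_right algebra_simps)
    finally show ?thesis .
  qed
  have dd: "DDs (T - {j}) (H f) = H (d1 j) - 2 * kap * (\<Sum>i\<in>T - {j}. (th i (w j i) + th i (w k i)) * d2 j i)"
    if j: "j \<in> T" for j
  proof -
    let ?T = "T - {j}"
    have T': "finite ?T" "?T \<subseteq> N" "j \<notin> ?T" "insert j ?T = T" "j \<in> N" "k \<notin> ?T" using T j by auto
    have HS: "H q = HH ?T q + pk j (pk j q) + pk k (pk k q)
        - 2 * kap * (\<Sum>i\<in>?T. (w j i + w k i) * q) - 2 * kap * (w k j * q)" for q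
    proof -
      have "(\<Sum>i\<in>T. w k i) = w k j + (\<Sum>i\<in>?T. w k i)" using j T by (simp add: sum.remove)
      then show ?thesis unfolding H_def HH_insert[OF T(1,4)] HH_insert[OF T'(1,3), unfolded T'(4)]
        by (simp add: algebra_simps sum.distrib sum_distrib_left)
    qed
    have c2: "th j (2 * kap) = 0" for j using th_add[of j 1 1] by (simp add: th_mult)
    have w1: "DDs ?T ((w j i + w k i) * f) = (w j i + w k i) * d1 j + (th i (w j i) + th i (w k i)) * d2 j i"
      if i: "i \<in> ?T" for i
    proof -
      have "th l (w j i + w k i) = 0" if "l \<in> ?T - {i}" for l
      proof -
        have "l \<noteq> j" "l \<noteq> k" "l \<noteq> i" using that T by auto
        then show ?thesis by (simp add: th_add th_w_other)
      qed
      then show ?thesis using DDs_mult1[OF T'(1,2) i, of "w j i + w k i" f] by (simp add: th_add d1_def d2_def)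
    qed
    have w0: "DDs ?T (w k j * f) = w k j * d1 j" unfolding d1_def using T by (intro DDs_mult0 th_w_other) auto
    have "DDs ?T (H f) = DDs ?T (HH ?T f) + DDs ?T (pk j (pk j f)) + DDs ?T (pk k (pk k f))
        - 2 * kap * (\<Sum>i\<in>?T. DDs ?T ((w j i + w k i) * f)) - 2 * kap * DDs ?T (w k j * f)"
      unfolding HS using T' by (simp add: DDs_add DDs_diff DDs_sum DDs_mult0 c2)
    also have "DDs ?T (HH ?T f) = HH ?T (d1 j)" unfolding d1_def using insert.IH[of ?T f] by simp
    also have "DDs ?T (pk j (pk j f)) = pk j (pk j (d1 j))" unfolding d1_def using T' by (simp add: pk_DDs)
    also have "DDs ?T (pk k (pk k f)) = pk k (pk k (d1 j))" unfolding d1_def using T' T by (simp add: pk_DDs)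
    also have "(\<Sum>i\<in>?T. DDs ?T ((w j i + w k i) * f)) =
        (\<Sum>i\<in>?T. (w j i + w k i) * d1 j + (th i (w j i) + th i (w k i)) * d2 j i)" by (intro sum.cong refl w1)
    finally show ?thesis unfolding w0 HS by (simp add: algebra_simps sum.distrib sum_distrib_left)
  qed
  have rec: "DDs ?S q = pk k (DDs T q) + u * DDs T q + kap * (\<Sum>j\<in>T. w k j * DDs (T - {j}) q)" for q
    by (rule DDs_insert[OF T])
  have a: "H (pk k d) = pk k (H d) + 2 * kap * (\<Sum>j\<in>T. t j) * d" unfolding H_def t_def by (rule HH_pk[OF T])
  have Hw: "H (w k j * q) = w k j * H q + 2 * (t j * (pk k q - pk j q)) + 2 * (th k (t j) * q)" if "j \<in> T" for j q
    unfolding H_def t_def using T that kj[OF that] by (intro HH_w) auto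
  have L: "H (DDs ?S f) = pk k (H d) + 2 * kap * (\<Sum>j\<in>T. t j) * d + u * H d +
      kap * (\<Sum>j\<in>T. w k j * H (d1 j) + 2 * (t j * (pk k (d1 j) - pk j (d1 j))) + 2 * (th k (t j) * d1 j))"
  proof -
    have "H (DDs ?S f) = H (pk k d) + u * H d + kap * (\<Sum>j\<in>T. H (w k j * d1 j))"
      unfolding rec H_def by (simp add: HH_add HH_const th_u HH_sum d_def d1_def)
    then show ?thesis using a Hw by simp
  qed
  have c2: "th k (2 * kap) = 0" using th_add[of k 1 1] by (simp add: th_mult)
  have R: "DDs ?S (H f) = pk k (H d) + 2 * kap * (\<Sum>j\<in>T. th k (t j) * d1 j + t j * pk k (d1 j))
      + u * H d + 2 * kap * (\<Sum>j\<in>T. u * (t j * d1 j))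
      + kap * (\<Sum>j\<in>T. w k j * (H (d1 j) - 2 * kap * (\<Sum>i\<in>T - {j}. (th i (w j i) + th i (w k i)) * d2 j i)))"
    unfolding rec c using dd
    by (simp add: pk_add pk_const[OF c2] pk_sum pk_mult[of k "t _"] distrib_left sum_distrib_left mult.left_commute)
  \<comment> \<open>Expanding d at j trades the terms t j * d for terms over T - {j}; those without
    a further match cancel, the others join the double sum.\<close>
  have dj: "d = pk j (d1 j) + u * d1 j + kap * (\<Sum>i\<in>T - {j}. w j i * d2 j i)" if j: "j \<in> T" for j
  proof -
    have "insert j (T - {j}) = T" using j by auto
    then show ?thesis unfolding d_def d1_def d2_def using DDs_insert[of "T - {j}" j f] T j by auto
  qed
  define G where "G j i = (t j * w j i + w k j * (th i (w j i) + th i (w k i))) * d2 j i" for j i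
  have "H (DDs ?S f) - DDs ?S (H f) = 2 * kap * ((\<Sum>j\<in>T. t j * (d - (pk j (d1 j) + u * d1 j))) +
      (\<Sum>j\<in>T. w k j * (kap * (\<Sum>i\<in>T - {j}. (th i (w j i) + th i (w k i)) * d2 j i))))"
    unfolding L R by (simp add: algebra_simps sum.distrib sum_subtractf sum_distrib_left sum_distrib_right)
  also have "(\<Sum>j\<in>T. t j * (d - (pk j (d1 j) + u * d1 j))) = (\<Sum>j\<in>T. t j * (kap * (\<Sum>i\<in>T - {j}. w j i * d2 j i)))"
    by (intro sum.cong refl) (use dj in \<open>simp add: algebra_simps\<close>)
  also have "... + (\<Sum>j\<in>T. w k j * (kap * (\<Sum>i\<in>T - {j}. (th i (w j i) + th i (w k i)) * d2 j i))) =
      kap * (\<Sum>j\<in>T. \<Sum>i\<in>T - {j}. G j i)" unfolding G_def by (simp add: algebra_simps sum.distrib sum_distrib_left)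
  also have "(\<Sum>j\<in>T. \<Sum>i\<in>T - {j}. G j i) = 0"
  proof (rule sum_antisym_off_diag[OF T(1)])
    fix i j assume ij: "i \<in> T" "j \<in> T" "i \<noteq> j"
    have s: "d2 j i = d2 i j" unfolding d2_def by (simp add: Diff_insert2[symmetric] insert_commute)
    have "G i j + G j i = (w i j * (th k (w k j) + th k (w k i)) + w k j * (th i (w i j) + th i (w i k))
      + w k i * (th j (w j i) + th j (w j k))) * d2 i j"
      unfolding G_def s t_def w_sym[of j i] w_sym[of j k] w_sym[of i k] by (simp add: algebra_simps)
    also have "... = 0" using triple[of i j k] ij kj by auto
    finally show "G i j + G j i = 0" .
  qed
  finally show ?case unfolding H_def by simp
qed (simp add: HH_def)


text \<open>Apply the product over ks of (th on f) + g (th on a) + u to the pair a, f and multiply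
  the two results. The form is linear in a: at the monomial of a permutation it is a Leibniz term of
  D(u) (\<open>BB_eigen\<close>), at the Vandermonde product it is the matching sum
  (\<open>BB_DDs\<close>). Summation over the permutations equates the two.\<close>

fun BB :: "nat list => 'a => 'a => 'a" where
  "BB [] a f = a * f"
| "BB (k # ks) a f = BB ks a (th k f + u * f) + g * BB ks (th k a) f"

lemma BB_add1: "BB ks (a + b) f = BB ks a f + BB ks b f"
  by (induction ks arbitrary: a b f) (auto simp: th_add algebra_simps)

lemma BB_add2: "BB ks a (f + h) = BB ks a f + BB ks a h"
proof (induction ks arbitrary: a f h)
  case (Cons k ks)
  have "th k (f + h) + u * (f + h) = (th k f + u * f) + (th k h + u * h)" by (simp add: th_add algebra_simps)
  then show ?case by (simp add: Cons algebra_simps)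
qed (simp add: algebra_simps)

lemma BB_const1: "(\<And>k. th k c = 0) ==> BB ks (c * a) f = c * BB ks a f"
proof (induction ks arbitrary: a f)
  case (Cons k ks)
  show ?case by (simp only: BB.simps th_mult Cons.prems mult_zero_left add_0_left Cons.IH[OF Cons.prems] distrib_left
        mult.left_commute)
qed simp

lemma BB_const2: "(\<And>k. th k c = 0) ==> BB ks a (c * f) = c * BB ks a f"
proof (induction ks arbitrary: a f)
  case (Cons k ks)
  have "th k (c * f) + u * (c * f) = c * (th k f + u * f)" using Cons.prems by (simp add: th_mult algebra_simps)
  then have "BB (k # ks) a (c * f) = c * BB ks a (th k f + u * f) + g * (c * BB ks (th k a) f)"
    by (simp only: BB.simps Cons.IH[OF Cons.prems])
  then show ?case by (simp add: distrib_left mult.left_commute)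
qed (simp add: algebra_simps)

lemma BB_0: "BB ks 0 f = 0" using BB_const1[of 0 ks 0 f] by simp

lemma BB_sum1: "BB ks (sum a A) f = (\<Sum>i\<in>A. BB ks (a i) f)"
  by (induction A rule: infinite_finite_induct) (auto simp: BB_add1 BB_0)

lemma th_BB: "th i (BB ks a f) = BB ks (th i a) f + BB ks a (th i f)"
proof (induction ks arbitrary: a f)
  case (Cons k ks)
  have "th i (th k f + u * f) = th k (th i f) + u * th i f" by (simp add: th_add th_mult th_u th_comm)
  then show ?case by (simp add: Cons th_add th_mult[of i g] th_g th_comm[of i k a] algebra_simps)
qed (simp add: th_mult)

lemma BB_DDs:
  assumes V: "\<And>k. k \<in> N ==> th k V = ph k * V"
  shows "distinct ks ==> set ks \<subseteq> N ==> BB ks V f = V * DDs (set ks) f"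
proof (induction ks arbitrary: f)
  case (Cons k ks)
  let ?S = "set ks"
  have k: "k \<in> N" "k \<notin> ?S" "?S \<subseteq> N" using Cons.prems by auto
  have IH: "BB ks V f = V * DDs ?S f" for f using Cons by auto
  let ?s = "\<Sum>j\<in>?S. w k j * DDs (?S - {j}) f"
  have t: "DDs ?S (th k f) = th k (DDs ?S f) - g * ?s" using th_DDs[of ?S k f] k by simp
  have uf: "DDs ?S (u * f) = u * DDs ?S f" using k by (intro DDs_mult0) (auto simp: th_u)
  \<comment> \<open>The product rule \<open>th_BB\<close> expresses the value at th k V through
    values at V. The terms with w then collect with the coefficient g^2 - g, which is the origin of
    \<open>kap\<close>.\<close>
  have "BB ks (th k V) f = th k (V * DDs ?S f) - V * DDs ?S (th k f)" using th_BB[of k ks V f] by (simp add: IH)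
  also have "... = V * (ph k * DDs ?S f + g * ?s)" by (simp add: th_mult V k t algebra_simps)
  finally have 1: "BB ks (th k V) f = V * (ph k * DDs ?S f + g * ?s)" .
  have 2: "BB ks V (th k f + u * f) = V * (th k (DDs ?S f) - g * ?s + u * DDs ?S f)" using k by (simp add: IH DDs_add uf t)
  have "BB (k # ks) V f = V * (th k (DDs ?S f) - g * ?s + u * DDs ?S f) + g * (V * (ph k * DDs ?S f + g * ?s))"
    by (simp only: BB.simps 1 2)
  then show ?case using k by (simp add: DDs_insert pk_def kap_def algebra_simps)
qed simp

lemma BB_eigen:
  assumes "\<And>i. th i a = r i * a" "\<And>i k. th k (r i) = 0"
  shows "BB ks a f = a * foldr (\<lambda>i q. th i q + (g * r i + u) * q) ks f"
proof (induction ks arbitrary: f)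
  case (Cons k ks)
  let ?T = "\<lambda>i q. th i q + (g * r i + u) * q"
  have comm: "foldr ?T ks (?T k f) = ?T k (foldr ?T ks f)" for f
  proof (induction ks)
    case (Cons l ks)
    have "?T l (?T k q) = ?T k (?T l q)" for q
      by (simp add: th_add th_mult th_g th_u assms(2) th_comm[of l k] algebra_simps)
    with Cons show ?case by simp
  qed simp
  have "BB (k # ks) a f = BB ks a (?T k f)"
    using BB_const1[of "r k" ks a f] BB_const2[of "r k" ks a f] BB_const2[of g ks a "r k * f"] assms th_g
    by (simp add: BB_add2 algebra_simps)
  also have "... = a * foldr ?T ks (?T k f)" by (rule Cons)
  finally show ?case by (simp add: comm)
qed simp

text \<open>That V is an eigenfunction of Sum th_k^2 turns Sum ph_k^2 into C plus the sum of the w,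
  so \<open>HH N\<close> and L differ by the constant g^2 C and \<open>HH_DDs\<close> carries
  over.\<close>

theorem laplace_DDs:
  assumes V: "\<And>k. k \<in> N ==> th k V = ph k * V" "V \<noteq> 0"
    and C: "(\<Sum>k\<in>N. th k (th k V)) = C * V" "\<And>k. th k C = 0"
  defines "L \<equiv> \<lambda>f. (\<Sum>k\<in>N. th k (th k f)) + 2 * g * (\<Sum>k\<in>N. ph k * th k f)"
  shows "DDs N (L f) = L (DDs N f)"
proof -
  let ?W = "\<Sum>i\<in>N. \<Sum>j\<in>N - {i}. w i j"
  have "(\<Sum>k\<in>N. th k (ph k) + ph k * ph k) * V = C * V"
    unfolding C(1)[symmetric] sum_distrib_right by (intro sum.cong refl) (simp add: V th_mult algebra_simps)
  then have "(\<Sum>k\<in>N. th k (ph k) + ph k * ph k) = C" using V by simp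
  then have C': "(\<Sum>k\<in>N. ph k * ph k) = C + ?W" by (simp add: th_ph_same sum.distrib sum_negf sum_subtractf algebra_simps)
  have *: "HH N f = L f + g * g * C * f" for f
  proof -
    have "(\<Sum>k\<in>N. pk k (pk k f)) = L f + g * (\<Sum>k\<in>N. th k (ph k)) * f + g * g * (\<Sum>k\<in>N. ph k * ph k) * f"
      unfolding L_def pk_def th_add th_mult th_g by (simp add: algebra_simps sum.distrib sum_distrib_left sum_distrib_right)
    also have "(\<Sum>k\<in>N. th k (ph k)) = - ?W" by (simp add: th_ph_same sum_negf)
    finally show ?thesis unfolding HH_def C' kap_def by (simp add: algebra_simps)
  qed
  have "DDs N (g * g * C * f) = g * g * C * DDs N f" using finN by (intro DDs_mult0) (auto simp: th_mult th_g C)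
  then show ?thesis using HH_DDs[OF finN subset_refl, of f] finN by (simp add: * DDs_add)
qed

end

subsection \<open>Derivations of a fraction field\<close>

text \<open>The matching sum has denominators x_i - x_j, so the Euler operators are extended to
  fractions by the quotient rule. \<open>SOME\<close> picks a representation;
  \<open>fderiv_Fract\<close> shows independence of it.\<close>

definition fderiv :: "('a::idom => 'a) => 'a fract => 'a fract" where
  "fderiv d q = (SOME r. \<exists>a b. b \<noteq> 0 \<and> q = Fract a b \<and> r = Fract (d a * b - a * d b) (b * b))"

locale derivation =
  fixes d :: "'a::idom => 'a"
  assumes d_add: "d (a + b) = d a + d b" and d_mult: "d (a * b) = d a * b + a * d b"
begin

lemma d_1: "d 1 = 0" using d_mult[of 1 1] by (simp only: mult_1_left mult_1_right add_cancel_right_right)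

lemma fderiv_Fract:
  assumes "b \<noteq> 0" shows "fderiv d (Fract a b) = Fract (d a * b - a * d b) (b * b)" unfolding fderiv_def
proof (rule some_equality)
  show "\<exists>a' b'. b' \<noteq> 0 \<and> Fract a b = Fract a' b' \<and> Fract (d a * b - a * d b) (b * b) = Fract (d a' * b' - a' * d b') (b' * b')"
    using assms by blast
next
  fix r assume "\<exists>a' b'. b' \<noteq> 0 \<and> Fract a b = Fract a' b' \<and> r = Fract (d a' * b' - a' * d b') (b' * b')"
  then obtain a' b' where b': "b' \<noteq> 0" and e: "Fract a b = Fract a' b'" and r: "r = Fract (d a' * b' - a' * d b') (b' * b')"
    by blast
  have ab: "a * b' = a' * b" using e assms b' by (simp add: eq_fract)
  then have "d (a * b') = d (a' * b)" by simp
  then have dab: "d a * b' + a * d b' = d a' * b + a' * d b" by (simp add: d_mult)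
  have "(d a * b - a * d b) * (b' * b') = b * b' * (d a * b' + a * d b') - b * d b' * (a * b') - b' * d b * (a * b')"
    by (simp add: algebra_simps)
  also have "... = b * b' * (d a' * b + a' * d b) - b * d b' * (a' * b) - b' * d b * (a' * b)" by (simp only: ab dab)
  also have "... = (d a' * b' - a' * d b') * (b * b)" by (simp add: algebra_simps)
  finally show "r = Fract (d a * b - a * d b) (b * b)" unfolding r using assms b' by (simp add: eq_fract)
qed

lemma fderiv_of: "fderiv d (Fract a 1) = Fract (d a) 1" by (simp add: fderiv_Fract d_1)

lemma fderiv_add: "fderiv d (p + q) = fderiv d p + fderiv d q"
proof (cases p, cases q)
  fix a b a' b' assume *: "p = Fract a b" "b \<noteq> 0" "q = Fract a' b'" "b' \<noteq> 0"
  have "fderiv d (p + q) = Fract (d (a * b' + a' * b) * (b * b') - (a * b' + a' * b) * d (b * b')) (b * b' * (b * b'))"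
    using * by (simp add: fderiv_Fract)
  moreover have "fderiv d p + fderiv d q =
      Fract ((d a * b - a * d b) * (b' * b') + (d a' * b' - a' * d b') * (b * b)) (b * b * (b' * b'))"
    using * by (simp add: fderiv_Fract)
  ultimately show ?thesis using * by (simp add: eq_fract d_add d_mult) (simp add: algebra_simps)
qed

lemma fderiv_mult: "fderiv d (p * q) = fderiv d p * q + p * fderiv d q"
proof (cases p, cases q)
  fix a b a' b' assume *: "p = Fract a b" "b \<noteq> 0" "q = Fract a' b'" "b' \<noteq> 0"
  have "fderiv d (p * q) = Fract (d (a * a') * (b * b') - (a * a') * d (b * b')) (b * b' * (b * b'))"
    using * by (simp add: fderiv_Fract)
  moreover have "fderiv d p * q + p * fderiv d q =
      Fract ((d a * b - a * d b) * a' * (b * (b' * b')) + a * (d a' * b' - a' * d b') * (b * b * b')) (b * b * b' * (b * (b' * b')))"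
    using * by (simp add: fderiv_Fract)
  ultimately show ?thesis using * by (simp add: eq_fract d_mult) (simp add: algebra_simps)
qed

end

text \<open>Apply both orders to q * b = a with a and b embedded elements, where they agree by
  assumption, and cancel b.\<close>

lemma fderiv_comm:
  assumes "derivation d" "derivation e" and "\<And>a. d (e a) = e (d a)"
  shows "fderiv d (fderiv e q) = fderiv e (fderiv d q)"
proof (cases q)
  interpret d: derivation d by fact
  interpret e: derivation e by fact
  fix a b assume *: "q = Fract a b" "b \<noteq> 0"
  let ?A = "Fract a 1" and ?B = "Fract b 1"
  have B: "?B \<noteq> 0" using * by (simp add: Zero_fract_def eq_fract)
  have qB: "q * ?B = ?A" using * by (simp add: eq_fract)
  let ?D = "fderiv d" and ?E = "fderiv e"
  have de: "?D (?E (Fract c 1)) = ?E (?D (Fract c 1))" for c by (simp add: d.fderiv_of e.fderiv_of assms(3))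
  have "?D (?E (q * ?B)) = ?E (?D (q * ?B))" unfolding qB by (rule de)
  then have "?D (?E q) * ?B + ?E q * ?D ?B + (?D q * ?E ?B + q * ?D (?E ?B)) =
      ?E (?D q) * ?B + ?D q * ?E ?B + (?E q * ?D ?B + q * ?E (?D ?B))"
    by (simp only: d.fderiv_add d.fderiv_mult e.fderiv_add e.fderiv_mult)
  then have "?D (?E q) * ?B = ?E (?D q) * ?B" unfolding de by (simp add: algebra_simps)
  then show ?thesis using B by simp
qed

lemma derivation_theta: "derivation (theta i)" by standard (simp_all add: theta_add theta_mult)

abbreviation fr :: "cpoly => cpoly fract" where "fr p \<equiv> Fract p 1"

lemma fr_add: "fr (p + q) = fr p + fr q" and fr_mult: "fr (p * q) = fr p * fr q"
  and fr_diff: "fr (p - q) = fr p - fr q"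
  and fr_inj: "fr p = fr q \<longleftrightarrow> p = q" and fr_0: "fr 0 = 0" and fr_1: "fr 1 = 1"
  by (simp_all add: eq_fract Zero_fract_def One_fract_def)

lemma fr_2: "fr 2 = 2" using fr_add[of 1 1] by (simp only: fr_1 one_add_one)

lemma fr_sum: "fr (sum f A) = (\<Sum>a\<in>A. fr (f a))" by (induction A rule: infinite_finite_induct) (auto simp: fr_0 fr_add)

lemma fr_hom: "semiring_hom fr" by standard (auto simp: fr_0 fr_1 simp del: add_fract mult_fract intro: fr_add fr_mult)

lemma theta_prod: "finite A ==> theta i (prod f A) = (\<Sum>a\<in>A. theta i (f a) * prod f (A - {a}))"
proof (induction A rule: finite_induct)
  case (insert a A)
  have "prod f (insert a A - {b}) = f a * prod f (A - {b})" if "b \<in> A" for b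
  proof -
    have "insert a A - {b} = insert a (A - {b})" using that insert by auto
    then show ?thesis using insert by simp
  qed
  moreover have "insert a A - {a} = A" using insert by auto
  ultimately show ?case using insert by (simp add: theta_mult sum_distrib_left mult_ac)
qed simp

text \<open>Logarithmic differentiation of a product. The target is any field in which the variables
  stay distinct: the fractions here, and evaluation at points with distinct coordinates in
  \<open>eval_Hop\<close>.\<close>

lemma theta_vand_field:
  fixes h :: "cpoly => 'b::field"
  assumes h: "semiring_hom h" and ne: "\<And>i j. i \<in> {1..n} ==> j \<in> {1..n} ==> i \<noteq> j ==> h (Var i) \<noteq> h (Var j)"
    and k: "k \<in> {1..n}"
  shows "h (theta k (vand n)) = (\<Sum>j\<in>{1..n} - {k}. h (Var k) / (h (Var k) - h (Var j))) * h (vand n)"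
proof -
  interpret h: semiring_hom h by fact
  let ?f = "\<lambda>(i, j). Var i - Var j :: cpoly"
  have nz: "h (?f ij) \<noteq> 0" if "ij \<in> pairs n" for ij
  proof (cases ij)
    case (Pair i j)
    then have "h (Var i) \<noteq> h (Var j)" using that by (intro ne) (auto simp: pairs_def)
    then show ?thesis by (simp add: Pair hom_diff[OF h])
  qed
  have "h (theta k (vand n)) = (\<Sum>ij\<in>pairs n. h (theta k (?f ij)) * h (prod ?f (pairs n - {ij})))"
    by (simp add: vand_pairs theta_prod h.hsum h.hmult)
  also have "... = (\<Sum>ij\<in>pairs n. h (theta k (?f ij)) / h (?f ij)) * h (vand n)" unfolding sum_distrib_right
  proof (intro sum.cong refl)
    fix ij assume ij: "ij \<in> pairs n"
    have "h (vand n) = h (?f ij) * h (prod ?f (pairs n - {ij}))"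
      using ij by (simp add: vand_pairs prod.remove[of "pairs n" ij] flip: h.hmult)
    then show "h (theta k (?f ij)) * h (prod ?f (pairs n - {ij})) = h (theta k (?f ij)) / h (?f ij) * h (vand n)"
      using nz[OF ij] by simp
  qed
  also have "(\<Sum>ij\<in>pairs n. h (theta k (?f ij)) / h (?f ij)) =
      (\<Sum>ij\<in>{ij \<in> pairs n. fst ij = k \<or> snd ij = k}. h (theta k (?f ij)) / h (?f ij))"
    by (rule sum.mono_neutral_right) (auto simp: theta_diff theta_Var split: if_splits)
  also have "... = (\<Sum>j\<in>{1..n} - {k}. h (Var k) / (h (Var k) - h (Var j)))"
  proof (rule sum.reindex_bij_witness[of _ "\<lambda>j. if k < j then (k, j) else (j, k)" "\<lambda>ij. if fst ij = k then snd ij else fst ij"])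
    fix ij assume ij: "ij \<in> {ij \<in> pairs n. fst ij = k \<or> snd ij = k}"
    obtain i j where e: "ij = (i, j)" by force
    show "h (Var k) / (h (Var k) - h (Var (if fst ij = k then snd ij else fst ij))) = h (theta k (?f ij)) / h (?f ij)"
    proof (cases "i = k")
      case True
      then show ?thesis using ij e by (auto simp: pairs_def theta_diff theta_Var hom_diff[OF h])
    next
      case False
      then have "j = k" "i < k" using ij e by (auto simp: pairs_def)
      then have "h (theta k (?f ij)) / h (?f ij) = - h (Var k) / (h (Var i) - h (Var k))"
        using e False by (simp add: theta_diff theta_Var hom_diff[OF h] hom_uminus[OF h])
      also have "... = h (Var k) / (h (Var k) - h (Var i))" by (metis minus_diff_eq minus_divide_divide)
      finally show ?thesis using e False \<open>j = k\<close> by simp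
    qed
  qed (use k in \<open>auto simp: pairs_def\<close>)
  finally show ?thesis .
qed

text \<open>Every exponent of the alternating sum is a rearrangement of rho, on which Sum theta_k^2
  acts by one and the same number.\<close>

lemma theta_altsum_squares:
  "(\<Sum>k=1..n. theta k (theta k (vand n))) = Const (\<Sum>k=1..n. of_nat (n - k) ^ 2) * vand n"
proof (rule poly_mapping_eqI)
  fix m
  have "(\<Sum>k=1..n. of_nat (lk m k) ^ 2) * lk (vand n) m = (\<Sum>k=1..n. of_nat (n - k) ^ 2) * lk (vand n) m"
  proof (cases "m \<in> ky (vand n)")
    case True
    then obtain \<sigma> where \<sigma>: "\<sigma> permutes {1..n}" "m = mk \<sigma> (rho n)" by (auto simp: vand_altsum keys_altsum)
    have "(\<Sum>k=1..n. of_nat (lk m k) ^ 2) = (\<Sum>k=1..n. of_nat (lk (rho n) (\<sigma> k)) ^ 2 :: complex)"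
      by (simp add: \<sigma>(2) lookup_map_key[OF permutes_inj[OF \<sigma>(1)]])
    also have "... = (\<Sum>k=1..n. of_nat (lk (rho n) k) ^ 2)"
      using sum.permute[OF \<sigma>(1), of "\<lambda>k. of_nat (lk (rho n) k) ^ 2 :: complex"] by (simp add: comp_def)
    also have "... = (\<Sum>k=1..n. of_nat (n - k) ^ 2)" by (rule sum.cong) (auto simp: lookup_rho)
    finally show ?thesis by simp
  qed (simp add: in_keys_iff)
  then show "lk (\<Sum>k=1..n. theta k (theta k (vand n))) m = lk (Const (\<Sum>k=1..n. of_nat (n - k) ^ 2) * vand n) m"
    by (simp add: lookup_sum lookup_theta lookup_Const_mult sum_distrib_right power2_eq_square mult.assoc)
qed

theorem Hop_D_op_commute:
  assumes p: "p \<in> sym_polys n"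
  shows "Hop n g (D_op n g u p) = D_op n g u (Hop n g p)"
proof -
  let ?g = "fr (Const (of_real g))" and ?u = "fr (Const u)" and ?th = "\<lambda>i. fderiv (theta i)"
  have th_fr: "?th i (fr q) = fr (theta i q)" for i q by (rule derivation.fderiv_of[OF derivation_theta])
  interpret cm "{1..n}" "\<lambda>i. fr (Var i)" ?th ?g ?u by standard
      (auto simp: th_fr theta_Var fr_0 fr_inj Var_inj simp del: add_fract mult_fract
        intro: derivation.fderiv_add[OF derivation_theta] derivation.fderiv_mult[OF derivation_theta]
          fderiv_comm[OF derivation_theta derivation_theta] theta_commute)
  let ?V = "fr (vand n)"
  have V: "?th k ?V = ph k * ?V" if "k \<in> {1..n}" for k
    unfolding th_fr ph_def by (rule theta_vand_field[OF fr_hom _ that]) (simp add: fr_inj Var_inj)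
  have V0: "?V \<noteq> 0" by (simp add: fr_inj flip: fr_0)
  \<comment> \<open>D(u) is the matching sum over all indices: by linearity of \<open>BB\<close> in
    its first argument the signed monomials add up to the Vandermonde determinant.\<close>
  have DD: "fr (D_op n g u q) = DDs {1..n} (fr q)" if q: "q \<in> sym_polys n" for q
  proof -
    let ?m = "\<lambda>\<sigma>. \<Prod>i=1..n. Var i ^ (n - \<sigma> i) :: cpoly"
    let ?c = "\<lambda>\<sigma> i. of_nat (n - \<sigma> i) * of_real g + u"
    let ?ks = "upto_list n"
    have tw: "fr (tw c ks q) = foldr (\<lambda>i r. ?th i r + fr (Const (c i)) * r) ks (fr q)" for c ks
      by (induction ks) (simp_all only: tw_simps foldr.simps id_apply o_apply fr_add fr_mult th_fr[symmetric])
    have B: "BB ?ks (fr (?m \<sigma>)) (fr q) = fr (?m \<sigma> * tw (?c \<sigma>) ?ks q)" if \<sigma>: "\<sigma> permutes {1..n}" for \<sigma>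
    proof -
      define r where "r i = fr (Const (if i \<in> {1..n} then of_nat (n - \<sigma> i) else 0))" for i
      have ev: "?th i (fr (?m \<sigma>)) = r i * fr (?m \<sigma>)" for i
      proof -
        have "lk (mk \<sigma> (rho n)) i = (if i \<in> {1..n} then n - \<sigma> i else 0)"
          using permutes_in_image[OF \<sigma>, of i] by (simp add: lookup_map_key permutes_inj[OF \<sigma>] lookup_rho)
        then have "theta i (?m \<sigma>) = Const (if i \<in> {1..n} then of_nat (n - \<sigma> i) else 0) * ?m \<sigma>"
          unfolding prod_Var_rho[OF \<sigma>] by (simp add: theta_single Const_def mult_single)
        then show ?thesis by (simp only: th_fr r_def fr_mult)
      qed
      have r0: "?th k (r i) = 0" for i k by (simp only: r_def th_fr theta_Const fr_0)
      have "BB ?ks (fr (?m \<sigma>)) (fr q) = fr (?m \<sigma>) * foldr (\<lambda>i q. ?th i q + (?g * r i + ?u) * q) ?ks (fr q)"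
        by (rule BB_eigen[OF ev r0])
      also have "foldr (\<lambda>i q. ?th i q + (?g * r i + ?u) * q) ?ks (fr q) = fr (tw (?c \<sigma>) ?ks q)" unfolding tw
      proof (rule foldr_cong)
        fix r' i assume "i \<in> set ?ks"
        then have "i \<in> {1..n}" by (simp only: set_upto_list)
        then have "?g * r i + ?u = fr (Const (?c \<sigma> i))"
          by (simp add: r_def Const_add Const_mult mult.commute flip: fr_add fr_mult del: add_fract mult_fract)
        then show "?th i r' + (?g * r i + ?u) * r' = ?th i r' + fr (Const (?c \<sigma> i)) * r'" by (simp only:)
      qed simp_all
      finally show ?thesis by (simp only: fr_mult)
    qed
    have s0: "?th k (fr (of_int j)) = 0" for k j unfolding th_fr Const_of_int[symmetric] by (simp only: theta_Const fr_0)
    have "fr (D_det n g u q) = (\<Sum>\<sigma> | \<sigma> permutes {1..n}. fr (of_int (sign \<sigma>)) * BB ?ks (fr (?m \<sigma>)) (fr q))"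
      unfolding D_det_tw fr_sum
    proof (intro sum.cong refl)
      fix \<sigma> assume "\<sigma> \<in> {\<sigma>. \<sigma> permutes {1..n}}"
      then show "fr (of_int (sign \<sigma>) * (?m \<sigma> * tw (?c \<sigma>) ?ks q)) = fr (of_int (sign \<sigma>)) * BB ?ks (fr (?m \<sigma>)) (fr q)"
        using B[of \<sigma>] by (simp only: mem_Collect_eq fr_mult)
    qed
    also have "... = BB ?ks (fr (altsum n)) (fr q)"
      unfolding altsum_def fr_sum fr_mult BB_sum1 by (intro sum.cong refl BB_const1[symmetric] s0)
    also have "... = ?V * DDs {1..n} (fr q)"
      unfolding vand_altsum[symmetric] by (subst BB_DDs[OF V]) (simp_all only: distinct_upt set_upto_list subset_refl)
    finally have "?V * fr (D_op n g u q) = ?V * DDs {1..n} (fr q)"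
      by (simp only: D_op_vquot vand_vquot[OF antisym_D_det[OF q]] flip: fr_mult)
    then show ?thesis by (rule mult_left_cancel[OF V0, THEN iffD1])
  qed
  define L where "L f = (\<Sum>k=1..n. ?th k (?th k f)) + 2 * ?g * (\<Sum>k=1..n. ph k * ?th k f)" for f
  \<comment> \<open>Doubling clears the 1/2 in \<open>Hnum\<close>, so that L has the shape used in
    \<open>laplace_DDs\<close>.\<close>
  have HL: "2 * fr (Hop n g q) = L (fr q)" if q: "q \<in> sym_polys n" for q
  proof -
    have "2 * Const (1 / 2) = Const (1 / 2 + 1 / 2 :: complex)" by (simp only: mult_2 Const_add)
    also have "... = 1" by simp
    finally have half: "2 * Const (1 / 2) = (1 :: cpoly)" .
    have e: "2 * Hnum n g q = vand n * (\<Sum>i=1..n. theta i (theta i q)) +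
        2 * (Const (of_real g) * (\<Sum>i=1..n. theta i (vand n) * theta i q))"
      unfolding Hnum_def distrib_left mult.assoc[symmetric, of 2 "Const (1/2)"] half by (simp only: mult_1_left)
    have "fr (theta i (vand n)) = ph i * ?V" if "i \<in> {1..n}" for i using V[OF that] by (simp only: th_fr)
    then have 3: "(\<Sum>i=1..n. fr (theta i (vand n)) * fr (theta i q)) = ?V * (\<Sum>i=1..n. ph i * fr (theta i q))"
      unfolding sum_distrib_left by (intro sum.cong refl) (simp only: mult_ac)
    have "fr (2 * Hnum n g q) = ?V * L (fr q)"
      unfolding L_def th_fr e fr_add fr_mult fr_sum fr_2 3 by (simp only: distrib_left mult_ac)
    moreover have "2 * Hnum n g q = vand n * (2 * Hop n g q)"
      using vand_vquot[OF antisym_Hnum[OF q], of g] by (simp add: Hop_def algebra_simps)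
    ultimately have "?V * fr (2 * Hop n g q) = ?V * L (fr q)" by (simp only: fr_mult)
    then have "fr (2 * Hop n g q) = L (fr q)" by (rule mult_left_cancel[OF V0, THEN iffD1])
    then show ?thesis by (simp only: fr_mult fr_2)
  qed
  have LD: "DDs {1..n} (L f) = L (DDs {1..n} f)" for f unfolding L_def
  proof (rule laplace_DDs[where V = ?V and C = "fr (Const (\<Sum>k=1..n. of_nat (n - k) ^ 2))"])
    show "(\<Sum>k=1..n. ?th k (?th k ?V)) = fr (Const (\<Sum>k=1..n. of_nat (n - k) ^ 2)) * ?V"
      by (simp only: th_fr theta_altsum_squares flip: fr_sum fr_mult)
    show "?th k (fr (Const (\<Sum>k=1..n. of_nat (n - k) ^ 2))) = 0" for k by (simp only: th_fr theta_Const fr_0)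
  qed (use V V0 in auto)
  have Dp: "D_op n g u p \<in> sym_polys n" unfolding D_op_vquot by (rule vquot_sym[OF antisym_D_det[OF p]])
  have Hp: "Hop n g p \<in> sym_polys n" unfolding Hop_def by (rule vquot_sym[OF antisym_Hnum[OF p]])
  have "2 * fr (Hop n g (D_op n g u p)) = DDs {1..n} (2 * fr (Hop n g p))" using HL[OF Dp] HL[OF p] DD[OF p] LD by simp
  also have "... = 2 * DDs {1..n} (fr (Hop n g p))"
  proof (rule DDs_mult0)
    show "?th j 2 = 0" for j using th_add[of j 1 1] th_1[of j] by simp
  qed auto
  also have "... = 2 * fr (D_op n g u (Hop n g p))" using DD[OF Hp] by simp
  finally have "fr (2 * Hop n g (D_op n g u p)) = fr (2 * D_op n g u (Hop n g p))" by (simp only: fr_mult fr_2)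
  then show ?thesis by (simp add: fr_inj del: mult_fract)
qed

section \<open>Jack polynomials\<close>

text \<open>Take the first index i where the partitions differ and choose u so that the factor of
  lam at i vanishes. The numbers nu_j + (n - j) g decrease strictly in j, agree before i, and at i
  that of mu is smaller, so no factor of mu vanishes.\<close>

lemma D_eval_separates:
  assumes g: "g > 0" and lam: "lam \<in> partitions n" and mu: "mu \<in> down n lam" "mu \<noteq> lam"
  obtains u where "D_eval n g u mu \<noteq> D_eval n g u lam"
proof -
  have mup: "mu \<in> partitions n" using mu by (simp add: down_def)
  define i where "i = (LEAST i. lk mu i \<noteq> lk lam i)"
  have ex: "\<exists>i. lk mu i \<noteq> lk lam i" using mu(2) by (auto intro: poly_mapping_eqI)
  have i: "lk mu i \<noteq> lk lam i" unfolding i_def by (rule LeastI_ex[OF ex])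
  have lt: "lk mu j = lk lam j" if "j < i" for j using not_less_Least[OF that[unfolded i_def]] by simp
  have in1: "i \<in> {1..n}"
  proof (rule ccontr)
    assume "i \<notin> {1..n}"
    then have "lk mu i = 0" "lk lam i = 0"
      using partitions_keys[OF mup] partitions_keys[OF lam] by (auto simp: in_keys_iff subset_iff)
    with i show False by simp
  qed
  have "pre mu i \<le> pre lam i" using mu lam mup by (auto simp: down_def dominated_pre)
  moreover have "(\<Sum>j<i. lk mu j) = (\<Sum>j<i. lk lam j)" by (rule sum.cong) (auto simp: lt)
  ultimately have less: "lk mu i < lk lam i" using i by (simp add: pre_def lessThan_Suc_atMost[symmetric])
  define a where "a nu j = real (lk nu j) + real (n - j) * g" for nu j
  have adec: "a nu k < a nu j" if nu: "nu \<in> partitions n" and "1 \<le> j" "j < k" "k \<le> n" for nu j k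
  proof -
    have "lk nu k \<le> lk nu j" using that by (intro partitions_antimono[OF nu]) auto
    moreover have "real (n - k) * g < real (n - j) * g" using that g by simp
    ultimately show ?thesis by (simp add: a_def)
  qed
  define u where "u = - complex_of_real (a lam i)"
  have trm: "of_nat (lk nu j) + of_nat (n - j) * of_real g + u = complex_of_real (a nu j - a lam i)" for nu j
    by (simp add: u_def a_def)
  have "D_eval n g u lam = 0" unfolding D_eval_def trm by (rule prod_zero) (use in1 in auto)
  moreover have "a mu j \<noteq> a lam i" if j: "j \<in> {1..n}" for j
  proof (cases "j < i")
    case True
    then have "a mu j = a lam j" by (simp add: a_def lt)
    then show ?thesis using adec[OF lam, of j i] True in1 j by auto
  next
    case False
    then have "a mu j \<le> a mu i" using adec[OF mup, of i j] in1 j by (cases "j = i") auto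
    also have "... < a lam i" using less by (simp add: a_def)
    finally show ?thesis by simp
  qed
  then have "D_eval n g u mu \<noteq> 0" unfolding D_eval_def trm by simp
  ultimately show ?thesis by (intro that[of u]) simp
qed

lemma jack_form:
  assumes "lam \<in> partitions n"
  shows "(\<exists>v. P = monomial_sym n lam + (\<Sum>\<mu> | \<mu> \<in> partitions n \<and> dominated n \<mu> lam \<and> \<mu> \<noteq> lam.
       Const (v \<mu>) * monomial_sym n \<mu>)) \<longleftrightarrow> P \<in> sym_span n (down n lam) \<and> lk P lam = 1"
proof -
  let ?U = "down n lam - {lam}"
  have U: "{\<mu>. \<mu> \<in> partitions n \<and> dominated n \<mu> lam \<and> \<mu> \<noteq> lam} = ?U" by (auto simp: down_def)
  have fin: "finite (down n lam)" by (rule finite_down[OF assms])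
  show ?thesis unfolding U
  proof
    assume "\<exists>v. P = monomial_sym n lam + (\<Sum>\<mu>\<in>?U. Const (v \<mu>) * monomial_sym n \<mu>)"
    then obtain v where P: "P = monomial_sym n lam + (\<Sum>\<mu>\<in>?U. Const (v \<mu>) * monomial_sym n \<mu>)" by blast
    have s: "(\<Sum>\<mu>\<in>?U. Const (v \<mu>) * monomial_sym n \<mu>) \<in> sym_span n ?U"
    proof (intro sym_span_sum sym_span_Const_mult)
      fix \<mu> assume \<mu>: "\<mu> \<in> ?U"
      then have "\<mu> \<in> partitions n" "down n \<mu> \<subseteq> ?U" using downset_strict[OF assms] by (auto simp: downset_def)
      then show "monomial_sym n \<mu> \<in> sym_span n ?U" using monomial_sym_span sym_span_mono by blast
    qed
    then have "P \<in> sym_span n (down n lam)"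
      unfolding P using monomial_sym_span[OF assms] by (intro sym_span_add) (auto intro: sym_span_mono)
    moreover have "lk P lam = 1"
      using sym_span_lookup[OF s assms] assms by (simp add: P lookup_add lookup_monomial_sym_partition)
    ultimately show "P \<in> sym_span n (down n lam) \<and> lk P lam = 1" ..
  next
    assume *: "P \<in> sym_span n (down n lam) \<and> lk P lam = 1"
    then have "P = (\<Sum>\<mu>\<in>down n lam. Const (lk P \<mu>) * monomial_sym n \<mu>)" by (intro sym_span_expand downset_down assms) auto
    also have "... = monomial_sym n lam + (\<Sum>\<mu>\<in>?U. Const (lk P \<mu>) * monomial_sym n \<mu>)"
      using * fin down_refl[OF assms] by (simp add: sum.remove[of "down n lam" lam])
    finally show "\<exists>v. P = monomial_sym n lam + (\<Sum>\<mu>\<in>?U. Const (v \<mu>) * monomial_sym n \<mu>)" by blast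
  qed
qed

text \<open>Existence comes from \<open>Hop\<close>, whose eigenvalue at lam differs from all lower
  ones: D(u) P is again an eigenvector in the same span, hence a multiple of P. Uniqueness comes
  from D(u): the difference of two candidates has a maximal exponent mu below lam, and a suitable u
  separates mu from lam.\<close>

theorem jack_props:
  assumes g: "g > 0" and lam: "lam \<in> partitions n"
  shows "jack n g lam \<in> sym_span n (down n lam)" "lk (jack n g lam) lam = 1"
    "Hop n g (jack n g lam) = Const (of_real (H_eval n g lam)) * jack n g lam"
proof -
  have sep: "complex_of_real (H_eval n g mu) \<noteq> of_real (H_eval n g lam)" if "mu \<in> down n lam" "mu \<noteq> lam" for mu
    using H_eval_strict[OF g lam that] by simp
  obtain P where P: "P \<in> sym_span n (down n lam)" "lk P lam = 1" "Hop n g P = Const (of_real (H_eval n g lam)) * P"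
    using tri_eigenvector[OF triangular_Hop lam sep] by blast
  have Ps: "P \<in> sym_polys n" using P by (simp add: sym_span_def)
  have DP: "D_op n g u P = Const (D_eval n g u lam) * P" for u
  proof -
    have D: "D_op n g u P \<in> sym_span n (down n lam)" "lk (D_op n g u P) lam = D_eval n g u lam"
      using triangular_D_op[of n g u] P lam by (auto simp: triangular_def)
    have "Hop n g (D_op n g u P) = Const (of_real (H_eval n g lam)) * D_op n g u P" unfolding Hop_D_op_commute[OF Ps] P(3)
      by (rule lin_op_Const_mult[OF tri_lin[OF triangular_D_op] Ps])
    from tri_eigenvector_unique[OF triangular_Hop lam sep P D(1) this]
    have "D_op n g u P = Const (lk (D_op n g u P) lam) * P" by simp
    then show ?thesis by (simp add: D(2))
  qed
  have "jack n g lam = P" unfolding jack_def jack_form[OF lam]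
  proof (rule the_equality)
    show "(P \<in> sym_span n (down n lam) \<and> lk P lam = 1) \<and> (\<forall>u. D_op n g u P =
        Const (\<Prod>i=1..n. of_nat (lk lam i) + of_nat (n - i) * of_real g + u) * P)" using P DP by (simp add: D_eval_def)
  next
    fix Q assume Q: "(Q \<in> sym_span n (down n lam) \<and> lk Q lam = 1) \<and> (\<forall>u. D_op n g u Q =
        Const (\<Prod>i=1..n. of_nat (lk lam i) + of_nat (n - i) * of_real g + u) * Q)"
    then have DQ: "D_op n g u Q = Const (D_eval n g u lam) * Q" for u by (simp add: D_eval_def)
    show "Q = P"
    proof (rule ccontr)
      assume "Q \<noteq> P"
      have v: "Q - P \<in> sym_span n (down n lam)" "lk (Q - P) lam = 0" "Q - P \<noteq> 0"
        using Q P \<open>Q \<noteq> P\<close> by (auto simp: lookup_minus intro: sym_span_diff)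
      have Dv: "D_op n g u (Q - P) = Const (D_eval n g u lam) * (Q - P)" for u
        using Q Ps lin_op_diff[OF tri_lin[OF triangular_D_op], of Q n P g u] by (simp add: DQ DP sym_span_def algebra_simps)
      obtain mu where mu: "mu \<in> down n lam" "mu \<noteq> lam" "lk (Q - P) mu \<noteq> 0"
        and "\<And>nu. nu \<in> ky (Q - P) \<inter> partitions n ==> mu \<in> down n nu ==> nu = mu"
      proof -
        let ?K = "ky (Q - P) \<inter> partitions n"
        have "?K \<noteq> {}"
        proof
          assume "?K = {}"
          then have "Q - P = 0" using v(1) by (intro sym_eq_0_if_partitions[of _ n]) (auto simp: in_keys_iff sym_span_def)
          with v(3) show False by simp
        qed
        then obtain mu where mu: "mu \<in> ?K" "\<And>nu. nu \<in> ?K ==> mu \<in> down n nu ==> nu = mu"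
          using ex_maximal[of ?K n] by (metis Int_lower2 finite_Int finite_keys)
        then have "mu \<in> down n lam" using v(1) unfolding sym_span_def by blast
        moreover have "lk (Q - P) mu \<noteq> 0" using mu(1) by (simp add: in_keys_iff)
        moreover from this v(2) have "mu \<noteq> lam" by auto
        ultimately show ?thesis using that mu(2) by blast
      qed
      obtain u where u: "D_eval n g u mu \<noteq> D_eval n g u lam" using D_eval_separates[OF g lam mu(1,2)] .
      have "lk (D_op n g u (Q - P)) mu = D_eval n g u mu * lk (Q - P) mu"
      proof -
        have K: "\<And>nu. nu \<in> ky (Q - P) \<inter> partitions n ==> mu \<in> down n nu ==> nu = mu" by fact
        let ?U = "\<Union>nu\<in>ky (Q - P) \<inter> partitions n. down n nu"
        have mup: "mu \<in> partitions n" using mu by (simp add: down_def)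
        show ?thesis
        proof (rule tri_lookup[OF triangular_D_op, of n ?U])
          show "downset n ?U" unfolding downset_def by (auto simp: finite_down) (auto simp: down_def intro: dominated_trans)
          show "Q - P \<in> sym_span n ?U" using v(1) down_refl by (auto simp: sym_span_def)
          have "mu \<in> ky (Q - P) \<inter> partitions n" using mu(3) mup by (simp add: in_keys_iff)
          then show "mu \<in> ?U" using down_refl[OF mup] by (rule UN_I)
          fix nu assume nu: "nu \<in> ?U" "mu \<in> down n nu"
          from nu(1) obtain k where k: "k \<in> ky (Q - P) \<inter> partitions n" "nu \<in> down n k" by blast
          then have "mu \<in> down n k" using nu(2) by (auto simp: down_def intro: dominated_trans)
          then have "k = mu" using K k by blast
          then show "nu = mu" using k nu by (auto simp: down_def intro: dominated_antisym)
        qed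
      qed
      then show False using mu(3) u by (simp add: Dv lookup_Const_mult)
    qed
  qed
  then show "jack n g lam \<in> sym_span n (down n lam)" "lk (jack n g lam) lam = 1"
    "Hop n g (jack n g lam) = Const (of_real (H_eval n g lam)) * jack n g lam" using P by auto
qed

lemma jack_sym: "g > 0 ==> lam \<in> partitions n ==> jack n g lam \<in> sym_polys n" using jack_props(1) by (auto simp: sym_span_def)

lemma jack_expand:
  assumes g: "g > 0" and p: "p \<in> sym_polys n"
  obtains U c where "finite U" "U \<subseteq> partitions n" "p = (\<Sum>mu\<in>U. Const (c mu) * jack n g mu)"
proof -
  obtain U where U: "downset n U" "p \<in> sym_span n U" using sym_in_span[OF p] .
  then obtain c where "p = (\<Sum>mu\<in>U. Const (c mu) * jack n g mu)"
    using unitriangular_expand[OF _ U, of "jack n g"] jack_props(1,2)[OF g] by blast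
  then show ?thesis using that[of U c] U by (auto simp: downset_def)
qed

text \<open>Operators that preserve the dominance filtration and commute with the Laplace--Beltrami
  operator are diagonal on the Jack polynomials, since the Laplace--Beltrami eigenvalue is
  strictly monotone in the dominance order.\<close>

theorem jack_eigen:
  assumes g: "g > 0" and lam: "lam \<in> partitions n"
    and L: "\<And>p. p \<in> sym_span n (down n lam) ==> L p \<in> sym_span n (down n lam)"
    and comm: "\<And>p. p \<in> sym_polys n ==> Hop n g (L p) = L (Hop n g p)"
    and lin: "lin_op n L"
  shows "L (jack n g lam) = Const (lk (L (jack n g lam)) lam) * jack n g lam"
proof -
  have sep: "complex_of_real (H_eval n g mu) \<noteq> of_real (H_eval n g lam)" if "mu \<in> down n lam" "mu \<noteq> lam" for mu
    using H_eval_strict[OF g lam that] by simp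
  have "Hop n g (L (jack n g lam)) = Const (of_real (H_eval n g lam)) * L (jack n g lam)"
    using comm[OF jack_sym[OF g lam]] lin_op_Const_mult[OF lin jack_sym[OF g lam]] jack_props(3)[OF g lam] by simp
  from tri_eigenvector_unique[OF triangular_Hop lam sep jack_props[OF g lam] L[OF jack_props(1)[OF g lam]] this]
  show ?thesis by simp
qed

section \<open>The Q-operator as a Dirichlet average\<close>

text \<open>In the variables \<open>r\<^sub>i = \<xi>\<^sub>i / y\<^sub>i\<close> the elementary symmetric functions of x are
  \<open>e\<^sub>k(x) = \<Sum>\<^bsub>|I|=k\<^esub> y\<^sub>I (1 + \<Sum>\<^bsub>i\<in>I\<^esub> r\<^sub>i)\<close>, and the constraint becomes \<open>\<Sum> r\<^sub>i = z - 1\<close>.\<close>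

definition welem :: "nat set => (nat => 'a::comm_semiring_1) => (nat => 'a) => nat => 'a" where
  "welem A x r k = (\<Sum>I | I \<subseteq> A \<and> card I = k. (\<Prod>i\<in>I. x i) * (1 + (\<Sum>i\<in>I. r i)))"

lemma welem_hom:
  "semiring_hom h ==> h (welem A x r k) = welem A (\<lambda>i. h (x i)) (\<lambda>i. h (r i)) k"
  by (simp add: welem_def semiring_hom.hsum semiring_hom.hprod semiring_hom.hmult semiring_hom.hadd semiring_hom.h1)

lemma welem_zero: "welem A x (\<lambda>_. 0) k = elem A x k" by (simp add: welem_def elem_def)

lemma welem_cong: "(\<And>i. i \<in> A ==> x i = x' i) ==> (\<And>i. i \<in> A ==> r i = r' i) ==> welem A x r k = welem A x' r' k"
  unfolding welem_def by (intro sum.cong refl arg_cong2[where f = "(*)"] arg_cong2[where f = "(+)"] prod.cong sum.cong) auto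

lemma welem_0 [simp]: "finite A ==> welem A x r 0 = 1"
proof -
  assume "finite A"
  then have "{I. I \<subseteq> A \<and> card I = 0} = {{}}" by (auto dest: finite_subset)
  then show ?thesis by (simp add: welem_def)
qed

lemma sum_pointed_subsets:
  fixes F :: "nat => nat set => 'a::comm_monoid_add"
  assumes "finite A"
  shows "(\<Sum>I | I \<subseteq> A \<and> card I = Suc k. \<Sum>i\<in>I. F i (I - {i})) = (\<Sum>i\<in>A. \<Sum>J | J \<subseteq> A - {i} \<and> card J = k. F i J)"
proof -
  have fin: "finite {I. I \<subseteq> A \<and> card I = k}" for k using assms by (simp add: finite_subset[of _ "Pow A"])
  have fS: "finite I" if "I \<subseteq> A" for I using that assms finite_subset by blast
  have "(\<Sum>I | I \<subseteq> A \<and> card I = Suc k. \<Sum>i\<in>I. F i (I - {i})) =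
      (\<Sum>(I, i)\<in>(SIGMA I:{I. I \<subseteq> A \<and> card I = Suc k}. I). F i (I - {i}))" by (rule sum.Sigma) (use fin fS in auto)
  also have "... = (\<Sum>(i, J)\<in>(SIGMA i:A. {J. J \<subseteq> A - {i} \<and> card J = k}). F i J)"
  proof (rule sum.reindex_bij_witness[of _ "\<lambda>(i, J). (insert i J, i)" "\<lambda>(I, i). (i, I - {i})"])
    fix a assume a: "a \<in> (SIGMA i:A. {J. J \<subseteq> A - {i} \<and> card J = k})"
    obtain i J where e: "a = (i, J)" by force
    then have "i \<in> A" "J \<subseteq> A - {i}" "card J = k" "finite J" using a fS[of J] by auto
    moreover from this have "card (insert i J) = Suc k" by (subst card_insert_disjoint) auto
    ultimately show "(case a of (i, J) => (insert i J, i)) \<in> (SIGMA I:{I. I \<subseteq> A \<and> card I = Suc k}. I)" using e by auto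
  qed (auto simp: insert_absorb)
  also have "... = (\<Sum>i\<in>A. \<Sum>J | J \<subseteq> A - {i} \<and> card J = k. F i J)"
    by (rule sum.Sigma[symmetric]) (use assms fin in \<open>auto intro: finite_subset[of _ "Pow A"]\<close>)
  finally show ?thesis .
qed

text \<open>A k-subset is counted once for each of the \<open>card A - k\<close> indices outside
  it.\<close>

lemma sum_avoiding_subsets:
  fixes F :: "nat set => 'a::comm_ring_1"
  assumes "finite A"
  shows "(\<Sum>i\<in>A. \<Sum>I | I \<subseteq> A - {i} \<and> card I = k. F I) = (of_nat (card A) - of_nat k) * (\<Sum>I | I \<subseteq> A \<and> card I = k. F I)"
proof -
  have fin: "finite {I. I \<subseteq> A \<and> card I = k}" using assms by (simp add: finite_subset[of _ "Pow A"])
  have "(\<Sum>i\<in>A. \<Sum>I | I \<subseteq> A - {i} \<and> card I = k. F I) = (\<Sum>i\<in>A. \<Sum>I | I \<subseteq> A \<and> card I = k. if i \<notin> I then F I else 0)"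
  proof (rule sum.cong[OF refl])
    fix i
    have "{I. I \<subseteq> A - {i} \<and> card I = k} = {I \<in> {I. I \<subseteq> A \<and> card I = k}. i \<notin> I}" by auto
    then show "(\<Sum>I | I \<subseteq> A - {i} \<and> card I = k. F I) = (\<Sum>I | I \<subseteq> A \<and> card I = k. if i \<notin> I then F I else 0)"
      using fin by (simp only: sum.inter_filter)
  qed
  also have "... = (\<Sum>I | I \<subseteq> A \<and> card I = k. \<Sum>i\<in>A. if i \<notin> I then F I else 0)" by (rule sum.swap)
  also have "... = (\<Sum>I | I \<subseteq> A \<and> card I = k. (of_nat (card A) - of_nat k) * F I)"
  proof (rule sum.cong[OF refl])
    fix I assume I: "I \<in> {I. I \<subseteq> A \<and> card I = k}"
    then have "finite I" using assms finite_subset by auto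
    have "(\<Sum>i\<in>A. if i \<notin> I then F I else 0) = (\<Sum>i\<in>A - I. F I)" using assms by (intro sum.mono_neutral_cong_right) auto
    also have "... = of_nat (card A - k) * F I" using I \<open>finite I\<close> by (simp add: card_Diff_subset)
    also have "of_nat (card A - k) = (of_nat (card A) - of_nat k :: 'a)"
      using I assms by (intro of_nat_diff) (auto intro: card_mono)
    finally show "(\<Sum>i\<in>A. if i \<notin> I then F I else 0) = (of_nat (card A) - of_nat k) * F I" .
  qed
  finally show ?thesis by (simp add: sum_distrib_left)
qed

lemma welem_count:
  fixes x :: "nat => 'a::comm_ring_1"
  assumes "finite A"
  shows "(\<Sum>i\<in>A. welem (A - {i}) x r k) = (of_nat (card A) - of_nat k) * welem A x r k"
  unfolding welem_def by (rule sum_avoiding_subsets[OF assms])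

lemma welem_Suc:
  fixes x :: "nat => 'a::comm_semiring_1"
  assumes "finite A"
  shows "welem A x r (Suc k) = elem A x (Suc k) + (\<Sum>i\<in>A. r i * (x i * elem (A - {i}) x k))"
proof -
  have "(\<Prod>i\<in>I. x i) * (\<Sum>i\<in>I. r i) = (\<Sum>i\<in>I. r i * (x i * (\<Prod>j\<in>I - {i}. x j)))" if "I \<subseteq> A" for I unfolding sum_distrib_left
  proof (intro sum.cong refl)
    fix i assume "i \<in> I"
    then have "(\<Prod>i\<in>I. x i) = x i * (\<Prod>j\<in>I - {i}. x j)" using finite_subset[OF that assms] by (intro prod.remove)
    then show "(\<Prod>i\<in>I. x i) * r i = r i * (x i * (\<Prod>j\<in>I - {i}. x j))" by (simp only: mult.commute)
  qed
  then have "welem A x r (Suc k) = elem A x (Suc k) + (\<Sum>I | I \<subseteq> A \<and> card I = Suc k. \<Sum>i\<in>I. r i * (x i * (\<Prod>j\<in>I - {i}. x j)))"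
    unfolding welem_def elem_def by (simp add: distrib_left sum.distrib)
  then show ?thesis unfolding sum_pointed_subsets[OF assms, of "\<lambda>i J. r i * (x i * (\<Prod>j\<in>J. x j))"]
    by (simp add: elem_def sum_distrib_left)
qed

lemma welem_remove:
  fixes x :: "nat => 'a::comm_semiring_1"
  assumes "finite A" "i \<in> A"
  shows "welem A x r (Suc k) = welem (A - {i}) x r (Suc k) + x i * (welem (A - {i}) x r k + r i * elem (A - {i}) x k)"
proof -
  let ?B = "A - {i}"
  have A: "A = insert i ?B" "finite ?B" "i \<notin> ?B" using assms by auto
  have "(\<Sum>I | I \<subseteq> ?B \<and> card I = k. (\<Prod>j\<in>insert i I. x j) * (1 + (\<Sum>j\<in>insert i I. r j))) =
      (\<Sum>I | I \<subseteq> ?B \<and> card I = k. x i * ((\<Prod>j\<in>I. x j) * (1 + (\<Sum>j\<in>I. r j)) + r i * (\<Prod>j\<in>I. x j)))"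
  proof (intro sum.cong refl)
    fix I assume "I \<in> {I. I \<subseteq> ?B \<and> card I = k}"
    then have "finite I" "i \<notin> I" using assms finite_subset[of I ?B] by auto
    then show "(\<Prod>j\<in>insert i I. x j) * (1 + (\<Sum>j\<in>insert i I. r j)) =
        x i * ((\<Prod>j\<in>I. x j) * (1 + (\<Sum>j\<in>I. r j)) + r i * (\<Prod>j\<in>I. x j))" by (simp add: algebra_simps)
  qed
  then have "(\<Sum>I | I \<subseteq> ?B \<and> card I = k. (\<Prod>j\<in>insert i I. x j) * (1 + (\<Sum>j\<in>insert i I. r j))) =
      x i * (welem ?B x r k + r i * elem ?B x k)"
    by (simp add: welem_def elem_def sum_distrib_left distrib_left sum.distrib)
  then show ?thesis using sum_insert_subsets[OF A(2,3), of "\<lambda>I. (\<Prod>j\<in>I. x j) * (1 + (\<Sum>j\<in>I. r j))" k]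
    unfolding A(1)[symmetric] by (simp add: welem_def)
qed

lemma welem_large:
  assumes "finite A" "card A < k" shows "welem A x r k = 0"
proof -
  have "card I \<noteq> k" if "I \<subseteq> A" for I using card_mono[OF assms(1) that] assms(2) by linarith
  then have "{I. I \<subseteq> A \<and> card I = k} = {}" by blast
  then show ?thesis unfolding welem_def by (simp only: sum.empty)
qed

text \<open>The left side is the monic polynomial in t whose roots are to be the x:
  \<open>welem\<close> collects its signed coefficients, so these are forced values for the e_k of
  the roots.\<close>

lemma prod_diff_welem:
  fixes x :: "nat => 'a::comm_ring_1"
  assumes "finite A"
  shows "(\<Prod>i\<in>A. t - x i) - (\<Sum>i\<in>A. r i * (x i * (\<Prod>j\<in>A - {i}. t - x j))) =
    (\<Sum>k\<le>card A. (- 1) ^ k * welem A x r k * t ^ (card A - k))"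
proof (cases "card A")
  case 0
  then show ?thesis using assms by simp
next
  case (Suc N)
  have c: "card (A - {i}) = N" if "i \<in> A" for i using that assms Suc by simp
  have "(\<Sum>k\<le>Suc N. (- 1) ^ k * welem A x r k * t ^ (Suc N - k)) =
      t ^ Suc N + (\<Sum>k\<le>N. (- 1) ^ Suc k * welem A x r (Suc k) * t ^ (N - k))"
    using assms by (subst sum.atMost_Suc_shift) simp
  also have "(\<Sum>k\<le>N. (- 1) ^ Suc k * welem A x r (Suc k) * t ^ (N - k)) =
      (\<Sum>k\<le>N. (- 1) ^ Suc k * elem A x (Suc k) * t ^ (N - k)) -
      (\<Sum>k\<le>N. \<Sum>i\<in>A. r i * (x i * ((- 1) ^ k * elem (A - {i}) x k * t ^ (N - k))))" unfolding sum_subtractf[symmetric]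
    by (intro sum.cong refl) (simp add: welem_Suc[OF assms] algebra_simps sum_distrib_left sum_distrib_right sum_negf)
  also have "(\<Sum>k\<le>N. \<Sum>i\<in>A. r i * (x i * ((- 1) ^ k * elem (A - {i}) x k * t ^ (N - k)))) =
      (\<Sum>i\<in>A. r i * (x i * (\<Prod>j\<in>A - {i}. t - x j)))" unfolding sum.swap[of _ A]
    by (intro sum.cong refl) (use assms Suc in \<open>simp add: prod_diff_elem sum_distrib_left\<close>)
  also have "t ^ Suc N + ((\<Sum>k\<le>N. (- 1) ^ Suc k * elem A x (Suc k) * t ^ (N - k)) - (\<Sum>i\<in>A. r i * (x i * (\<Prod>j\<in>A - {i}. t - x j)))) =
      (\<Sum>k\<le>Suc N. (- 1) ^ k * elem A x k * t ^ (Suc N - k)) - (\<Sum>i\<in>A. r i * (x i * (\<Prod>j\<in>A - {i}. t - x j)))"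
    using assms by (subst sum.atMost_Suc_shift) simp
  also have "(\<Sum>k\<le>Suc N. (- 1) ^ k * elem A x k * t ^ (Suc N - k)) = (\<Prod>i\<in>A. t - x i)"
    using prod_diff_elem[OF assms, of t x] Suc by simp
  finally show ?thesis using Suc by simp
qed

subsection \<open>Roots\<close>

lemma signed_coeffs_unique:
  fixes a b :: "nat => complex"
  assumes "\<And>t. t \<in> T ==> (\<Sum>k\<le>n. (- 1) ^ k * a k * t ^ (n - k)) = (\<Sum>k\<le>n. (- 1) ^ k * b k * t ^ (n - k))"
    and "infinite T" "k \<le> n"
  shows "a k = b k"
proof -
  let ?p = "\<lambda>a. \<Sum>k\<le>n. monom ((- 1) ^ k * a k :: complex) (n - k)"
  have p: "poly (?p a) t = (\<Sum>k\<le>n. (- 1) ^ k * a k * t ^ (n - k))" for a t by (simp add: poly_sum poly_monom)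
  have "T \<subseteq> {t. poly (?p a - ?p b) t = 0}" using assms(1) by (auto simp: p)
  then have "infinite {t. poly (?p a - ?p b) t = 0}" using assms(2) finite_subset by blast
  then have "?p a - ?p b = 0" using poly_roots_finite by blast
  then have "coeff (?p a) (n - k) = coeff (?p b) (n - k)" by simp
  moreover have "coeff (?p a) (n - k) = (- 1) ^ k * a k" for a
  proof -
    have "coeff (?p a) (n - k) = (\<Sum>j\<le>n. if j = k then (- 1) ^ j * a j else 0)"
      unfolding coeff_sum coeff_monom using assms(3) by (intro sum.cong refl) auto
    then show ?thesis using assms(3) by simp
  qed
  ultimately show ?thesis by simp
qed

lemma monic_factor:
  fixes p :: "complex poly"
  assumes "degree p = n" "lead_coeff p = 1"
  shows "\<exists>x :: nat => complex. p = (\<Prod>i=1..n. [:- x i, 1:])" using assms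
proof (induction n arbitrary: p)
  case 0
  then obtain c where "p = [:c:]" by (auto elim: degree_eq_zeroE)
  then show ?case using 0 by simp
next
  case (Suc n)
  have "\<not> constant (poly p)" using Suc by (simp add: constant_degree)
  then obtain a where "poly p a = 0" using fundamental_theorem_of_algebra by blast
  then obtain q where q: "p = [:- a, 1:] * q" by (auto simp: poly_eq_0_iff_dvd elim: dvdE)
  have "q \<noteq> 0" using q Suc by auto
  then have "degree p = Suc (degree q)" unfolding q by (subst degree_mult_eq) auto
  moreover have "lead_coeff q = 1" using Suc q by (metis lead_coeff_mult lead_coeff_pCons(1) mult_1 one_neq_zero pCons_eq_0_iff lead_coeff_1 one_pCons)
  ultimately obtain x where x: "q = (\<Prod>i=1..n. [:- x i, 1:])" using Suc by auto
  have "p = (\<Prod>i\<in>{1..Suc n}. [:- (x(Suc n := a)) i, 1:])"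
  proof -
    have "(\<Prod>i=1..n. [:- (x(Suc n := a)) i, 1:]) = (\<Prod>i=1..n. [:- x i, 1:])" by (rule prod.cong) auto
    then show ?thesis by (simp add: q x mult.commute)
  qed
  then show ?case by blast
qed

text \<open>Algebraic closedness supplies x for arbitrary complex y and r. If y_k = ... = y_n = 1,
  every summand of the polynomial contains (t - 1)^(n - k), so that many roots are 1 and are given
  the indices above k. With k = n + 1 the condition on y is void.\<close>

lemma welem_roots:
  fixes y r :: "nat => complex"
  assumes k: "1 \<le> k" and y: "\<And>i. i \<in> {k..n} ==> y i = 1"
  obtains x where "\<And>j. elem {1..n} x j = welem {1..n} y r j" "\<And>i. i > k ==> x i = 1"
proof -
  let ?c = "welem {1..n} y r" and ?Y = "\<lambda>i. \<Prod>j\<in>{1..n} - {i}. [:- y j, 1:]"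
  define p where "p = ?Y 0 - (\<Sum>i=1..n. smult (r i * y i) (?Y i))"
  have pt: "poly p t = (\<Sum>k\<le>n. (- 1) ^ k * ?c k * t ^ (n - k))" for t
    using prod_diff_welem[of "{1..n}" t y r] by (simp add: p_def poly_sum poly_prod mult.assoc)
  then have p: "p = (\<Sum>k\<le>n. monom ((- 1) ^ k * ?c k) (n - k))"
    by (simp add: poly_eq_poly_eq_iff[symmetric] fun_eq_iff poly_sum poly_monom)
  have "coeff p n = (\<Sum>j\<le>n. if j = 0 then 1 else 0)" unfolding p coeff_sum coeff_monom by (intro sum.cong refl) auto
  then have cn: "coeff p n = 1" by simp
  moreover have "degree p \<le> n" unfolding p by (rule degree_sum_le) (auto intro: order_trans[OF degree_monom_le])
  ultimately have dp: "degree p = n" using le_degree[of p n] by simp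
  let ?L = "[:- 1, 1:] :: complex poly"
  have "?L ^ (n - k) dvd ?Y i" for i
  proof -
    \<comment> \<open>At most one of the n - k + 1 factors t - 1 is missing from the product that
      omits i.\<close>
    have "Suc n - k - 1 \<le> card ({k..n} - {i})" using diff_card_le_card_Diff[of "{i}" "{k..n}"] by simp
    then have "?L ^ (n - k) dvd ?L ^ card ({k..n} - {i})" by (intro le_imp_power_dvd) simp
    also have "... = (\<Prod>j\<in>{k..n} - {i}. [:- y j, 1:])" using y by simp
    also have "... dvd ?Y i" by (rule prod_dvd_prod_subset) (use k in auto)
    finally show ?thesis .
  qed
  then have "?L ^ (n - k) dvd p" unfolding p_def by (intro dvd_diff dvd_sum dvd_smult)
  then obtain q where q: "p = ?L ^ (n - k) * q" by (rule dvdE)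
  have "q \<noteq> 0" using q cn by auto
  then have "degree q = n - (n - k)" using dp unfolding q by (simp add: degree_mult_eq degree_power_eq)
  moreover have "lead_coeff q = 1" using cn dp lead_coeff_mult[of "?L ^ (n - k)" q] by (simp add: q[symmetric] lead_coeff_power)
  ultimately obtain x0 where x0: "q = (\<Prod>i\<in>{1..n - (n - k)}. [:- x0 i, 1:])" using monic_factor by blast
  define x where "x i = (if i \<le> k then x0 i else 1)" for i
  have "p = (\<Prod>i=1..n. [:- x i, 1:])"
  proof -
    have "(\<Prod>i=1..n. [:- x i, 1:]) = (\<Prod>i\<in>{1..n - (n - k)} \<union> {k<..n}. [:- x i, 1:])" by (rule prod.cong) auto
    also have "... = (\<Prod>i\<in>{1..n - (n - k)}. [:- x i, 1:]) * (\<Prod>i\<in>{k<..n}. [:- x i, 1:])" by (rule prod.union_disjoint) auto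
    also have "(\<Prod>i\<in>{1..n - (n - k)}. [:- x i, 1:]) = q" unfolding x0 by (rule prod.cong) (auto simp: x_def)
    finally show ?thesis by (simp add: q x_def)
  qed
  then have e: "(\<Sum>k\<le>n. (- 1) ^ k * elem {1..n} x k * t ^ (n - k)) = (\<Sum>k\<le>n. (- 1) ^ k * ?c k * t ^ (n - k))" for t
    using prod_diff_elem[of "{1..n}" t x] pt[of t] by (simp add: poly_prod)
  have "elem {1..n} x j = ?c j" for j
  proof (cases "j \<le> n")
    case True
    show ?thesis
      by (rule signed_coeffs_unique[where T = UNIV and a = "elem {1..n} x" and b = ?c, OF e infinite_UNIV_char_0 True])
  qed (simp add: elem_large welem_large)
  then show ?thesis by (rule that) (simp add: x_def)
qed

subsection \<open>The average\<close>

text \<open>Variables 1, ..., n are the y and variables n + 1, ..., 2n the r; this is e_k(x) as a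
  polynomial in both.\<close>

abbreviation ehat :: "nat => nat => cpoly" where
  "ehat n \<equiv> welem {1..n} Var (\<lambda>i. Var (n + i))"

definition xsub :: "nat => cpoly => cpoly" where
  "xsub n F = insertion Const (ehat n) F"

lemma xsub_hom: "semiring_hom (xsub n)" unfolding xsub_def by (rule insertion_Const_hom)

lemma xsub_add: "xsub n (F + G) = xsub n F + xsub n G"
  and xsub_mult: "xsub n (F * G) = xsub n F * xsub n G"
  and xsub_0 [simp]: "xsub n 0 = 0" and xsub_1 [simp]: "xsub n 1 = 1"
  and xsub_sum: "xsub n (sum f A) = (\<Sum>a\<in>A. xsub n (f a))"
  and xsub_prod: "xsub n (prod f A) = (\<Prod>a\<in>A. xsub n (f a))"
  and xsub_power: "xsub n (F ^ k) = xsub n F ^ k"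
  and xsub_diff: "xsub n (F - G) = xsub n F - xsub n G" using xsub_hom[of n] by (auto simp: hom_simps hom_diff)

lemma xsub_Const [simp]: "xsub n (Const c) = Const c" and xsub_Var [simp]: "xsub n (Var k) = ehat n k"
  by (simp_all add: xsub_def insertion_Const_Const
      insertion_Const_Var)

lemma eval_xsub_roots:
  assumes "\<And>k. elem {1..n} x k = welem {1..n} v (\<lambda>i. v (n + i)) k"
  shows "eval v (xsub n F) = eval x (esub n F)" unfolding xsub_def esub_def eval_insertion
  by (simp add: welem_hom[OF eval_hom] eval_elem assms)

text \<open>Every complex point (y, r) comes from some x by \<open>welem_roots\<close>, so a
  relation among the e_k persists after substitution of the \<open>ehat\<close>. This makes
  \<open>Qalg\<close> independent of the chosen representation.\<close>

lemma xsub_eq_0: "esub n F = 0 ==> xsub n F = 0"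
proof (rule mpoly_eqI)
  fix v :: "nat => complex" assume "esub n F = 0"
  obtain x where "\<And>k. elem {1..n} x k = welem {1..n} v (\<lambda>i. v (n + i)) k"
    by (rule welem_roots[of "Suc n" n v "\<lambda>i. v (n + i)"]) auto
  from eval_xsub_roots[OF this, of F] show "eval v (xsub n F) = eval v 0" by (simp add: \<open>esub n F = 0\<close>)
qed

lemma xsub_cong: "esub n F = esub n G ==> xsub n F = xsub n G"
  using xsub_eq_0[of n "F - G"] by (simp add: xsub_diff hom_diff[OF esub_hom])

definition rdeg :: "nat => expo => nat" where
  "rdeg n m = (\<Sum>i=1..n. lk m (n + i))"

text \<open>The moments of the symmetric Dirichlet distribution with parameter g.\<close>

definition mom :: "nat => real => expo => complex" where
  "mom n g m = (\<Prod>i=1..n. pochhammer (of_real g) (lk m (n + i))) / pochhammer (of_real (real n * g)) (rdeg n m)"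

definition ypart :: "nat => expo => expo" where
  "ypart n m = (\<Sum>i=1..n. sg i (lk m i))"

lemma lookup_ypart: "lk (ypart n m) i = (if i \<in> {1..n} then lk m i else 0)"
  unfolding ypart_def lookup_sum by (simp add: lookup_single when_def)

lemma ypart_add: "ypart n (a + b) = ypart n a + ypart n b" by (rule poly_mapping_eqI) (simp add: lookup_ypart lookup_add)

text \<open>The average over r on the simplex Sum r_i = z - 1, with y kept as variables: a monomial
  of degree d in r contributes (z - 1)^d times its moment on the unit simplex.\<close>

definition EE :: "nat => real => complex => cpoly => cpoly" where
  "EE n g z p = (\<Sum>m\<in>ky p. sg (ypart n m) (lk p m * ((z - 1) ^ rdeg n m * mom n g m)))"

text \<open>The same average with a number as value. Exponents of y are disregarded; in use the y
  have already been replaced by numbers.\<close>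

definition MM :: "nat => real => complex => cpoly => complex" where
  "MM n g z p = (\<Sum>m\<in>ky p. lk p m * ((z - 1) ^ rdeg n m * mom n g m))"

lemma EE_superset: "finite M ==> ky p \<subseteq> M ==> EE n g z p = (\<Sum>m\<in>M. sg (ypart n m) (lk p m * ((z - 1) ^ rdeg n m * mom n g m)))"
  unfolding EE_def by (rule sum.mono_neutral_left) (auto simp: in_keys_iff)

lemma MM_superset: "finite M ==> ky p \<subseteq> M ==> MM n g z p = (\<Sum>m\<in>M. lk p m * ((z - 1) ^ rdeg n m * mom n g m))"
  unfolding MM_def by (rule sum.mono_neutral_left) (auto simp: in_keys_iff)

lemma EE_add: "EE n g z (p + q) = EE n g z p + EE n g z q"
proof -
  let ?M = "ky p \<union> ky q"
  have "EE n g z (p + q) = (\<Sum>m\<in>?M. sg (ypart n m) (lk (p + q) m * ((z - 1) ^ rdeg n m * mom n g m)))"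
    by (rule EE_superset) (use keys_add[of p q] in auto)
  then show ?thesis by (simp add: EE_superset[of ?M] lookup_add distrib_right single_add sum.distrib)
qed

lemma MM_add: "MM n g z (p + q) = MM n g z p + MM n g z q"
proof -
  let ?M = "ky p \<union> ky q"
  have "MM n g z (p + q) = (\<Sum>m\<in>?M. lk (p + q) m * ((z - 1) ^ rdeg n m * mom n g m))"
    by (rule MM_superset) (use keys_add[of p q] in auto)
  then show ?thesis by (simp add: MM_superset[of ?M] lookup_add distrib_right sum.distrib)
qed

lemma EE_0 [simp]: "EE n g z 0 = 0" and MM_0 [simp]: "MM n g z 0 = 0" by (simp_all add: EE_def MM_def)

lemma EE_single: "EE n g z (sg m a) = sg (ypart n m) (a * ((z - 1) ^ rdeg n m * mom n g m))"
  by (subst EE_superset[of "{m}"]) auto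

lemma MM_single: "MM n g z (sg m a) = a * ((z - 1) ^ rdeg n m * mom n g m)" by (subst MM_superset[of "{m}"]) auto

lemma EE_Const_mult: "EE n g z (Const c * p) = Const c * EE n g z p" by (induction p rule: mpoly_induct)
    (auto simp: distrib_left EE_add EE_single Const_def mult_single mult.assoc)

lemma MM_Const_mult: "MM n g z (Const c * p) = c * MM n g z p" by (induction p rule: mpoly_induct)
    (auto simp: distrib_left MM_add MM_single Const_def mult_single mult.assoc)

lemma EE_sum: "EE n g z (sum f A) = (\<Sum>a\<in>A. EE n g z (f a))"
  by (induction A rule: infinite_finite_induct) (auto simp: EE_add)

lemma MM_sum: "MM n g z (sum f A) = (\<Sum>a\<in>A. MM n g z (f a))"
  by (induction A rule: infinite_finite_induct) (auto simp: MM_add)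

lemma EE_theta:
  assumes "i \<in> {1..n}" shows "EE n g z (theta i p) = theta i (EE n g z p)" by (induction p rule: mpoly_induct)
    (use assms in \<open>auto simp: theta_add EE_add theta_single EE_single lookup_ypart mult.assoc\<close>)

section \<open>Specialisation of y, and the algebraic form of the Q-operator\<close>

definition suby :: "nat => (nat => complex) => cpoly => cpoly" where
  "suby n y p = insertion Const (\<lambda>i. if i \<in> {1..n} then Const (y i) else Var i) p"

lemma suby_hom: "semiring_hom (suby n y)" unfolding suby_def by (rule insertion_Const_hom)

lemma suby_add: "suby n y (p + q) = suby n y p + suby n y q"
  and suby_mult: "suby n y (p * q) = suby n y p * suby n y q"
  and suby_0 [simp]: "suby n y 0 = 0" and suby_1 [simp]: "suby n y 1 = 1"
  and suby_diff: "suby n y (p - q) = suby n y p - suby n y q"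
  and suby_sum: "suby n y (sum f A) = (\<Sum>a\<in>A. suby n y (f a))" using suby_hom[of n y]
  by (auto simp: semiring_hom.hadd semiring_hom.hmult semiring_hom.hsum
      semiring_hom.h0 semiring_hom.h1 hom_diff)

lemma suby_Const [simp]: "suby n y (Const c) = Const c" by (simp add: suby_def insertion_Const_Const)

lemma suby_Var: "suby n y (Var i) = (if i \<in> {1..n} then Const (y i) else Var i)" by (simp add: suby_def insertion_Const_Var)

lemma eval_suby: "eval v (suby n y p) = eval (\<lambda>i. if i \<in> {1..n} then y i else v i) p"
  unfolding suby_def eval_insertion by (rule arg_cong[of _ _ "\<lambda>v. eval v p"]) auto

text \<open>Moments see only the r-part of an exponent, so inserting numbers for y commutes with
  averaging.\<close>

lemma eval_EE: "eval y (EE n g z p) = MM n g z (suby n y p)"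
proof (induction p rule: mpoly_induct)
  case (add m a p)
  define m' where "m' = m - ypart n m"
  have lm': "lk m' i = (if i \<in> {1..n} then 0 else lk m i)" for i by (auto simp: m'_def lookup_minus lookup_ypart)
  have m: "m = ypart n m + m'" by (rule poly_mapping_eqI) (auto simp: lookup_add lookup_ypart lm')
  have ky: "ky (ypart n m) \<subseteq> {1..n}" "ky m' \<inter> {1..n} = {}" by (auto simp: in_keys_iff lookup_ypart lm' split: if_splits)
  let ?\<sigma> = "\<lambda>i. if i \<in> {1..n} then Const (y i) else Var i :: cpoly"
  have "mon ?\<sigma> (ypart n m) = mon (\<lambda>i. Const (y i)) (ypart n m)" unfolding mon_def by (rule prod.cong) (use ky in auto)
  also have "... = Const (mon y (ypart n m))"
    by (simp add: mon_def semiring_hom.hprod[OF Const_hom] semiring_hom.hpower[OF Const_hom])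
  finally have 1: "mon ?\<sigma> (ypart n m) = Const (mon y (ypart n m))" .
  have 2: "mon ?\<sigma> m' = mon Var m'" unfolding mon_def by (rule prod.cong) (use ky in auto)
  have "mon ?\<sigma> m = Const (mon y (ypart n m)) * mon Var m'" by (subst m) (simp only: mon_add 1 2)
  then have "suby n y (sg m a) = sg m' (a * mon y (ypart n m))"
    unfolding suby_def insertion_Const_single by (simp add: single_conv_mon Const_mult mult.assoc)
  moreover have "rdeg n m' = rdeg n m" "mom n g m' = mom n g m" by (auto simp: rdeg_def mom_def lm')
  ultimately have "eval y (EE n g z (sg m a)) = MM n g z (suby n y (sg m a))"
    by (simp add: EE_single eval_single MM_single mult_ac)
  with add show ?case by (simp add: EE_add eval_add suby_add MM_add)
qed simp

text \<open>Any representation of f by the e_k gives the same result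
  (\<open>Qalg_esub\<close>).\<close>

definition Qalg :: "nat => real => complex => cpoly => cpoly" where
  "Qalg n g z f = EE n g z (xsub n (SOME F. f = esub n F))"

lemma Qalg_esub: "Qalg n g z (esub n F) = EE n g z (xsub n F)"
proof -
  have "esub n F = esub n (SOME G. esub n F = esub n G)" by (rule someI[of _ F]) (rule refl)
  then show ?thesis unfolding Qalg_def by (metis xsub_cong)
qed

lemma lin_op_Qalg: "lin_op n (Qalg n g z)" unfolding lin_op_def
proof (intro conjI ballI allI)
  fix p q assume "p \<in> sym_polys n" "q \<in> sym_polys n"
  then obtain F G where "p = esub n F" "q = esub n G" by (metis sym_polys_esub)
  then show "Qalg n g z (p + q) = Qalg n g z p + Qalg n g z q" by (simp add: Qalg_esub xsub_add EE_add flip: esub_add)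
next
  fix c p assume "p \<in> sym_polys n"
  then obtain F where F: "p = esub n F" by (metis sym_polys_esub)
  have "Const c * p = esub n (Const c * F)" by (simp add: F esub_mult)
  then show "Qalg n g z (Const c * p) = Const c * Qalg n g z p" by (simp add: F Qalg_esub xsub_mult EE_Const_mult)
qed

text \<open>Permutes the pairs (y_i, r_i). The moments are symmetric in r, so averaging turns
  invariance under this action into symmetry in y.\<close>

definition dbl :: "nat => (nat => nat) => nat => nat" where
  "dbl n \<pi> i = (if i \<in> {1..n} then \<pi> i else if i \<in> {n+1..n+n} then n + \<pi> (i - n) else i)"

lemma dbl_inverse:
  assumes "\<pi> permutes {1..n}" shows "dbl n (inv \<pi>) (dbl n \<pi> i) = i" "dbl n \<pi> (dbl n (inv \<pi>) i) = i"
proof -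
  have in1: "\<pi> i \<in> {1..n}" "inv \<pi> i \<in> {1..n}" if "i \<in> {1..n}" for i
    using that permutes_in_image[OF assms] permutes_in_image[OF permutes_inv[OF assms]] by metis+
  consider "i \<in> {1..n}" | "i \<in> {n+1..n+n}" | "i \<notin> {1..n}" "i \<notin> {n+1..n+n}" by blast
  then have "dbl n (inv \<pi>) (dbl n \<pi> i) = i \<and> dbl n \<pi> (dbl n (inv \<pi>) i) = i"
  proof cases
    case 2
    then have j: "i - n \<in> {1..n}" by auto
    have "n + \<pi> (i - n) \<notin> {1..n}" "n + \<pi> (i - n) \<in> {n+1..n+n}" "n + inv \<pi> (i - n) \<notin> {1..n}" "n + inv \<pi> (i - n) \<in> {n+1..n+n}"
      using in1[OF j] by auto
    moreover have "i \<notin> {1..n}" using 2 by auto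
    ultimately show ?thesis using 2 by (auto simp: dbl_def permutes_inverses[OF assms])
  qed (use in1 in \<open>auto simp: dbl_def permutes_inverses[OF assms]\<close>)
  then show "dbl n (inv \<pi>) (dbl n \<pi> i) = i" "dbl n \<pi> (dbl n (inv \<pi>) i) = i" by auto
qed

lemma bij_dbl: "\<pi> permutes {1..n} ==> bij (dbl n \<pi>)"
  by (rule bij_betw_byWitness[where f' = "dbl n (inv \<pi>)"]) (auto simp: dbl_inverse)

lemma inv_dbl: "\<pi> permutes {1..n} ==> inv (dbl n \<pi>) = dbl n (inv \<pi>)"
  by (rule inv_unique_comp) (auto simp: fun_eq_iff dbl_inverse)

lemma EE_pm_dbl:
  assumes \<pi>: "\<pi> permutes {1..n}"
  shows "EE n g z (pm (dbl n \<pi>) p) = pm \<pi> (EE n g z p)"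
proof (induction p rule: mpoly_induct)
  case (add m a p)
  let ?m = "mk (inv (dbl n \<pi>)) m"
  have \<pi>': "inv \<pi> permutes {1..n}" by (rule permutes_inv[OF \<pi>])
  have lm: "lk ?m i = lk m (dbl n (inv \<pi>) i)" for i
    using bij_dbl[OF \<pi>'] by (simp add: inv_dbl[OF \<pi>] lookup_map_key bij_is_inj)
  have in1: "inv \<pi> i \<in> {1..n} \<longleftrightarrow> i \<in> {1..n}" for i by (rule permutes_in_image[OF \<pi>'])
  have lr: "lk ?m (n + i) = lk m (n + inv \<pi> i)" if "i \<in> {1..n}" for i using that by (auto simp: lm dbl_def)
  have "rdeg n ?m = rdeg n m" unfolding rdeg_def using sum.permute[OF \<pi>', of "\<lambda>i. lk m (n + i)"] by (simp add: lr comp_def)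
  moreover have "(\<Prod>i=1..n. pochhammer (complex_of_real g) (lk ?m (n + i))) = (\<Prod>i=1..n. pochhammer (complex_of_real g) (lk m (n + i)))"
    using prod.permute[OF \<pi>', of "\<lambda>i. pochhammer (complex_of_real g) (lk m (n + i))"] by (simp add: lr comp_def)
  moreover have "ypart n ?m = mk (inv \<pi>) (ypart n m)"
  proof (rule poly_mapping_eqI)
    fix i
    show "lk (ypart n ?m) i = lk (mk (inv \<pi>) (ypart n m)) i"
      using in1[of i] by (auto simp: lookup_map_key permutes_inj[OF \<pi>'] lookup_ypart lm dbl_def)
  qed
  ultimately have "EE n g z (pm (dbl n \<pi>) (sg m a)) = pm \<pi> (EE n g z (sg m a))"
    by (simp add: pm_single[OF bij_dbl[OF \<pi>]] pm_single[OF permutes_bij[OF \<pi>]] EE_single mom_def)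
  with add show ?case by (simp add: pm_add EE_add)
qed simp

lemma pm_dbl_ehat:
  assumes \<pi>: "\<pi> permutes {1..n}" shows "pm (dbl n \<pi>) (ehat n k) = ehat n k"
proof -
  have inj: "inj_on \<pi> I" for I using permutes_inj[OF \<pi>] inj_on_subset by blast
  have "pm (dbl n \<pi>) (ehat n k) = welem {1..n} (\<lambda>i. Var (\<pi> i)) (\<lambda>i. Var (n + \<pi> i)) k"
    unfolding welem_hom[OF pm_hom] by (rule welem_cong) (auto simp: dbl_def)
  also have "... = (\<Sum>I | I \<subseteq> {1..n} \<and> card I = k. (\<Prod>i\<in>\<pi> ` I. Var i) * (1 + (\<Sum>i\<in>\<pi> ` I. Var (n + i))))"
    by (simp add: welem_def prod.reindex[OF inj] sum.reindex[OF inj])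
  finally show ?thesis
    unfolding sum_image_subsets[OF inj, of "\<lambda>I. (\<Prod>i\<in>I. Var i) * (1 + (\<Sum>i\<in>I. Var (n + i))) :: cpoly", symmetric]
      permutes_image[OF \<pi>] by (simp only: welem_def)
qed

lemma keys_EE: "ky (EE n g z p) \<subseteq> ypart n ` ky p"
  unfolding EE_def by (rule order_trans[OF Poly_Mapping.keys_sum]) (auto split: if_splits)

lemma EE_xsub_sym: "EE n g z (xsub n F) \<in> sym_polys n" unfolding sym_polys_pm
proof (intro CollectI conjI allI impI)
  have "ky (ypart n m) \<subseteq> {1..n}" for m by (auto simp: in_keys_iff lookup_ypart split: if_splits)
  then show "vars (EE n g z (xsub n F)) \<subseteq> {1..n}" using keys_EE by (fastforce simp: vars_def)
  fix \<pi> assume \<pi>: "\<pi> permutes {1..n}"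
  have "pm (dbl n \<pi>) (xsub n F) = xsub n F"
    unfolding xsub_def hom_insertion[OF Const_hom pm_hom] pm_Const by (simp add: pm_dbl_ehat[OF \<pi>])
  then show "pm \<pi> (EE n g z (xsub n F)) = EE n g z (xsub n F)" by (metis EE_pm_dbl[OF \<pi>])
qed

lemma Qalg_sym: "p \<in> sym_polys n ==> Qalg n g z p \<in> sym_polys n" by (metis EE_xsub_sym Qalg_esub sym_polys_esub)

definition yhull :: "nat => expo => cpoly => bool" where
  "yhull n lam p \<longleftrightarrow> (\<forall>m\<in>ky p. ypart n m \<in> dhull n lam)"

lemma yhull_mult: "yhull n a p ==> yhull n b q ==> yhull n (a + b) (p * q)" unfolding yhull_def
proof
  fix m assume *: "\<forall>m\<in>ky p. ypart n m \<in> dhull n a" "\<forall>m\<in>ky q. ypart n m \<in> dhull n b" "m \<in> ky (p * q)"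
  then obtain k l where "k \<in> ky p" "l \<in> ky q" "m = k + l" using keys_mult[of p q] by auto
  with * show "ypart n m \<in> dhull n (a + b)" by (simp add: ypart_add hull_add)
qed

lemma yhull_1: "yhull n 0 1" by (simp add: yhull_def ypart_def zero_in_hull)

lemma yhull_prod: "(\<And>a. a \<in> A ==> yhull n (m a) (f a)) ==> yhull n (sum m A) (prod f A)"
  by (induction A rule: infinite_finite_induct) (auto simp: yhull_1 yhull_mult)

lemma yhull_ehat: "yhull n (col k) (ehat n k)" unfolding yhull_def
proof
  fix m assume "m \<in> ky (ehat n k)"
  then have "m \<in> (\<Union>I\<in>{I. I \<subseteq> {1..n} \<and> card I = k}. ky ((\<Prod>i\<in>I. Var i) * (1 + (\<Sum>i\<in>I. Var (n + i))) :: cpoly))"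
    unfolding welem_def by (rule subsetD[OF Poly_Mapping.keys_sum])
  then obtain I where I: "I \<subseteq> {1..n}" "card I = k" "m \<in> ky ((\<Prod>i\<in>I. Var i) * (1 + (\<Sum>i\<in>I. Var (n + i))) :: cpoly)" by blast
  have fin: "finite I" using I finite_subset by blast
  define s where "s = (\<Sum>i\<in>I. sg i (1 :: nat))"
  obtain b where b: "b \<in> ky (1 + (\<Sum>i\<in>I. Var (n + i)) :: cpoly)" "m = s + b"
    using I(3) keys_mult[of "\<Prod>i\<in>I. Var i :: cpoly"] by (auto simp: prod_Var_set[OF fin] s_def)
  have "b \<in> ky (1 :: cpoly) \<union> (\<Union>i\<in>I. ky (Var (n + i) :: cpoly))"
    using b(1) keys_add[of "1 :: cpoly"] Poly_Mapping.keys_sum[of "\<lambda>i. Var (n + i) :: cpoly" I] by blast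
  then have "b = 0 \<or> (\<exists>i\<in>I. b = sg (n + i) 1)" by (auto simp: Var_def)
  then have "ypart n b = 0" using I(1) by (auto intro!: poly_mapping_eqI simp: lookup_ypart lookup_single when_def)
  moreover have "ypart n s = s"
  proof (rule poly_mapping_eqI)
    fix i
    have "lk s i = (if i \<in> I then 1 else 0)" unfolding s_def lookup_sum using fin by (simp add: lookup_single when_def)
    then show "lk (ypart n s) i = lk s i" using I(1) by (auto simp: lookup_ypart)
  qed
  ultimately show "ypart n m \<in> dhull n (col k)" using subset_hull[OF I(1,2)] by (simp add: b(2) ypart_add s_def)
qed

text \<open>The y-exponents of \<open>ehat n k\<close> are those of e_k and averaging leaves them
  unchanged, so the hull bound for products of e_k is inherited.\<close>

lemma Qalg_span:
  assumes U: "downset n U" and p: "p \<in> sym_span n U"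
  shows "Qalg n g z p \<in> sym_span n U"
proof -
  obtain c where c: "p = esub n (\<Sum>mu\<in>U. Const (c mu) * emon n mu)" using sym_span_esub[OF U p] .
  have E: "EE n g z (xsub n (emon n mu)) \<in> sym_span n (down n mu)" if mu: "mu \<in> partitions n" for mu
  proof -
    have "yhull n (\<Sum>_<lk mu r - lk mu (Suc r). col r) (ehat n r ^ (lk mu r - lk mu (Suc r)))" if "r \<in> {1..n}" for r
      using yhull_prod[of "{..<lk mu r - lk mu (Suc r)}" n "\<lambda>_. col r" "\<lambda>_. ehat n r"] yhull_ehat[of n r] that by simp
    then have "yhull n (\<Sum>r=1..n. \<Sum>_<lk mu r - lk mu (Suc r). col r) (\<Prod>r=1..n. ehat n r ^ (lk mu r - lk mu (Suc r)))"
      by (rule yhull_prod)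
    then have "yhull n mu (xsub n (emon n mu))" unfolding partition_cols[OF mu] emon_def xsub_prod xsub_power xsub_Var .
    then have "ky (EE n g z (xsub n (emon n mu))) \<subseteq> dhull n mu" using keys_EE unfolding yhull_def by blast
    then show ?thesis by (simp add: sym_span_down_iff[OF mu] EE_xsub_sym)
  qed
  have Q: "Qalg n g z p = (\<Sum>mu\<in>U. Const (c mu) * EE n g z (xsub n (emon n mu)))"
    by (simp add: c Qalg_esub xsub_sum xsub_mult EE_sum EE_Const_mult)
  have "EE n g z (xsub n (emon n mu)) \<in> sym_span n U" if "mu \<in> U" for mu
  proof (rule sym_span_mono[OF E])
    show "mu \<in> partitions n" "down n mu \<subseteq> U" using that U by (auto simp: downset_def)
  qed
  then show ?thesis unfolding Q by (intro sym_span_sum sym_span_Const_mult)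
qed

lemma MM_eq_0: "suby n y p = 0 ==> eval y (EE n g z p) = 0" by (simp add: eval_EE)

theorem Qalg_restrict:
  assumes f: "f \<in> sym_polys n" and k: "1 \<le> k" "k \<le> n" and zero: "restrict_ones k f = 0"
  shows "restrict_ones (k - 1) (Qalg n g z f) = 0"
proof (rule mpoly_eqI)
  fix v :: "nat => complex"
  define y where "y i = (if i \<le> k - 1 then v i else 1)" for i
  have ev: "eval v (restrict_ones j q) = eval (\<lambda>i. if i \<le> j then v i else 1) q" for v j q
    unfolding restrict_ones_def eval_insertion by (rule arg_cong[of _ _ "\<lambda>v. eval v q"]) auto
  obtain F where F: "f = esub n F" using sym_polys_esub[OF f] by blast
  \<comment> \<open>The integrand itself vanishes identically in r: at the roots x, whose
    coordinates above k are 1, f equals its restriction.\<close>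
  have "suby n y (xsub n F) = 0"
  proof (rule mpoly_eqI)
    fix r :: "nat => complex"
    define u where "u i = (if i \<in> {1..n} then y i else r i)" for i
    have "u i = 1" if "i \<in> {k..n}" for i using that k by (auto simp: u_def y_def)
    then obtain x where x: "\<And>j. elem {1..n} x j = welem {1..n} u (\<lambda>i. u (n + i)) j" "\<And>i. i > k ==> x i = 1"
      using welem_roots[OF k(1), of n u] by blast
    have "eval r (suby n y (xsub n F)) = eval u (xsub n F)" unfolding eval_suby u_def ..
    also have "... = eval x f" unfolding F by (rule eval_xsub_roots[OF x(1)])
    also have "... = eval x (restrict_ones k f)"
      unfolding ev by (rule arg_cong[of _ _ "\<lambda>v. eval v f"]) (auto simp: fun_eq_iff x(2))
    finally show "eval r (suby n y (xsub n F)) = eval r 0" by (simp add: zero)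
  qed
  then have "eval y (Qalg n g z f) = 0" unfolding F Qalg_esub by (rule MM_eq_0)
  moreover have "eval v (restrict_ones (k - 1) (Qalg n g z f)) = eval y (Qalg n g z f)" unfolding ev y_def ..
  ultimately show "eval v (restrict_ones (k - 1) (Qalg n g z f)) = eval v 0" by simp
qed

subsection \<open>Commutation with the Laplace--Beltrami operator\<close>

text \<open>e_(k-1) in the variables other than i and j, with e_(-1) = 0: the coefficient of y_j in
  e_k over A - {i}.\<close>

definition eps :: "nat set => (nat => 'a::comm_semiring_1) => nat => nat => nat => 'a" where
  "eps A y i j k = (case k of 0 => 0 | Suc k' => elem (A - {i} - {j}) y k')"

lemma eps_0 [simp]: "eps A y i j 0 = 0" and eps_Suc [simp]: "eps A y i j (Suc k) = elem (A - {i} - {j}) y k"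
  by (simp_all add: eps_def)

lemma eps_commute: "eps A y i j k = eps A y j i k" by (cases k) (simp_all add: Diff_insert2[symmetric] insert_commute)

lemma elem_remove_Suc:
  assumes "finite A" "i \<in> A"
  shows "elem A x (Suc k) = elem (A - {i}) x (Suc k) + x i * elem (A - {i}) x k"
  using elem_insert_Suc[of "A - {i}" i x k] assms by (simp add: insert_absorb)

lemma elem_remove_eps:
  assumes "finite A" "i \<in> A" "j \<in> A" "i \<noteq> j"
  shows "elem (A - {i}) y k = elem (A - {i} - {j}) y k + y j * eps A y i j k"
  using assms elem_remove_Suc[of "A - {i}" j y] by (cases k) auto

lemma welem_remove_eps:
  fixes y r :: "nat => 'a::comm_ring_1"
  assumes "finite A" "i \<in> A"
  shows "welem (A - {i}) y r k = elem (A - {i}) y k + (\<Sum>j\<in>A - {i}. r j * (y j * eps A y i j k))"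
  using assms by (cases k) (simp_all add: welem_Suc)

text \<open>\<open>a i j\<close> stands for y_i / (y_i - y_j) and is given by an equation because
  the identity is applied in a polynomial ring. After multiplication by y_i - y_j both sides are
  expanded by splitting off i and j.\<close>

lemma welem_pair:
  fixes y r :: "nat => 'a::idom" and a :: "nat => nat => 'a" and k :: nat
  assumes A: "finite A" "i \<in> A" "j \<in> A" "i \<noteq> j" and ne: "y i \<noteq> y j"
    and a: "a i j * (y i - y j) = y i" "a j i * (y j - y i) = y j"
  defines "W \<equiv> welem A y r k"
  shows "a i j * (W - welem (A - {i}) y r k) + a j i * (W - welem (A - {j}) y r k)
      + a i j * y j * (r j - r i) * eps A y i j k = W - welem (A - {i} - {j}) y r k"
proof (cases k)
  case 0
  then show ?thesis using A by (simp add: W_def)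
next
  case (Suc k')
  let ?B = "A - {i} - {j}"
  define b0 b1 e1 where "b0 = welem ?B y r k" "b1 = welem ?B y r k'" "e1 = elem ?B y k'"
  define b2 e2 where "b2 = (case k' of 0 => 0 | Suc l => welem ?B y r l)" "e2 = (case k' of 0 => 0 | Suc l => elem ?B y l)"
  have Bji: "A - {j} - {i} = ?B" by auto
  have fin: "finite (A - {i})" "finite (A - {j})" "j \<in> A - {i}" "i \<in> A - {j}" using A by auto
  have wi: "welem (A - {i}) y r k = b0 + y j * (b1 + r j * e1)" unfolding Suc welem_remove[OF fin(1,3)] b0_b1_e1_def by simp
  have wj: "welem (A - {j}) y r k = b0 + y i * (b1 + r i * e1)"
    unfolding Suc welem_remove[OF fin(2,4)] Bji b0_b1_e1_def by simp
  have w': "welem (A - {i}) y r k' = b1 + y j * (b2 + r j * e2)" "elem (A - {i}) y k' = e1 + y j * e2"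
    using welem_remove[OF fin(1,3), of y r] elem_remove_Suc[OF fin(1,3), of y] A
    unfolding b0_b1_e1_def b2_e2_def by (cases k'; simp)+
  have W: "W = b0 + y j * (b1 + r j * e1) + y i * (b1 + y j * (b2 + r j * e2) + r i * (e1 + y j * e2))"
    unfolding W_def Suc welem_remove[OF A(1,2)] w' using wi by (simp add: Suc)
  have a2: "a j i * (y i - y j) = - y j" using a(2) by (simp add: algebra_simps)
  let ?L = "a i j * (W - welem (A - {i}) y r k) + a j i * (W - welem (A - {j}) y r k) + a i j * y j * (r j - r i) * e1"
  have "(y i - y j) * ?L = (a i j * (y i - y j)) * (W - welem (A - {i}) y r k) + (a j i * (y i - y j)) * (W - welem (A - {j}) y r k)
      + (a i j * (y i - y j)) * y j * (r j - r i) * e1" by (simp add: algebra_simps)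
  also have "... = y i * (W - welem (A - {i}) y r k) - y j * (W - welem (A - {j}) y r k) + y i * y j * (r j - r i) * e1"
    unfolding a(1) a2 by simp
  also have "... = (y i - y j) * (W - b0)" unfolding wi wj W by (simp add: algebra_simps)
  finally have "?L = W - b0" using ne by simp
  then show ?thesis by (simp add: Suc b0_b1_e1_def)
qed

text \<open>The sum of \<open>welem_pair\<close> over ordered pairs. On the right, counting subsets
  that avoid two indices gives the factor (N - K) (N - K - 1).\<close>

lemma welem_laplace:
  fixes y r :: "nat => 'a::idom" and a :: "nat => nat => 'a" and k :: nat
  assumes A: "finite A" and ne: "\<And>i j. i \<in> A ==> j \<in> A ==> i \<noteq> j ==> y i \<noteq> y j"
    and a: "\<And>i j. i \<in> A ==> j \<in> A ==> i \<noteq> j ==> a i j * (y i - y j) = y i"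
  defines "W \<equiv> welem A y r k" and "N \<equiv> of_nat (card A)" and "K \<equiv> of_nat k"
  shows "2 * (\<Sum>i\<in>A. \<Sum>j\<in>A - {i}. a i j * (W - welem (A - {i}) y r k)) +
      (\<Sum>i\<in>A. \<Sum>j\<in>A - {i}. a i j * y j * (r j - r i) * eps A y i j k) = (N * (N - 1) - (N - K) * (N - K - 1)) * W"
proof -
  let ?S = "\<lambda>F. \<Sum>i\<in>A. \<Sum>j\<in>A - {i}. F i j :: 'a"
  have N1: "of_nat (card (A - {i})) = N - 1" if "i \<in> A" for i
    using card.remove[OF A that] by (simp add: N_def del: card_Diff_singleton)
  have "?S (\<lambda>i j. a i j * (W - welem (A - {i}) y r k) + a j i * (W - welem (A - {j}) y r k)
      + a i j * y j * (r j - r i) * eps A y i j k) = ?S (\<lambda>i j. W - welem (A - {i} - {j}) y r k)" unfolding W_def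
  proof (intro sum.cong refl)
    fix i j assume ij: "i \<in> A" "j \<in> A - {i}"
    then have "j \<in> A" "i \<noteq> j" "j \<noteq> i" by auto
    with ij show "a i j * (welem A y r k - welem (A - {i}) y r k) + a j i * (welem A y r k - welem (A - {j}) y r k)
      + a i j * y j * (r j - r i) * eps A y i j k = welem A y r k - welem (A - {i} - {j}) y r k"
      by (intro welem_pair A ne a) auto
  qed
  moreover have "?S (\<lambda>i j. a j i * (W - welem (A - {j}) y r k)) = ?S (\<lambda>i j. a i j * (W - welem (A - {i}) y r k))"
    by (rule sum_offdiag_swap[OF A, of "\<lambda>i j. a i j * (W - welem (A - {i}) y r k)"])
  moreover have "?S (\<lambda>i j. W - welem (A - {i} - {j}) y r k) = (N * (N - 1) - (N - K) * (N - K - 1)) * W"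
  proof -
    have "?S (\<lambda>i j. W - welem (A - {i} - {j}) y r k) = (\<Sum>i\<in>A. (N - 1) * W - (N - 1 - K) * welem (A - {i}) y r k)"
    proof (rule sum.cong[OF refl])
      fix i assume i: "i \<in> A"
      have "(\<Sum>j\<in>A - {i}. W - welem (A - {i} - {j}) y r k) = of_nat (card (A - {i})) * W - (of_nat (card (A - {i})) - of_nat k) * welem (A - {i}) y r k"
        using A by (simp only: sum_subtractf sum_constant welem_count[of "A - {i}" y r k] finite_Diff)
      then show "(\<Sum>j\<in>A - {i}. W - welem (A - {i} - {j}) y r k) = (N - 1) * W - (N - 1 - K) * welem (A - {i}) y r k"
        unfolding N1[OF i] K_def .
    qed
    also have "... = N * ((N - 1) * W) - (N - 1 - K) * ((N - K) * W)"
      unfolding sum_subtractf sum_distrib_left[symmetric] welem_count[OF A] by (simp add: N_def K_def W_def)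
    finally show ?thesis by (simp add: algebra_simps)
  qed
  ultimately show ?thesis by (simp add: sum.distrib)
qed

text \<open>The carre du champ of e_k(x) and e_l(x): the first sum stems from derivatives in y, the
  second from the diffusion in r (see \<open>GG_ehat\<close>).\<close>

definition gam :: "nat set => (nat => 'a::comm_ring_1) => (nat => 'a) => nat => nat => 'a" where
  "gam A y r k l = (\<Sum>i\<in>A. (welem A y r k - welem (A - {i}) y r k) * (welem A y r l - welem (A - {i}) y r l))
    + (\<Sum>i\<in>A. \<Sum>j\<in>A - {i}. r i * r j * (y i * y j) * (eps A y i j k * eps A y i j l))"

text \<open>Moving one unit from l to k changes \<open>gam\<close> by products of two
  \<open>welem\<close>: the mixed terms \<open>eps\<close> times \<open>elem\<close> produced by the
  first sum are exactly those lost in the second.\<close>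

lemma gam_Suc:
  fixes y r :: "nat => 'a::comm_ring_1"
  assumes A: "finite A"
  shows "gam A y r (Suc k) l - gam A y r k (Suc l) =
    of_nat (Suc k) * (welem A y r (Suc k) * welem A y r l) - of_nat (Suc l) * (welem A y r k * welem A y r (Suc l))"
proof -
  define W where "W = welem A y r"
  define Wi where "Wi i = welem (A - {i}) y r" for i
  define E where "E i = elem (A - {i}) y" for i
  define Eij where "Eij i j = elem (A - {i} - {j}) y" for i j
  define ep where "ep i j = eps A y i j" for i j
  have rem: "W (Suc k) - Wi i (Suc k) = y i * (Wi i k + r i * E i k)" if "i \<in> A" for i k
    unfolding W_def Wi_def E_def welem_remove[OF A that] by simp
  have tot: "(\<Sum>i\<in>A. y i * (Wi i k + r i * E i k)) = of_nat (Suc k) * W (Suc k)" for k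
  proof -
    have "(\<Sum>i\<in>A. y i * (Wi i k + r i * E i k)) = (\<Sum>i\<in>A. W (Suc k) - Wi i (Suc k))" by (intro sum.cong refl) (simp add: rem)
    also have "... = of_nat (card A) * W (Suc k) - (of_nat (card A) - of_nat (Suc k)) * W (Suc k)"
      unfolding sum_subtractf Wi_def welem_count[OF A] by (simp add: W_def)
    finally show ?thesis by (simp add: algebra_simps)
  qed
  define G1 where "G1 k l = (\<Sum>i\<in>A. (W k - Wi i k) * (W l - Wi i l))" for k l
  define G2 where "G2 k l = (\<Sum>i\<in>A. \<Sum>j\<in>A - {i}. r i * r j * (y i * y j) * (ep i j k * ep i j l))" for k l
  have "G1 (Suc k) l - G1 k (Suc l) = (\<Sum>i\<in>A. y i * (Wi i k + r i * E i k) * W l - W k * (y i * (Wi i l + r i * E i l))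
      + y i * r i * (Wi i k * E i l - E i k * Wi i l))" unfolding G1_def sum_subtractf[symmetric]
    by (intro sum.cong refl) (simp add: rem algebra_simps)
  also have "... = of_nat (Suc k) * W (Suc k) * W l - W k * (of_nat (Suc l) * W (Suc l))
      + (\<Sum>i\<in>A. y i * r i * (Wi i k * E i l - E i k * Wi i l))"
    unfolding sum.distrib sum_subtractf sum_distrib_left[symmetric] sum_distrib_right[symmetric] tot by simp
  also have "(\<Sum>i\<in>A. y i * r i * (Wi i k * E i l - E i k * Wi i l)) =
      (\<Sum>i\<in>A. \<Sum>j\<in>A - {i}. r i * r j * (y i * y j) * (ep i j k * Eij i j l - Eij i j k * ep i j l))"
  proof (intro sum.cong refl)
    fix i assume i: "i \<in> A"
    have Wi: "Wi i k = E i k + (\<Sum>j\<in>A - {i}. r j * (y j * ep i j k))" for k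
      unfolding Wi_def E_def ep_def by (rule welem_remove_eps[OF A i])
    have Ei: "E i k = Eij i j k + y j * ep i j k" if "j \<in> A - {i}" for j k
      unfolding E_def Eij_def ep_def using that i A by (intro elem_remove_eps) auto
    have "y i * r i * (Wi i k * E i l - E i k * Wi i l) =
        (\<Sum>j\<in>A - {i}. y i * r i * (r j * (y j * ep i j k) * E i l - E i k * (r j * (y j * ep i j l))))"
      unfolding Wi by (simp add: algebra_simps sum_distrib_left sum_distrib_right sum_subtractf)
    also have "... = (\<Sum>j\<in>A - {i}. r i * r j * (y i * y j) * (ep i j k * Eij i j l - Eij i j k * ep i j l))"
      by (intro sum.cong refl) (simp add: Ei algebra_simps)
    finally show "y i * r i * (Wi i k * E i l - E i k * Wi i l) =
      (\<Sum>j\<in>A - {i}. r i * r j * (y i * y j) * (ep i j k * Eij i j l - Eij i j k * ep i j l))" .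
  qed
  finally have 1: "G1 (Suc k) l - G1 k (Suc l) = of_nat (Suc k) * W (Suc k) * W l - W k * (of_nat (Suc l) * W (Suc l))
      + (\<Sum>i\<in>A. \<Sum>j\<in>A - {i}. r i * r j * (y i * y j) * (ep i j k * Eij i j l - Eij i j k * ep i j l))" .
  have 2: "G2 (Suc k) l - G2 k (Suc l) = - (\<Sum>i\<in>A. \<Sum>j\<in>A - {i}. r i * r j * (y i * y j) * (ep i j k * Eij i j l - Eij i j k * ep i j l))"
    unfolding G2_def sum_subtractf[symmetric] sum_negf[symmetric]
    by (intro sum.cong refl) (simp add: ep_def Eij_def algebra_simps)
  have "(G1 (Suc k) l + G2 (Suc k) l) - (G1 k (Suc l) + G2 k (Suc l)) = (G1 (Suc k) l - G1 k (Suc l)) + (G2 (Suc k) l - G2 k (Suc l))"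
    by (simp only: add_diff_add)
  also have "... = of_nat (Suc k) * (W (Suc k) * W l) - of_nat (Suc l) * (W k * W (Suc l))"
    unfolding 1 2 by (simp only: add.assoc add.right_inverse add_0_right mult.assoc mult.left_commute[of "W k"])
  finally show ?thesis unfolding gam_def G1_def G2_def W_def Wi_def ep_def .
qed

definition dd :: "nat => nat => nat => cpoly => cpoly" where
  "dd n i j q = mpderiv (n + i) q - mpderiv (n + j) q"

text \<open>The generator of a Jacobi diffusion that preserves \<open>r\<^sub>i + r\<^sub>j\<close>; the Dirichlet distribution is invariant.\<close>

definition TT :: "nat => real => nat => nat => cpoly => cpoly" where
  "TT n g i j q = Var (n + i) * Var (n + j) * dd n i j (dd n i j q) +
     Const (of_real g) * (Var (n + j) - Var (n + i)) * dd n i j q"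

lemma dd_mult: "dd n i j (p * q) = dd n i j p * q + p * dd n i j q" by (simp add: dd_def mpderiv_mult algebra_simps)

lemma mpderiv_uminus: "mpderiv i (- p) = - mpderiv i p"
  using mpderiv_add[of i p "- p"] by (simp add: eq_neg_iff_add_eq_0 add.commute)

lemma dd_add: "dd n i j (p + q) = dd n i j p + dd n i j q" by (simp add: dd_def mpderiv_add)

lemma dd_Const [simp]: "dd n i j (Const c) = 0" by (simp add: dd_def)

lemma TT_mult: "TT n g i j (p * q) = p * TT n g i j q + q * TT n g i j p +
    2 * (Var (n + i) * Var (n + j) * (dd n i j p * dd n i j q))" by (simp add: TT_def dd_mult dd_add algebra_simps)

lemma TT_add: "TT n g i j (p + q) = TT n g i j p + TT n g i j q" by (simp add: TT_def dd_add algebra_simps)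

lemma TT_Const [simp]: "TT n g i j (Const c) = 0" using dd_Const[of n i j 0] by (simp add: TT_def)

text \<open>Integration by parts in terms of moments: raising the exponent of r_i multiplies a
  moment by (g + m_i) / (n g + d), with d the degree. On a monomial both sides therefore contain (g
  + m_i) (g + m_j).\<close>

lemma MM_exchange:
  assumes g: "g > 0" and i: "i \<in> {1..n}" and j: "j \<in> {1..n}"
  shows "MM n g z (Var (n + i) * (theta (n + j) h + Const (of_real g) * h)) =
    MM n g z (Var (n + j) * (theta (n + i) h + Const (of_real g) * h))"
proof (induction h rule: mpoly_induct)
  case (add m c h)
  have mom: "mom n g (m + sg (n + i) 1) = (\<Prod>l=1..n. pochhammer (of_real g) (lk m (n + l))) * (of_real g + of_nat (lk m (n + i)))
      / pochhammer (of_real (real n * g)) (Suc (rdeg n m))" "rdeg n (m + sg (n + i) 1) = Suc (rdeg n m)"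
    if "i \<in> {1..n}" for i
  proof -
    have l: "lk (m + sg (n + i) 1) (n + l) = lk m (n + l) + (if l = i then 1 else 0)" for l
      by (simp add: lookup_add lookup_single when_def)
    have "(\<Prod>l=1..n. pochhammer (complex_of_real g) (lk (m + sg (n + i) 1) (n + l))) =
        (\<Prod>l=1..n. pochhammer (complex_of_real g) (lk m (n + l)) * (if l = i then of_real g + of_nat (lk m (n + i)) else 1))"
      unfolding l by (intro prod.cong refl) (simp add: pochhammer_Suc[unfolded Suc_eq_plus1])
    also have "... = (\<Prod>l=1..n. pochhammer (of_real g) (lk m (n + l))) * (of_real g + of_nat (lk m (n + i)))"
      using that by (simp add: prod.distrib)
    moreover show r: "rdeg n (m + sg (n + i) 1) = Suc (rdeg n m)" unfolding rdeg_def l using that by (simp add: sum.distrib)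
    ultimately show "mom n g (m + sg (n + i) 1) = (\<Prod>l=1..n. pochhammer (of_real g) (lk m (n + l))) * (of_real g + of_nat (lk m (n + i)))
      / pochhammer (of_real (real n * g)) (Suc (rdeg n m))" by (simp add: mom_def)
  qed
  have s: "Var (n + i) * (theta (n + j) (sg m c) + Const (of_real g) * sg m c) =
      sg (m + sg (n + i) 1) (c * (of_real g + of_nat (lk m (n + j))))" for i j
    by (simp add: theta_single Const_def Var_def mult_single distrib_left algebra_simps flip: single_add)
  have "MM n g z (Var (n + i) * (theta (n + j) (sg m c) + Const (of_real g) * sg m c)) =
      MM n g z (Var (n + j) * (theta (n + i) (sg m c) + Const (of_real g) * sg m c))"
    unfolding s MM_single mom[OF i] mom[OF j] by (simp add: mult_ac)
  with add show ?case by (simp add: theta_add distrib_left MM_add algebra_simps)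
qed simp

lemma MM_diff: "MM n g z (p - q) = MM n g z p - MM n g z q" using MM_add[of n g z "p - q" q] by simp

text \<open>Written with Euler operators, \<open>TT\<close> contains two terms of the form treated
  by \<open>MM_exchange\<close>, with h the derivative of q in r_i and in r_j. Exchanging the
  indices turns them into the terms that are subtracted.\<close>

lemma MM_TT:
  assumes g: "g > 0" and i: "i \<in> {1..n}" and j: "j \<in> {1..n}" and ij: "i \<noteq> j"
  shows "MM n g z (TT n g i j q) = 0"
proof -
  let ?i = "n + i" and ?j = "n + j" and ?g = "Const (complex_of_real g)"
  have cross: "Var ?i * (Var ?j * mpderiv ?i (mpderiv ?j q)) = theta ?i (theta ?j q)"
    "Var ?i * (Var ?j * mpderiv ?j (mpderiv ?i q)) = theta ?i (theta ?j q)"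
  proof -
    have "Var ?i * (Var ?j * mpderiv ?i (mpderiv ?j q)) = Var ?j * theta ?i (mpderiv ?j q)"
      by (simp add: Var_mpderiv[symmetric] mult.left_commute)
    also have "... = theta ?i (Var ?j * mpderiv ?j q)" using ij by (simp add: theta_mult theta_Var)
    finally show "Var ?i * (Var ?j * mpderiv ?i (mpderiv ?j q)) = theta ?i (theta ?j q)" by (simp add: Var_mpderiv)
    have "Var ?i * (Var ?j * mpderiv ?j (mpderiv ?i q)) = Var ?i * theta ?j (mpderiv ?i q)" by (simp add: Var_mpderiv)
    also have "... = theta ?j (Var ?i * mpderiv ?i q)" using ij by (simp add: theta_mult theta_Var)
    finally show "Var ?i * (Var ?j * mpderiv ?j (mpderiv ?i q)) = theta ?i (theta ?j q)"
      by (simp add: Var_mpderiv theta_commute)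
  qed
  have same: "Var ?i * (Var ?j * mpderiv ?i (mpderiv ?i q)) = Var ?j * theta ?i (mpderiv ?i q)"
    "Var ?i * (Var ?j * mpderiv ?j (mpderiv ?j q)) = Var ?i * theta ?j (mpderiv ?j q)"
    by (simp_all add: Var_mpderiv[symmetric] mult.left_commute)
  have dd2: "dd n i j (dd n i j q) = mpderiv ?i (mpderiv ?i q) - mpderiv ?i (mpderiv ?j q) - mpderiv ?j (mpderiv ?i q) + mpderiv ?j (mpderiv ?j q)"
    unfolding dd_def diff_conv_add_uminus mpderiv_add mpderiv_uminus by simp
  have 1: "TT n g i j q = Var ?j * (theta ?i (mpderiv ?i q) + ?g * mpderiv ?i q) + Var ?i * (theta ?j (mpderiv ?j q) + ?g * mpderiv ?j q)
      - 2 * theta ?i (theta ?j q) - ?g * theta ?i q - ?g * theta ?j q"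
  proof -
    have "Var ?i * Var ?j * dd n i j (dd n i j q) = Var ?j * theta ?i (mpderiv ?i q) + Var ?i * theta ?j (mpderiv ?j q) - 2 * theta ?i (theta ?j q)"
      unfolding dd2 mult.assoc distrib_left right_diff_distrib cross same by (simp add: algebra_simps)
    moreover have "?g * (Var ?j - Var ?i) * dd n i j q = ?g * (Var ?j * mpderiv ?i q) + ?g * (Var ?i * mpderiv ?j q) - ?g * theta ?i q - ?g * theta ?j q"
      unfolding dd_def by (simp add: algebra_simps flip: Var_mpderiv)
    ultimately show ?thesis unfolding TT_def by (simp add: algebra_simps)
  qed
  have 2: "MM n g z (Var ?j * (theta ?i (mpderiv ?i q) + ?g * mpderiv ?i q)) = MM n g z (theta ?i (theta ?j q) + ?g * theta ?i q)"
  proof -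
    have "Var ?i * theta ?j (mpderiv ?i q) = theta ?j (theta ?i q)"
      using ij by (simp add: theta_mult theta_Var flip: Var_mpderiv[of ?i])
    then have "Var ?i * (theta ?j (mpderiv ?i q) + ?g * mpderiv ?i q) = theta ?i (theta ?j q) + ?g * theta ?i q"
      unfolding distrib_left mult.left_commute[of "Var ?i" ?g] Var_mpderiv by (simp only: theta_commute[of ?i])
    then show ?thesis using MM_exchange[OF g j i, of z "mpderiv ?i q"] by simp
  qed
  have 3: "MM n g z (Var ?i * (theta ?j (mpderiv ?j q) + ?g * mpderiv ?j q)) = MM n g z (theta ?i (theta ?j q) + ?g * theta ?j q)"
  proof -
    have "Var ?j * theta ?i (mpderiv ?j q) = theta ?i (theta ?j q)"
      using ij by (simp add: theta_mult theta_Var flip: Var_mpderiv[of ?j])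
    then have "Var ?j * (theta ?i (mpderiv ?j q) + ?g * mpderiv ?j q) = theta ?i (theta ?j q) + ?g * theta ?j q"
      unfolding distrib_left mult.left_commute[of "Var ?j" ?g] Var_mpderiv by simp
    then show ?thesis using MM_exchange[OF g i j, of z "mpderiv ?j q"] by simp
  qed
  show ?thesis unfolding 1 MM_diff MM_add 2 3 mult_2 by simp
qed

section \<open>A diffusion in the pairs (y, r) that averages to the Laplace--Beltrami
  operator\<close>

definition distinct_pts :: "nat => (nat => complex) => bool" where
  "distinct_pts n y \<longleftrightarrow> (\<forall>i\<in>{1..n}. \<forall>j\<in>{1..n}. i \<noteq> j --> y i \<noteq> y j)"

definition acoef :: "(nat => complex) => nat => nat => complex" where
  "acoef y i j = y i / (y i - y j)"

definition wcoef :: "(nat => complex) => nat => nat => complex" where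
  "wcoef y i j = y i * y j / (y i - y j) ^ 2"

lemma eval_Hop:
  assumes y: "distinct_pts n y" and p: "p \<in> sym_polys n"
  shows "eval y (Hop n g p) = 1 / 2 * (\<Sum>i=1..n. eval y (theta i (theta i p))) +
    of_real g * (\<Sum>i=1..n. \<Sum>j\<in>{1..n} - {i}. acoef y i j * eval y (theta i p))"
proof -
  have V: "eval y (vand n) \<noteq> 0"
  proof
    assume "eval y (vand n) = 0"
    then have "(\<Prod>p\<in>pairs n. y (fst p) - y (snd p)) = 0" by (simp add: vand_pairs eval_prod case_prod_unfold eval_diff)
    then obtain p where p: "p \<in> pairs n" "y (fst p) - y (snd p) = 0" by (auto simp: prod_zero_iff finite_pairs)
    then show False using y by (fastforce simp: pairs_def distinct_pts_def)
  qed
  have t: "eval y (theta k (vand n)) = (\<Sum>j\<in>{1..n} - {k}. acoef y k j) * eval y (vand n)" if "k \<in> {1..n}" for k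
    using theta_vand_field[OF eval_hom _ that, of y] y by (simp add: distinct_pts_def acoef_def)
  have "eval y (vand n) * eval y (Hop n g p) = eval y (Hnum n g p)"
    using vand_vquot[OF antisym_Hnum[OF p], of g] by (simp add: Hop_def flip: eval_mult)
  also have "... = eval y (vand n) * (1 / 2 * (\<Sum>i=1..n. eval y (theta i (theta i p))) +
    of_real g * (\<Sum>i=1..n. \<Sum>j\<in>{1..n} - {i}. acoef y i j * eval y (theta i p)))"
  proof -
    have "(\<Sum>i=1..n. eval y (theta i (vand n)) * eval y (theta i p)) =
        eval y (vand n) * (\<Sum>i=1..n. \<Sum>j\<in>{1..n} - {i}. acoef y i j * eval y (theta i p))"
      unfolding sum_distrib_left[of "eval y (vand n)"]
      by (intro sum.cong refl) (simp add: t sum_distrib_left sum_distrib_right mult_ac)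
    then show ?thesis by (simp add: Hnum_def eval_add eval_mult eval_sum algebra_simps)
  qed
  finally show ?thesis using V by simp
qed

text \<open>On symmetric polynomials in the pairs \<open>(y\<^sub>i, r\<^sub>i)\<close> this operator has the same average as the
  Laplace--Beltrami operator in y, and it intertwines exactly.\<close>

definition LL :: "nat => real => (nat => complex) => cpoly => cpoly" where
  "LL n g y p = Const (1 / 2) * (\<Sum>i=1..n. suby n y (theta i (theta i p))) +
     Const (of_real g) * (\<Sum>i=1..n. \<Sum>j\<in>{1..n} - {i}. Const (acoef y i j) * suby n y (theta i p)) +
     Const (1 / 2) * (\<Sum>i=1..n. \<Sum>j\<in>{1..n} - {i}. Const (wcoef y i j) * TT n g i j (suby n y p))"

text \<open>The carre du champ of \<open>LL\<close>, that is its defect from the Leibniz rule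
  (\<open>LL_mult\<close>).\<close>

definition GG :: "nat => (nat => complex) => cpoly => cpoly => cpoly" where
  "GG n y p q = (\<Sum>i=1..n. suby n y (theta i p) * suby n y (theta i q)) + (\<Sum>i=1..n. \<Sum>j\<in>{1..n} - {i}. Const (wcoef y i j) *
        (Var (n + i) * Var (n + j) * (dd n i j (suby n y p) * dd n i j (suby n y q))))"

lemma half: "Const (1 / 2) * (2 * f) = (f :: cpoly)"
proof -
  have "Const (1 / 2) * (2 * f) = (Const (1/2) + Const (1/2)) * f" by (simp only: mult_2 distrib_left distrib_right)
  then show ?thesis by (simp flip: Const_add)
qed

lemma LL_mult: "LL n g y (p * q) = suby n y p * LL n g y q + suby n y q * LL n g y p + GG n y p q"
proof -
  have 1: "(\<Sum>i=1..n. suby n y (theta i (theta i (p * q)))) =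
      suby n y p * (\<Sum>i=1..n. suby n y (theta i (theta i q))) + suby n y q * (\<Sum>i=1..n. suby n y (theta i (theta i p))) +
      2 * (\<Sum>i=1..n. suby n y (theta i p) * suby n y (theta i q))" unfolding theta_mult theta_add suby_add suby_mult
    by (simp add: algebra_simps sum.distrib sum_distrib_left)
  have 2: "(\<Sum>i=1..n. \<Sum>j\<in>{1..n} - {i}. Const (acoef y i j) * suby n y (theta i (p * q))) =
      suby n y p * (\<Sum>i=1..n. \<Sum>j\<in>{1..n} - {i}. Const (acoef y i j) * suby n y (theta i q)) +
      suby n y q * (\<Sum>i=1..n. \<Sum>j\<in>{1..n} - {i}. Const (acoef y i j) * suby n y (theta i p))"
    unfolding theta_mult theta_add suby_add suby_mult by (simp add: algebra_simps sum.distrib sum_distrib_left)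
  have 3: "(\<Sum>i=1..n. \<Sum>j\<in>{1..n} - {i}. Const (wcoef y i j) * TT n g i j (suby n y (p * q))) =
      suby n y p * (\<Sum>i=1..n. \<Sum>j\<in>{1..n} - {i}. Const (wcoef y i j) * TT n g i j (suby n y q)) +
      suby n y q * (\<Sum>i=1..n. \<Sum>j\<in>{1..n} - {i}. Const (wcoef y i j) * TT n g i j (suby n y p)) +
      2 * (\<Sum>i=1..n. \<Sum>j\<in>{1..n} - {i}. Const (wcoef y i j) *
        (Var (n + i) * Var (n + j) * (dd n i j (suby n y p) * dd n i j (suby n y q))))" unfolding suby_mult TT_mult
    by (simp add: algebra_simps sum.distrib sum_distrib_left)
  show ?thesis unfolding LL_def GG_def 1 2 3 distrib_left half by (simp add: algebra_simps)
qed

lemma LL_add: "LL n g y (p + q) = LL n g y p + LL n g y q"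
  unfolding LL_def theta_add suby_add TT_add by (simp add: distrib_left sum.distrib)

lemma LL_Const: "LL n g y (Const c) = 0" by (simp add: LL_def)

lemma GG_add: "GG n y (p + q) s = GG n y p s + GG n y q s"
  unfolding GG_def theta_add suby_add dd_add by (simp add: distrib_left distrib_right sum.distrib)

lemma GG_Const: "GG n y (Const c) s = 0" by (simp add: GG_def)

lemma GG_mult: "GG n y (p * q) s = suby n y p * GG n y q s + suby n y q * GG n y p s"
  unfolding GG_def theta_mult suby_add suby_mult dd_mult by (simp add: algebra_simps sum.distrib sum_distrib_left)

text \<open>The terms with \<open>TT\<close> average to 0, and averaging over r commutes with the
  Euler operators in y.\<close>

lemma MM_LL:
  assumes g: "g > 0" and y: "distinct_pts n y" and p: "EE n g z p \<in> sym_polys n"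
  shows "MM n g z (LL n g y p) = eval y (Hop n g (EE n g z p))"
proof -
  have "MM n g z (\<Sum>i=1..n. \<Sum>j\<in>{1..n} - {i}. Const (wcoef y i j) * TT n g i j (suby n y p)) = 0"
    unfolding MM_sum MM_Const_mult by (intro sum.neutral ballI) (use MM_TT[OF g] in auto)
  then show ?thesis unfolding LL_def eval_Hop[OF y p] MM_add MM_Const_mult MM_sum
    by (simp only: mult_zero_right add_0_right eval_EE EE_theta[symmetric] cong: sum.cong)
qed

section \<open>Action of the diffusion on the generators e_k(x)\<close>

lemma theta_idem:
  assumes "vars p \<subseteq> V" "i \<notin> V" shows "theta i (p::cpoly) = 0"
  by (rule poly_mapping_eqI) (use vars_lookup[OF assms(1) _ assms(2)] in \<open>auto simp: lookup_theta in_keys_iff\<close>)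

abbreviation ycst :: "(nat => complex) => nat => cpoly" where "ycst y i \<equiv> Const (y i)"
abbreviation rvar :: "nat => nat => cpoly" where "rvar n i \<equiv> Var (n + i)"

lemma theta_welem_other:
  assumes "i \<in> {1..n}" shows "theta i (welem ({1..n} - {i}) Var (rvar n) k) = 0" "theta i (elem ({1..n} - {i}) Var k) = 0"
proof -
  have v: "i \<notin> ({1..n} - {i}) \<union> {n<..}" using assms by auto
  show "theta i (welem ({1..n} - {i}) Var (rvar n) k) = 0"
    by (rule theta_idem[OF _ v], unfold welem_def, intro vars_sum vars_mult vars_prod vars_add) (auto simp: vars_Var)
  show "theta i (elem ({1..n} - {i}) Var k) = 0"
    by (rule theta_idem[OF _ v], unfold elem_def, intro vars_sum vars_prod) (auto simp: vars_Var)
qed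

lemma theta_ehat:
  assumes i: "i \<in> {1..n}"
  shows "theta i (ehat n k) = ehat n k - welem ({1..n} - {i}) Var (rvar n) k"
proof (cases k)
  case (Suc l)
  have "i \<noteq> n + i" using i by auto
  then show ?thesis unfolding Suc welem_remove[OF finite_atLeastAtMost i, of Var "rvar n" l]
    by (simp add: theta_add theta_mult theta_Var theta_welem_other[OF i] distrib_left)
qed simp

lemma theta_theta_ehat: "i \<in> {1..n} ==> theta i (theta i (ehat n k)) = theta i (ehat n k)"
  by (simp add: theta_ehat theta_diff theta_welem_other)

lemma suby_welem:
  assumes "A \<subseteq> {1..n}"
  shows "suby n y (welem A Var (rvar n) k) = welem A (ycst y) (rvar n) k"
  unfolding welem_hom[OF suby_hom] by (rule welem_cong) (use assms in \<open>auto simp: suby_Var\<close>)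

lemma mpderiv_welem:
  assumes i: "i \<in> {1..n}"
  shows "mpderiv (n + i) (welem {1..n} (ycst y) (rvar n) k) = elem {1..n} (ycst y) k - elem ({1..n} - {i}) (ycst y) k"
proof (cases k)
  case (Suc l)
  have w: "mpderiv (n + i) (welem ({1..n} - {i}) (ycst y) (rvar n) k) = 0" for k
  proof (rule mpderiv_eqI)
    have "theta (n + i) (welem ({1..n} - {i}) (ycst y) (rvar n) k) = 0"
      by (rule theta_idem[of _ "- {n + i}"], unfold welem_def, intro vars_sum vars_mult vars_prod vars_add)
        (auto simp: vars_Var)
    then show "Var (n + i) * 0 = theta (n + i) (welem ({1..n} - {i}) (ycst y) (rvar n) k)" by simp
  qed
  have e: "mpderiv (n + i) (elem ({1..n} - {i}) (ycst y) k) = 0" for k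
    using elem_hom[OF Const_hom, of "{1..n} - {i}" y k] by (metis mpderiv_Const)
  show ?thesis
    unfolding Suc welem_remove[OF finite_atLeastAtMost i, of "ycst y" "rvar n" l] elem_remove_Suc[OF finite_atLeastAtMost i]
    by (simp add: mpderiv_add mpderiv_mult mpderiv_Var w e)
qed (use mpderiv_Const[of "n + i" 1] in simp)

lemma dd_ehat:
  assumes "i \<in> {1..n}" "j \<in> {1..n}" "i \<noteq> j"
  shows "dd n i j (suby n y (ehat n k)) = Const (y i - y j) * eps {1..n} (ycst y) i j k"
proof -
  have "{1..n} - {j} - {i} = {1..n} - {i} - {j}" by auto
  then show ?thesis using elem_remove_eps[OF _ assms, of "ycst y" k] elem_remove_eps[of "{1..n}" j i "ycst y" k] assms
    by (simp only: dd_def suby_welem[OF order_refl] mpderiv_welem Const_diff)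
      (simp add: eps_commute[of _ _ j i] algebra_simps)
qed

lemma eps_Const: "\<exists>c. eps A (ycst y) i j k = Const c"
proof (cases k)
  case (Suc k')
  then show ?thesis using elem_hom[OF Const_hom, of _ y k'] by (metis eps_Suc)
qed (auto intro: exI[of _ 0])

text \<open>\<open>ehat\<close> is affine in r, so the second-order part vanishes and the drift
  remains.\<close>

lemma TT_ehat:
  assumes "i \<in> {1..n}" "j \<in> {1..n}" "i \<noteq> j"
  shows "TT n g i j (suby n y (ehat n k)) =
    Const (of_real g) * (rvar n j - rvar n i) * (Const (y i - y j) * eps {1..n} (ycst y) i j k)"
proof -
  obtain c where "eps {1..n} (ycst y) i j k = Const c" using eps_Const by blast
  then have "dd n i j (dd n i j (suby n y (ehat n k))) = 0" unfolding dd_ehat[OF assms] by (simp flip: Const_mult)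
  then show ?thesis unfolding TT_def by (simp add: dd_ehat[OF assms])
qed

text \<open>The Laplace--Beltrami eigenvalue \<open>H_eval\<close> of a single column of height k
  \<le> n.\<close>

definition hcoef :: "nat => real => nat => complex" where
  "hcoef n g k = (of_nat k + of_real g * (of_nat n * (of_nat n - 1) - (of_nat n - of_nat k) * (of_nat n - of_nat k - 1))) / 2"

lemma sum_theta_ehat: "(\<Sum>i=1..n. theta i (ehat n k)) = of_nat k * ehat n k"
proof -
  have "(\<Sum>i=1..n. theta i (ehat n k)) = (\<Sum>i=1..n. ehat n k - welem ({1..n} - {i}) Var (\<lambda>i. Var (n + i)) k)"
    by (rule sum.cong) (auto simp: theta_ehat)
  also have "... = of_nat k * ehat n k" by (simp add: sum_subtractf welem_count algebra_simps)
  finally show ?thesis .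
qed

lemma acoef_mult: "distinct_pts n y ==> i \<in> {1..n} ==> j \<in> {1..n} ==> i \<noteq> j ==> acoef y i j * (y i - y j) = y i"
  by (auto simp: acoef_def distinct_pts_def)

text \<open>\<open>theta i\<close> is idempotent on \<open>ehat\<close>, so the second-order part in
  y gives k/2. The first-order part S1 and the drift S2 enter only as 2 S1 + S2, the combination
  that \<open>welem_laplace\<close> evaluates.\<close>

lemma LL_ehat:
  assumes y: "distinct_pts n y"
  shows "LL n g y (ehat n k) = Const (hcoef n g k) * suby n y (ehat n k)"
proof -
  let ?W = "welem {1..n} (ycst y) (rvar n) k"
  let ?a = "\<lambda>i j. Const (acoef y i j)"
  have W: "suby n y (ehat n k) = ?W" by (rule suby_welem) simp
  have t: "suby n y (theta i (ehat n k)) = ?W - welem ({1..n} - {i}) (ycst y) (rvar n) k" if "i \<in> {1..n}" for i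
    using that by (simp add: theta_ehat suby_diff suby_welem)
  have s1: "(\<Sum>i=1..n. suby n y (theta i (theta i (ehat n k)))) = Const (of_nat k) * ?W"
  proof -
    have "(\<Sum>i=1..n. suby n y (theta i (theta i (ehat n k)))) = suby n y (\<Sum>i=1..n. theta i (ehat n k))"
      unfolding suby_sum by (intro sum.cong refl) (simp add: theta_theta_ehat)
    also have "... = suby n y (Const (of_nat k) * ehat n k)" by (simp add: sum_theta_ehat Const_of_nat)
    finally show ?thesis by (simp add: suby_mult W)
  qed
  define S1 where "S1 = (\<Sum>i=1..n. \<Sum>j\<in>{1..n} - {i}. ?a i j * suby n y (theta i (ehat n k)))"
  define S2 where "S2 = (\<Sum>i=1..n. \<Sum>j\<in>{1..n} - {i}. ?a i j * ycst y j * (rvar n j - rvar n i) * eps {1..n} (ycst y) i j k)"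
  define c :: complex where "c = of_nat n * (of_nat n - 1) - (of_nat n - of_nat k) * (of_nat n - of_nat k - 1)"
  have "2 * (\<Sum>i=1..n. \<Sum>j\<in>{1..n} - {i}. ?a i j * (?W - welem ({1..n} - {i}) (ycst y) (rvar n) k)) + S2 =
      (of_nat (card {1..n}) * (of_nat (card {1..n}) - 1) -
        (of_nat (card {1..n}) - of_nat k) * (of_nat (card {1..n}) - of_nat k - 1)) * ?W" unfolding S2_def
    by (rule welem_laplace) (use y acoef_mult[OF y] in \<open>auto simp: distinct_pts_def simp flip: Const_diff Const_mult\<close>)
  also have "(of_nat (card {1..n}) * (of_nat (card {1..n}) - 1) -
        (of_nat (card {1..n}) - of_nat k) * (of_nat (card {1..n}) - of_nat k - 1)) = Const c"
    by (simp add: c_def Const_diff Const_mult Const_of_nat)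
  finally have l: "2 * (\<Sum>i=1..n. \<Sum>j\<in>{1..n} - {i}. ?a i j * (?W - welem ({1..n} - {i}) (ycst y) (rvar n) k)) + S2 = Const c * ?W" .
  have S12: "2 * S1 + S2 = Const c * ?W"
  proof -
    have "S1 = (\<Sum>i=1..n. \<Sum>j\<in>{1..n} - {i}. ?a i j * (?W - welem ({1..n} - {i}) (ycst y) (rvar n) k))"
      unfolding S1_def by (intro sum.cong refl) (simp only: t)
    with l show ?thesis by simp
  qed
  have S3: "(\<Sum>i=1..n. \<Sum>j\<in>{1..n} - {i}. Const (wcoef y i j) * TT n g i j (suby n y (ehat n k))) = Const (of_real g) * S2"
    unfolding S2_def sum_distrib_left
  proof (intro sum.cong refl)
    fix i j assume ij: "i \<in> {1..n}" "j \<in> {1..n} - {i}"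
    then have "y i - y j \<noteq> 0" using y by (auto simp: distinct_pts_def)
    \<comment> \<open>This matches the derivative of \<open>ehat\<close>, which carries y_i - y_j,
      to the drift in \<open>welem_laplace\<close>; it fixes the weight \<open>wcoef\<close> in
      \<open>LL\<close>.\<close>
    then have "wcoef y i j * (y i - y j) = acoef y i j * y j" by (simp add: wcoef_def acoef_def power2_eq_square)
    then have "Const (wcoef y i j) * Const (y i - y j) = ?a i j * ycst y j" by (simp flip: Const_mult)
    then show "Const (wcoef y i j) * TT n g i j (suby n y (ehat n k)) =
        Const (of_real g) * (?a i j * ycst y j * (rvar n j - rvar n i) * eps {1..n} (ycst y) i j k)"
      using ij by (subst TT_ehat) (auto simp: mult_ac)
  qed
  have "LL n g y (ehat n k) = Const (1 / 2) * (Const (of_nat k) * ?W) + Const (of_real g) * S1 + Const (1 / 2) * (Const (of_real g) * S2)"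
    unfolding LL_def s1 S1_def[symmetric] S3 ..
  also have "... = Const (1 / 2) * (Const (of_nat k) * ?W + Const (of_real g) * (2 * S1 + S2))"
    by (subst (1) half[of "Const (of_real g) * S1", symmetric]) (simp add: algebra_simps)
  also have "... = Const (1 / 2) * (Const (of_nat k) + Const (of_real g) * Const c) * ?W"
    unfolding S12 by (simp add: algebra_simps)
  also have "Const (1 / 2) * (Const (of_nat k) + Const (of_real g) * Const c) = Const (hcoef n g k)"
    by (simp add: hcoef_def c_def flip: Const_add Const_mult)
  finally show ?thesis by (simp add: W)
qed

lemma GG_ehat:
  assumes y: "distinct_pts n y"
  shows "GG n y (ehat n k) (ehat n l) = gam {1..n} (ycst y) (rvar n) k l"
proof -
  have t: "suby n y (theta i (ehat n k)) = welem {1..n} (ycst y) (rvar n) k - welem ({1..n} - {i}) (ycst y) (rvar n) k" if "i \<in> {1..n}" for i k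
    using that by (simp add: theta_ehat suby_diff suby_welem)
  have "Const (wcoef y i j) * (rvar n i * rvar n j * (dd n i j (suby n y (ehat n k)) * dd n i j (suby n y (ehat n l)))) =
      rvar n i * rvar n j * (ycst y i * ycst y j) * (eps {1..n} (ycst y) i j k * eps {1..n} (ycst y) i j l)"
    if "i \<in> {1..n}" "j \<in> {1..n} - {i}" for i j
  proof -
    have ij: "i \<in> {1..n}" "j \<in> {1..n}" "i \<noteq> j" using that by auto
    then have "y i - y j \<noteq> 0" using y by (auto simp: distinct_pts_def)
    then have "wcoef y i j * ((y i - y j) * (y i - y j)) = y i * y j" by (simp add: wcoef_def power2_eq_square)
    then have "Const (wcoef y i j) * (Const (y i - y j) * Const (y i - y j)) = ycst y i * ycst y j" by (simp flip: Const_mult)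
    moreover have "w * (a * b * ((d * e) * (d * f))) = a * b * (w * (d * d)) * (e * f)" for w a b d e f :: "cpoly"
      by (simp only: mult_ac)
    ultimately show ?thesis unfolding dd_ehat[OF ij] by simp
  qed
  then have "(\<Sum>i=1..n. \<Sum>j\<in>{1..n} - {i}. Const (wcoef y i j) * (rvar n i * rvar n j *
        (dd n i j (suby n y (ehat n k)) * dd n i j (suby n y (ehat n l))))) =
      (\<Sum>i=1..n. \<Sum>j\<in>{1..n} - {i}. rvar n i * rvar n j * (ycst y i * ycst y j) *
        (eps {1..n} (ycst y) i j k * eps {1..n} (ycst y) i j l))" by (intro sum.cong refl) blast
  moreover have "(\<Sum>i=1..n. suby n y (theta i (ehat n k)) * suby n y (theta i (ehat n l))) =
      (\<Sum>i=1..n. (welem {1..n} (ycst y) (rvar n) k - welem ({1..n} - {i}) (ycst y) (rvar n) k) *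
        (welem {1..n} (ycst y) (rvar n) l - welem ({1..n} - {i}) (ycst y) (rvar n) l))"
    by (intro sum.cong refl) (simp only: t)
  ultimately show ?thesis unfolding GG_def gam_def by simp
qed

text \<open>Shift k down to 0 with \<open>gam_Suc\<close>; there \<open>GG\<close> vanishes because
  \<open>ehat n 0\<close> is constant. The polynomial G is the same for all y.\<close>

lemma gam_expressible:
  "\<exists>G. \<forall>y. distinct_pts n y --> GG n y (ehat n k) (ehat n l) = suby n y (xsub n G)"
proof (induction k arbitrary: l)
  case 0
  show ?case using GG_Const[of n _ 1] by (intro exI[of _ 0]) auto
next
  case (Suc k)
  obtain G where G: "\<And>y. distinct_pts n y ==> GG n y (ehat n k) (ehat n (Suc l)) = suby n y (xsub n G)" using Suc by blast
  let ?G = "G + (of_nat (Suc k) * (Var (Suc k) * Var l) - of_nat (Suc l) * (Var k * Var (Suc l)))"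
  have ofn: "xsub n (of_nat m) = of_nat m" "suby n y (of_nat m) = of_nat m" for m y
    by (metis Const_of_nat xsub_Const) (metis Const_of_nat suby_Const)
  have "GG n y (ehat n (Suc k)) (ehat n l) = suby n y (xsub n ?G)" if y: "distinct_pts n y" for y
    using gam_Suc[of "{1..n}" "ycst y" "rvar n" k l] G[OF y]
    unfolding GG_ehat[OF y] xsub_add xsub_diff xsub_mult xsub_Var ofn suby_add suby_diff suby_mult suby_welem[OF order_refl]
    by (simp add: algebra_simps del: of_nat_Suc)
  then show ?case by blast
qed

text \<open>A second-order operator is determined by its values and its carre du champ on the generators.\<close>

lemma LL_expressible:
  "(\<exists>F'. \<forall>y. distinct_pts n y --> LL n g y (xsub n F) = suby n y (xsub n F')) \<and>
   (\<forall>k. \<exists>G. \<forall>y. distinct_pts n y --> GG n y (xsub n F) (ehat n k) = suby n y (xsub n G))"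
proof (induction F rule: mpoly_ring_induct)
  case (Const a)
  show ?case by (intro conjI allI exI[of _ 0]) (auto simp: LL_Const GG_Const)
next
  case (add F1 F2)
  show ?case
  proof (intro conjI allI)
    from add obtain F1' F2' where "\<And>y. distinct_pts n y ==> LL n g y (xsub n F1) = suby n y (xsub n F1')"
      "\<And>y. distinct_pts n y ==> LL n g y (xsub n F2) = suby n y (xsub n F2')" by blast
    then show "\<exists>F'. \<forall>y. distinct_pts n y --> LL n g y (xsub n (F1 + F2)) = suby n y (xsub n F')"
      by (intro exI[of _ "F1' + F2'"]) (auto simp: xsub_add LL_add suby_add)
    fix k
    from add obtain G1 G2 where "\<And>y. distinct_pts n y ==> GG n y (xsub n F1) (ehat n k) = suby n y (xsub n G1)"
      "\<And>y. distinct_pts n y ==> GG n y (xsub n F2) (ehat n k) = suby n y (xsub n G2)" by meson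
    then show "\<exists>G. \<forall>y. distinct_pts n y --> GG n y (xsub n (F1 + F2)) (ehat n k) = suby n y (xsub n G)"
      by (intro exI[of _ "G1 + G2"]) (auto simp: xsub_add GG_add suby_add)
  qed
next
  case (times F j)
  show ?case
  proof (intro conjI allI)
    from times obtain F' G where "\<And>y. distinct_pts n y ==> LL n g y (xsub n F) = suby n y (xsub n F')"
      "\<And>y. distinct_pts n y ==> GG n y (xsub n F) (ehat n j) = suby n y (xsub n G)" by meson
    \<comment> \<open>The three summands of \<open>LL_mult\<close>; F' and G come from the
      hypothesis for F, and the value on the generator is \<open>LL_ehat\<close>.\<close>
    then show "\<exists>F'. \<forall>y. distinct_pts n y --> LL n g y (xsub n (F * Var j)) = suby n y (xsub n F')"
      by (intro exI[of _ "F * (Const (hcoef n g j) * Var j) + Var j * F' + G"])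
        (simp add: xsub_mult xsub_add LL_mult LL_ehat suby_add suby_mult)
    fix k
    from times obtain G1 where G1: "\<And>y. distinct_pts n y ==> GG n y (xsub n F) (ehat n k) = suby n y (xsub n G1)" by meson
    obtain G2 where "\<And>y. distinct_pts n y ==> GG n y (ehat n j) (ehat n k) = suby n y (xsub n G2)" using gam_expressible by meson
    with G1 show "\<exists>G. \<forall>y. distinct_pts n y --> GG n y (xsub n (F * Var j)) (ehat n k) = suby n y (xsub n G)"
      by (intro exI[of _ "F * G2 + Var j * G1"]) (simp add: xsub_mult xsub_add GG_mult suby_add suby_mult)
  qed
qed

text \<open>At z = 1 the average is concentrated at r = 0, where x = y.\<close>

lemma EE_1_hom: "semiring_hom (EE n g 1)"
proof
  have s: "EE n g 1 (sg m a) = sg (ypart n m) (a * 0 ^ rdeg n m)" for m a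
  proof (cases "rdeg n m = 0")
    case True
    then have "mom n g m = 1" by (simp add: mom_def rdeg_def)
    then show ?thesis by (simp add: EE_single)
  qed (simp add: EE_single power_0_left)
  have r: "rdeg n (m + m') = rdeg n m + rdeg n m'" for m m' by (simp add: rdeg_def lookup_add sum.distrib)
  show "EE n g 1 1 = 1" using s[of 0 1] by (simp add: rdeg_def ypart_def)
  show "EE n g 1 (p * q) = EE n g 1 p * EE n g 1 q" for p q
  proof (induction p rule: mpoly_induct)
    case (add m a p)
    have "EE n g 1 (sg m a * q) = EE n g 1 (sg m a) * EE n g 1 q"
      by (induction q rule: mpoly_induct) (simp_all add: s r distrib_left EE_add mult_single ypart_add power_add mult_ac)
    with add show ?case by (simp add: distrib_right EE_add)
  qed simp
qed (simp_all add: EE_add)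

lemma EE_1_xsub: "EE n g 1 (xsub n F) = esub n F"
proof -
  have C: "EE n g 1 (Const c) = Const c" for c unfolding Const_def EE_single by (simp add: rdeg_def ypart_def mom_def)
  have l: "lk (sg i (1 :: nat)) j = (if i = j then 1 else 0)" for i j :: nat by (simp add: lookup_single when_def)
  have V: "EE n g 1 (Var i) = Var i" "EE n g 1 (Var (n + i)) = 0" if i: "i \<in> {1..n}" for i
  proof -
    have "ypart n (sg i 1) = sg i 1" by (rule poly_mapping_eqI) (use i in \<open>auto simp: lookup_ypart l\<close>)
    moreover have "i \<noteq> n + j" if "j \<in> {1..n}" for j using i that by auto
    then have z: "lk (sg i (1 :: nat)) (n + j) = 0" if "j \<in> {1..n}" for j using that by (simp add: l)
    then have "rdeg n (sg i 1) = 0" "mom n g (sg i 1) = 1" by (simp_all add: mom_def rdeg_def)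
    ultimately show "EE n g 1 (Var i) = Var i" unfolding Var_def EE_single by simp
    have "rdeg n (sg (n + i) 1) = 1" using i by (simp add: rdeg_def l)
    then show "EE n g 1 (Var (n + i)) = 0" unfolding Var_def EE_single by simp
  qed
  have "EE n g 1 (ehat n k) = esym n k" for k
    unfolding welem_hom[OF EE_1_hom] welem_zero[symmetric] by (rule welem_cong) (simp_all add: V)
  then show ?thesis unfolding xsub_def esub_def hom_insertion[OF Const_hom EE_1_hom] C by simp
qed

text \<open>The polynomial F' of \<open>LL_expressible\<close> involves neither y nor z. Averaging
  shows that \<open>Hop\<close> after Q is the average of F' for every z, and the case z = 1, where
  Q is the identity, identifies F' with \<open>Hop\<close> of p.\<close>

theorem Hop_Qalg_commute:
  assumes g: "g > 0" and p: "p \<in> sym_polys n"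
  shows "Hop n g (Qalg n g z p) = Qalg n g z (Hop n g p)"
proof -
  obtain F where F: "p = esub n F" using sym_polys_esub[OF p] by blast
  obtain F' where F': "\<And>y. distinct_pts n y ==> LL n g y (xsub n F) = suby n y (xsub n F')" using LL_expressible by blast
  have H: "Hop n g (EE n g z (xsub n F)) = EE n g z (xsub n F')" for z
  proof (rule mpoly_eqI_ordered)
    show "vars (Hop n g (EE n g z (xsub n F))) \<subseteq> {1..n}" "vars (EE n g z (xsub n F')) \<subseteq> {1..n}"
      unfolding Hop_def by (intro sym_vars vquot_sym antisym_Hnum EE_xsub_sym)+
    fix y :: "nat => real" assume "inj y"
    then have y: "distinct_pts n (\<lambda>i. complex_of_real (y i))" by (simp add: distinct_pts_def inj_eq)
    show "eval (\<lambda>i. complex_of_real (y i)) (Hop n g (EE n g z (xsub n F))) = eval (\<lambda>i. complex_of_real (y i)) (EE n g z (xsub n F'))"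
      unfolding MM_LL[OF g y EE_xsub_sym, symmetric] F'[OF y] eval_EE ..
  qed
  show ?thesis unfolding F Qalg_esub H using H[of 1] by (simp add: EE_1_xsub Qalg_esub)
qed

theorem Qalg_jack:
  assumes g: "g > 0" and lam: "lam \<in> partitions n"
  shows "Qalg n g z (jack n g lam) = Const (lk (Qalg n g z (jack n g lam)) lam) * jack n g lam"
  by (rule jack_eigen[OF g lam Qalg_span[OF downset_down[OF lam]] Hop_Qalg_commute[OF g] lin_op_Qalg])

section \<open>The integral\<close>

subsection \<open>Partial fractions\<close>

text \<open>Lagrange interpolation: both sides are monic of the same degree and agree at the points
  y_i.\<close>

lemma partial_fractions:
  fixes x y :: "nat => 'a::field"
  assumes A: "finite A" "inj_on y A"
  shows "(\<Prod>k\<in>A. t - x k) = (\<Prod>k\<in>A. t - y k) - (\<Sum>i\<in>A. (\<Prod>k\<in>A. x k - y i) / (\<Prod>k\<in>A - {i}. y k - y i) * (\<Prod>j\<in>A - {i}. t - y j))"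
proof -
  define c where "c i = (\<Prod>k\<in>A. x k - y i) / (\<Prod>k\<in>A - {i}. y k - y i)" for i
  let ?X = "\<Prod>k\<in>A. [:- x k, 1:]" and ?Y = "\<Prod>k\<in>A. [:- y k, 1:]"
  let ?S = "\<Sum>i\<in>A. smult (c i) (\<Prod>j\<in>A - {i}. [:- y j, 1:])"
  have dp: "degree (\<Prod>k\<in>B. [:- z k, 1:]) = card B" for z :: "nat => 'a" and B by (subst degree_prod_eq_sum_degree) auto
  have lp: "coeff (\<Prod>k\<in>B. [:- z k, 1:]) (card B) = 1" for z :: "nat => 'a" and B
    using lead_coeff_prod[of "\<lambda>k. [:- z k, 1:]" B] by (simp add: dp)
  have cs: "coeff ?S (card A) = 0"
  proof -
    have "coeff (\<Prod>j\<in>A - {i}. [:- y j, 1:]) (card A) = 0" if "i \<in> A" for i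
      using card.remove[OF A(1) that] by (intro coeff_eq_0) (simp only: dp)
    then show ?thesis by (simp add: coeff_sum)
  qed
  have "?X = ?Y - ?S"
  proof (rule poly_eqI_degree_lead_coeff[where n = "card A" and A = "y ` A"])
    show "coeff ?X (card A) = coeff (?Y - ?S) (card A)" by (simp add: lp cs)
    show "card A \<le> card (y ` A)" using A by (simp add: card_image)
    show "degree ?X \<le> card A" by (simp add: dp)
    show "degree (?Y - ?S) \<le> card A"
    proof (intro degree_diff_le degree_sum_le A)
      fix i assume "i \<in> A"
      show "degree (smult (c i) (\<Prod>j\<in>A - {i}. [:- y j, 1:])) \<le> card A"
        by (rule order_trans[OF degree_smult_le]) (use A in \<open>simp add: dp card_mono\<close>)
    qed (simp add: dp)
    fix z assume "z \<in> y ` A"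
    then obtain i where i: "i \<in> A" "z = y i" by auto
    have "poly ?S z = (\<Sum>k\<in>A. if k = i then c i * (\<Prod>j\<in>A - {i}. y i - y j) else 0)"
      unfolding poly_sum poly_smult poly_prod i(2)
    proof (rule sum.cong[OF refl])
      fix k assume "k \<in> A"
      show "c k * (\<Prod>j\<in>A - {k}. poly [:- y j, 1:] (y i)) = (if k = i then c i * (\<Prod>j\<in>A - {i}. y i - y j) else 0)"
      proof (cases "k = i")
        case False
        then have "(\<Prod>j\<in>A - {k}. poly [:- y j, 1:] (y i)) = 0" using A i by (intro prod_zero) auto
        then show ?thesis using False by simp
      qed simp
    qed
    then have S: "poly ?S z = c i * (\<Prod>j\<in>A - {i}. y i - y j)" using A i by simp
    have flip: "(\<Prod>k\<in>B. a k - b) = (- 1) ^ card B * (\<Prod>k\<in>B. b - a k)" for a :: "nat => 'a" and b and B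
      using prod_constant[of "- 1 :: 'a" B] prod.distrib[of "\<lambda>_. - 1" "\<lambda>k. b - a k" B, symmetric] by simp
    have ne: "(\<Prod>j\<in>A - {i}. y i - y j) \<noteq> 0" using A i by (auto simp: inj_on_def)
    have "card A = Suc (card (A - {i}))" by (rule card.remove[OF A(1) i(1)])
    then have "c i = - (\<Prod>k\<in>A. y i - x k) / (\<Prod>k\<in>A - {i}. y i - y k)" unfolding c_def flip[of _ "y i"] by simp
    then have "poly ?S z = - (\<Prod>k\<in>A. y i - x k)" using S ne by simp
    moreover have "poly ?X z = (\<Prod>k\<in>A. y i - x k)" by (simp add: poly_prod i)
    moreover have "poly ?Y z = 0" unfolding poly_prod using A i by (intro prod_zero) auto
    ultimately show "poly ?X z = poly (?Y - ?S) z" by simp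
  qed
  then have "poly ?X t = poly (?Y - ?S) t" by simp
  then show ?thesis by (simp add: poly_prod poly_sum c_def)
qed

text \<open>The variable r_i = \<xi>_i / y_i, with the index set as a parameter because the
  integration shrinks it.\<close>

definition ratio :: "nat set => (nat => 'a::field) => (nat => 'a) => nat => 'a" where
  "ratio A x y i = (\<Prod>k\<in>A. x k - y i) / ((\<Prod>k\<in>A - {i}. y k - y i) * y i)"

lemma elem_welem_ratio:
  fixes x y :: "nat => complex"
  assumes A: "finite A" "inj_on y A" "0 \<notin> y ` A"
  shows "elem A x k = welem A y (ratio A x y) k"
proof (cases "k \<le> card A")
  case True
  have "(\<Sum>k\<le>card A. (- 1) ^ k * elem A x k * t ^ (card A - k)) =
      (\<Sum>k\<le>card A. (- 1) ^ k * welem A y (ratio A x y) k * t ^ (card A - k))" for t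
  proof -
    have "(\<Sum>i\<in>A. ratio A x y i * (y i * (\<Prod>j\<in>A - {i}. t - y j))) =
        (\<Sum>i\<in>A. (\<Prod>k\<in>A. x k - y i) / (\<Prod>k\<in>A - {i}. y k - y i) * (\<Prod>j\<in>A - {i}. t - y j))"
      by (intro sum.cong refl) (use A in \<open>auto simp: ratio_def\<close>)
    then show ?thesis
      unfolding prod_diff_welem[OF A(1), symmetric] prod_diff_elem[OF A(1), symmetric] partial_fractions[OF A(1,2), of t x]
      by simp
  qed
  then show ?thesis
    by (rule signed_coeffs_unique[where T = UNIV and a = "elem A x" and b = "welem A y (ratio A x y)", OF _ infinite_UNIV_char_0 True])
qed (use A in \<open>simp add: elem_large welem_large\<close>)

text \<open>The partial fraction identity divided by Prod (y_k - t). It is applied at the split-off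
  coordinate t = x_m and at t = y_m.\<close>

lemma prod_roots_ratio:
  fixes x y :: "nat => real"
  assumes A: "finite A" "inj_on y A" "0 \<notin> y ` A" and t: "t \<notin> y ` A"
  shows "(\<Prod>k\<in>A. x k - t) = (\<Prod>k\<in>A. y k - t) * (1 + (\<Sum>i\<in>A. y i * ratio A x y i / (y i - t)))"
proof -
  have flip: "(\<Prod>k\<in>B. a k - b) = (- 1) ^ card B * (\<Prod>k\<in>B. b - a k)" for a :: "nat => real" and b and B
    using prod_constant[of "- 1 :: real" B] prod.distrib[of "\<lambda>_. - 1" "\<lambda>k. b - a k" B, symmetric] by simp
  have "(\<Prod>k\<in>A. t - x k) = (\<Prod>k\<in>A. t - y k) * (1 + (\<Sum>i\<in>A. y i * ratio A x y i / (y i - t)))"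
  proof -
    have "(\<Prod>k\<in>A. x k - y i) / (\<Prod>k\<in>A - {i}. y k - y i) * (\<Prod>j\<in>A - {i}. t - y j) =
        - ((\<Prod>k\<in>A. t - y k) * (y i * ratio A x y i / (y i - t)))" if i: "i \<in> A" for i
    proof -
      have "(\<Prod>k\<in>A. t - y k) = (t - y i) * (\<Prod>j\<in>A - {i}. t - y j)" using A i by (intro prod.remove)
      moreover have "t - y i \<noteq> 0" "y i - t \<noteq> 0" "y i \<noteq> 0" using t i A by auto
      moreover have "(\<Prod>k\<in>A - {i}. y k - y i) \<noteq> 0" using A i by (auto simp: inj_on_def)
      ultimately show ?thesis unfolding ratio_def by (simp add: divide_simps) (simp add: algebra_simps)
    qed
    then have "(\<Sum>i\<in>A. (\<Prod>k\<in>A. x k - y i) / (\<Prod>k\<in>A - {i}. y k - y i) * (\<Prod>j\<in>A - {i}. t - y j)) =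
        - ((\<Prod>k\<in>A. t - y k) * (\<Sum>i\<in>A. y i * ratio A x y i / (y i - t)))" by (simp add: sum_distrib_left sum_negf)
    then show ?thesis unfolding partial_fractions[OF A(1,2), of t x] by (simp add: distrib_left)
  qed
  then show ?thesis unfolding flip[of _ t] by simp
qed

subsection \<open>Integrals over products of intervals\<close>

abbreviation lb :: "nat set => (nat => real) measure" where "lb J \<equiv> \<Pi>\<^sub>M i\<in>J. lborel"
abbreviation RN :: "(nat => real) measure" where "RN \<equiv> \<Pi>\<^sub>M i\<in>UNIV. borel"

interpretation lbp: product_sigma_finite "\<lambda>_::nat. lborel :: real measure" by standard

text \<open>Outside J the coordinates of points of the product space are constantly
  \<open>undefined\<close>, so measurability may be used for every index.\<close>

lemma measurable_coord [measurable]: "(\<lambda>x. x i) \<in> borel_measurable (lb J)"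
proof (cases "i \<in> J")
  case False
  then have "(\<lambda>x. x i) \<in> borel_measurable (lb J) \<longleftrightarrow> (\<lambda>x. undefined :: real) \<in> borel_measurable (lb J)"
    by (intro measurable_cong) (auto simp: space_PiM PiE_def extensional_def)
  then show ?thesis by simp
qed (use measurable_component_singleton[of i J "\<lambda>_. lborel"] in simp)

lemma measurable_RN:
  assumes "\<And>i. (\<lambda>x. f x i) \<in> borel_measurable M" shows "f \<in> measurable M RN"
  using measurable_PiM_single'[of UNIV "\<lambda>i x. f x i" M "\<lambda>_. borel"] assms by simp

lemma measurable_RN_compose:
  assumes "G \<in> borel_measurable RN" "\<And>i. (\<lambda>x. f x i) \<in> borel_measurable M"
  shows "(\<lambda>x. G (f x)) \<in> borel_measurable M" by (rule measurable_compose[OF measurable_RN[OF assms(2)] assms(1)])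

lemma nn_integral_lb_insert:
  assumes "finite J" "i \<notin> J" "f \<in> borel_measurable (lb (insert i J))"
  shows "(\<integral>\<^sup>+x. f x \<partial>lb (insert i J)) = (\<integral>\<^sup>+x. \<integral>\<^sup>+t. f (x(i := t)) \<partial>lborel \<partial>lb J)"
    and "(\<integral>\<^sup>+x. f x \<partial>lb (insert i J)) = (\<integral>\<^sup>+t. \<integral>\<^sup>+x. f (x(i := t)) \<partial>lb J \<partial>lborel)"
  using lbp.product_nn_integral_insert[OF assms] lbp.product_nn_integral_insert_rev[OF assms] by auto

lemma nn_integral_lb_empty: "(\<integral>\<^sup>+x. f x \<partial>lb {}) = f (\<lambda>_. undefined)" by (simp add: PiM_empty nn_integral_count_space_finite)

lemma nn_integral_lb_scale:
  assumes "finite J" "\<And>i. i \<in> J ==> 0 < c i" "f \<in> borel_measurable (lb J)"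
  shows "(\<integral>\<^sup>+x. f x \<partial>lb J) = ennreal (\<Prod>i\<in>J. c i) * (\<integral>\<^sup>+x. f (restrict (\<lambda>i. c i * x i) J) \<partial>lb J)" using assms
proof (induction J arbitrary: f rule: finite_induct)
  case empty
  then show ?case unfolding nn_integral_lb_empty by (simp add: restrict_def)
next
  case (insert i J)
  have c: "0 < c i" "\<And>j. j \<in> J ==> 0 < c j" using insert.prems by auto
  let ?h = "\<lambda>x. f (restrict (\<lambda>i. c i * x i) (insert i J))"
  let ?g = "\<lambda>x t. f (restrict (\<lambda>j. c j * (x(i := t)) j) (insert i J))"
  note [measurable] = insert.prems(2)
  have m1[measurable]: "(\<lambda>x. \<integral>\<^sup>+t. f (x(i := t)) \<partial>lborel) \<in> borel_measurable (lb J)" by measurable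
  have sc: "(\<lambda>x. restrict (\<lambda>i. c i * x i) K) \<in> measurable (lb K) (lb K)" for K
    by (rule measurable_restrict) (simp add: measurable_coord borel_measurable_times)
  have "(\<integral>\<^sup>+x. f x \<partial>lb (insert i J)) = (\<integral>\<^sup>+x. \<integral>\<^sup>+t. f (x(i := t)) \<partial>lborel \<partial>lb J)"
    by (rule nn_integral_lb_insert) (use insert in auto)
  also have "... = ennreal (\<Prod>i\<in>J. c i) * (\<integral>\<^sup>+x. \<integral>\<^sup>+t. f ((restrict (\<lambda>i. c i * x i) J)(i := t)) \<partial>lborel \<partial>lb J)"
    by (rule insert.IH[OF c(2) m1])
  also have "(\<integral>\<^sup>+x. \<integral>\<^sup>+t. f ((restrict (\<lambda>i. c i * x i) J)(i := t)) \<partial>lborel \<partial>lb J) =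
      (\<integral>\<^sup>+x. ennreal (c i) * (\<integral>\<^sup>+t. ?g x t \<partial>lborel) \<partial>lb J)"
  proof (rule nn_integral_cong)
    fix x assume x: "x \<in> space (lb J)"
    let ?x = "restrict (\<lambda>i. c i * x i) J"
    have "?x \<in> space (lb J)" by (simp add: space_PiM)
    then have "(\<lambda>t. f (?x(i := t))) \<in> borel_measurable lborel"
      by (rule measurable_compose[OF measurable_component_update[of ?x J "\<lambda>_. lborel" i] insert.prems(2)])
        (rule insert.hyps)
    then have "(\<integral>\<^sup>+t. f (?x(i := t)) \<partial>lborel) = ennreal \<bar>c i\<bar> * (\<integral>\<^sup>+t. f (?x(i := 0 + c i * t)) \<partial>lborel)"
      using c by (intro nn_integral_real_affine) auto
    also have "(\<lambda>t. ?x(i := 0 + c i * t)) = (\<lambda>t. restrict (\<lambda>j. c j * (x(i := t)) j) (insert i J))"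
      using insert.hyps by (auto simp: fun_eq_iff)
    finally show "(\<integral>\<^sup>+t. f (?x(i := t)) \<partial>lborel) = ennreal (c i) * (\<integral>\<^sup>+t. ?g x t \<partial>lborel)" unfolding abs_of_pos[OF c(1)] .
  qed
  also have "... = ennreal (c i) * (\<integral>\<^sup>+x. \<integral>\<^sup>+t. ?g x t \<partial>lborel \<partial>lb J)"
  proof (rule nn_integral_cmult)
    have "?h \<in> borel_measurable (lb (insert i J))" by (rule measurable_compose[OF sc insert.prems(2)])
    from measurable_compose[OF measurable_add_dim this]
    show "(\<lambda>x. \<integral>\<^sup>+t. ?g x t \<partial>lborel) \<in> borel_measurable (lb J)"
      by (intro lborel.borel_measurable_nn_integral) (simp add: case_prod_unfold)
  qed
  also have "(\<integral>\<^sup>+x. \<integral>\<^sup>+t. ?g x t \<partial>lborel \<partial>lb J) = (\<integral>\<^sup>+x. ?h x \<partial>lb (insert i J))"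
    by (rule nn_integral_lb_insert(1)[symmetric, where f = ?h])
      (use insert.hyps measurable_compose[OF sc insert.prems(2)] in auto)
  also have "ennreal (\<Prod>i\<in>J. c i) * (ennreal (c i) * (\<integral>\<^sup>+x. ?h x \<partial>lb (insert i J))) =
      ennreal (\<Prod>i\<in>insert i J. c i) * (\<integral>\<^sup>+x. ?h x \<partial>lb (insert i J))"
    using insert.hyps c by (simp add: ennreal_mult prod_nonneg less_imp_le mult_ac)
  finally show ?case .
qed

text \<open>f = h (b - t) reaches 0 at b or at an earlier zero of h, after which h stays \<le> 0 and
  the integrand vanishes. Up to that point -f increases, and the monotone substitution rule applies
  to it.\<close>

lemma nn_integral_decreasing_substitution:
  fixes f f' h :: "real => real" and \<Phi> :: "real => ennreal"
  assumes \<Phi>[measurable]: "\<Phi> \<in> borel_measurable borel" and ab: "a < b"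
    and f: "\<And>t. t \<in> {a..b} ==> (f has_real_derivative f' t) (at t)" "continuous_on {a..b} f'"
    and h: "\<And>t. t \<in> {a..b} ==> f t = h t * (b - t)" "continuous_on {a..b} h"
      "\<And>s t. a \<le> s ==> s \<le> t ==> t \<le> b ==> h t \<le> h s"
    and neg: "\<And>t. t \<in> {a..b} ==> 0 \<le> h t ==> f' t \<le> 0"
    and less: "\<And>t. a < t ==> t < b ==> 0 < h t ==> f t < f a"
  shows "(\<integral>\<^sup>+t. (if a < t \<and> t < b \<and> 0 < h t then \<Phi> (f t) * ennreal (- f' t) else 0) \<partial>lborel) =
    (\<integral>\<^sup>+s. (if 0 < s \<and> s < f a then \<Phi> s else 0) \<partial>lborel)"
proof (cases "0 < f a")
  case False
  have "\<not> (a < t \<and> t < b \<and> 0 < h t)" for t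
  proof
    assume t: "a < t \<and> t < b \<and> 0 < h t"
    then have "0 < f t" by (simp add: h)
    then show False using less[of t] t False by auto
  qed
  then show ?thesis using False by (intro nn_integral_cong) auto
next
  case True
  then have ha: "0 < h a" using h(1)[of a] ab by (simp add: zero_less_mult_iff)
  \<comment> \<open>The first case takes b itself; otherwise h changes sign in between and \<tau> is
    a zero of h.\<close>
  obtain \<tau> where \<tau>: "a < \<tau>" "\<tau> \<le> b" "0 \<le> h \<tau>" "\<And>t. \<tau> < t ==> t < b ==> h t \<le> 0" "f \<tau> = 0"
  proof (cases "0 \<le> h b")
    case True
    then show ?thesis using ab h(1)[of b] by (intro that[of b]) auto
  next
    case False
    then obtain \<tau> where t: "a \<le> \<tau>" "\<tau> \<le> b" "h \<tau> = 0" using IVT2'[of h b 0 a] ha ab h(2) by auto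
    then have "a < \<tau>" using ha by (cases "a = \<tau>") auto
    moreover have "h t \<le> 0" if "\<tau> < t" "t < b" for t using h(3)[of \<tau> t] t that by auto
    ultimately show ?thesis using t h(1)[of \<tau>] by (intro that[of \<tau>]) auto
  qed
  have neg': "0 \<le> - f' t" if "t \<in> {a..\<tau>}" for t using neg[of t] h(3)[of t \<tau>] that \<tau> by auto
  let ?F = "\<lambda>t. if a < t \<and> t < b \<and> 0 < h t then \<Phi> (f t) * ennreal (- f' t) else 0"
  define \<Psi> where "\<Psi> s = (if 0 < - s \<and> - s < f a then \<Phi> (- s) else 0)" for s
  have [measurable]: "\<Psi> \<in> borel_measurable borel" unfolding \<Psi>_def by measurable
  have "(\<integral>\<^sup>+t. ?F t \<partial>lborel) = (\<integral>\<^sup>+t. \<Psi> (- f t) * ennreal (- f' t) * indicator {a..\<tau>} t \<partial>lborel)"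
  proof (rule nn_integral_cong)
    fix t
    show "?F t = \<Psi> (- f t) * ennreal (- f' t) * indicator {a..\<tau>} t"
    proof (cases "a < t \<and> t < b \<and> 0 < h t")
      case True
      then have "t \<le> \<tau>" using \<tau>(4)[of t] by force
      moreover have "0 < f t" using True by (simp add: h)
      ultimately show ?thesis using True less[of t] by (simp add: \<Psi>_def)
    next
      case False
      have "\<Psi> (- f t) = 0" if t: "a \<le> t" "t \<le> \<tau>"
      proof (rule ccontr)
        assume "\<Psi> (- f t) \<noteq> 0"
        then have f0: "0 < f t" "f t < f a" by (auto simp: \<Psi>_def split: if_splits)
        then have "t \<noteq> a" "t \<noteq> b" using h(1)[of b] ab by auto
        then have "a < t" "t < b" using t \<tau> by auto
        then show False using f0 False by (simp add: h zero_less_mult_iff)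
      qed
      then show ?thesis using False by (auto simp: indicator_def)
    qed
  qed
  also have "... = (\<integral>\<^sup>+s. \<Psi> s * indicator {- f a..- f \<tau>} s \<partial>lborel)"
    by (rule nn_integral_substitution_aux[symmetric, where g = "\<lambda>t. - f t" and g' = "\<lambda>t. - f' t"])
      (use \<tau> neg' in \<open>auto intro!: DERIV_minus f continuous_on_minus continuous_on_subset[OF f(2)]\<close>)
  also have "... = (\<integral>\<^sup>+s. \<Psi> s \<partial>lborel)" by (rule nn_integral_cong) (auto simp: \<Psi>_def \<tau>(5) indicator_def)
  also have "... = (\<integral>\<^sup>+s. \<Psi> (- s) \<partial>lborel)" using nn_integral_real_affine[of \<Psi> "- 1" 0] by simp
  also have "... = (\<integral>\<^sup>+s. (if 0 < s \<and> s < f a then \<Phi> s else 0) \<partial>lborel)" unfolding \<Psi>_def minus_minus ..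
  finally show ?thesis .
qed

subsection \<open>Change of variables\<close>

text \<open>Indices run from m, so that the smallest one can be split off in an induction.\<close>

definition vdm :: "nat => nat => (nat => real) => real" where
  "vdm m n x = (\<Prod>j\<in>{m..n}. \<Prod>i\<in>{m..<j}. x j - x i)"

definition ilace :: "nat => nat => (nat => real) => (nat => real) => bool" where
  "ilace m n y x \<longleftrightarrow> (\<forall>i\<in>{m..n}. y i < x i) \<and> (\<forall>i\<in>{m..<n}. x i < y (Suc i))"

definition incr :: "nat => nat => (nat => real) => bool" where
  "incr m n y \<longleftrightarrow> (\<forall>i\<in>{m..n}. 0 < y i) \<and> (\<forall>i\<in>{m..<n}. y i < y (Suc i))"

definition lastpt :: "nat => nat => (nat => real) => real => (nat => real) => nat => real" where
  "lastpt m n y z x = x(n := z * (\<Prod>i\<in>{m..n}. y i) / (\<Prod>i\<in>{m..<n}. x i))"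

lemma incr_less: "incr m n y ==> m \<le> i ==> i < j ==> j \<le> n ==> y i < y j"
proof (induction j)
  case (Suc j)
  then have "y j < y (Suc j)" by (auto simp: incr_def)
  then show ?case using Suc by (cases "i = j") auto
qed simp

lemma incr_pos: "incr m n y ==> m \<le> i ==> i \<le> n ==> 0 < y i" by (simp add: incr_def)

lemma incr_Suc: "incr m n y ==> incr (Suc m) n y" by (auto simp: incr_def)

lemma incr_inj: "incr m n y ==> inj_on y {m..n}"
  by (rule linorder_inj_onI') (auto dest: incr_less[of m n y] simp: less_imp_neq)

lemma vdm_peel: "m \<le> n ==> vdm m n x = vdm (Suc m) n x * (\<Prod>j\<in>{Suc m..n}. x j - x m)"
proof -
  assume "m \<le> n"
  then have A: "{m..n} = insert m {Suc m..n}" by auto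
  have "(\<Prod>i\<in>{m..<j}. x j - x i) = (\<Prod>i\<in>{Suc m..<j}. x j - x i) * (x j - x m)" if "j \<in> {Suc m..n}" for j
  proof -
    have "{m..<j} = insert m {Suc m..<j}" using that by auto
    then show ?thesis by (simp add: mult.commute)
  qed
  then show ?thesis unfolding vdm_def A by (simp add: prod.distrib)
qed

lemma vdm_cong: "(\<And>i. i \<in> {m..n} ==> x i = x' i) ==> vdm m n x = vdm m n x'" unfolding vdm_def by (intro prod.cong refl) auto

lemma vdm_pos:
  assumes "\<And>i j. m \<le> i ==> i < j ==> j \<le> n ==> x i < x j" shows "0 < vdm m n x"
  unfolding vdm_def by (intro prod_pos) (auto intro: assms)

lemma ilace_less:
  assumes "incr m n y" "ilace m n y x" "m \<le> i" "i < j" "j \<le> n" shows "x i < x j"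
proof -
  have "x i < y (Suc i)" "y j < x j" using assms by (auto simp: ilace_def)
  moreover have "y (Suc i) \<le> y j" using assms incr_less[of m n y "Suc i" j] by (cases "Suc i = j") auto
  ultimately show ?thesis by simp
qed

lemma ratio_pos:
  assumes y: "incr m n y" and x: "ilace m n y x" and i: "i \<in> {m..n}"
  shows "0 < ratio {m..n} x y i"
proof -
  have "(\<Prod>k\<in>{m..n}. x k - y i) = (x i - y i) * (\<Prod>k\<in>{m..n} - {i}. x k - y i)" using i by (intro prod.remove) auto
  then have "ratio {m..n} x y i = (x i - y i) * (\<Prod>k\<in>{m..n} - {i}. (x k - y i) / (y k - y i)) / y i"
    by (simp add: ratio_def prod_dividef)
  moreover have "0 < x i - y i" "0 < y i" using x i incr_pos[OF y] by (auto simp: ilace_def)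
  moreover have "0 < (x k - y i) / (y k - y i)" if k: "k \<in> {m..n} - {i}" for k
  proof (cases "k < i")
    case True
    then have "y (Suc k) \<le> y i" using i incr_less[OF y, of "Suc k" i] k by (cases "Suc k = i") auto
    moreover have "x k < y (Suc k)" using x k i True by (auto simp: ilace_def)
    moreover have "y k < y i" using incr_less[OF y, of k i] True k i by auto
    ultimately show ?thesis by (intro divide_neg_neg) auto
  next
    case False
    then have "y i < y k" using incr_less[OF y, of i k] k i by auto
    moreover have "y k < x k" using x k by (auto simp: ilace_def)
    ultimately show ?thesis by (intro divide_pos_pos) auto
  qed
  then have "0 < (\<Prod>k\<in>{m..n} - {i}. (x k - y i) / (y k - y i))" by (intro prod_pos) auto
  ultimately show ?thesis by simp
qed

text \<open>Each product over {m..n} loses one factor, and the remaining products of X' k - t and X'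
  k - y m are rewritten by \<open>prod_roots_ratio\<close> in the ratios of the smaller
  configuration.\<close>

lemma peel:
  fixes X' :: "nat => real"
  assumes mn: "m < n" and y: "incr m n y" and t: "y m < t" "t < y (Suc m)"
  defines "A \<equiv> {Suc m..n}" and "X \<equiv> X'(m := t)"
  shows "ilace m n y X \<longleftrightarrow> ilace (Suc m) n y X'"
    and "vdm m n X = vdm (Suc m) n X' * ((\<Prod>k\<in>A. y k - t) * (1 + (\<Sum>i\<in>A. y i * ratio A X' y i / (y i - t))))"
    and "i \<in> A ==> ratio {m..n} X y i = ratio A X' y i * (y i - t) / (y i - y m)"
    and "ratio {m..n} X y m = (t - y m) / y m * (1 + (\<Sum>i\<in>A. y i * ratio A X' y i / (y i - y m)))"
proof -
  have mnA: "{m..n} = insert m A" "m \<notin> A" "finite A" using mn by (auto simp: A_def)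
  have "{m..<n} = insert m {Suc m..<n}" using mn by auto
  then show "ilace m n y X \<longleftrightarrow> ilace (Suc m) n y X'" unfolding ilace_def mnA(1) using t by (auto simp: X_def A_def)
  have lt: "t < y k" "y m < y k" if "k \<in> A" for k
    using that incr_less[OF y, of "Suc m" k] incr_less[OF y, of m k] t by (cases "k = Suc m"; force simp: A_def)+
  have "0 < y k" if "k \<in> A" for k using that incr_pos[OF y, of k] by (simp add: A_def)
  then have "0 \<notin> y ` A" by fastforce
  then have A: "finite A" "inj_on y A" "0 \<notin> y ` A" using incr_inj[OF incr_Suc[OF y]] by (auto simp: A_def)
  have XA: "(\<Prod>k\<in>A. X k - s) = (\<Prod>k\<in>A. X' k - s)" for s by (intro prod.cong) (use mnA in \<open>auto simp: X_def\<close>)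
  have v: "vdm m n X = vdm (Suc m) n X' * (\<Prod>k\<in>A. X' k - t)"
  proof -
    have "vdm (Suc m) n X = vdm (Suc m) n X'" by (rule vdm_cong) (simp add: X_def)
    moreover have "X m = t" by (simp add: X_def)
    ultimately show ?thesis using vdm_peel[of m n X] XA[of t] mn by (simp add: A_def)
  qed
  show "vdm m n X = vdm (Suc m) n X' * ((\<Prod>k\<in>A. y k - t) * (1 + (\<Sum>i\<in>A. y i * ratio A X' y i / (y i - t))))"
    unfolding v by (subst prod_roots_ratio[OF A]) (use lt in \<open>auto dest: less_imp_neq\<close>)
  show "ratio {m..n} X y i = ratio A X' y i * (y i - t) / (y i - y m)" if i: "i \<in> A"
  proof -
    have "{m..n} - {i} = insert m (A - {i})" using mnA i by auto
    then have "(\<Prod>k\<in>{m..n} - {i}. y k - y i) = (y m - y i) * (\<Prod>k\<in>A - {i}. y k - y i)" using mnA by simp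
    moreover have "(\<Prod>k\<in>{m..n}. X k - y i) = (t - y i) * (\<Prod>k\<in>A. X' k - y i)" using mnA XA[of "y i"] by (simp add: X_def)
    moreover have "(\<Prod>k\<in>A - {i}. y k - y i) \<noteq> 0" using A i by (auto simp: inj_on_def)
    ultimately show ?thesis using lt[OF i] A i unfolding ratio_def by (simp add: divide_simps) (simp add: algebra_simps)
  qed
  have "(\<Prod>k\<in>A. X' k - y m) = (\<Prod>k\<in>A. y k - y m) * (1 + (\<Sum>i\<in>A. y i * ratio A X' y i / (y i - y m)))"
    by (rule prod_roots_ratio[OF A]) (use lt in \<open>auto dest: less_imp_neq\<close>)
  moreover have "{m..n} - {m} = A" using mnA by auto
  moreover have "(\<Prod>k\<in>{m..n}. X k - y m) = (t - y m) * (\<Prod>k\<in>A. X' k - y m)" using mnA XA[of "y m"] by (simp add: X_def)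
  moreover have "(\<Prod>k\<in>A. y k - y m) \<noteq> 0" using lt A by (force simp: prod_zero_iff)
  ultimately show "ratio {m..n} X y m = (t - y m) / y m * (1 + (\<Sum>i\<in>A. y i * ratio A X' y i / (y i - y m)))"
    unfolding ratio_def by simp
qed

text \<open>The x-side: x_n is eliminated through the constraint on the product, and 1 / Prod x_k is
  the density that the delta function leaves behind (\<open>delta_density\<close>). Values in
  \<open>ennreal\<close> allow integrals to be exchanged freely.\<close>

definition Ki :: "nat => nat => (nat => real) => real => ((nat => real) => ennreal) => (nat => real) => ennreal" where
  "Ki m n y z G x = (if ilace m n y (lastpt m n y z x)
     then ennreal (vdm m n (lastpt m n y z x) / (\<Prod>k\<in>{m..<n}. x k)) * G (ratio {m..n} (lastpt m n y z x) y) else 0)"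

text \<open>The r-side: here the smallest index m is the one eliminated, through Sum r_i = z -
  1.\<close>

definition Kj :: "nat => nat => real => ((nat => real) => ennreal) => (nat => real) => ennreal" where
  "Kj m n z G r = (if (\<forall>i\<in>{m<..n}. 0 < r i) \<and> (\<Sum>i\<in>{m<..n}. r i) < z - 1 then G (r(m := z - 1 - (\<Sum>i\<in>{m<..n}. r i))) else 0)"

lemma measurable_lastpt [measurable]: "(\<lambda>x. lastpt m n y z x i) \<in> borel_measurable (lb J)"
  unfolding lastpt_def fun_upd_apply by measurable

lemma measurable_Ki:
  assumes G: "G \<in> borel_measurable RN" shows "Ki m n y z G \<in> borel_measurable (lb J)"
proof -
  have [measurable]: "(\<lambda>x. G (ratio {m..n} (lastpt m n y z x) y)) \<in> borel_measurable (lb J)"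
    unfolding ratio_def by (rule measurable_RN_compose[OF G]) measurable
  show ?thesis unfolding Ki_def[abs_def] ilace_def vdm_def by measurable
qed

lemma measurable_Kj:
  assumes G: "G \<in> borel_measurable RN" shows "Kj m n z G \<in> borel_measurable (lb J)"
proof -
  have [measurable]: "(\<lambda>r. G (r(m := z - 1 - (\<Sum>i\<in>{m<..n}. r i)))) \<in> borel_measurable (lb J)"
    unfolding fun_upd_apply by (rule measurable_RN_compose[OF G]) measurable
  show ?thesis unfolding Kj_def[abs_def] by measurable
qed

section \<open>Change of variables: splitting off the smallest pair y_m, x_m\<close>

locale one_step =
  fixes m n :: nat and y :: "nat => real" and z :: real
  assumes mn: "m < n" and y: "incr m n y" and z: "0 < z"
begin

abbreviation "a \<equiv> y m"
abbreviation "b \<equiv> y (Suc m)"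
abbreviation "R \<equiv> {Suc m<..n}"

text \<open>With t = x_m fixed, \<open>c t i\<close> scales r_i of the full configuration to that of
  the reduced one; \<open>back t\<close> recovers the full r, including r_m, from the reduced
  r.\<close>

abbreviation "c t i \<equiv> (y i - a) / (y i - t)"
abbreviation "back t r \<equiv> \<lambda>i. if i = m then (t - a) / a * (1 + (\<Sum>i\<in>{Suc m..n}. y i * r i / (y i - a)))
  else r i * (y i - t) / (y i - a)"

text \<open>\<open>h t r\<close> is the reduced coordinate with index m + 1, forced by the reduced
  constraint with parameter a z / t; \<open>f t r\<close> is the corresponding full coordinate, and
  \<open>w\<close> is minus its derivative in t.\<close>

definition h :: "real => (nat => real) => real" where
  "h t r = a * z / t - 1 - (\<Sum>i\<in>R. c t i * r i)"

definition f :: "real => (nat => real) => real" where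
  "f t r = h t r / (b - a) * (b - t)"

definition w :: "real => (nat => real) => real" where
  "w t r = (b * h t r + (b - t) * (1 + (\<Sum>i\<in>R. y i * (c t i * r i) / (y i - t)))) / (t * (b - a))"

lemma ab: "0 < a" "a < b" "0 < b" using mn incr_less[OF y, of m "Suc m"] incr_pos[OF y, of m] by auto

lemma R: "i \<in> R ==> b < y i" "i \<in> R ==> a < y i" using incr_less[OF y, of "Suc m" i] ab by auto

text \<open>Consistency of the coordinates: the r_m computed by \<open>back\<close> is what the full
  constraint leaves. At t = a it shows that f starts at z - 1 - Sum r_i.\<close>

lemma sum_peeled:
  assumes "a \<le> t" "t \<le> b"
  shows "z - 1 - f t r - (\<Sum>i\<in>R. r i) = (t - a) / a * (1 + (b * h t r / (b - a) + (\<Sum>i\<in>R. y i * (c t i * r i) / (y i - a))))"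
proof -
  define C where "C = (\<Sum>i\<in>R. c t i * r i)"
  have 1: "(\<Sum>i\<in>R. y i * (c t i * r i) / (y i - a)) = C + a * (\<Sum>i\<in>R. r i / (y i - t))"
    unfolding C_def sum_distrib_left sum.distrib[symmetric]
  proof (intro sum.cong refl)
    fix i assume "i \<in> R"
    then have "y i - a \<noteq> 0" "y i - t \<noteq> 0" using R[of i] assms by auto
    then show "y i * (c t i * r i) / (y i - a) = c t i * r i + a * (r i / (y i - t))"
      by (simp add: divide_simps) (simp add: algebra_simps)
  qed
  have 2: "C = (\<Sum>i\<in>R. r i) + (t - a) * (\<Sum>i\<in>R. r i / (y i - t))" unfolding C_def sum_distrib_left sum.distrib[symmetric]
  proof (intro sum.cong refl)
    fix i assume "i \<in> R"
    then have "y i - t \<noteq> 0" using R[of i] assms by auto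
    then show "c t i * r i = r i + (t - a) * (r i / (y i - t))" by (simp add: divide_simps) (simp add: algebra_simps)
  qed
  define D where "D = (\<Sum>i\<in>R. r i / (y i - t))"
  define S where "S = (\<Sum>i\<in>R. r i)"
  have H: "h t r = a * z / t - 1 - C" by (simp add: h_def C_def)
  have zz: "z = (h t r + 1 + C) * t / a" using ab assms unfolding H by simp
  show ?thesis unfolding 1 f_def D_def[symmetric] S_def[symmetric] using ab assms 2[folded D_def S_def]
    by (subst zz) (simp add: divide_simps, simp add: algebra_simps)
qed

lemma derivative:
  assumes "a \<le> t" "t \<le> b" shows "((\<lambda>t. f t r) has_real_derivative - w t r) (at t)"
proof -
  have ne: "t \<noteq> 0" "\<And>i. i \<in> R ==> y i - t \<noteq> 0" "b - a \<noteq> 0" using assms R ab by force+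
  define D where "D = (\<Sum>i\<in>R. (y i - a) / (y i - t) ^ 2 * r i)"
  have d: "((\<lambda>t. c t i * r i) has_real_derivative (y i - a) / (y i - t) ^ 2 * r i) (at t)" if "i \<in> R" for i
    using ne(2)[OF that] by (auto intro!: derivative_eq_intros simp: power2_eq_square)
  have "((\<lambda>t. \<Sum>i\<in>R. c t i * r i) has_real_derivative D) (at t)" unfolding D_def by (rule DERIV_sum) (rule d)
  moreover have "((\<lambda>t. a * z / t - 1) has_real_derivative - (a * z / t ^ 2)) (at t)"
    using ne by (auto intro!: derivative_eq_intros simp: power2_eq_square)
  ultimately have hd: "((\<lambda>t. h t r) has_real_derivative - (a * z / t ^ 2) - D) (at t)"
    unfolding h_def by (rule DERIV_diff[rotated])
  have "((\<lambda>t. f t r) has_real_derivative (- (a * z / t ^ 2) - D) / (b - a) * (b - t) + (- 1) * (h t r / (b - a))) (at t)"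
    unfolding f_def by (intro DERIV_mult DERIV_cdivide hd) (auto intro!: derivative_eq_intros)
  moreover have "(- (a * z / t ^ 2) - D) / (b - a) * (b - t) + (- 1) * (h t r / (b - a)) = - w t r"
  proof -
    define C where "C = (\<Sum>i\<in>R. c t i * r i)"
    have 1: "(\<Sum>i\<in>R. y i * (c t i * r i) / (y i - t)) = C + t * D"
      unfolding C_def D_def sum_distrib_left sum.distrib[symmetric]
    proof (intro sum.cong refl)
      fix i assume "i \<in> R"
      from ne(2)[OF this] show "y i * (c t i * r i) / (y i - t) = c t i * r i + t * ((y i - a) / (y i - t) ^ 2 * r i)"
        by (simp add: divide_simps power2_eq_square) (simp add: algebra_simps)
    qed
    have 2: "a * z / t ^ 2 = (h t r + 1 + C) / t" using ne by (simp add: h_def C_def power2_eq_square)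
    show ?thesis unfolding w_def 1 2 using ne by (simp add: divide_simps) (simp add: algebra_simps)
  qed
  ultimately show ?thesis by simp
qed

text \<open>For fixed positive r_i with i in R, the coordinate s = f t r falls from z - 1 - Sum r_i
  to 0 as t increases, as long as h stays positive.\<close>

lemma one_dim:
  assumes r: "\<And>i. i \<in> R ==> 0 < r i" and \<Phi>: "\<Phi> \<in> borel_measurable borel"
  shows "(\<integral>\<^sup>+t. (if a < t \<and> t < b \<and> 0 < h t r then \<Phi> (f t r) * ennreal (w t r) else 0) \<partial>lborel) =
    (\<integral>\<^sup>+s. (if 0 < s \<and> s < z - 1 - (\<Sum>i\<in>R. r i) then \<Phi> s else 0) \<partial>lborel)"
proof -
  have fa: "f a r = z - 1 - (\<Sum>i\<in>R. r i)" using sum_peeled[of a r] ab by simp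
  have ne: "t \<noteq> 0" "\<And>i. i \<in> R ==> y i - t \<noteq> 0" if "t \<in> {a..b}" for t using that R ab by force+
  have ch: "continuous_on {a..b} (\<lambda>t. h t r)" unfolding h_def using ne by (intro continuous_intros) auto
  have pos: "0 \<le> (\<Sum>i\<in>R. y i * (c t i * r i) / s i)" if "t \<le> b" "\<And>i. i \<in> R ==> 0 < s i" for t s
  proof (intro sum_nonneg)
    fix i assume i: "i \<in> R"
    then have "0 \<le> y i" "0 \<le> y i - a" "0 \<le> y i - t" "0 \<le> r i" "0 < s i"
      using R[OF i] ab that(1) that(2)[OF i] r[OF i] by linarith+
    then show "0 \<le> y i * (c t i * r i) / s i" by (intro divide_nonneg_pos mult_nonneg_nonneg divide_nonneg_nonneg)
  qed
  have "(\<integral>\<^sup>+t. (if a < t \<and> t < b \<and> 0 < h t r / (b - a) then \<Phi> (f t r) * ennreal (- (- w t r)) else 0) \<partial>lborel) =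
    (\<integral>\<^sup>+s. (if 0 < s \<and> s < f a r then \<Phi> s else 0) \<partial>lborel)"
  proof (rule nn_integral_decreasing_substitution[OF \<Phi> ab(2), where h = "\<lambda>t. h t r / (b - a)" and f' = "\<lambda>t. - w t r" and f = "\<lambda>t. f t r"])
    show "((\<lambda>t. f t r) has_real_derivative - w t r) (at t)" if "t \<in> {a..b}" for t using derivative that by auto
    show "continuous_on {a..b} (\<lambda>t. - w t r)" unfolding w_def using ne ab by (intro continuous_intros ch) auto
    show "continuous_on {a..b} (\<lambda>t. h t r / (b - a))" using ab by (intro continuous_intros ch) auto
    show "h t r / (b - a) \<le> h s r / (b - a)" if st: "a \<le> s" "s \<le> t" "t \<le> b" for s t
    proof (rule divide_right_mono)
      have "a * z / t \<le> a * z / s" using st ab z by (intro divide_left_mono) auto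
      moreover have "(\<Sum>i\<in>R. (y i - a) / (y i - s) * r i) \<le> (\<Sum>i\<in>R. c t i * r i)"
      proof (intro sum_mono mult_right_mono divide_left_mono)
        fix i assume i: "i \<in> R"
        show "0 \<le> r i" "0 \<le> y i - a" "y i - t \<le> y i - s" "0 < (y i - s) * (y i - t)"
          using r[OF i] R[OF i] st by (auto intro: mult_pos_pos)
      qed
      ultimately show "h t r \<le> h s r" unfolding h_def by simp
    qed (use ab in simp)
    show "- w t r \<le> 0" if t: "t \<in> {a..b}" "0 \<le> h t r / (b - a)" for t
    proof -
      have "0 \<le> h t r" using t ab by (simp add: zero_le_divide_iff)
      moreover have "0 \<le> (\<Sum>i\<in>R. y i * (c t i * r i) / (y i - t))" by (rule pos) (use t R in force)+
      ultimately show ?thesis unfolding w_def using t ab by simp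
    qed
    show "f t r < f a r" if t: "a < t" "t < b" "0 < h t r / (b - a)" for t
    proof -
      have "0 < h t r" using t ab by (simp add: zero_less_divide_iff)
      moreover have "0 \<le> (\<Sum>i\<in>R. y i * (c t i * r i) / (y i - a))" by (rule pos) (use t R in force)+
      ultimately have "0 < (t - a) / a * (1 + (b * h t r / (b - a) + (\<Sum>i\<in>R. y i * (c t i * r i) / (y i - a))))"
        using t ab by (intro mult_pos_pos divide_pos_pos add_pos_nonneg add_nonneg_nonneg divide_nonneg_pos mult_nonneg_nonneg) auto
      then show ?thesis unfolding fa using sum_peeled[of t r] t by simp
    qed
  qed (simp add: f_def)
  then show ?thesis using ab unfolding fa minus_minus by (simp add: zero_less_divide_iff)
qed

text \<open>The factor by which the Vandermonde product over Prod x_k of the full configuration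
  exceeds that of the reduced one.\<close>

definition W :: "real => (nat => real) => real" where
  "W t r = (\<Prod>k\<in>{Suc m..n}. y k - t) / t * (1 + (\<Sum>i\<in>{Suc m..n}. y i * r i / (y i - t)))"

definition G' :: "((nat => real) => ennreal) => real => (nat => real) => ennreal" where
  "G' G t r = ennreal (W t r) * G (back t r)"

definition Gs :: "((nat => real) => ennreal) => real => (nat => real) => ennreal" where
  "Gs G s r = G (r(Suc m := s, m := z - 1 - (s + (\<Sum>i\<in>R. r i))))"

definition Kh :: "((nat => real) => ennreal) => real => (nat => real) => ennreal" where
  "Kh G t r = (if (\<forall>i\<in>R. 0 < r i) \<and> 0 < h t r then Gs G (f t r) r * ennreal (w t r) else 0)"

lemma measurable_G':
  assumes G: "G \<in> borel_measurable RN" shows "G' G t \<in> borel_measurable RN"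
proof -
  have [measurable]: "(\<lambda>r. G (back t r)) \<in> borel_measurable RN" by (rule measurable_RN_compose[OF G]) measurable
  show ?thesis unfolding G'_def[abs_def] W_def by measurable
qed

lemma measurable_Gs:
  assumes G: "G \<in> borel_measurable RN" and u: "u \<in> borel_measurable M" and v: "\<And>i. (\<lambda>x. v x i) \<in> borel_measurable M"
  shows "(\<lambda>x. Gs G (u x) (v x)) \<in> borel_measurable M"
proof -
  note [measurable] = u v
  show ?thesis unfolding Gs_def fun_upd_apply by (rule measurable_RN_compose[OF G]) measurable
qed

lemma measurable_Kh:
  assumes G: "G \<in> borel_measurable RN" and [measurable]: "u \<in> borel_measurable (lb J)"
  shows "(\<lambda>x. Kh G (u x) x) \<in> borel_measurable (lb J)"
proof -
  have [measurable]: "(\<lambda>x. h (u x) x) \<in> borel_measurable (lb J)" unfolding h_def by measurable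
  have "(\<lambda>x. f (u x) x) \<in> borel_measurable (lb J)" unfolding f_def by measurable
  from measurable_Gs[OF G this measurable_coord]
  have [measurable]: "(\<lambda>x. Gs G (f (u x) x) x) \<in> borel_measurable (lb J)" .
  show ?thesis unfolding Kh_def w_def by measurable
qed

text \<open>Dividing the constraint Prod x = z Prod y by t = x_m and absorbing a = y_m leaves the
  constraint of the smaller configuration, with z a / t in place of z.\<close>

lemma Ki_peel:
  assumes dep: "\<And>u v. (\<forall>i\<in>{m..n}. u i = v i) ==> G u = G v" and t: "a < t" "t < b"
  shows "Ki m n y z G (x(m := t)) = Ki (Suc m) n y (z * a / t) (G' G t) x"
proof -
  define X' where "X' = lastpt (Suc m) n y (z * a / t) x"
  let ?A = "{Suc m..n}"
  have sets: "{m..<n} = insert m {Suc m..<n}" "{m..n} = insert m ?A" using mn by auto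
  have P: "(\<Prod>k\<in>{m..<n}. (x(m := t)) k) = t * (\<Prod>k\<in>{Suc m..<n}. x k)" unfolding sets by simp
  have X: "lastpt m n y z (x(m := t)) = X'(m := t)" unfolding X'_def lastpt_def P using mn by (auto simp: sets fun_eq_iff)
  note pl = peel[OF mn y t, where X' = X']
  show ?thesis
  proof (cases "ilace (Suc m) n y X'")
    case True
    have "0 < vdm (Suc m) n X'" by (rule vdm_pos) (use ilace_less[OF incr_Suc[OF y] True] in auto)
    moreover have "0 < (\<Prod>k\<in>{Suc m..<n}. x k)"
    proof (rule prod_pos)
      fix k assume k: "k \<in> {Suc m..<n}"
      then have "y k < X' k" using True by (auto simp: ilace_def)
      moreover have "X' k = x k" using k by (simp add: X'_def lastpt_def)
      ultimately show "0 < x k" using incr_pos[OF y, of k] k by auto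
    qed
    ultimately have pos: "0 \<le> vdm (Suc m) n X' / (\<Prod>k\<in>{Suc m..<n}. x k)" by simp
    have v: "vdm m n (X'(m := t)) / (t * (\<Prod>k\<in>{Suc m..<n}. x k)) = vdm (Suc m) n X' / (\<Prod>k\<in>{Suc m..<n}. x k) * W t (ratio ?A X' y)"
      unfolding pl(2) W_def by simp
    have "G (ratio {m..n} (X'(m := t)) y) = G (back t (ratio ?A X' y))"
    proof (rule dep, rule ballI)
      fix i assume "i \<in> {m..n}"
      then show "ratio {m..n} (X'(m := t)) y i = back t (ratio ?A X' y) i" using pl(3)[of i] pl(4) unfolding sets(2) by auto
    qed
    then show ?thesis
      unfolding Ki_def X X'_def[symmetric] pl(1) P v ennreal_mult'[OF pos] G'_def by (simp add: True mult.assoc)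
  next
    case False
    then show ?thesis unfolding Ki_def X X'_def[symmetric] pl(1) by simp
  qed
qed

lemma Ki_outside: "\<not> (a < t \<and> t < b) ==> Ki m n y z G (x(m := t)) = 0" using mn by (auto simp: Ki_def ilace_def lastpt_def)

text \<open>In full coordinates the weight \<open>W\<close> becomes (b - a) Prod (y_k - t) times
  \<open>w\<close>, and \<open>w\<close> is just the Jacobian of t into f t r: here the change of
  variables closes up.\<close>

lemma Kj_scaled:
  assumes dep: "\<And>u v. (\<forall>i\<in>{m..n}. u i = v i) ==> G u = G v" and t: "a < t" "t < b"
  shows "Kj (Suc m) n (z * a / t) (G' G t) (restrict (\<lambda>i. c t i * r i) R) = ennreal ((b - a) * (\<Prod>k\<in>R. y k - t)) * Kh G t r"
proof -
  define \<rho> where "\<rho> = restrict (\<lambda>i. c t i * r i) R"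
  have Rt: "0 < y i - t" "0 < y i - a" if "i \<in> R" for i using R[OF that] t by auto
  have hh: "z * a / t - 1 - (\<Sum>i\<in>R. \<rho> i) = h t r" by (simp add: h_def \<rho>_def mult.commute)
  have cond: "(\<forall>i\<in>R. 0 < \<rho> i) \<longleftrightarrow> (\<forall>i\<in>R. 0 < r i)"
  proof (rule ball_cong[OF refl])
    fix i assume i: "i \<in> R"
    then obtain c where "0 < c" "\<rho> i = c * r i" using divide_pos_pos[OF Rt(2)[OF i] Rt(1)[OF i]] by (auto simp: \<rho>_def)
    then show "0 < \<rho> i \<longleftrightarrow> 0 < r i" by (simp add: zero_less_mult_iff)
  qed
  have A: "{Suc m..n} = insert (Suc m) R" using mn by auto
  define \<sigma> where "\<sigma> = \<rho>(Suc m := h t r)"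
  have sA: "(\<Sum>i\<in>{Suc m..n}. y i * \<sigma> i / d i) = b * h t r / d (Suc m) + (\<Sum>i\<in>R. y i * (c t i * r i) / d i)" for d
    unfolding A by (simp add: \<sigma>_def \<rho>_def)
  have "W t \<sigma> = (b - a) * (\<Prod>k\<in>R. y k - t) * w t r"
  proof -
    have "t \<noteq> 0" "b - t \<noteq> 0" "b - a \<noteq> 0" using t ab by auto
    moreover have "(\<Prod>k\<in>{Suc m..n}. y k - t) = (b - t) * (\<Prod>k\<in>R. y k - t)" unfolding A by simp
    ultimately show ?thesis unfolding W_def sA w_def by (simp add: divide_simps) (simp add: algebra_simps)
  qed
  moreover have "0 \<le> (b - a) * (\<Prod>k\<in>R. y k - t)" using ab Rt by (intro mult_nonneg_nonneg prod_nonneg) (auto intro: less_imp_le)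
  ultimately have W: "ennreal (W t \<sigma>) = ennreal ((b - a) * (\<Prod>k\<in>R. y k - t)) * ennreal (w t r)" by (simp add: ennreal_mult')
  have "G (back t \<sigma>) = Gs G (f t r) r" unfolding Gs_def
  proof (rule dep, rule ballI)
    fix i assume i: "i \<in> {m..n}"
    consider "i = m" | "i = Suc m" | "i \<in> R" using i by fastforce
    then show "back t \<sigma> i = (r(Suc m := f t r, m := z - 1 - (f t r + (\<Sum>i\<in>R. r i)))) i"
    proof cases
      case 1
      then show ?thesis unfolding sA using sum_peeled[of t r] t by simp
    next
      case 3
      then have "i \<noteq> m" "i \<noteq> Suc m" by auto
      moreover have "\<rho> i * (y i - t) / (y i - a) = r i" using Rt[OF 3] 3 by (simp add: \<rho>_def)
      ultimately show ?thesis by (simp add: \<sigma>_def)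
    qed (simp add: \<sigma>_def f_def)
  qed
  then have "G' G t \<sigma> = ennreal ((b - a) * (\<Prod>k\<in>R. y k - t)) * (Gs G (f t r) r * ennreal (w t r))"
    unfolding G'_def W by (simp add: mult_ac)
  moreover have "Kj (Suc m) n (z * a / t) (G' G t) \<rho> = (if (\<forall>i\<in>R. 0 < \<rho> i) \<and> 0 < z * a / t - 1 - (\<Sum>i\<in>R. \<rho> i) then G' G t (\<rho>(Suc m := z * a / t - 1 - (\<Sum>i\<in>R. \<rho> i))) else 0)"
    by (simp add: Kj_def)
  ultimately show ?thesis unfolding hh cond Kh_def \<sigma>_def[symmetric] \<rho>_def[symmetric] by simp
qed

text \<open>Integrate over t = x_m last, apply the hypothesis to the other x, and rescale the r_i
  with i in R to full coordinates. Then exchange the order and substitute s = f t r in the inner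
  integral over t.\<close>

lemma step:
  assumes G: "G \<in> borel_measurable RN" and dep: "\<And>u v. (\<forall>i\<in>{m..n}. u i = v i) ==> G u = G v"
    and IH: "\<And>z G. 0 < z ==> G \<in> borel_measurable RN ==> (\<And>u v. (\<forall>i\<in>{Suc m..n}. u i = v i) ==> G u = G v) ==>
      (\<integral>\<^sup>+x. Ki (Suc m) n y z G x \<partial>lb {Suc m..<n}) = ennreal (vdm (Suc m) n y) * (\<integral>\<^sup>+r. Kj (Suc m) n z G r \<partial>lb {Suc m<..n})"
  shows "(\<integral>\<^sup>+x. Ki m n y z G x \<partial>lb {m..<n}) = ennreal (vdm m n y) * (\<integral>\<^sup>+r. Kj m n z G r \<partial>lb {m<..n})"
proof -
  let ?V = "vdm m n y"
  let ?L = "\<lambda>t. \<integral>\<^sup>+x. Ki m n y z G (x(m := t)) \<partial>lb {Suc m..<n}"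
  let ?E = "\<lambda>t. \<integral>\<^sup>+r. Kh G t r \<partial>lb R"
  have inner: "?L t = ennreal ?V * ?E t"
    if t: "a < t" "t < b" for t
  proof -
    let ?K = "\<lambda>r. Kj (Suc m) n (z * a / t) (G' G t) (restrict (\<lambda>i. c t i * r i) R)"
    have Rt: "0 < y i - t" "0 < y i - a" if "i \<in> R" for i using R[OF that] t by auto
    have "?L t = (\<integral>\<^sup>+x. Ki (Suc m) n y (z * a / t) (G' G t) x \<partial>lb {Suc m..<n})"
      by (rule nn_integral_cong) (rule Ki_peel[OF dep t])
    also have "... = ennreal (vdm (Suc m) n y) * (\<integral>\<^sup>+r. Kj (Suc m) n (z * a / t) (G' G t) r \<partial>lb R)"
    proof (rule IH)
      show "0 < z * a / t" using z ab t by simp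
      show "G' G t \<in> borel_measurable RN" by (rule measurable_G'[OF G])
      fix u v :: "nat => real" assume uv: "\<forall>i\<in>{Suc m..n}. u i = v i"
      then have s: "(\<Sum>i\<in>{Suc m..n}. y i * u i / d i) = (\<Sum>i\<in>{Suc m..n}. y i * v i / d i)" for d by simp
      have "G (\<lambda>i. if i = m then (t - a) / a * (1 + (\<Sum>i\<in>{Suc m..n}. y i * v i / (y i - a))) else u i * (y i - t) / (y i - a)) =
          G (\<lambda>i. if i = m then (t - a) / a * (1 + (\<Sum>i\<in>{Suc m..n}. y i * v i / (y i - a))) else v i * (y i - t) / (y i - a))"
        by (rule dep) (use uv in auto)
      then show "G' G t u = G' G t v" unfolding G'_def W_def s by simp
    qed
    also have "(\<integral>\<^sup>+r. Kj (Suc m) n (z * a / t) (G' G t) r \<partial>lb R) = ennreal (\<Prod>i\<in>R. c t i) * (\<integral>\<^sup>+r. ?K r \<partial>lb R)"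
      by (rule nn_integral_lb_scale) (use Rt in \<open>auto intro: measurable_Kj measurable_G' G divide_pos_pos\<close>)
    also have "(\<integral>\<^sup>+r. ?K r \<partial>lb R) = ennreal ((b - a) * (\<Prod>k\<in>R. y k - t)) * ?E t"
    proof -
      have "(\<integral>\<^sup>+r. ?K r \<partial>lb R) = (\<integral>\<^sup>+r. ennreal ((b - a) * (\<Prod>k\<in>R. y k - t)) * Kh G t r \<partial>lb R)"
        by (rule nn_integral_cong) (rule Kj_scaled[OF dep t])
      then show ?thesis by (simp only: nn_integral_cmult[OF measurable_Kh[OF G measurable_const]] UNIV_I space_borel)
    qed
    also have "ennreal (vdm (Suc m) n y) * (ennreal (\<Prod>i\<in>R. c t i) * (ennreal ((b - a) * (\<Prod>k\<in>R. y k - t)) * ?E t)) =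
        ennreal ?V * ?E t"
    proof -
      \<comment> \<open>The Jacobian Prod c of the rescaling turns Prod (y_k - t) into Prod (y_k -
        a); with b - a this is the factor by which the Vandermonde product of y grows.\<close>
      have "{Suc m..n} = insert (Suc m) R" using mn by auto
      then have "?V = vdm (Suc m) n y * ((b - a) * (\<Prod>k\<in>R. y k - a))" using vdm_peel[of m n y] mn by simp
      moreover have "(\<Prod>k\<in>R. y k - a) = (\<Prod>i\<in>R. c t i) * (\<Prod>k\<in>R. y k - t)"
        unfolding prod.distrib[symmetric] by (intro prod.cong refl) (use Rt in \<open>force\<close>)
      ultimately have V: "?V = vdm (Suc m) n y * ((\<Prod>i\<in>R. c t i) * ((b - a) * (\<Prod>k\<in>R. y k - t)))" by simp
      have "0 < vdm (Suc m) n y" by (rule vdm_pos) (use incr_less[OF y] in auto)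
      moreover have "0 \<le> (\<Prod>i\<in>R. c t i)" "0 \<le> (b - a) * (\<Prod>k\<in>R. y k - t)"
        using ab Rt by (auto intro!: mult_nonneg_nonneg prod_nonneg divide_nonneg_nonneg intro: less_imp_le)
      ultimately show ?thesis unfolding V by (simp add: ennreal_mult mult.assoc)
    qed
    finally show ?thesis .
  qed
  \<comment> \<open>t is stored in the coordinate Suc m, which s will occupy afterwards; Fubini on
    {m<..n} then moves the integral over t inside.\<close>
  define H where "H \<omega> = (if a < \<omega> (Suc m) \<and> \<omega> (Suc m) < b then Kh G (\<omega> (Suc m)) \<omega> else 0)" for \<omega> :: "nat => real"
  have mH: "H \<in> borel_measurable (lb J)" for J
  proof -
    note [measurable] = measurable_Kh[OF G measurable_coord[of "Suc m" J]]
    show ?thesis unfolding H_def by measurable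
  qed
  have Hs: "H (r(Suc m := t)) = (if a < t \<and> t < b then Kh G t r else 0)" for r t
  proof -
    have "(\<Sum>i\<in>R. F i * (r(Suc m := t)) i) = (\<Sum>i\<in>R. F i * r i)" "(\<Sum>i\<in>R. (r(Suc m := t)) i) = (\<Sum>i\<in>R. r i)"
      "(\<Sum>i\<in>R. F i * (E i * (r(Suc m := t)) i) / D i) = (\<Sum>i\<in>R. F i * (E i * r i) / D i)" for E F D
      by (intro sum.cong refl; simp)+
    moreover have "(\<forall>i\<in>R. 0 < (r(Suc m := t)) i) \<longleftrightarrow> (\<forall>i\<in>R. 0 < r i)" by auto
    ultimately have "Kh G t (r(Suc m := t)) = Kh G t r" unfolding Kh_def h_def f_def w_def Gs_def by simp
    then show ?thesis by (simp add: H_def)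
  qed
  have I: "{m..<n} = insert m {Suc m..<n}" "{m<..n} = insert (Suc m) R" using mn by auto
  have "(\<integral>\<^sup>+x. Ki m n y z G x \<partial>lb {m..<n}) = (\<integral>\<^sup>+t. \<integral>\<^sup>+x. Ki m n y z G (x(m := t)) \<partial>lb {Suc m..<n} \<partial>lborel)"
    unfolding I(1) by (rule nn_integral_lb_insert(2)) (auto intro: measurable_Ki[OF G])
  also have "... = (\<integral>\<^sup>+t. ennreal ?V * (\<integral>\<^sup>+r. H (r(Suc m := t)) \<partial>lb R) \<partial>lborel)"
  proof (rule nn_integral_cong)
    fix t
    show "?L t = ennreal ?V * (\<integral>\<^sup>+r. H (r(Suc m := t)) \<partial>lb R)"
    proof (cases "a < t \<and> t < b")
      case True
      then show ?thesis unfolding Hs using inner[of t] by simp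
    next
      case False
      then show ?thesis unfolding Hs if_not_P[OF False] Ki_outside[OF False] by simp
    qed
  qed
  also have "... = (\<integral>\<^sup>+t. \<integral>\<^sup>+r. ennreal ?V * H (r(Suc m := t)) \<partial>lb R \<partial>lborel)"
  proof (intro nn_integral_cong nn_integral_cmult[symmetric])
    fix t
    have [measurable]: "(\<lambda>r. Kh G t r) \<in> borel_measurable (lb R)" by (rule measurable_Kh[OF G]) simp
    show "(\<lambda>r. H (r(Suc m := t))) \<in> borel_measurable (lb R)" unfolding Hs by measurable
  qed
  also have "... = (\<integral>\<^sup>+\<omega>. ennreal ?V * H \<omega> \<partial>lb {m<..n})"
    unfolding I(2) by (rule nn_integral_lb_insert(2)[symmetric]) (use mH in auto)
  also have "... = ennreal ?V * (\<integral>\<^sup>+\<omega>. H \<omega> \<partial>lb {m<..n})" by (rule nn_integral_cmult[OF mH])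
  also have "(\<integral>\<^sup>+\<omega>. H \<omega> \<partial>lb {m<..n}) = (\<integral>\<^sup>+r. \<integral>\<^sup>+t. H (r(Suc m := t)) \<partial>lborel \<partial>lb R)"
    unfolding I(2) by (rule nn_integral_lb_insert(1)) (use mH in auto)
  also have "... = (\<integral>\<^sup>+r. \<integral>\<^sup>+s. Kj m n z G (r(Suc m := s)) \<partial>lborel \<partial>lb R)"
  proof (rule nn_integral_cong)
    fix r :: "nat => real"
    let ?Z = "\<lambda>s. if 0 < s \<and> s < z - 1 - (\<Sum>i\<in>R. r i) then Gs G s r else 0"
    have K: "Kj m n z G (r(Suc m := s)) = (if (\<forall>i\<in>R. 0 < r i) then ?Z s else 0)" for s
    proof -
      have "(\<Sum>i\<in>{m<..n}. (r(Suc m := s)) i) = s + (\<Sum>i\<in>R. r i)" unfolding I(2) by simp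
      moreover have "(\<forall>i\<in>{m<..n}. 0 < (r(Suc m := s)) i) \<longleftrightarrow> 0 < s \<and> (\<forall>i\<in>R. 0 < r i)" unfolding I(2) by auto
      moreover have "s + c < z - 1 \<longleftrightarrow> s < z - 1 - c" for c by linarith
      ultimately show ?thesis unfolding Kj_def Gs_def by simp
    qed
    show "(\<integral>\<^sup>+t. H (r(Suc m := t)) \<partial>lborel) = (\<integral>\<^sup>+s. Kj m n z G (r(Suc m := s)) \<partial>lborel)"
    proof (cases "\<forall>i\<in>R. 0 < r i")
      case True
      let ?N = "\<lambda>t. if a < t \<and> t < b \<and> 0 < h t r then Gs G (f t r) r * ennreal (w t r) else 0"
      have "(\<lambda>s. Gs G s r) \<in> borel_measurable borel" by (rule measurable_Gs[OF G]) auto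
      from one_dim[of r, OF _ this] True
      have "(\<integral>\<^sup>+t. ?N t \<partial>lborel) = (\<integral>\<^sup>+s. ?Z s \<partial>lborel)" by blast
      moreover have "H (r(Suc m := t)) = ?N t" for t unfolding Hs Kh_def using True by auto
      moreover have "Kj m n z G (r(Suc m := s)) = ?Z s" for s unfolding K using True by auto
      ultimately show ?thesis by (simp only:)
    next
      case False
      then have "H (r(Suc m := t)) = 0" "Kj m n z G (r(Suc m := t)) = 0" for t unfolding Hs K Kh_def by auto
      then show ?thesis by simp
    qed
  qed
  also have "... = (\<integral>\<^sup>+r. Kj m n z G r \<partial>lb {m<..n})"
    unfolding I(2) by (rule nn_integral_lb_insert(1)[symmetric]) (auto intro: measurable_Kj[OF G])
  finally show ?thesis .
qed

end

text \<open>Downward induction on m. For m = n no free variable is left on either side: x_n = z y_n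
  and r_n = z - 1.\<close>

theorem interlacing_integral:
  assumes "m \<le> n" "incr m n y" "0 < z" "G \<in> borel_measurable RN" "\<And>u v. (\<forall>i\<in>{m..n}. u i = v i) ==> G u = G v"
  shows "(\<integral>\<^sup>+x. Ki m n y z G x \<partial>lb {m..<n}) = ennreal (vdm m n y) * (\<integral>\<^sup>+r. Kj m n z G r \<partial>lb {m<..n})" using assms
proof (induction m arbitrary: z G rule: inc_induct)
  case base
  have y: "0 < y n" using base.prems(1) by (simp add: incr_def)
  let ?u = "\<lambda>_. undefined :: real"
  have "ratio {n..n} (lastpt n n y z ?u) y n = z - 1" using y by (simp add: ratio_def lastpt_def divide_simps algebra_simps)
  then have "G (ratio {n..n} (lastpt n n y z ?u) y) = G (?u(n := z - 1))" by (intro base.prems(4)) simp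
  moreover have "ilace n n y (lastpt n n y z ?u) \<longleftrightarrow> 0 < z - 1" using y by (simp add: ilace_def lastpt_def)
  moreover have "vdm n n x = 1" for x by (simp add: vdm_def)
  moreover have "{n..<n} = {}" "{n<..n} = {}" by auto
  ultimately show ?case by (simp add: nn_integral_lb_empty Ki_def Kj_def)
next
  case (step m)
  then interpret one_step m n y z by unfold_locales auto
  show ?case
  proof (rule step)
    show "G \<in> borel_measurable RN" by (rule step.prems(3))
    show "G u = G v" if "\<forall>i\<in>{m..n}. u i = v i" for u v by (rule step.prems(4)[OF that])
    fix z' :: real and G' :: "(nat => real) => ennreal"
    assume "0 < z'" "G' \<in> borel_measurable RN" "\<And>u v. (\<forall>i\<in>{Suc m..n}. u i = v i) ==> G' u = G' v"
    then show "(\<integral>\<^sup>+x. Ki (Suc m) n y z' G' x \<partial>lb {Suc m..<n}) =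
        ennreal (vdm (Suc m) n y) * (\<integral>\<^sup>+r. Kj (Suc m) n z' G' r \<partial>lb {Suc m<..n})" by (intro step.IH incr_Suc[OF y])
  qed
qed

subsection \<open>Moments of the Dirichlet distribution\<close>

lemma nn_integral_Beta:
  fixes \<alpha> \<beta> T :: real
  assumes "0 < \<alpha>" "0 < \<beta>" "0 < T"
  shows "(\<integral>\<^sup>+s. (if 0 < s \<and> s < T then ennreal (s powr (\<alpha> - 1) * (T - s) powr (\<beta> - 1)) else 0) \<partial>lborel) =
    ennreal (T powr (\<alpha> + \<beta> - 1) * Beta \<alpha> \<beta>)"
proof -
  let ?f = "\<lambda>t :: real. if t \<in> {0..1} then t powr (\<alpha> - 1) * (1 - t) powr (\<beta> - 1) else 0"
  let ?g = "\<lambda>t. if 0 < 0 + T * t \<and> 0 + T * t < T then ennreal ((0 + T * t) powr (\<alpha> - 1) * (T - (0 + T * t)) powr (\<beta> - 1)) else 0"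
  have "(?f has_integral Beta \<alpha> \<beta>) UNIV"
    unfolding has_integral_restrict_UNIV by (rule has_integral_Beta_real[OF assms(1,2)])
  then have B: "(\<integral>\<^sup>+t. ?f t \<partial>lborel) = ennreal (Beta \<alpha> \<beta>)" by (intro nn_integral_has_integral_lborel) auto
  have "(\<integral>\<^sup>+s. (if 0 < s \<and> s < T then ennreal (s powr (\<alpha> - 1) * (T - s) powr (\<beta> - 1)) else 0) \<partial>lborel) =
      ennreal \<bar>T\<bar> * (\<integral>\<^sup>+t. ?g t \<partial>lborel)" by (rule nn_integral_real_affine) (use assms in auto)
  also have "(\<integral>\<^sup>+t. ?g t \<partial>lborel) = (\<integral>\<^sup>+t. ennreal (T powr (\<alpha> + \<beta> - 2)) * ennreal (?f t) \<partial>lborel)"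
  proof (rule nn_integral_cong)
    fix t :: real
    show "?g t = ennreal (T powr (\<alpha> + \<beta> - 2)) * ennreal (?f t)"
    proof (cases "0 < t \<and> t < 1")
      case True
      then have "(T - T * t) powr (\<beta> - 1) = T powr (\<beta> - 1) * (1 - t) powr (\<beta> - 1)"
        using assms powr_mult[of T "1 - t" "\<beta> - 1"] by (simp add: algebra_simps)
      moreover have "T powr (\<alpha> + \<beta> - 2) = T powr (\<alpha> - 1) * T powr (\<beta> - 1)" by (simp add: powr_add[symmetric])
      ultimately show ?thesis using True assms by (simp add: powr_mult ennreal_mult[symmetric] mult_ac)
    next
      case False
      then have 1: "\<not> (0 < 0 + T * t \<and> 0 + T * t < T)" using assms by (auto simp: zero_less_mult_iff)
      have 2: "?f t = 0" using False by auto
      show ?thesis unfolding if_not_P[OF 1] 2 by simp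
    qed
  qed
  also have "... = ennreal (T powr (\<alpha> + \<beta> - 2)) * ennreal (Beta \<alpha> \<beta>)" unfolding B[symmetric] by (rule nn_integral_cmult) simp
  also have "ennreal \<bar>T\<bar> * (ennreal (T powr (\<alpha> + \<beta> - 2)) * ennreal (Beta \<alpha> \<beta>)) = ennreal (T powr (\<alpha> + \<beta> - 1) * Beta \<alpha> \<beta>)"
  proof -
    have "T * T powr (\<alpha> + \<beta> - 2) = T powr (\<alpha> + \<beta> - 1)" using assms powr_add[of T 1 "\<alpha> + \<beta> - 2"] by simp
    then show ?thesis using assms by (simp add: ennreal_mult'[symmetric] mult.assoc[symmetric])
  qed
  finally show ?thesis .
qed

text \<open>\<beta> is the parameter of the eliminated coordinate and is generalised: integrating
  out r_i by the Beta integral replaces \<beta> by a_i + \<beta>.\<close>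

lemma dirichlet_integral:
  fixes a :: "nat => real"
  assumes "finite J" "\<And>i. i \<in> J ==> 0 < a i" "0 < \<beta>" "0 < \<tau>"
  shows "(\<integral>\<^sup>+r. (if (\<forall>i\<in>J. 0 < r i) \<and> (\<Sum>i\<in>J. r i) < \<tau>
      then ennreal ((\<Prod>i\<in>J. r i powr (a i - 1)) * (\<tau> - (\<Sum>i\<in>J. r i)) powr (\<beta> - 1)) else 0) \<partial>lb J) =
    ennreal (\<tau> powr (\<beta> + (\<Sum>i\<in>J. a i) - 1) * ((\<Prod>i\<in>J. Gamma (a i)) * Gamma \<beta> / Gamma (\<beta> + (\<Sum>i\<in>J. a i))))" using assms
proof (induction J arbitrary: \<beta> rule: finite_induct)
  case empty
  then have "Gamma \<beta> \<noteq> 0" using Gamma_real_pos[of \<beta>] by (auto simp: less_le)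
  then show ?case unfolding nn_integral_lb_empty using empty by simp
next
  case (insert i J)
  have a: "0 < a i" "\<And>j. j \<in> J ==> 0 < a j" using insert.prems by auto
  define F where "F \<beta> J r = (if (\<forall>i\<in>J. 0 < r i) \<and> (\<Sum>i\<in>J. r i) < \<tau>
      then ennreal ((\<Prod>i\<in>J. r i powr (a i - 1)) * (\<tau> - (\<Sum>i\<in>J. r i)) powr (\<beta> - 1)) else 0)" for \<beta> J and r :: "nat => real"
  have m: "F \<beta> K \<in> borel_measurable (lb L)" if [simp]: "finite K" for \<beta> K L unfolding F_def[abs_def] by measurable
  have inner: "(\<integral>\<^sup>+s. F \<beta> (insert i J) (r(i := s)) \<partial>lborel) = ennreal (Beta (a i) \<beta>) * F (a i + \<beta>) J r" for r
  proof -
    let ?P = "\<Prod>j\<in>J. r j powr (a j - 1)" and ?S = "\<Sum>j\<in>J. r j"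
    have eq: "F \<beta> (insert i J) (r(i := s)) = (if (\<forall>j\<in>J. 0 < r j) then
        (if 0 < s \<and> s < \<tau> - ?S then ennreal ?P * ennreal (s powr (a i - 1) * (\<tau> - ?S - s) powr (\<beta> - 1)) else 0) else 0)" for s
    proof -
      have e1: "(\<Sum>j\<in>insert i J. (r(i := s)) j) = s + ?S"
        using insert.hyps by (subst sum.insert) (auto intro!: arg_cong2[where f = "(+)"] sum.cong)
      have e2: "(\<Prod>j\<in>insert i J. (r(i := s)) j powr (a j - 1)) = s powr (a i - 1) * ?P"
        using insert.hyps by (subst prod.insert) (auto intro!: arg_cong2[where f = "(*)"] prod.cong)
      have e3: "(\<forall>j\<in>insert i J. 0 < (r(i := s)) j) \<longleftrightarrow> 0 < s \<and> (\<forall>j\<in>J. 0 < r j)" using insert.hyps by auto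
      have e4: "\<tau> - (s + ?S) = \<tau> - ?S - s" "s + ?S < \<tau> \<longleftrightarrow> s < \<tau> - ?S" by linarith+
      have p: "0 \<le> ?P" by (simp add: prod_nonneg)
      have "ennreal (s powr (a i - 1) * ?P * w) = ennreal ?P * ennreal (s powr (a i - 1) * w)" for w
        unfolding ennreal_mult'[OF p, symmetric] by (simp only: mult_ac)
      then show ?thesis unfolding F_def e1 e2 e3 e4 by auto
    qed
    show ?thesis
    proof (cases "(\<forall>j\<in>J. 0 < r j) \<and> ?S < \<tau>")
      case True
      then have T: "0 < \<tau> - ?S" by simp
      have "(\<integral>\<^sup>+s. F \<beta> (insert i J) (r(i := s)) \<partial>lborel) =
          (\<integral>\<^sup>+s. ennreal ?P * (if 0 < s \<and> s < \<tau> - ?S then ennreal (s powr (a i - 1) * (\<tau> - ?S - s) powr (\<beta> - 1)) else 0) \<partial>lborel)"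
        unfolding eq using True by (intro nn_integral_cong) auto
      also have "... = ennreal ?P * ennreal ((\<tau> - ?S) powr (a i + \<beta> - 1) * Beta (a i) \<beta>)"
        by (subst nn_integral_cmult) (auto simp: nn_integral_Beta[OF a(1) insert.prems(2) T])
      finally show ?thesis using True Beta_def[of "a i" \<beta>] a insert.prems
        by (simp add: F_def ennreal_mult'[symmetric] ennreal_mult''[symmetric] prod_nonneg mult_ac)
    next
      case False
      have "F \<beta> (insert i J) (r(i := s)) = 0" for s unfolding eq using False by auto
      moreover have "F (a i + \<beta>) J r = 0" using False by (auto simp: F_def)
      ultimately show ?thesis by simp
    qed
  qed
  have "(\<integral>\<^sup>+r. F \<beta> (insert i J) r \<partial>lb (insert i J)) = (\<integral>\<^sup>+r. \<integral>\<^sup>+s. F \<beta> (insert i J) (r(i := s)) \<partial>lborel \<partial>lb J)"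
    by (rule nn_integral_lb_insert(1)) (use insert.hyps m in auto)
  also have "... = ennreal (Beta (a i) \<beta>) * (\<integral>\<^sup>+r. F (a i + \<beta>) J r \<partial>lb J)"
    unfolding inner by (rule nn_integral_cmult) (use insert.hyps m in auto)
  also have "(\<integral>\<^sup>+r. F (a i + \<beta>) J r \<partial>lb J) =
      ennreal (\<tau> powr (a i + \<beta> + (\<Sum>i\<in>J. a i) - 1) * ((\<Prod>i\<in>J. Gamma (a i)) * Gamma (a i + \<beta>) / Gamma (a i + \<beta> + (\<Sum>i\<in>J. a i))))"
    unfolding F_def by (rule insert.IH[OF a(2) add_pos_pos[OF a(1)]]) (use insert.prems in auto)
  also have "ennreal (Beta (a i) \<beta>) * \<dots> = ennreal (\<tau> powr (\<beta> + (\<Sum>i\<in>insert i J. a i) - 1) *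
      ((\<Prod>i\<in>insert i J. Gamma (a i)) * Gamma \<beta> / Gamma (\<beta> + (\<Sum>i\<in>insert i J. a i))))"
  proof -
    have "0 < Gamma (a i + \<beta>)" "0 < Gamma (a i)" "0 < Gamma \<beta>"
      using a(1) insert.prems(2) by (auto intro: Gamma_real_pos add_pos_pos)
    then have "0 \<le> Beta (a i) \<beta>" "Beta (a i) \<beta> * Gamma (a i + \<beta>) = Gamma (a i) * Gamma \<beta>" by (auto simp: Beta_def)
    then show ?thesis using insert.hyps
      by (simp add: ennreal_mult'[symmetric] mult_ac add_ac) (simp add: mult.left_commute[of _ "Beta _ _"] mult.assoc[symmetric])
  qed
  finally show ?case unfolding F_def .
qed

section \<open>Dirichlet weights on the interlacing region\<close>

definition Kw :: "nat => (nat => real) => real => (nat => real) => (nat => real) => real" where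
  "Kw n y z a x = (if ilace 1 n y (lastpt 1 n y z x)
     then vdm 1 n (lastpt 1 n y z x) / (\<Prod>k\<in>{1..<n}. x k) * (\<Prod>i=1..n. ratio {1..n} (lastpt 1 n y z x) y i powr (a i - 1)) else 0)"

lemma ilace_lastpt_pos:
  assumes y: "incr 1 n y" and x: "ilace 1 n y (lastpt 1 n y z x)" and k: "k \<in> {1..<n}"
  shows "0 < x k"
proof -
  have "y k < lastpt 1 n y z x k" using x k by (auto simp: ilace_def)
  moreover have "lastpt 1 n y z x k = x k" using k by (simp add: lastpt_def)
  ultimately show ?thesis using incr_pos[OF y, of k] k by auto
qed

text \<open>The parameters a_i are free so that a monomial in r can be absorbed into the weight;
  positivity of the integrand carries the value over from the nonnegative integral.\<close>

lemma Kw_integral: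
  assumes n: "1 \<le> n" and y: "incr 1 n y" and z: "1 < z" and a: "\<And>i. i \<in> {1..n} ==> 0 < a i"
  shows "has_bochner_integral (lb {1..<n}) (Kw n y z a)
    (vdm 1 n y * ((z - 1) powr ((\<Sum>i=1..n. a i) - 1) * ((\<Prod>i=1..n. Gamma (a i)) / Gamma (\<Sum>i=1..n. a i))))"
proof (rule has_bochner_integral_nn_integral)
  define G where "G r = ennreal (\<Prod>i=1..n. r i powr (a i - 1))" for r :: "nat => real"
  have G: "G \<in> borel_measurable RN" unfolding G_def by measurable
  have nonneg: "0 \<le> vdm 1 n (lastpt 1 n y z x) / (\<Prod>k\<in>{1..<n}. x k)" if "ilace 1 n y (lastpt 1 n y z x)" for x
    using vdm_pos[of 1 n "lastpt 1 n y z x"] ilace_less[OF y that] ilace_lastpt_pos[OF y that]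
    by (intro divide_nonneg_nonneg prod_nonneg) (auto intro: less_imp_le)
  have Ki: "ennreal (Kw n y z a x) = Ki 1 n y z G x" for x
  proof (cases "ilace 1 n y (lastpt 1 n y z x)")
    case True
    show ?thesis unfolding Kw_def Ki_def G_def if_P[OF True] ennreal_mult'[OF nonneg[OF True]] ..
  qed (simp add: Kw_def Ki_def)
  show "AE x in lb {1..<n}. 0 \<le> Kw n y z a x"
  proof (rule AE_I2)
    fix x
    have "0 \<le> (\<Prod>i=1..n. ratio {1..n} (lastpt 1 n y z x) y i powr (a i - 1))" by (simp add: prod_nonneg)
    then show "0 \<le> Kw n y z a x"
      unfolding Kw_def by (cases "ilace 1 n y (lastpt 1 n y z x)") (simp_all only: if_True if_False mult_nonneg_nonneg[OF nonneg] order_refl)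
  qed
  show "Kw n y z a \<in> borel_measurable (lb {1..<n})" unfolding Kw_def[abs_def] ilace_def vdm_def ratio_def by measurable
  have D: "0 < (\<Prod>i=1..n. Gamma (a i)) / Gamma (\<Sum>i=1..n. a i)"
    using a n by (intro divide_pos_pos prod_pos Gamma_real_pos sum_pos) auto
  have V: "0 < vdm 1 n y" by (rule vdm_pos) (use incr_less[OF y] in auto)
  show "0 \<le> vdm 1 n y * ((z - 1) powr ((\<Sum>i=1..n. a i) - 1) * ((\<Prod>i=1..n. Gamma (a i)) / Gamma (\<Sum>i=1..n. a i)))"
    using D V by (intro mult_nonneg_nonneg) auto
  have I: "{1..n} = insert 1 {1<..n}" using n by auto
  have "Kj 1 n z G r = (if (\<forall>i\<in>{1<..n}. 0 < r i) \<and> (\<Sum>i\<in>{1<..n}. r i) < z - 1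
      then ennreal ((\<Prod>i\<in>{1<..n}. r i powr (a i - 1)) * (z - 1 - (\<Sum>i\<in>{1<..n}. r i)) powr (a 1 - 1)) else 0)" for r
  proof -
    have "(\<Prod>i=1..n. (r(1 := s)) i powr (a i - 1)) = (\<Prod>i\<in>{1<..n}. r i powr (a i - 1)) * s powr (a 1 - 1)" for s
      unfolding I by (simp add: mult.commute)
    then show ?thesis by (simp add: Kj_def G_def)
  qed
  then have "(\<integral>\<^sup>+r. Kj 1 n z G r \<partial>lb {1<..n}) = ennreal ((z - 1) powr (a 1 + (\<Sum>i\<in>{1<..n}. a i) - 1) *
      ((\<Prod>i\<in>{1<..n}. Gamma (a i)) * Gamma (a 1) / Gamma (a 1 + (\<Sum>i\<in>{1<..n}. a i))))"
    using dirichlet_integral[of "{1<..n}" a "a 1" "z - 1"] a n z by simp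
  moreover have "(\<integral>\<^sup>+x. Ki 1 n y z G x \<partial>lb {1..<n}) = ennreal (vdm 1 n y) * (\<integral>\<^sup>+r. Kj 1 n z G r \<partial>lb {1<..n})"
    by (rule interlacing_integral[OF n y _ G]) (use z in \<open>auto simp: G_def\<close>)
  ultimately show "(\<integral>\<^sup>+x. ennreal (Kw n y z a x) \<partial>lb {1..<n}) =
    ennreal (vdm 1 n y * ((z - 1) powr ((\<Sum>i=1..n. a i) - 1) * ((\<Prod>i=1..n. Gamma (a i)) / Gamma (\<Sum>i=1..n. a i))))"
    unfolding Ki ennreal_mult'[OF less_imp_le[OF V]] by (simp add: I mult.commute)
qed

subsection \<open>The integral operator is the algebraic one\<close>

lemma ordered_pos_incr: "ordered_pos n y ==> incr 1 n y"
proof -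
  assume y: "ordered_pos n y"
  have "i \<in> {1..n} --> 0 < y i" for i
  proof (induction i)
    case (Suc i)
    show ?case
    proof (cases "i = 0")
      case True
      then show ?thesis using y by (simp add: ordered_pos_def One_nat_def)
    next
      case False
      show ?thesis
      proof
        assume "Suc i \<in> {1..n}"
        then have "0 < y i" "y i < y (Suc i)" using False Suc y by (auto simp: ordered_pos_def)
        then show "0 < y (Suc i)" by simp
      qed
    qed
  qed simp
  then show ?thesis using y by (auto simp: incr_def ordered_pos_def)
qed

text \<open>On the hypersurface \<open>\<prod> x\<^sub>i = const\<close> the two square roots share the factor
  \<open>(\<Sum> 1/x\<^sub>i\<^sup>2)\<^sup>1\<^sup>/\<^sup>2\<close>.\<close>

lemma delta_density:
  fixes x :: "nat => real" and c :: real
  assumes n: "1 \<le> n" and x: "\<And>k. k \<in> {1..<n} ==> 0 < x k" and c: "0 < c"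
  defines "\<phi> \<equiv> \<lambda>x. c / (\<Prod>i\<in>{1..<n}. x i)"
  shows "sqrt (1 + (\<Sum>i\<in>{1..<n}. (partial i \<phi> x)\<^sup>2)) /
      sqrt (\<Sum>i=1..n. (partial i (\<lambda>x. (\<Prod>i=1..n. x i) - c) (x(n := \<phi> x)))\<^sup>2) = 1 / (\<Prod>i\<in>{1..<n}. x i)"
proof -
  define P where "P = (\<Prod>i\<in>{1..<n}. x i)"
  have P: "0 < P" unfolding P_def by (intro prod_pos x)
  have I: "{1..n} = insert n {1..<n}" using n by auto
  let ?R = "\<lambda>i. \<Prod>j\<in>{1..<n} - {i}. x j"
  have p1: "partial i \<phi> x = - (\<phi> x / x i)" if i: "i \<in> {1..<n}" for i
  proof -
    have "\<phi> (x(i := t)) = c / ?R i / t" for t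
    proof -
      have "(\<Prod>j\<in>{1..<n} - {i}. (x(i := t)) j) = ?R i" by (rule prod.cong) auto
      then have "(\<Prod>j\<in>{1..<n}. (x(i := t)) j) = t * ?R i" using i by (subst prod.remove[of _ i]) auto
      then show ?thesis by (simp add: \<phi>_def mult.commute)
    qed
    moreover have "((\<lambda>t. C / t) has_real_derivative - (C / x i) / x i) (at (x i))" for C
      using x[OF i] by (auto intro!: derivative_eq_intros simp: power2_eq_square)
    ultimately have "partial i \<phi> x = - (c / ?R i / x i) / x i" unfolding partial_def by (simp only: DERIV_imp_deriv)
    moreover have "\<phi> x = c / ?R i / x i" unfolding \<phi>_def using i by (subst prod.remove[of _ i]) (auto simp: mult.commute)
    ultimately show ?thesis by simp
  qed
  let ?X = "x(n := \<phi> x)"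
  let ?D = "\<lambda>i. partial i (\<lambda>x. (\<Prod>i=1..n. x i) - c) ?X"
  let ?Q = "\<lambda>i. \<Prod>j\<in>{1..n} - {i}. ?X j"
  have X: "0 < ?X i" if "i \<in> {1..n}" for i using that x P c n by (auto simp: \<phi>_def P_def)
  have PX: "(\<Prod>i=1..n. ?X i) = c"
  proof -
    have "(\<Prod>i\<in>{1..<n}. ?X i) = P" unfolding P_def by (rule prod.cong) auto
    moreover have "\<phi> x * P = c" using P unfolding \<phi>_def P_def[symmetric] by simp
    ultimately show ?thesis unfolding I by simp
  qed
  have p2: "?D i = c / ?X i" if i: "i \<in> {1..n}" for i
  proof -
    have "(\<Prod>j=1..n. (?X(i := t)) j) - c = t * ?Q i - c" for t
    proof -
      have "(\<Prod>j\<in>{1..n} - {i}. (?X(i := t)) j) = ?Q i" by (rule prod.cong) auto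
      then show ?thesis using i by (subst prod.remove[of _ i]) auto
    qed
    moreover have "((\<lambda>t. t * C - c) has_real_derivative C) (at (?X i))" for C by (auto intro!: derivative_eq_intros)
    ultimately have "?D i = ?Q i" unfolding partial_def by (simp only: DERIV_imp_deriv)
    also have "?X i * \<dots> = c" unfolding PX[symmetric] using i by (intro prod.remove[symmetric]) auto
    then have "?Q i = c / ?X i" using X[OF i] by (metis mult.commute nonzero_eq_divide_eq less_irrefl)
    finally show ?thesis .
  qed
  define S where "S = (\<Sum>i\<in>{1..<n}. 1 / (x i)\<^sup>2)"
  have "0 \<le> S" unfolding S_def by (intro sum_nonneg) auto
  have \<phi>: "0 < \<phi> x" using P c by (simp add: \<phi>_def P_def)
  have s1: "1 + (\<Sum>i\<in>{1..<n}. (partial i \<phi> x)\<^sup>2) = (\<phi> x)\<^sup>2 * (1 / (\<phi> x)\<^sup>2 + S)"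
  proof -
    have "(\<Sum>i\<in>{1..<n}. (partial i \<phi> x)\<^sup>2) = (\<phi> x)\<^sup>2 * S"
      unfolding S_def sum_distrib_left by (intro sum.cong refl) (simp add: p1 power_divide)
    then show ?thesis using \<phi> by (simp add: distrib_left)
  qed
  have s2: "(\<Sum>i=1..n. (?D i)\<^sup>2) = c\<^sup>2 * (1 / (\<phi> x)\<^sup>2 + S)"
  proof -
    have "(\<Sum>i=1..n. (?D i)\<^sup>2) = (\<Sum>i=1..n. c\<^sup>2 * (1 / (?X i)\<^sup>2))"
      by (intro sum.cong refl) (simp only: p2 power_divide times_divide_eq_right mult_1_right)
    also have "... = c\<^sup>2 * (1 / (\<phi> x)\<^sup>2 + S)" unfolding sum_distrib_left[symmetric] I S_def by simp
    finally show ?thesis .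
  qed
  have "0 < 1 / (\<phi> x)\<^sup>2 + S" using \<phi> \<open>0 \<le> S\<close> by (intro add_pos_nonneg) auto
  then have "sqrt ((\<phi> x)\<^sup>2 * (1 / (\<phi> x)\<^sup>2 + S)) / sqrt (c\<^sup>2 * (1 / (\<phi> x)\<^sup>2 + S)) = \<phi> x / c"
    using \<phi> c by (simp add: real_sqrt_mult)
  then show ?thesis unfolding s1 s2 using c by (simp add: \<phi>_def)
qed

text \<open>For fixed y, p(x) is a polynomial q in r. Each monomial of q shifts the Dirichlet
  parameters, so the integrand is a finite combination of the \<open>Kw\<close>, and the Gamma
  quotients become the moments \<open>mom\<close>.\<close>

theorem Q_integral_Qalg:
  assumes n: "1 \<le> n" and g: "0 < g" and z: "1 < z" and y0: "ordered_pos n y" and p: "p \<in> sym_polys n"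
  shows "Q_integral n g z p y = eval (\<lambda>i. complex_of_real (y i)) (Qalg n g (complex_of_real z) p)"
proof -
  have y: "incr 1 n y" by (rule ordered_pos_incr[OF y0])
  obtain F where F: "p = esub n F" using sym_polys_esub[OF p] by blast
  let ?y = "\<lambda>i. complex_of_real (y i)"
  define q where "q = suby n ?y (xsub n F)"
  \<comment> \<open>The weight contributes g and the monomial m its exponent of r_i.\<close>
  define a where "a m i = g + real (lk m (n + i))" for m :: "expo" and i
  have a: "0 < a m i" for m i using g by (simp add: a_def)
  have asum: "(\<Sum>i=1..n. a m i) = real n * g + real (rdeg n m)" for m by (simp add: a_def sum.distrib rdeg_def)
  define V where "V = vdm 1 n y"
  let ?W = "\<lambda>m. V * ((z - 1) powr (real n * g + real (rdeg n m) - 1) * ((\<Prod>i=1..n. Gamma (a m i)) / Gamma (real n * g + real (rdeg n m))))"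
  have V: "0 < V" unfolding V_def by (rule vdm_pos) (use incr_less[OF y] in auto)
  have vdm: "vandermonde n = vdm 1 n" by (auto simp: vandermonde_def vdm_def)
  define Y where "Y = (\<Prod>i=1..n. y i powr (g - 1))"
  have ypos: "0 < y i" if "i \<in> {1..n}" for i using incr_pos[OF y] that by simp
  have Y: "0 < Y" unfolding Y_def by (intro prod_pos) (use ypos in force)
  define c where "c = z * (\<Prod>i=1..n. y i)"
  have c: "0 < c" unfolding c_def using z ypos by (intro mult_pos_pos prod_pos) auto
  define \<phi> where "\<phi> x = c / (\<Prod>i\<in>{1..<n}. x i)" for x :: "nat => real"
  have X: "x(n := \<phi> x) = lastpt 1 n y z x" for x by (simp add: lastpt_def \<phi>_def c_def)
  define J where "J x = complex_of_real (sqrt (1 + (\<Sum>i\<in>{1..<n}. (partial i \<phi> x)\<^sup>2))) *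
      (indicator (interlacing n y) (x(n := \<phi> x)) *
        (complex_of_real (vandermonde n (x(n := \<phi> x)) * (\<Prod>i=1..n. xi n (x(n := \<phi> x)) y i powr (g - 1))) *
          eval (\<lambda>i. complex_of_real ((x(n := \<phi> x)) i)) p) /
        complex_of_real (sqrt (\<Sum>i=1..n. (partial i (\<lambda>x. (\<Prod>i=1..n. x i) - c) (x(n := \<phi> x)))\<^sup>2)))" for x
  have J: "J x = complex_of_real Y * (\<Sum>m\<in>ky q. lk q m * complex_of_real (Kw n y z (a m) x))" for x
  proof (cases "ilace 1 n y (x(n := \<phi> x))")
    case False
    then have "x(n := \<phi> x) \<notin> interlacing n y" by (simp add: interlacing_def ilace_def)
    moreover have "Kw n y z (a m) x = 0" for m using False by (simp add: Kw_def X)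
    ultimately show ?thesis unfolding J_def by simp
  next
    case True
    define X where "X = x(n := \<phi> x)"
    note T = True[folded X_def] True[unfolded X]
    have XL: "lastpt 1 n y z x = X" by (simp add: X X_def)
    define r where "r = ratio {1..n} X y"
    let ?X = "\<lambda>i. complex_of_real (X i)"
    let ?M = "\<lambda>m. \<Prod>i=1..n. r i ^ lk m (n + i)"
    have rpos: "0 < r i" if "i \<in> {1..n}" for i unfolding r_def by (rule ratio_pos[OF y T(1) that])
    have ind: "indicator (interlacing n y) X = (1 :: complex)" using T by (simp add: interlacing_def ilace_def)
    define D1 where "D1 = sqrt (1 + (\<Sum>i\<in>{1..<n}. (partial i \<phi> x)\<^sup>2))"
    define D2 where "D2 = sqrt (\<Sum>i=1..n. (partial i (\<lambda>x. (\<Prod>i=1..n. x i) - c) X)\<^sup>2)"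
    have D: "D1 / D2 = 1 / (\<Prod>k\<in>{1..<n}. x k)"
      unfolding D1_def D2_def X_def \<phi>_def by (rule delta_density[OF n ilace_lastpt_pos[OF y T(2)] c])
    have "xi n X y i powr (g - 1) = y i powr (g - 1) * r i powr (g - 1)" if i: "i \<in> {1..n}" for i
    proof -
      have "xi n X y i = y i * r i" using ypos[OF i] by (simp add: xi_def r_def ratio_def)
      then show ?thesis using ypos[OF i] rpos[OF i] by (simp add: powr_mult)
    qed
    then have xi: "(\<Prod>i=1..n. xi n X y i powr (g - 1)) = Y * (\<Prod>i=1..n. r i powr (g - 1))" by (simp add: Y_def prod.distrib)
    \<comment> \<open>Variables outside the block of the r get the value 1 and drop out of
      \<open>mon v m\<close>.\<close>
    define v where "v i = (if i \<in> {n+1..n+n} then complex_of_real (r (i - n)) else 1)" for i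
    let ?v = "\<lambda>i. if i \<in> {1..n} then ?y i else v i"
    have vr: "v (n + i) = complex_of_real (r i)" if "i \<in> {1..n}" for i using that by (simp add: v_def)
    have ev: "eval ?X p = (\<Sum>m\<in>ky q. lk q m * complex_of_real (?M m))"
    proof -
      have "eval ?X p = eval ?v (xsub n F)" unfolding F
      proof (rule eval_xsub_roots[symmetric])
        fix k
        have "inj_on ?y {1..n}" by (rule inj_onI) (simp add: inj_on_eq_iff[OF incr_inj[OF y]])
        moreover have "0 \<notin> ?y ` {1..n}" using ypos by force
        ultimately have "elem {1..n} ?X k = welem {1..n} ?y (ratio {1..n} ?X ?y) k" by (intro elem_welem_ratio) auto
        also have "... = welem {1..n} ?v (\<lambda>i. ?v (n + i)) k" by (rule welem_cong) (auto simp: v_def r_def ratio_def)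
        finally show "elem {1..n} ?X k = welem {1..n} ?v (\<lambda>i. ?v (n + i)) k" .
      qed
      also have "... = eval v q" by (simp add: q_def eval_suby)
      also have "... = (\<Sum>m\<in>ky q. lk q m * mon v m)" by (simp add: eval_def insertion_mon)
      also have "... = (\<Sum>m\<in>ky q. lk q m * complex_of_real (?M m))"
      proof (intro sum.cong refl arg_cong2[where f = "(*)"])
        fix m assume "m \<in> ky q"
        have "mon v m = (\<Prod>i\<in>ky m \<union> {n+1..n+n}. v i ^ lk m i)" by (rule mon_superset) auto
        also have "... = (\<Prod>i\<in>{n+1..n+n}. v i ^ lk m i)" by (rule prod.mono_neutral_right) (auto simp: v_def)
        also have "... = (\<Prod>i=1..n. v (n + i) ^ lk m (n + i))"
          by (rule prod.reindex_bij_witness[of _ "\<lambda>i. n + i" "\<lambda>i. i - n"]) auto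
        also have "... = complex_of_real (?M m)"
          unfolding of_real_prod of_real_power by (intro prod.cong refl) (simp only: vr)
        finally show "mon v m = complex_of_real (?M m)" .
      qed
      finally show ?thesis .
    qed
    have Kw: "Kw n y z (a m) x = D1 / D2 * (vdm 1 n X * ((\<Prod>i=1..n. r i powr (g - 1)) * ?M m))" for m
    proof -
      have "(\<Prod>i=1..n. r i powr (a m i - 1)) = (\<Prod>i=1..n. r i powr (g - 1) * r i ^ lk m (n + i))"
      proof (rule prod.cong[OF refl])
        fix i assume i: "i \<in> {1..n}"
        have "r i powr (a m i - 1) = r i powr ((g - 1) + real (lk m (n + i)))" by (simp only: a_def diff_add_eq)
        also have "... = r i powr (g - 1) * r i ^ lk m (n + i)"
          unfolding powr_add using rpos[OF i] by (simp add: powr_realpow)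
        finally show "r i powr (a m i - 1) = r i powr (g - 1) * r i ^ lk m (n + i)" .
      qed
      then show ?thesis unfolding Kw_def XL D using T(1) by (simp add: r_def prod.distrib)
    qed
    have "J x = complex_of_real (D1 / D2) * complex_of_real (vdm 1 n X * (Y * (\<Prod>i=1..n. r i powr (g - 1)))) *
        (\<Sum>m\<in>ky q. lk q m * complex_of_real (?M m))"
      unfolding J_def X_def[symmetric] D1_def[symmetric] D2_def[symmetric] ind vdm xi ev by simp
    then show ?thesis unfolding Kw by (simp add: sum_distrib_left sum_divide_distrib mult_ac)
  qed
  have int: "has_bochner_integral (lb {1..<n}) (\<lambda>x. complex_of_real (Kw n y z (a m) x)) (complex_of_real (?W m))" for m
    unfolding V_def asum[symmetric] by (rule has_bochner_integral_of_real, rule Kw_integral[OF n y z a])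
  have "integral\<^sup>L (lb {1..<n}) J = complex_of_real Y * (\<Sum>m\<in>ky q. lk q m * complex_of_real (?W m))" unfolding J[abs_def]
    by (rule has_bochner_integral_integral_eq)
      (intro has_bochner_integral_mult_right has_bochner_integral_sum int)
  moreover have "delta_integral n (interlacing n y) (\<lambda>x. (\<Prod>i=1..n. x i) - z * (\<Prod>i=1..n. y i))
       (\<lambda>x. z * (\<Prod>i=1..n. y i) / (\<Prod>i\<in>{1..<n}. x i))
       (\<lambda>x. complex_of_real (vandermonde n x * (\<Prod>i=1..n. xi n x y i powr (g - 1)))
              * eval (\<lambda>i. complex_of_real (x i)) p) = integral\<^sup>L (lb {1..<n}) J"
    unfolding delta_integral_def graph_integral_def J_def \<phi>_def c_def ..
  ultimately have Q: "Q_integral n g z p y = complex_of_real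
       (Gamma (real n * g) / Gamma g ^ n * (z - 1) powr (1 - real n * g) / (V * Y)) *
      (complex_of_real Y * (\<Sum>m\<in>ky q. lk q m * complex_of_real (?W m)))" unfolding Q_integral_def vdm V_def Y_def by simp
  \<comment> \<open>Gamma (g + k) = Gamma g * (g)_k for each index and for the sum n g; the powers
    of z - 1 leave the degree of m in r.\<close>
  have coef: "Gamma (real n * g) / Gamma g ^ n * (z - 1) powr (1 - real n * g) / (V * Y) * Y * ?W m =
      (z - 1) ^ rdeg n m * ((\<Prod>i=1..n. pochhammer g (lk m (n + i))) / pochhammer (real n * g) (rdeg n m))" for m
  proof -
    have poch: "Gamma (u + real k) = Gamma u * pochhammer u k" "Gamma u \<noteq> 0" if "0 < u" for u :: real and k
    proof -
      have "u \<notin> \<int>\<^sub>\<le>\<^sub>0" using that by (auto elim!: nonpos_Ints_cases)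
      then show "Gamma (u + real k) = Gamma u * pochhammer u k" "Gamma u \<noteq> 0"
        using pochhammer_Gamma[of u k] by (auto simp: Gamma_eq_zero_iff)
    qed
    have ng: "0 < real n * g" using n g by simp
    have "(\<Prod>i=1..n. Gamma (a m i)) = Gamma g ^ n * (\<Prod>i=1..n. pochhammer g (lk m (n + i)))"
      unfolding a_def poch(1)[OF g] prod.distrib by simp
    moreover have "(z - 1) powr (1 - real n * g) * (z - 1) powr (real n * g + real (rdeg n m) - 1) = (z - 1) ^ rdeg n m"
      using z by (simp add: powr_add[symmetric] powr_realpow[symmetric])
    ultimately show ?thesis unfolding poch(1)[OF ng] using poch(2)[OF ng] poch(2)[OF g] V Y by (simp add: field_simps)
  qed
  have "Q_integral n g z p y = (\<Sum>m\<in>ky q. lk q m *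
      complex_of_real (Gamma (real n * g) / Gamma g ^ n * (z - 1) powr (1 - real n * g) / (V * Y) * Y * ?W m))"
    unfolding Q sum_distrib_left by (intro sum.cong refl) (simp only: of_real_mult mult_ac)
  also have "... = (\<Sum>m\<in>ky q. lk q m * ((complex_of_real z - 1) ^ rdeg n m * mom n g m))"
    unfolding coef mom_def pochhammer_of_real by simp
  also have "... = eval ?y (Qalg n g (complex_of_real z) p)" unfolding F Qalg_esub eval_EE q_def[symmetric] MM_def ..
  finally show ?thesis .
qed

section \<open>Factorisation of the separating operator\<close>

lemma hom_poly:
  assumes h: "semiring_hom h"
  shows "poly (map_poly h R) (h x) = h (poly R x)"
proof -
  interpret semiring_hom h by fact
  show ?thesis by (induction R) (auto simp: map_poly_pCons hadd hmult)
qed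

lemma map_poly_hom_add: "semiring_hom h ==> map_poly h (R + S) = map_poly h R + map_poly h S"
  by (rule poly_eqI) (simp add: coeff_map_poly semiring_hom.h0 semiring_hom.hadd)

lemma map_poly_hom_smult: "semiring_hom h ==> map_poly h (smult a R) = smult (h a) (map_poly h R)"
  by (rule poly_eqI) (simp add: coeff_map_poly semiring_hom.h0 semiring_hom.hmult)

lemma poly_eqI_Const:
  fixes R S :: "cpoly poly"
  assumes "infinite Z" "\<And>z. z \<in> Z ==> poly R (Const z) = poly S (Const z)"
  shows "R = S"
proof (rule ccontr)
  assume "R \<noteq> S"
  then have "finite {x. poly (R - S) x = 0}" by (intro poly_roots_finite) simp
  moreover have "Const ` Z \<subseteq> {x. poly (R - S) x = 0}" using assms(2) by auto
  ultimately have "finite (Const ` Z)" by (rule rev_finite_subset)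
  then show False using assms(1) finite_imageD[of Const Z] by (auto simp: inj_on_def)
qed

text \<open>Applying h to the coefficients gives a polynomial with the same values at all constants,
  hence the same polynomial.\<close>

lemma hom_fixes_coeffs:
  fixes R :: "cpoly poly"
  assumes h: "semiring_hom h" "\<And>c. h (Const c) = Const c" and R: "\<And>z. h (poly R (Const z)) = poly R (Const z)"
  shows "h (coeff R j) = coeff R j"
proof -
  have "map_poly h R = R" by (rule poly_eqI_Const[OF infinite_UNIV_char_0]) (metis h hom_poly R)
  then show ?thesis by (metis coeff_map_poly semiring_hom.h0[OF h(1)])
qed

text \<open>Besides permutations, the homomorphism that kills every variable outside {1..n} fixes
  all values; so it fixes the coefficients, which bounds their variables.\<close>

lemma coeffs_sym:
  assumes R: "\<And>z. poly R (Const z) \<in> sym_polys n"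
  shows "coeff R j \<in> sym_polys n"
proof -
  let ?h = "insertion Const (\<lambda>i. if i \<in> {1..n} then Var i else (0 :: cpoly))"
  have "?h (coeff R j) = coeff R j"
  proof (rule hom_fixes_coeffs)
    show "semiring_hom ?h" by (rule insertion_Const_hom)
    show "?h (Const c) = Const c" for c by (rule insertion_Const_Const)
    fix z
    have "?h (poly R (Const z)) = insertion Const Var (poly R (Const z))"
      by (rule insertion_cong) (use sym_vars[OF R[of z]] in auto)
    then show "?h (poly R (Const z)) = poly R (Const z)" by (simp only: insertion_Var_id)
  qed
  moreover have "vars (?h (coeff R j)) \<subseteq> {1..n}" by (rule vars_insertion) (auto simp: vars_Var)
  ultimately have "vars (coeff R j) \<subseteq> {1..n}" by simp
  moreover have "pm \<pi> (coeff R j) = coeff R j" if "\<pi> permutes {1..n}" for \<pi>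
  proof (rule hom_fixes_coeffs)
    show "semiring_hom (pm \<pi>)" by (rule pm_hom)
    show "pm \<pi> (Const c) = Const c" for c by simp
    show "pm \<pi> (poly R (Const z)) = poly R (Const z)" for z by (rule sym_pm[OF R that])
  qed
  ultimately show ?thesis by (simp add: sym_polys_pm)
qed

lemma poly_Const_sym: "(\<And>j. coeff R j \<in> sym_polys n) ==> poly R (Const z) \<in> sym_polys n"
  unfolding poly_altdef by (intro sym_sum sym_mult sym_power) auto

lemma Qalg_polynomial:
  assumes p: "p \<in> sym_polys n"
  shows "\<exists>R. \<forall>z. poly R (Const z) = Qalg n g z p"
proof -
  obtain F where F: "p = esub n F" using sym_polys_esub[OF p] by blast
  let ?q = "xsub n F"
  have "sg (ypart n m) (lk ?q m * mom n g m) * (Const z - 1) ^ rdeg n m =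
      sg (ypart n m) (lk ?q m * ((z - 1) ^ rdeg n m * mom n g m))" for m z
  proof -
    have "(Const z - 1) ^ rdeg n m = (Const ((z - 1) ^ rdeg n m) :: cpoly)"
      using Const_diff[of z 1] by (simp add: semiring_hom.hpower[OF Const_hom])
    then show ?thesis by (simp add: Const_def mult_single mult_ac)
  qed
  then have "poly (\<Sum>m\<in>ky ?q. smult (sg (ypart n m) (lk ?q m * mom n g m)) ([:- 1, 1:] ^ rdeg n m)) (Const z) = Qalg n g z p" for z
    unfolding F Qalg_esub EE_def by (simp add: poly_sum poly_power)
  then show ?thesis by blast
qed

section \<open>The Q-operator and its eigenvalues as polynomials in z\<close>

context
  fixes n :: nat and g :: real
  assumes n: "1 \<le> n" and g: "0 < g"
begin

text \<open>Infinitely many z > 1 determine a polynomial in z, and the ordered points determine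
  polynomials in y, so the description picks out the polynomial that interpolates
  \<open>Qalg\<close>.\<close>

lemma Q_poly:
  assumes p: "p \<in> sym_polys n"
  shows "coeff (Q_poly n g p) j \<in> sym_polys n" "poly (Q_poly n g p) (Const z) = Qalg n g z p"
proof -
  obtain R where R: "\<And>z. poly R (Const z) = Qalg n g z p" using Qalg_polynomial[OF p] by blast
  have Rsym: "coeff R j \<in> sym_polys n" for j by (rule coeffs_sym) (simp add: R Qalg_sym p)
  have "Q_poly n g p = R" unfolding Q_poly_def
  proof (rule the_equality)
    show "(\<forall>j. coeff R j \<in> sym_polys n) \<and> (\<forall>z y. 1 < z \<and> ordered_pos n y -->
        eval (\<lambda>i. complex_of_real (y i)) (poly R (Const (complex_of_real z))) = Q_integral n g z p y)"
      using Rsym Q_integral_Qalg[OF n g _ _ p] by (simp add: R)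
    fix R' assume R': "(\<forall>j. coeff R' j \<in> sym_polys n) \<and> (\<forall>z y. 1 < z \<and> ordered_pos n y -->
        eval (\<lambda>i. complex_of_real (y i)) (poly R' (Const (complex_of_real z))) = Q_integral n g z p y)"
    show "R' = R"
    proof (rule poly_eqI_Const[where Z = "complex_of_real ` {1<..}"])
      show "infinite (complex_of_real ` {1<..})" by (subst finite_image_iff) (auto intro: inj_onI simp: infinite_Ioi)
      fix z assume "z \<in> complex_of_real ` {1<..}"
      then obtain t where t: "z = complex_of_real t" "1 < t" by auto
      show "poly R' (Const z) = poly R (Const z)"
      proof (rule mpoly_eqI_ordered)
        show "vars (poly R' (Const z)) \<subseteq> {1..n}" "vars (poly R (Const z)) \<subseteq> {1..n}"
          using R' Rsym by (auto intro!: sym_vars poly_Const_sym)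
        show "eval (\<lambda>i. complex_of_real (y i)) (poly R' (Const z)) = eval (\<lambda>i. complex_of_real (y i)) (poly R (Const z))"
          if "ordered_pos n y" for y using R' t that Q_integral_Qalg[OF n g t(2) that p] by (simp add: R)
      qed
    qed
  qed
  then show "coeff (Q_poly n g p) j \<in> sym_polys n" "poly (Q_poly n g p) (Const z) = Qalg n g z p" by (simp_all add: R Rsym)
qed

lemma Q_op: "p \<in> sym_polys n ==> Q_op n g z p = Qalg n g z p" by (simp add: Q_op_def Q_poly(2))

lemma lk_poly_Const: "lk (poly R (Const z)) lam = poly (map_poly (\<lambda>c. lk c lam) R) z"
  for R :: "cpoly poly" by (induction R) (auto simp: map_poly_pCons lookup_add lookup_Const_mult)

text \<open>The Jack polynomial has coefficient 1 at lam, so the eigenvalue is the lam-coefficient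
  of its image and therefore polynomial in z.\<close>

lemma Q_eigenvalue:
  assumes lam: "lam \<in> partitions n"
  shows "Q_op n g z (jack n g lam) = Const (poly (Q_eigenvalue n g lam) z) * jack n g lam"
proof -
  let ?q = "map_poly (\<lambda>c. lk c lam) (Q_poly n g (jack n g lam))"
  have J: "jack n g lam \<in> sym_polys n" by (rule jack_sym[OF g lam])
  have J1: "lk (jack n g lam) lam = 1" using jack_props[OF g lam] by blast
  have q: "\<forall>z. Q_op n g z (jack n g lam) = Const (poly ?q z) * jack n g lam"
    using Qalg_jack[OF g lam] by (simp add: Q_op[OF J] Q_poly(2)[OF J] flip: lk_poly_Const)
  have "Q_eigenvalue n g lam = ?q" unfolding Q_eigenvalue_def
  proof (rule the_equality)
    show "\<forall>z. Q_op n g z (jack n g lam) = Const (poly ?q z) * jack n g lam" by (rule q)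
    fix q' assume q': "\<forall>z. Q_op n g z (jack n g lam) = Const (poly q' z) * jack n g lam"
    have "poly q' z = poly ?q z" for z
    proof -
      have "lk (Const (poly q' z) * jack n g lam) lam = lk (Const (poly ?q z) * jack n g lam) lam" using q q' by metis
      then show ?thesis by (simp only: lookup_Const_mult J1 mult_1_right)
    qed
    then show "q' = ?q" by (simp add: poly_eq_poly_eq_iff[symmetric] fun_eq_iff)
  qed
  then show ?thesis using q by simp
qed

lemma Q_poly_add:
  assumes "p \<in> sym_polys n" "q \<in> sym_polys n" shows "Q_poly n g (p + q) = Q_poly n g p + Q_poly n g q"
  by (rule poly_eqI_Const[OF infinite_UNIV_char_0])
    (use assms in \<open>simp add: Q_poly(2) sym_add lin_op_add[OF lin_op_Qalg]\<close>)

lemma Q_poly_Const_mult: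
  assumes "p \<in> sym_polys n" shows "Q_poly n g (Const c * p) = smult (Const c) (Q_poly n g p)"
  by (rule poly_eqI_Const[OF infinite_UNIV_char_0])
    (use assms in \<open>simp add: Q_poly(2) sym_mult lin_op_Const_mult[OF lin_op_Qalg]\<close>)

lemma Q_poly_jack:
  assumes lam: "lam \<in> partitions n"
  shows "Q_poly n g (jack n g lam) = smult (jack n g lam) (map_poly Const (Q_eigenvalue n g lam))"
proof (rule poly_eqI_Const[OF infinite_UNIV_char_0])
  fix z
  have J: "jack n g lam \<in> sym_polys n" by (rule jack_sym[OF g lam])
  show "poly (Q_poly n g (jack n g lam)) (Const z) = poly (smult (jack n g lam) (map_poly Const (Q_eigenvalue n g lam))) (Const z)"
    using Q_eigenvalue[OF lam, of z] by (simp add: Q_poly(2)[OF J] Q_op[OF J] hom_poly[OF Const_hom] mult.commute)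
qed

end

subsection \<open>Restriction\<close>

lemma restrict_hom: "semiring_hom (restrict_ones k)" unfolding restrict_ones_def by (rule insertion_Const_hom)

lemma restrict_Const [simp]: "restrict_ones k (Const c) = Const c"
  unfolding restrict_ones_def by (rule insertion_Const_Const)

lemma restrict_restrict:
  assumes "j \<le> k" shows "restrict_ones j (restrict_ones k p) = restrict_ones j p"
  unfolding restrict_ones_def[of k] hom_insertion[OF Const_hom restrict_hom] unfolding restrict_ones_def using assms
  by (auto simp: insertion_Const_Const insertion_Const_Var
      semiring_hom.h1[OF insertion_Const_hom] intro!: arg_cong2[where f = "\<lambda>c \<sigma>. insertion c \<sigma> p"])

lemma restrict_id: "p \<in> sym_polys n ==> restrict_ones n p = p"
proof -
  assume "p \<in> sym_polys n"
  then have "restrict_ones n p = insertion Const Var p"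
    unfolding restrict_ones_def by (intro insertion_cong) (use sym_vars in fastforce)
  then show ?thesis by (simp only: insertion_Var_id)
qed

lemma restrict_0:
  assumes "p \<in> sym_polys n" shows "restrict_ones 0 p = Const (eval (\<lambda>_. 1) p)"
proof -
  have "restrict_ones 0 p = insertion Const (\<lambda>_. Const 1) p"
    unfolding restrict_ones_def by (intro insertion_cong) (use sym_vars[OF assms] in force)
  then show ?thesis unfolding eval_def hom_insertion[OF semiring_hom_id Const_hom] .
qed

lemma restrict_sym:
  assumes p: "p \<in> sym_polys n" and j: "j \<le> n"
  shows "restrict_ones j p \<in> sym_polys j"
proof -
  have "vars (restrict_ones j p) \<subseteq> {1..j}"
    unfolding restrict_ones_def by (rule vars_insertion) (use sym_vars[OF p] in \<open>auto simp: vars_Var\<close>)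
  moreover have "pm \<pi> (restrict_ones j p) = restrict_ones j p" if \<pi>: "\<pi> permutes {1..j}" for \<pi>
  proof -
    have "pm \<pi> (restrict_ones j p) = insertion Const (\<lambda>i. if i \<le> j then Var (\<pi> i) else 1) p"
      unfolding restrict_ones_def hom_insertion[OF Const_hom pm_hom]
      by (intro arg_cong2[where f = "\<lambda>c \<sigma>. insertion c \<sigma> p"]) auto
    also have "... = insertion Const (\<lambda>i. if \<pi> i \<le> j then Var (\<pi> i) else 1) p"
    proof (rule insertion_cong)
      fix i assume "i \<in> vars p"
      then have "1 \<le> i" using sym_vars[OF p] by auto
      moreover have "\<pi> i \<in> {1..j} \<longleftrightarrow> i \<in> {1..j}" by (rule permutes_in_image[OF \<pi>])
      moreover have "i \<notin> {1..j} ==> \<pi> i = i" by (rule permutes_not_in[OF \<pi>])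
      ultimately show "(if i \<le> j then Var (\<pi> i) else 1) = (if \<pi> i \<le> j then Var (\<pi> i) else (1 :: cpoly))"
        by (cases "i \<le> j") auto
    qed
    also have "... = restrict_ones j (pm \<pi> p)" unfolding pm_def hom_insertion[OF Const_hom restrict_hom]
      by (intro arg_cong2[where f = "\<lambda>c \<sigma>. insertion c \<sigma> p"])
        (auto simp: restrict_ones_def insertion_Const_Const insertion_Const_Var)
    also have "pm \<pi> p = p"
    proof (rule sym_pm[OF p])
      show "\<pi> permutes {1..n}" by (rule permutes_subset[OF \<pi>]) (use j in auto)
    qed
    finally show ?thesis .
  qed
  ultimately show ?thesis by (simp add: sym_polys_pm)
qed

lemma restrict_esym:
  "restrict_ones k (esym (Suc k) (Suc j)) = esym k (Suc j) + esym k j"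
proof -
  have "esym (Suc k) (Suc j) = elem {1..k} Var (Suc j) + Var (Suc k) * elem {1..k} (Var :: nat => cpoly) j"
    using elem_insert_Suc[of "{1..k}" "Suc k" "Var :: nat => cpoly" j] by (simp add: atLeastAtMostSuc_conv)
  moreover have "restrict_ones k (elem {1..k} Var i) = elem {1..k} Var i" for i by (rule restrict_id[OF esym_sym])
  moreover have "restrict_ones k (Var (Suc k)) = 1" unfolding restrict_ones_def by (simp add: insertion_Const_Var)
  ultimately show ?thesis by (simp add: semiring_hom.hadd[OF restrict_hom] semiring_hom.hmult[OF restrict_hom])
qed

text \<open>By \<open>restrict_esym\<close> a lift of e_(j+1) is e_(j+1) in one more variable minus
  a lift of e_j. Lifts of the generators give lifts of all symmetric polynomials.\<close>

lemma restrict_surj_Suc: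
  assumes h: "h \<in> sym_polys k"
  shows "\<exists>f\<in>sym_polys (Suc k). restrict_ones k f = h"
proof -
  have "\<exists>f\<in>sym_polys (Suc k). restrict_ones k f = esym k j" for j
  proof (induction j)
    case 0
    show ?case by (rule bexI[of _ 1]) (auto simp: semiring_hom.h1[OF restrict_hom])
  next
    case (Suc j)
    then obtain f where f: "f \<in> sym_polys (Suc k)" "restrict_ones k f = esym k j" by blast
    show ?case by (rule bexI[of _ "esym (Suc k) (Suc j) - f"])
        (auto simp: hom_diff[OF restrict_hom] restrict_esym f intro: esym_sym)
  qed
  then obtain E where E: "\<And>j. E j \<in> sym_polys (Suc k)" "\<And>j. restrict_ones k (E j) = esym k j" by metis
  obtain F where F: "h = esub k F" using sym_polys_esub[OF h] by blast
  have "insertion Const E F \<in> sym_polys (Suc k)"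
    unfolding insertion_def by (intro sym_sum sym_mult sym_prod sym_power E) auto
  moreover have "restrict_ones k (insertion Const E F) = h"
    unfolding hom_insertion[OF Const_hom restrict_hom] F esub_def by (simp add: E(2))
  ultimately show ?thesis by blast
qed

lemma restrict_surj:
  assumes "k \<le> n" "h \<in> sym_polys k"
  shows "\<exists>f\<in>sym_polys n. restrict_ones k f = h" using assms
proof (induction arbitrary: h rule: inc_induct)
  case base
  then show ?case using restrict_id by blast
next
  case (step k)
  obtain f where f: "f \<in> sym_polys (Suc k)" "restrict_ones k f = h" using restrict_surj_Suc[OF step.prems] by blast
  then obtain f' where "f' \<in> sym_polys n" "restrict_ones (Suc k) f' = f" using step.IH by blast
  then show ?case using f restrict_restrict[of k "Suc k" f'] by auto
qed

subsection \<open>The factors\<close>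

text \<open>The inner variables are x, restricted to the first k - 1 of them; the outer
  \<open>Var k\<close> is z_k.\<close>

definition AQ :: "nat => real => nat => cpoly => cpoly mpoly" where
  "AQ n g k f = poly (map_poly (\<lambda>c. Const (restrict_ones (k - 1) c)) (Q_poly n g f)) (Var k)"

text \<open>The choice of the symmetric lift f of h to n variables does not matter: \<open>Q\<^sub>z\<close> maps the
  kernel of the restriction to k variables into the kernel of the restriction to k - 1 variables.\<close>

definition AA :: "nat => real => nat => cpoly => cpoly mpoly" where
  "AA n g k h = AQ n g k (SOME f. f \<in> sym_polys n \<and> restrict_ones k f = h)"

text \<open>The preimage of \<open>in_z\<close> in C[z], where symmetry in the z can be
  stated.\<close>

definition in_z1 :: "nat => complex poly => cpoly" where
  "in_z1 k q = poly (map_poly Const q) (Var k)"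

lemma eval_in_z1: "eval z (in_z1 k q) = poly q (z k)" using hom_poly[OF eval_hom, of z "map_poly Const q" "Var k"]
  by (simp add: in_z1_def map_poly_map_poly comp_def)

lemma pm_in_z1: "pm \<pi> (in_z1 k q) = in_z1 (\<pi> k) q" using hom_poly[OF pm_hom, of \<pi> "map_poly Const q" "Var k"]
  by (simp add: in_z1_def map_poly_map_poly comp_def)

lemma vars_in_z1: "vars (in_z1 k q) \<subseteq> {k}" unfolding in_z1_def poly_altdef
  by (intro vars_sum vars_mult vars_power) (auto simp: coeff_map_poly vars_Var)

lemma prod_in_z1_sym: "(\<Prod>k=1..n. in_z1 k q) \<in> sym_polys n"
proof -
  have "vars (\<Prod>k=1..n. in_z1 k q) \<subseteq> {1..n}" by (intro vars_prod) (use vars_in_z1 in fastforce)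
  moreover have "pm \<pi> (\<Prod>k=1..n. in_z1 k q) = (\<Prod>k=1..n. in_z1 k q)" if "\<pi> permutes {1..n}" for \<pi>
    unfolding semiring_hom.hprod[OF pm_hom] pm_in_z1 using prod.permute[OF that, of "\<lambda>k. in_z1 k q"] by (simp add: comp_def)
  ultimately show ?thesis by (simp add: sym_polys_pm)
qed

section \<open>The embedding of C[z], and operators that act on x alone\<close>

lemma lookup_z_embed: "lk (z_embed s) m = Const (lk s m)" by (simp add: z_embed_def map.rep_eq when_def)

lemma z_embed_add: "z_embed (p + q) = z_embed p + z_embed q"
  by (rule poly_mapping_eqI) (simp add: lookup_z_embed lookup_add Const_add)

lemma z_embed_single: "z_embed (sg m a) = sg m (Const a)"
  by (rule poly_mapping_eqI) (simp add: lookup_z_embed lookup_single when_def)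

lemma z_embed_Const: "z_embed (Const c) = Const (Const c)" unfolding Const_def[of c] z_embed_single by (simp add: Const_def)

lemma z_embed_Var: "z_embed (Var k) = Var k" by (simp add: Var_def z_embed_single)

lemma z_embed_hom: "semiring_hom z_embed"
proof
  show z0: "z_embed 0 = 0" by (rule poly_mapping_eqI) (simp add: lookup_z_embed)
  show "z_embed 1 = 1" using z_embed_Const[of 1] by simp
  show "z_embed (p + q) = z_embed p + z_embed q" for p q by (rule z_embed_add)
  show "z_embed (p * q) = z_embed p * z_embed q" for p q
  proof (induction p rule: mpoly_induct)
    case (add m a p)
    have "z_embed (sg m a * q) = z_embed (sg m a) * z_embed q" by (induction q rule: mpoly_induct)
        (auto simp: z0 z_embed_add z_embed_single distrib_left mult_single Const_mult)
    with add show ?case by (simp add: distrib_right z_embed_add)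
  qed (simp add: z0)
qed

lemma z_embed_in_z1: "z_embed (in_z1 k q) = in_z k q" using hom_poly[OF z_embed_hom, of "map_poly Const q" "Var k"]
  by (simp add: in_z1_def in_z_def map_poly_map_poly comp_def z_embed_Var z_embed_Const semiring_hom.h0[OF z_embed_hom])

lemma linear_on_sym_0: "linear_on_sym k A ==> A 0 = 0" unfolding linear_on_sym_def by (metis Const_0 mult_zero_left sym_0)

lemma linear_on_sym_sum:
  assumes A: "linear_on_sym k A" and h: "\<And>a. a \<in> U ==> h a \<in> sym_polys k"
  shows "A (\<Sum>a\<in>U. Const (c a) * h a) = (\<Sum>a\<in>U. Const (Const (c a)) * A (h a))" using h
proof (induction U rule: infinite_finite_induct)
  case (insert a U)
  have "Const (c a) * h a \<in> sym_polys k" "(\<Sum>a\<in>U. Const (c a) * h a) \<in> sym_polys k"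
    using insert.prems by (auto intro!: sym_sum sym_mult)
  then have "A (Const (c a) * h a + (\<Sum>a\<in>U. Const (c a) * h a)) = A (Const (c a) * h a) + A (\<Sum>a\<in>U. Const (c a) * h a)"
    using A unfolding linear_on_sym_def by blast
  moreover have "A (Const (c a) * h a) = Const (Const (c a)) * A (h a)"
    using A insert.prems unfolding linear_on_sym_def by blast
  ultimately show ?case using insert by simp
qed (simp_all add: linear_on_sym_0[OF A])

text \<open>\<open>extend_z\<close> works monomial by monomial in z; linearity of A regroups the
  result for sums of products h(x) s(z) with arbitrary s.\<close>

lemma extend_z_sum:
  assumes A: "linear_on_sym k A" and U: "finite U" and h: "\<And>a. a \<in> U ==> h a \<in> sym_polys k"
  shows "extend_z A (\<Sum>a\<in>U. Const (h a) * z_embed (s a)) = (\<Sum>a\<in>U. A (h a) * z_embed (s a))"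
proof -
  let ?F = "\<Sum>a\<in>U. Const (h a) * z_embed (s a)"
  let ?M = "ky ?F \<union> (\<Union>a\<in>U. ky (s a))"
  have M: "finite ?M" using U by simp
  have lkF: "lk ?F m = (\<Sum>a\<in>U. Const (lk (s a) m) * h a)" for m
    by (simp add: lookup_sum lookup_Const_mult lookup_z_embed mult.commute)
  have "extend_z A ?F = (\<Sum>m\<in>?M. A (lk ?F m) * sg m 1)" unfolding extend_z_def using M
    by (intro sum.mono_neutral_left) (auto simp: in_keys_iff linear_on_sym_0[OF A])
  also have "... = (\<Sum>m\<in>?M. \<Sum>a\<in>U. Const (Const (lk (s a) m)) * A (h a) * sg m 1)"
    unfolding lkF by (intro sum.cong refl) (simp only: linear_on_sym_sum[OF A h] sum_distrib_right)
  also have "... = (\<Sum>a\<in>U. \<Sum>m\<in>?M. Const (Const (lk (s a) m)) * A (h a) * sg m 1)" by (rule sum.swap)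
  also have "... = (\<Sum>a\<in>U. A (h a) * z_embed (s a))"
  proof (rule sum.cong[OF refl])
    fix a assume a: "a \<in> U"
    have "z_embed (s a) = z_embed (\<Sum>m\<in>ky (s a). sg m (lk (s a) m))" by (simp only: lk_sum_single)
    also have "... = (\<Sum>m\<in>ky (s a). sg m (Const (lk (s a) m)))" by (simp add: semiring_hom.hsum[OF z_embed_hom] z_embed_single)
    also have "... = (\<Sum>m\<in>?M. sg m (Const (lk (s a) m)))"
      by (rule sum.mono_neutral_left[OF M]) (use a in \<open>auto simp: in_keys_iff\<close>)
    also have "... = (\<Sum>m\<in>?M. Const (Const (lk (s a) m)) * sg m 1)" by (intro sum.cong refl) (simp add: Const_def mult_single)
    finally show "(\<Sum>m\<in>?M. Const (Const (lk (s a) m)) * A (h a) * sg m 1) = A (h a) * z_embed (s a)"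
      by (simp only: sum_distrib_left mult_ac)
  qed
  finally show ?thesis .
qed

section \<open>Properties of the factors\<close>

context
  fixes n :: nat and g :: real
  assumes n: "1 \<le> n" and g: "0 < g"
begin

lemma cr_hom: "semiring_hom (\<lambda>c. Const (restrict_ones j c) :: cpoly mpoly)"
  by (rule semiring_hom_comp[OF restrict_hom Const_hom])

lemma AQ_add:
  assumes "p \<in> sym_polys n" "q \<in> sym_polys n" shows "AQ n g k (p + q) = AQ n g k p + AQ n g k q"
  by (simp add: AQ_def Q_poly_add[OF n g assms] map_poly_hom_add[OF cr_hom])

lemma AQ_Const_mult:
  assumes "p \<in> sym_polys n" shows "AQ n g k (Const c * p) = Const (Const c) * AQ n g k p"
  by (simp add: AQ_def Q_poly_Const_mult[OF n g assms] map_poly_hom_smult[OF cr_hom])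

text \<open>\<open>Qalg_restrict\<close> holds for every z, so each coefficient in z restricts to 0.
  This is what makes the choice of the lift in \<open>AA\<close> harmless.\<close>

lemma AQ_0:
  assumes f: "f \<in> sym_polys n" and k: "k \<in> {1..n}" and zero: "restrict_ones k f = 0"
  shows "AQ n g k f = 0"
proof -
  have "map_poly (restrict_ones (k - 1)) (Q_poly n g f) = 0"
  proof (rule poly_eqI_Const[OF infinite_UNIV_char_0])
    fix z
    have "poly (map_poly (restrict_ones (k - 1)) (Q_poly n g f)) (restrict_ones (k - 1) (Const z)) =
        restrict_ones (k - 1) (Qalg n g z f)" unfolding hom_poly[OF restrict_hom] Q_poly(2)[OF n g f] ..
    then show "poly (map_poly (restrict_ones (k - 1)) (Q_poly n g f)) (Const z) = poly 0 (Const z)"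
      using Qalg_restrict[OF f _ _ zero, of g z] k by simp
  qed
  then have "restrict_ones (k - 1) (coeff (Q_poly n g f) j) = 0" for j
    using coeff_map_poly[of "restrict_ones (k - 1)" "Q_poly n g f" j] by (simp add: semiring_hom.h0[OF restrict_hom])
  then have "map_poly (\<lambda>c. Const (restrict_ones (k - 1) c) :: cpoly mpoly) (Q_poly n g f) = 0"
    by (intro poly_eqI) (simp add: coeff_map_poly semiring_hom.h0[OF restrict_hom])
  then show ?thesis by (simp add: AQ_def)
qed

lemma AA_restrict:
  assumes f: "f \<in> sym_polys n" and k: "k \<in> {1..n}"
  shows "AA n g k (restrict_ones k f) = AQ n g k f"
proof -
  define f' where "f' = (SOME f'. f' \<in> sym_polys n \<and> restrict_ones k f' = restrict_ones k f)"
  have f': "f' \<in> sym_polys n" "restrict_ones k f' = restrict_ones k f"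
    using someI[of "\<lambda>f'. f' \<in> sym_polys n \<and> restrict_ones k f' = restrict_ones k f" f] f unfolding f'_def by auto
  have d: "f' - f \<in> sym_polys n" using f f' by auto
  have "AQ n g k (f' - f) = 0" by (rule AQ_0[OF d k]) (simp add: hom_diff[OF restrict_hom] f')
  then show ?thesis using AQ_add[OF d f, of k] by (simp add: AA_def f'_def[symmetric])
qed

lemma AA_linear:
  assumes k: "k \<in> {1..n}" shows "linear_on_sym k (AA n g k)"
proof -
  have lift: "\<exists>f\<in>sym_polys n. restrict_ones k f = h" if "h \<in> sym_polys k" for h by (rule restrict_surj) (use k that in auto)
  show ?thesis unfolding linear_on_sym_def
  proof (intro conjI ballI allI)
    fix p r assume "p \<in> sym_polys k" "r \<in> sym_polys k"
    then obtain f f' where f: "f \<in> sym_polys n" "restrict_ones k f = p" "f' \<in> sym_polys n" "restrict_ones k f' = r"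
      using lift by metis
    have pr: "p + r = restrict_ones k (f + f')" by (simp only: semiring_hom.hadd[OF restrict_hom] f(2,4))
    show "AA n g k (p + r) = AA n g k p + AA n g k r" unfolding pr AA_restrict[OF sym_add[OF f(1,3)] k] AQ_add[OF f(1,3)]
      using AA_restrict[OF f(1) k] AA_restrict[OF f(3) k] by (simp only: f(2,4))
  next
    fix c p assume "p \<in> sym_polys k"
    then obtain f where f: "f \<in> sym_polys n" "restrict_ones k f = p" using lift by metis
    have cp: "Const c * p = restrict_ones k (Const c * f)" by (simp only: semiring_hom.hmult[OF restrict_hom] restrict_Const f(2))
    show "AA n g k (Const c * p) = Const (Const c) * AA n g k p"
      unfolding cp AA_restrict[OF sym_mult[OF sym_Const f(1)] k] AQ_Const_mult[OF f(1)]
      using AA_restrict[OF f(1) k] by (simp only: f(2))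
  qed
qed

lemma AA_target:
  assumes k: "k \<in> {1..n}" shows "AA n g k ` sym_polys k \<subseteq> A_target k"
proof
  fix F assume "F \<in> AA n g k ` sym_polys k"
  then obtain h where h: "h \<in> sym_polys k" "F = AA n g k h" by auto
  obtain f where f: "f \<in> sym_polys n" "restrict_ones k f = h" using restrict_surj[of k n h] k h by auto
  let ?R = "Q_poly n g f"
  have F: "F = AQ n g k f" using AA_restrict[OF f(1) k] f h by simp
  have c: "coeff (map_poly (\<lambda>c. Const (restrict_ones (k - 1) c)) ?R) j = Const (restrict_ones (k - 1) (coeff ?R j))" for j
    by (simp add: coeff_map_poly semiring_hom.h0[OF restrict_hom])
  have "vars F \<subseteq> {k}" unfolding F AQ_def poly_altdef c by (intro vars_sum vars_mult vars_power) (auto simp: vars_Var)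
  moreover have "lk F m \<in> sym_polys (k - 1)" for m
  proof -
    have v: "Var k ^ j = (sg (sg k j) 1 :: cpoly mpoly)" for j using single_conv_mon[of "sg k j" "1 :: cpoly"] by simp
    have "lk (Const (restrict_ones (k - 1) (coeff ?R j)) * Var k ^ j :: cpoly mpoly) m \<in> sym_polys (k - 1)" for j
    proof -
      have "k - 1 \<le> n" using k by auto
      then have "restrict_ones (k - 1) (coeff ?R j) \<in> sym_polys (k - 1)" by (rule restrict_sym[OF Q_poly(1)[OF n g f(1)]])
      then show ?thesis unfolding lookup_Const_mult v by (simp add: lookup_single when_def)
    qed
    then show ?thesis unfolding F AQ_def poly_altdef c lookup_sum by (intro sym_sum)
  qed
  ultimately show "F \<in> A_target k" by (simp add: A_target_def)
qed

lemma AA_jack: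
  assumes k: "k \<in> {1..n}" and lam: "lam \<in> partitions n"
  shows "AA n g k (restrict_ones k (jack n g lam)) =
    Const (restrict_ones (k - 1) (jack n g lam)) * in_z k (Q_eigenvalue n g lam)"
proof -
  have "map_poly (\<lambda>c. Const (restrict_ones (k - 1) c) :: cpoly mpoly) (map_poly Const (Q_eigenvalue n g lam)) =
      map_poly (\<lambda>c. Const (Const c)) (Q_eigenvalue n g lam)"
    by (simp add: map_poly_map_poly comp_def semiring_hom.h0[OF restrict_hom])
  then show ?thesis
    unfolding AA_restrict[OF jack_sym[OF g lam] k] AQ_def Q_poly_jack[OF n g lam] map_poly_hom_smult[OF cr_hom]
    by (simp add: in_z_def)
qed

lemma foldr_Q_op:
  assumes U: "U \<subseteq> partitions n"
  shows "foldr (\<lambda>k. Q_op n g (z k)) ks (\<Sum>mu\<in>U. Const (c mu) * jack n g mu) =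
    (\<Sum>mu\<in>U. Const (c mu * (\<Prod>k\<leftarrow>ks. poly (Q_eigenvalue n g mu) (z k))) * jack n g mu)"
proof (induction ks)
  case (Cons k ks)
  let ?c = "\<lambda>mu. c mu * (\<Prod>k\<leftarrow>ks. poly (Q_eigenvalue n g mu) (z k))"
  have J: "jack n g mu \<in> sym_polys n" if "mu \<in> U" for mu using that U jack_sym[OF g] by blast
  have "Q_op n g (z k) (\<Sum>mu\<in>U. Const (?c mu) * jack n g mu) = Qalg n g (z k) (\<Sum>mu\<in>U. Const (?c mu) * jack n g mu)"
    by (intro Q_op[OF n g] sym_sum sym_mult J) auto
  also have "... = (\<Sum>mu\<in>U. Const (?c mu) * Qalg n g (z k) (jack n g mu))" by (rule lin_op_sum[OF lin_op_Qalg J])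
  also have "... = (\<Sum>mu\<in>U. Const (c mu * (\<Prod>k\<leftarrow>k # ks. poly (Q_eigenvalue n g mu) (z k))) * jack n g mu)"
  proof (rule sum.cong[OF refl])
    fix mu assume mu: "mu \<in> U"
    then have "Qalg n g (z k) (jack n g mu) = Const (poly (Q_eigenvalue n g mu) (z k)) * jack n g mu"
      using Q_eigenvalue[OF n g, of mu "z k"] U by (auto simp: Q_op[OF n g J])
    then show "Const (?c mu) * Qalg n g (z k) (jack n g mu) =
        Const (c mu * (\<Prod>k\<leftarrow>k # ks. poly (Q_eigenvalue n g mu) (z k))) * jack n g mu" by (simp add: Const_mult mult_ac)
  qed
  finally show ?case using Cons by simp
qed simp

text \<open>The operators Q are diagonal in the Jack basis with a common eigenvalue polynomial, so
  the result is a combination of products Prod q_mu(z_k), symmetric in z. Its values at all z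
  identify it.\<close>

lemma S_op_expand:
  assumes U: "U \<subseteq> partitions n"
  shows "S_op n g (\<Sum>mu\<in>U. Const (c mu) * jack n g mu) =
    (\<Sum>mu\<in>U. Const (c mu * eval (\<lambda>_. 1) (jack n g mu)) * (\<Prod>k=1..n. in_z1 k (Q_eigenvalue n g mu)))"
    (is "S_op n g ?f = ?s")
proof -
  have ev: "eval z ?s = eval (\<lambda>_. 1) (foldr (\<lambda>k. Q_op n g (z k)) [1..<Suc n] ?f)" for z
  proof -
    have "(\<Prod>k\<leftarrow>[1..<Suc n]. F k) = (\<Prod>k=1..n. F k)" for F :: "nat => complex"
      by (simp add: prod.distinct_set_conv_list[symmetric] atLeastLessThanSuc_atLeastAtMost del: upt_Suc)
    then show ?thesis unfolding foldr_Q_op[OF U] by (simp add: eval_sum eval_mult eval_prod eval_in_z1 mult_ac del: upt_Suc)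
  qed
  have sym: "?s \<in> sym_polys n" by (intro sym_sum sym_mult prod_in_z1_sym) auto
  show ?thesis unfolding S_op_def
  proof (rule the_equality)
    show "?s \<in> sym_polys n \<and> (\<forall>z. eval z ?s = eval (\<lambda>_. 1) (foldr (\<lambda>k. Q_op n g (z k)) [1..<Suc n] ?f))"
      using sym ev by blast
    fix s assume "s \<in> sym_polys n \<and> (\<forall>z. eval z s = eval (\<lambda>_. 1) (foldr (\<lambda>k. Q_op n g (z k)) [1..<Suc n] ?f))"
    then show "s = ?s" using ev by (intro mpoly_eqI) metis
  qed
qed

text \<open>The state after the factors with indices n, ..., j + 1: x is cut down to j variables,
  and each of z_(j+1), ..., z_n carries its eigenvalue. As \<open>foldr\<close> applies the last
  entry first, the induction runs downward from j = n.\<close>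

lemma foldr_extend_z:
  assumes U: "finite U" "U \<subseteq> partitions n" and j: "j \<le> n"
  shows "foldr (\<lambda>k. extend_z (AA n g k)) [Suc j..<Suc n] (Const (\<Sum>mu\<in>U. Const (c mu) * jack n g mu)) =
    (\<Sum>mu\<in>U. Const (Const (c mu) * restrict_ones j (jack n g mu)) * z_embed (\<Prod>k\<in>{j<..n}. in_z1 k (Q_eigenvalue n g mu)))"
  using j
proof (induction j rule: inc_induct)
  case base
  have "Const (\<Sum>mu\<in>U. Const (c mu) * jack n g mu) = (\<Sum>mu\<in>U. Const (Const (c mu) * restrict_ones n (jack n g mu)) :: cpoly mpoly)"
    unfolding semiring_hom.hsum[OF Const_hom]
    by (intro sum.cong refl) (use U jack_sym[OF g] in \<open>auto simp: restrict_id subset_iff\<close>)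
  then show ?case by (simp add: semiring_hom.h1[OF z_embed_hom])
next
  case (step j)
  let ?k = "Suc j" and ?e = "\<lambda>mu. \<Prod>k\<in>{Suc j<..n}. in_z1 k (Q_eigenvalue n g mu)"
  have k: "?k \<in> {1..n}" using step by auto
  have J: "restrict_ones ?k (jack n g mu) \<in> sym_polys ?k" if "mu \<in> U" for mu
    by (rule restrict_sym) (use that U jack_sym[OF g] step in auto)
  have "[Suc j..<Suc n] = ?k # [Suc ?k..<Suc n]" using step by (simp add: upt_conv_Cons del: upt_Suc)
  then have "foldr (\<lambda>k. extend_z (AA n g k)) [Suc j..<Suc n] (Const (\<Sum>mu\<in>U. Const (c mu) * jack n g mu)) =
      extend_z (AA n g ?k) (\<Sum>mu\<in>U. Const (Const (c mu) * restrict_ones ?k (jack n g mu)) * z_embed (?e mu))"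
    using step.IH by simp
  also have "... = (\<Sum>mu\<in>U. AA n g ?k (Const (c mu) * restrict_ones ?k (jack n g mu)) * z_embed (?e mu))"
    by (rule extend_z_sum[OF AA_linear[OF k] U(1)]) (use J in \<open>auto intro!: sym_mult\<close>)
  also have "... = (\<Sum>mu\<in>U. Const (Const (c mu) * restrict_ones j (jack n g mu)) * z_embed (\<Prod>k\<in>{j<..n}. in_z1 k (Q_eigenvalue n g mu)))"
  proof (rule sum.cong[OF refl])
    fix mu assume mu: "mu \<in> U"
    have "AA n g ?k (Const (c mu) * restrict_ones ?k (jack n g mu)) = Const (Const (c mu)) * AA n g ?k (restrict_ones ?k (jack n g mu))"
      using AA_linear[OF k] J[OF mu] unfolding linear_on_sym_def by blast
    also have "... = Const (Const (c mu)) * (Const (restrict_ones j (jack n g mu)) * in_z ?k (Q_eigenvalue n g mu))"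
      using AA_jack[OF k, of mu] mu U by auto
    finally have 1: "AA n g ?k (Const (c mu) * restrict_ones ?k (jack n g mu)) =
        Const (Const (c mu)) * (Const (restrict_ones j (jack n g mu)) * in_z ?k (Q_eigenvalue n g mu))" .
    have "{j<..n} = insert ?k {?k<..n}" using step by auto
    then have 2: "z_embed (\<Prod>k\<in>{j<..n}. in_z1 k (Q_eigenvalue n g mu)) = in_z ?k (Q_eigenvalue n g mu) * z_embed (?e mu)"
      by (simp add: semiring_hom.hmult[OF z_embed_hom] z_embed_in_z1)
    show "AA n g ?k (Const (c mu) * restrict_ones ?k (jack n g mu)) * z_embed (?e mu) =
        Const (Const (c mu) * restrict_ones j (jack n g mu)) * z_embed (\<Prod>k\<in>{j<..n}. in_z1 k (Q_eigenvalue n g mu))"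
      unfolding 1 2 Const_mult by (simp only: mult.assoc)
  qed
  finally show ?case .
qed

end

theorem theorem6p2:
  fixes n :: nat and g :: real
  assumes "n \<ge> 1" and "g > 0"
  shows "\<exists>A :: nat \<Rightarrow> complex mpoly \<Rightarrow> complex mpoly mpoly.
     (\<forall>k\<in>{1..n}. linear_on_sym k (A k) \<and> A k ` sym_polys k \<subseteq> A_target k) \<and>
     (\<forall>f\<in>sym_polys n.
        z_embed (S_op n g f) = foldr (\<lambda>k. extend_z (A k)) [1..<Suc n] (Const f)) \<and>
     (\<forall>lam\<in>partitions n.
        (\<forall>z. Q_op n g z (jack n g lam) = Const (poly (Q_eigenvalue n g lam) z) * jack n g lam) \<and>
        (\<forall>k\<in>{1..n}.
           A k (restrict_ones k (jack n g lam)) =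
             Const (restrict_ones (k - 1) (jack n g lam)) * in_z k (Q_eigenvalue n g lam)))"
proof (intro exI[of _ "AA n g"] conjI ballI allI)
  fix f assume "f \<in> sym_polys n"
  then obtain U c where U: "finite U" "U \<subseteq> partitions n" and f: "f = (\<Sum>mu\<in>U. Const (c mu) * jack n g mu)"
    using jack_expand[OF assms(2)] by blast
  let ?e = "\<lambda>mu. \<Prod>k\<in>{1..n}. in_z1 k (Q_eigenvalue n g mu)"
  have "z_embed (S_op n g f) = (\<Sum>mu\<in>U. Const (Const (c mu * eval (\<lambda>_. 1) (jack n g mu))) * z_embed (?e mu))"
    unfolding f S_op_expand[OF assms U(2)]
    by (simp only: semiring_hom.hsum[OF z_embed_hom] semiring_hom.hmult[OF z_embed_hom] z_embed_Const)
  \<comment> \<open>After the last factor no x is left: restriction to zero variables is the value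
    at (1, ..., 1), which is how \<open>S_op\<close> evaluates.\<close>
  also have "\<dots> = (\<Sum>mu\<in>U. Const (Const (c mu) * restrict_ones 0 (jack n g mu)) * z_embed (?e mu))"
  proof (rule sum.cong[OF refl])
    fix mu assume "mu \<in> U"
    then have "restrict_ones 0 (jack n g mu) = Const (eval (\<lambda>_. 1) (jack n g mu))"
      using U by (intro restrict_0[where n = n] jack_sym[OF assms(2)]) auto
    then show "Const (Const (c mu * eval (\<lambda>_. 1) (jack n g mu))) * z_embed (?e mu) =
        Const (Const (c mu) * restrict_ones 0 (jack n g mu)) * z_embed (?e mu)"
      by (simp only: Const_mult)
  qed
  also have "\<dots> = foldr (\<lambda>k. extend_z (AA n g k)) [1..<Suc n] (Const f)"
  proof -
    have "{1..n} = {0<..n}" by auto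
    then show ?thesis using foldr_extend_z[OF assms U, of 0 c] unfolding f by (simp add: One_nat_def del: upt_Suc)
  qed
  finally show "z_embed (S_op n g f) = foldr (\<lambda>k. extend_z (AA n g k)) [1..<Suc n] (Const f)" .
qed (use AA_linear[OF assms] AA_target[OF assms] Q_eigenvalue[OF assms] AA_jack[OF assms] in auto)

end
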